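(* Let $k,p\ge 2$ and $1\le h\le k$ be integers and let $s=p(k+1)+h$. Let $$t=h-\Bigl\lfloor\frac{h-1}{p}\Bigr\rfloor p,\qquad r=k+\Bigl\lceil\frac{h}{p}\Bigr\rceil.$$ Then, for all sufficiently large $n$, $K_{t-1}\vee T_{n-t+1,r}$ is the unique graph (up to isomorphism) in $\mathrm{EX}_{q}(n,C_s^{k})$.
   Context: All graphs are finite and simple. $C_s$ is the cycle of order $s$. For an integer $k\ge2$, the $k$-th power $G^k$ of a graph $G$ has vertex set $V(G)$ and joins two distinct vertices whenever their distance in $G$ is at most $k$. $K_n$ is the complete graph on $n$ vertices ($K_0$ is the empty graph, so for $t=1$ the graph $K_{t-1}\vee T_{n-t+1,r}$ is $T_{n,r}$). The join $G_1\vee G_2$ of vertex-disjoint graphs is obtained from their disjoint union by adding all edges between $V(G_1)$ and $V(G_2)$. The Turán graph $T_{n,r}$ is the complete $r$-partite graph on $n$ vertices with parts as balanced as possible. A graph is $F$-free if it contains no copy of $F$ as a (not necessarily induced) subgraph. The signless Laplacian matrix is $Q(G)=D(G)+A(G)$ (diagonal degree matrix plus adjacency matrix), and $q(G)$ is its largest eigenvalue. $\mathrm{EX}_q(n,F)$ is the set of $n$-vertex $F$-free graphs attaining the maximum of $q$ among all $n$-vertex $F$-free graphs. *)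

theory Defs
  imports
    Complex_Main
    "Graph_Theory.Graph_Theory"
    "Jordan_Normal_Form.Spectral_Radius"
begin

text \<open>
  A finite simple graph is a \<^locale>\<open>pair_graph\<close>: a finite, loop-free, symmetric digraph whose
  arcs are ordered pairs of vertices, so that every edge \<open>{u, v}\<close> is represented by the two
  arcs \<open>(u, v)\<close> and \<open>(v, u)\<close>. Isomorphism is \<^const>\<open>digraph_iso\<close>.
\<close>

definition complete_graph :: "nat \<Rightarrow> nat pair_pre_digraph" where
  "complete_graph n = \<lparr> pverts = {..<n}, parcs = {(u, v). u < n \<and> v < n \<and> u \<noteq> v} \<rparr>"

definition cycle_graph :: "nat \<Rightarrow> nat pair_pre_digraph" where
  "cycle_graph s = \<lparr> pverts = {..<s},
     parcs = {(u, v). u < s \<and> v < s \<and> u \<noteq> v \<and> (v = (u + 1) mod s \<or> u = (v + 1) mod s)} \<rparr>"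

text \<open>The parts are the residue classes modulo \<open>r\<close>.\<close>

definition turan_graph :: "nat \<Rightarrow> nat \<Rightarrow> nat pair_pre_digraph" where
  "turan_graph n r = \<lparr> pverts = {..<n}, parcs = {(u, v). u < n \<and> v < n \<and> u mod r \<noteq> v mod r} \<rparr>"

definition graph_join ::
    "'a pair_pre_digraph \<Rightarrow> 'b pair_pre_digraph \<Rightarrow> ('a + 'b) pair_pre_digraph" where
  "graph_join G H = \<lparr> pverts = pverts G <+> pverts H,
     parcs = map_prod Inl Inl ` parcs G \<union> map_prod Inr Inr ` parcs H
       \<union> (Inl ` pverts G) \<times> (Inr ` pverts H) \<union> (Inr ` pverts H) \<times> (Inl ` pverts G) \<rparr>"

text \<open>Infinite when no walk exists.\<close>

definition graph_dist :: "'a pair_pre_digraph \<Rightarrow> 'a \<Rightarrow> 'a \<Rightarrow> ereal" where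
  "graph_dist G u v = wf_digraph.\<mu> (with_proj G) (\<lambda>_. 1) u v"

definition graph_power :: "'a pair_pre_digraph \<Rightarrow> nat \<Rightarrow> 'a pair_pre_digraph" where
  "graph_power G k = \<lparr> pverts = pverts G,
     parcs = {(u, v). u \<in> pverts G \<and> v \<in> pverts G \<and> u \<noteq> v \<and> graph_dist G u v \<le> ereal (real k)} \<rparr>"

definition contains_copy :: "'a pair_pre_digraph \<Rightarrow> 'b pair_pre_digraph \<Rightarrow> bool" where
  "contains_copy G F \<longleftrightarrow> (\<exists>H. subgraph H (with_proj G) \<and> digraph_iso (with_proj F) H)"

text \<open>
  Matrices index the vertices by \<open>0, \<dots>, n - 1\<close> in increasing order; every other enumeration
  gives a permutation-similar matrix.
\<close>

definition vertex_list :: "'a::linorder pair_pre_digraph \<Rightarrow> 'a list" where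
  "vertex_list G = sorted_list_of_set (pverts G)"

definition adjacency_matrix :: "'a::linorder pair_pre_digraph \<Rightarrow> real mat" where
  "adjacency_matrix G = mat (card (pverts G)) (card (pverts G))
     (\<lambda>(i, j). if (vertex_list G ! i, vertex_list G ! j) \<in> parcs G then 1 else 0)"

definition degree_matrix :: "'a::linorder pair_pre_digraph \<Rightarrow> real mat" where
  "degree_matrix G = mat (card (pverts G)) (card (pverts G))
     (\<lambda>(i, j). if i = j then real (out_degree (with_proj G) (vertex_list G ! i)) else 0)"

definition signless_laplacian :: "'a::linorder pair_pre_digraph \<Rightarrow> real mat" where
  "signless_laplacian G = degree_matrix G + adjacency_matrix G"

text \<open>
  All complex eigenvalues of this real symmetric matrix are real, so that \<^const>\<open>spectrum\<close> over
  the reals contains all of them.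
\<close>

definition q_index :: "'a::linorder pair_pre_digraph \<Rightarrow> real" where
  "q_index G = Max (spectrum (signless_laplacian G))"

definition n_vertex_free_graphs :: "nat \<Rightarrow> 'b pair_pre_digraph \<Rightarrow> nat pair_pre_digraph set" where
  "n_vertex_free_graphs n F = {G. pair_graph G \<and> card (pverts G) = n \<and> \<not> contains_copy G F}"

text \<open>
  Vertices are drawn from the natural numbers, so every \<open>n\<close>-vertex graph has an isomorphic
  copy here, and the set is closed under isomorphism.
\<close>

definition EX_q :: "nat \<Rightarrow> 'b pair_pre_digraph \<Rightarrow> nat pair_pre_digraph set" where
  "EX_q n F = {G \<in> n_vertex_free_graphs n F. \<forall>H \<in> n_vertex_free_graphs n F. q_index H \<le> q_index G}"

lemma complete_graph_complete: "K\<^bsub>n\<^esub> (with_proj (complete_graph n))"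
  by (auto simp: complete_digraph_pair_def complete_graph_def)

lemma pair_graphI:
  assumes "finite (pverts G)" "parcs G \<subseteq> pverts G \<times> pverts G" "irrefl (parcs G)" "sym (parcs G)"
  shows "pair_graph G"
proof -
  have "finite (parcs G)" using assms(1,2) by (meson finite_SigmaI finite_subset)
  with assms show ?thesis
    by unfold_locales (auto simp: symmetric_def irrefl_def)
qed

lemma pair_graph_cycle: "pair_graph (cycle_graph s)"
  by (rule pair_graphI) (auto simp: cycle_graph_def irrefl_def sym_def)

lemma pair_graph_turan: "pair_graph (turan_graph n r)"
  by (rule pair_graphI) (auto simp: turan_graph_def irrefl_def sym_def)

lemma turan_parts_balanced:
  fixes i j n r :: nat
  assumes "i < r" "j < r"
  shows "card {v. v < n \<and> v mod r = i} \<le> card {v. v < n \<and> v mod r = j} + 1"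
proof -
  let ?A = "{v. v < n \<and> v mod r = i}" and ?B = "{v. v < n \<and> v mod r = j}"
  let ?f = "\<lambda>v. r * (v div r - 1) + j"
  have *: "v div r \<ge> 1" if "v \<in> ?A - {i}" for v
  proof -
    have "\<not> v < r" using that by auto
    then show ?thesis using assms(1) by (simp add: Suc_le_eq div_greater_zero_iff)
  qed
  have "card (?A - {i}) \<le> card ?B"
  proof (rule card_inj_on_le[of ?f])
    show "inj_on ?f (?A - {i})"
    proof (rule inj_onI)
      fix v w assume v: "v \<in> ?A - {i}" and w: "w \<in> ?A - {i}" and eq: "?f v = ?f w"
      from eq have "v div r - 1 = w div r - 1" using assms(1) by simp
      with *[OF v] *[OF w] have "v div r = w div r" by simp
      moreover have "v mod r = w mod r" using v w by simp
      ultimately show "v = w" by (metis div_mult_mod_eq)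
    qed
    show "?f ` (?A - {i}) \<subseteq> ?B"
    proof (rule image_subsetI)
      fix v assume v: "v \<in> ?A - {i}"
      obtain d where d: "v div r = Suc d" using *[OF v] by (cases "v div r") auto
      have "v = r * Suc d + v mod r" using d by (metis mult_div_mod_eq)
      then have "v = r + (r * d + i)" using v by simp
      with v have "r + (r * d + i) < n" by simp
      with assms have "r * d + j < n" by linarith
      then show "?f v \<in> ?B" using d \<open>j < r\<close> by simp
    qed
  qed auto
  moreover have "card ?A \<le> card (?A - {i}) + 1"
    using diff_card_le_card_Diff[of "{i}" ?A] by simp
  ultimately show ?thesis by linarith
qed

lemma pair_graph_join:
  assumes "pair_graph G" "pair_graph H"
  shows "pair_graph (graph_join G H)"
proof -
  interpret G: pair_graph G by fact
  interpret H: pair_graph H by fact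
  have "sym (parcs G)" "sym (parcs H)"
    using G.pair_sym_arcs H.pair_sym_arcs by (simp_all add: symmetric_def)
  show ?thesis
  proof (rule pair_graphI)
    show "finite (pverts (graph_join G H))"
      using G.pair_finite_verts H.pair_finite_verts by (simp add: graph_join_def)
    show "parcs (graph_join G H) \<subseteq> pverts (graph_join G H) \<times> pverts (graph_join G H)"
      by (auto simp: graph_join_def dest: G.in_arcsD1 G.in_arcsD2 H.in_arcsD1 H.in_arcsD2)
    show "irrefl (parcs (graph_join G H))"
      by (auto simp: graph_join_def irrefl_def dest: G.pair_no_loops H.pair_no_loops)
    show "sym (parcs (graph_join G H))"
      using \<open>sym (parcs G)\<close> \<open>sym (parcs H)\<close>
      by (intro symI) (auto simp: graph_join_def dest: symD)
  qed
qed

lemma digraph_iso_pair_iff: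
  assumes "pair_wf_digraph G" "pair_wf_digraph H"
  shows "digraph_iso (with_proj G) (with_proj H) \<longleftrightarrow>
    (\<exists>f. bij_betw f (pverts G) (pverts H) \<and>
      (\<forall>u\<in>pverts G. \<forall>v\<in>pverts G. (u, v) \<in> parcs G \<longleftrightarrow> (f u, f v) \<in> parcs H))"
    (is "?L \<longleftrightarrow> ?R")
proof
  interpret G: pair_wf_digraph G by fact
  assume ?L
  then obtain h where h: "pre_digraph.digraph_isomorphism (with_proj G) h"
    and H: "with_proj H = app_iso h (with_proj G)"
    unfolding digraph_iso_def by blast
  from arg_cong[OF H, of verts] arg_cong[OF H, of arcs]
    arg_cong[OF H, of tail] arg_cong[OF H, of head]
  have eqs: "pverts H = iso_verts h ` pverts G" "parcs H = iso_arcs h ` parcs G"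
    "iso_tail h = fst" "iso_head h = snd" by simp_all
  have inj: "inj_on (iso_verts h) (pverts G)"
    and arc: "\<And>a. a \<in> parcs G \<Longrightarrow> iso_arcs h a = (iso_verts h (fst a), iso_verts h (snd a))"
    using h eqs by (auto simp: pre_digraph.digraph_isomorphism_def prod_eq_iff)
  have "(u, v) \<in> parcs G \<longleftrightarrow> (iso_verts h u, iso_verts h v) \<in> parcs H"
    if "u \<in> pverts G" "v \<in> pverts G" for u v
  proof
    assume "(u, v) \<in> parcs G" then show "(iso_verts h u, iso_verts h v) \<in> parcs H"
      using arc[of "(u, v)"] by (force simp: eqs)
  next
    assume "(iso_verts h u, iso_verts h v) \<in> parcs H"
    then obtain x y where xy: "(x, y) \<in> parcs G"
      and "iso_verts h u = iso_verts h x" "iso_verts h v = iso_verts h y"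
      by (auto simp: eqs arc)
    with inj that G.in_arcsD1 G.in_arcsD2 have "u = x" "v = y"
      by (auto dest: inj_onD)
    with xy show "(u, v) \<in> parcs G" by simp
  qed
  with inj eqs show ?R by (auto simp: bij_betw_def intro!: exI[of _ "iso_verts h"])
next
  interpret G: pair_wf_digraph G by fact
  interpret H: pair_wf_digraph H by fact
  assume ?R
  then obtain f where bij: "bij_betw f (pverts G) (pverts H)"
    and f: "\<And>u v. u \<in> pverts G \<Longrightarrow> v \<in> pverts G \<Longrightarrow> (u, v) \<in> parcs G \<longleftrightarrow> (f u, f v) \<in> parcs H"
    by blast
  let ?h = "\<lparr> iso_verts = f, iso_arcs = map_prod f f, iso_head = snd, iso_tail = fst \<rparr>"
  have inj: "inj_on f (pverts G)" using bij by (simp add: bij_betw_def)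
  have "inj_on (map_prod f f) (parcs G)"
    using inj G.in_arcsD1 G.in_arcsD2 by (auto simp: inj_on_def)
  then have 1: "pre_digraph.digraph_isomorphism (with_proj G) ?h"
    using inj G.wf_digraph by (auto simp: pre_digraph.digraph_isomorphism_def)
  have "parcs H = map_prod f f ` parcs G"
  proof (intro equalityI subsetI)
    fix e assume e: "e \<in> parcs H"
    then have "fst e \<in> f ` pverts G" "snd e \<in> f ` pverts G"
      using bij H.arc_fst_in_verts H.arc_snd_in_verts by (auto simp: bij_betw_def)
    then obtain u v where "u \<in> pverts G" "v \<in> pverts G" "e = (f u, f v)"
      by (metis imageE prod.collapse)
    with e f show "e \<in> map_prod f f ` parcs G" by force
  next
    fix e assume "e \<in> map_prod f f ` parcs G"
    then obtain u v where uv: "(u, v) \<in> parcs G" "e = (f u, f v)" by auto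
    with f[OF G.in_arcsD1[OF uv(1)] G.in_arcsD2[OF uv(1)]] show "e \<in> parcs H" by simp
  qed
  then have "with_proj H = app_iso ?h (with_proj G)"
    using bij by (simp add: with_proj_def app_iso_def bij_betw_def)
  with 1 show ?L unfolding digraph_iso_def by blast
qed

lemma contains_copy_iff:
  assumes "pair_wf_digraph G" "pair_wf_digraph F"
  shows "contains_copy G F \<longleftrightarrow>
    (\<exists>f. inj_on f (pverts F) \<and> f ` pverts F \<subseteq> pverts G \<and>
      (\<forall>(u, v) \<in> parcs F. (f u, f v) \<in> parcs G))"
    (is "?L \<longleftrightarrow> ?R")
proof
  assume ?L
  then obtain H h where sub: "subgraph H (with_proj G)"
    and h: "pre_digraph.digraph_isomorphism (with_proj F) h" and H: "H = app_iso h (with_proj F)"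
    unfolding contains_copy_def digraph_iso_def by blast
  have c: "iso_tail h = fst" "iso_head h = snd"
    using sub unfolding H by (auto simp: subgraph_def compatible_def)
  have "iso_arcs h a = (iso_verts h (fst a), iso_verts h (snd a))" if "a \<in> parcs F" for a
    using h that c by (auto simp: pre_digraph.digraph_isomorphism_def prod_eq_iff)
  moreover have arcs: "iso_arcs h ` parcs F \<subseteq> parcs G"
    and verts: "iso_verts h ` pverts F \<subseteq> pverts G"
    using sub unfolding H by (auto simp: subgraph_def)
  ultimately have "(iso_verts h u, iso_verts h v) \<in> parcs G" if "(u, v) \<in> parcs F" for u v
    using that by (metis fst_conv image_subset_iff snd_conv)
  moreover have "inj_on (iso_verts h) (pverts F)"
    using h by (simp add: pre_digraph.digraph_isomorphism_def)
  ultimately show ?R using verts by blast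
next
  interpret G: pair_wf_digraph G by fact
  interpret F: pair_wf_digraph F by fact
  assume ?R
  then obtain f where f: "inj_on f (pverts F)" "f ` pverts F \<subseteq> pverts G"
    "\<And>u v. (u, v) \<in> parcs F \<Longrightarrow> (f u, f v) \<in> parcs G" by blast
  let ?h = "\<lparr> iso_verts = f, iso_arcs = map_prod f f, iso_head = snd, iso_tail = fst \<rparr>"
  have "inj_on (map_prod f f) (parcs F)"
    using f(1) F.in_arcsD1 F.in_arcsD2 by (auto simp: inj_on_def)
  then have 1: "pre_digraph.digraph_isomorphism (with_proj F) ?h"
    using f(1) F.wf_digraph by (auto simp: pre_digraph.digraph_isomorphism_def)
  then have "wf_digraph (app_iso ?h (with_proj F))"
    by (rule F.wf_digraphI_app_iso)
  then have "subgraph (app_iso ?h (with_proj F)) (with_proj G)"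
    using f G.wf_digraph by (auto simp: subgraph_def compatible_def)
  with 1 show ?L unfolding contains_copy_def digraph_iso_def by blast
qed

lemma graph_dist_le_iff:
  assumes "pair_wf_digraph G"
  shows "graph_dist G u v \<le> ereal (real k) \<longleftrightarrow>
    (\<exists>p. pre_digraph.awalk (with_proj G) u p v \<and> length p \<le> k)"
    (is "?L \<longleftrightarrow> ?R")
proof -
  interpret G: pair_wf_digraph G by fact
  have cost: "G.awalk_cost (\<lambda>_. 1) p = real (length p)" for p
    by (induction p) (auto simp: G.awalk_cost_def)
  have dist: "graph_dist G u v = (INF p\<in>{p. G.awalk u p v}. ereal (real (length p)))"
    by (simp add: graph_dist_def G.\<mu>_def cost)
  show ?thesis
  proof
    assume ?L
    then have "graph_dist G u v < ereal (real k + 1)"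
      by (rule le_less_trans) simp
    then obtain p where "G.awalk u p v" "real (length p) < real k + 1"
      unfolding dist by (auto simp: INF_less_iff)
    then show ?R by (intro exI[of _ p]) auto
  next
    assume ?R
    then obtain p where "G.awalk u p v" "length p \<le> k" by blast
    then show ?L unfolding dist by (intro INF_lower2[of p]) auto
  qed
qed

end

theory Submission imports Defs "HOL-Analysis.Function_Topology" "HOL-Analysis.Convex" "HOL-Number_Theory.Cong"
begin

text \<open>
  Write \<open>s = p r + t\<close> with \<open>1 \<le> t \<le> p\<close> (lemma \<open>parameters\<close>). Two facts about \<open>C\<^sub>s\<^sup>k\<close> decide the
  extremal problem. An independent set of \<open>C\<^sub>s\<^sup>k\<close> has at most \<open>p\<close> vertices, because the arcs of
  \<open>k + 1\<close> consecutive vertices that start at its elements are disjoint and \<open>s < (p + 1) (k + 1)\<close>;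
  hence \<open>C\<^sub>s\<^sup>k\<close> is not contained in a graph obtained from an \<open>r\<close>-partite graph by adding \<open>t - 1\<close>
  vertices (\<open>cyc_hub_join_free\<close>). On the other hand, cutting the cycle into \<open>t\<close> blocks of length
  \<open>r + 1\<close> and \<open>p - t\<close> blocks of length \<open>r\<close> colours it with \<open>r > k\<close> colours so that the only
  monochromatic edges are \<open>t\<close> disjoint ones of a single colour. So \<open>C\<^sub>s\<^sup>k\<close> is contained in every large
  complete \<open>r\<close>-partite graph together with \<open>t\<close> disjoint edges whose ends are complete to all parts
  but one, a \<open>matching_blowup\<close> (\<open>blowup_contains_cycle_power\<close>). The rest of the argument uses only
  these two facts, which are the assumptions of the locale \<open>forbidden\<close>.

  The index \<open>q\<close> is handled through the quadratic form: \<open>q\<close> is the maximum of the sum of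
  \<open>(x u + x v)\<^sup>2\<close> over the edges, for unit vectors \<open>x\<close>, attained at a nonnegative vector, here called
  a Perron vector. Let \<open>G\<close> be extremal with \<open>n\<close> vertices, \<open>n\<close> large. The Turan graph gives
  \<open>q \<ge> 2 (1 - 1/r) n - 2\<close>.

  Approximate structure. Deleting a vertex with the smallest Perron entry does not decrease
  \<open>q/(n - 1)\<close>, and it increases this quotient by a term of order \<open>1/n\<close> unless the Perron vector is
  almost constant (\<open>deletion_step\<close>). The supremum of the quotient over all free graphs therefore
  converges as \<open>n\<close> grows, and after the deletion of a small fraction of the vertices of \<open>G\<close> an
  almost constant Perron vector must appear (\<open>flat_subgraph_exists\<close>). Such a graph has minimum
  degree close to \<open>(1 - 1/r) n\<close> (\<open>flat_min_degree\<close>). A pigeonhole argument in the style of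
  Erdos and Stone finds in it a large complete \<open>r\<close>-partite graph, and sorting the vertices by
  their adjacencies to it gives a \<open>core\<close>: \<open>r\<close> independent sets of about \<open>n/r\<close> vertices each,
  almost completely joined to one another (\<open>core_exists\<close>).

  Exact structure. The core makes the Perron vector of \<open>G\<close> itself nearly constant on the core and
  bounded elsewhere (\<open>core_near_uniform\<close>); since joining any vertex to all parts of the core but one
  keeps the graph free, all degrees are at least about \<open>(1 - 1/r) n\<close> (\<open>extremal_min_degree\<close>).
  A hub is a vertex with linearly many neighbours in every part. The number of hubs is bounded, for
  \<open>t\<close> hubs with many common neighbours in \<open>r - 1\<close> parts would yield a \<open>matching_blowup\<close>. Comparing \<open>G\<close>
  with the join of \<open>K\<^bsub>t-1\<^esub>\<close> and a complete \<open>r\<close>-partite graph, tested on the Perron vector of \<open>G\<close>,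
  bounds the total number of core vertices missed by the hubs (\<open>deficiency\<close>); a count of the typical
  adjacencies between parts and hubs then forces exactly \<open>t - 1\<close> hubs, each adjacent to almost the
  whole core (\<open>hubs\<close>). They supply \<open>t - 1\<close> disjoint edges into any given part, so a single edge
  inside a part would complete a \<open>matching_blowup\<close> (\<open>parts_independent\<close>). Hence \<open>G\<close> is a subgraph of a
  join of \<open>K\<^bsub>t-1\<^esub>\<close> and a complete \<open>r\<close>-partite graph.

  Such a join is a complete multipartite graph with \<open>t - 1\<close> singleton classes. For class sizes
  \<open>m\<^sub>i\<close> its index is determined by the equation that the numbers \<open>m\<^sub>i / (q - n + 2 m\<^sub>i)\<close> add up to \<open>1\<close>,
  and the concavity of \<open>m / (c + 2 m)\<close> shows that \<open>q\<close> increases when two classes become more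
  balanced (\<open>multipartite_move\<close>). So the \<open>r\<close> parts differ in size by at most one.
\<close>

section \<open>The signless Laplacian form and its Perron vector\<close>

definition nbhd :: "('a \<Rightarrow> 'a \<Rightarrow> bool) \<Rightarrow> 'a set \<Rightarrow> 'a \<Rightarrow> 'a set" where
  "nbhd E V u = {v \<in> V. E u v}"

text \<open>
  The signless Laplacian \<open>D + A\<close> of the graph on \<open>V\<close>, applied to \<open>x\<close>. Graphs are given by an
  adjacency predicate and a vertex set, so that an induced subgraph has the same \<open>E\<close> and a
  smaller \<open>V\<close>.
\<close>

definition qop :: "('a \<Rightarrow> 'a \<Rightarrow> bool) \<Rightarrow> 'a set \<Rightarrow> ('a \<Rightarrow> real) \<Rightarrow> 'a \<Rightarrow> real" where
  "qop E V x u = (\<Sum>v\<in>nbhd E V u. x u + x v)"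

definition qform :: "('a \<Rightarrow> 'a \<Rightarrow> bool) \<Rightarrow> 'a set \<Rightarrow> ('a \<Rightarrow> real) \<Rightarrow> real" where
  "qform E V x = (\<Sum>u\<in>V. x u * qop E V x u)"

definition nrm2 :: "'a set \<Rightarrow> ('a \<Rightarrow> real) \<Rightarrow> real" where
  "nrm2 V x = (\<Sum>u\<in>V. (x u)\<^sup>2)"

text \<open>
  The last conjunct says that \<open>q\<close> is the maximum of the Rayleigh quotient, so that every test vector
  gives a lower bound for \<open>q\<close>.
\<close>

definition perron :: "('a \<Rightarrow> 'a \<Rightarrow> bool) \<Rightarrow> 'a set \<Rightarrow> real \<Rightarrow> ('a \<Rightarrow> real) \<Rightarrow> bool" where
  "perron E V q x \<longleftrightarrow> (\<forall>u\<in>V. 0 \<le> x u) \<and> (\<exists>u\<in>V. 0 < x u) \<and>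
     (\<forall>u\<in>V. qop E V x u = q * x u) \<and> (\<forall>y. qform E V y \<le> q * nrm2 V y)"

text \<open>
  For a finite nonempty \<open>V\<close> and a symmetric \<open>E\<close> the number \<open>q\<close> exists and is unique
  (\<open>perron_exists\<close>, \<open>perron_unique\<close>).
\<close>

definition qidx :: "('a \<Rightarrow> 'a \<Rightarrow> bool) \<Rightarrow> 'a set \<Rightarrow> real" where
  "qidx E V = (THE q. \<exists>x. perron E V q x)"

lemma nbhd_subset: "nbhd E V u \<subseteq> V"
  by (auto simp: nbhd_def)

lemma finite_nbhd [simp]: "finite V \<Longrightarrow> finite (nbhd E V u)"
  by (auto simp: nbhd_def)

lemma sum_nbhd: "finite V \<Longrightarrow> (\<Sum>v\<in>nbhd E V u. f v) = (\<Sum>v\<in>V. if E u v then f v else 0)"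
  unfolding nbhd_def by (simp add: sum.If_cases Int_def)

lemma sum_nbhd_swap:
  fixes f :: "'a \<Rightarrow> 'a \<Rightarrow> real"
  assumes "finite V" "symp E"
  shows "(\<Sum>u\<in>V. \<Sum>v\<in>nbhd E V u. f u v) = (\<Sum>u\<in>V. \<Sum>v\<in>nbhd E V u. f v u)"
proof -
  have "(\<Sum>u\<in>V. \<Sum>v\<in>nbhd E V u. f u v) = (\<Sum>u\<in>V. \<Sum>v\<in>V. if E u v then f u v else 0)"
    using assms by (simp add: sum_nbhd)
  also have "\<dots> = (\<Sum>v\<in>V. \<Sum>u\<in>V. if E u v then f u v else 0)" by (rule sum.swap)
  also have "\<dots> = (\<Sum>v\<in>V. \<Sum>u\<in>V. if E v u then f u v else 0)"
    using sympD[OF assms(2)] by (intro sum.cong refl) metis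
  finally show ?thesis using assms by (simp add: sum_nbhd)
qed

text \<open>
  The form is the sum of \<open>(x u + x v)\<^sup>2\<close> over the edges; the factor \<open>2\<close> comes from counting every
  edge in both directions. In this shape the form is monotone in the edge set and in the entries
  of a nonnegative vector.
\<close>

lemma qform_edges:
  assumes "finite V" "symp E"
  shows "2 * qform E V x = (\<Sum>u\<in>V. \<Sum>v\<in>nbhd E V u. (x u + x v)\<^sup>2)"
proof -
  have "qform E V x = (\<Sum>u\<in>V. \<Sum>v\<in>nbhd E V u. x u * (x u + x v))"
    by (simp only: qform_def qop_def sum_distrib_left)
  moreover have "\<dots> = (\<Sum>u\<in>V. \<Sum>v\<in>nbhd E V u. x v * (x v + x u))"
    by (rule sum_nbhd_swap[OF assms])
  ultimately have "2 * qform E V x = (\<Sum>u\<in>V. \<Sum>v\<in>nbhd E V u. x u * (x u + x v) + x v * (x v + x u))"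
    by (simp add: sum.distrib)
  then show ?thesis by (simp add: power2_eq_square algebra_simps)
qed

lemma qform_scale: "qform E V (\<lambda>u. c * x u) = c\<^sup>2 * qform E V x"
  by (simp add: qform_def qop_def sum_distrib_left power2_eq_square algebra_simps)

lemma nrm2_scale: "nrm2 V (\<lambda>u. c * x u) = c\<^sup>2 * nrm2 V x"
  by (simp add: nrm2_def sum_distrib_left power_mult_distrib)

lemma nrm2_nonneg: "0 \<le> nrm2 V x"
  by (simp add: nrm2_def sum_nonneg)

lemma nrm2_eq_0: "finite V \<Longrightarrow> nrm2 V x = 0 \<longleftrightarrow> (\<forall>u\<in>V. x u = 0)"
  by (simp add: nrm2_def sum_nonneg_eq_0_iff)

lemma qform_cong: "(\<And>u. u \<in> V \<Longrightarrow> x u = y u) \<Longrightarrow> qform E V x = qform E V y"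
  unfolding qform_def qop_def
  by (intro sum.cong arg_cong2[where f="(*)"]) (auto simp: nbhd_def)

lemma nrm2_cong: "(\<And>u. u \<in> V \<Longrightarrow> x u = y u) \<Longrightarrow> nrm2 V x = nrm2 V y"
  unfolding nrm2_def by (intro sum.cong) auto

lemma perron_qform:
  assumes "perron E V q x" shows "qform E V x = q * nrm2 V x"
  using assms by (simp add: perron_def qform_def nrm2_def power2_eq_square sum_distrib_left algebra_simps)

lemma perron_nrm2_pos: "finite V \<Longrightarrow> perron E V q x \<Longrightarrow> 0 < nrm2 V x"
  using nrm2_nonneg[of V x] nrm2_eq_0[of V x] unfolding perron_def by fastforce

lemma perron_unique:
  assumes "finite V" "perron E V q x" "perron E V q' x'" shows "q = q'"
proof -
  have "a \<le> b" if "perron E V a y" "perron E V b z" for a b y z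
  proof -
    have "a * nrm2 V y \<le> b * nrm2 V y"
      using perron_qform[OF that(1)] that(2) by (metis perron_def)
    then show ?thesis using perron_nrm2_pos[OF assms(1) that(1)] by simp
  qed
  then show ?thesis using assms by (meson antisym)
qed

text \<open>
  First-order optimality: along \<open>x + \<epsilon> e\<^sub>w\<close> the difference of the two sides of \<open>max\<close> is a quadratic
  polynomial in \<open>\<epsilon>\<close> that vanishes at \<open>0\<close> and has constant sign, so its linear coefficient, which is a
  multiple of \<open>qop E V x w - q * x w\<close>, is zero.
\<close>

lemma maximiser_eigen:
  assumes fin: "finite V" and sym: "symp E" and max: "\<And>y. qform E V y \<le> q * nrm2 V y"
    and eq: "qform E V x = q * nrm2 V x" and w: "w \<in> V"
  shows "qop E V x w = q * x w"
proof -
  let ?z = "\<lambda>u. if u = w then 1 else 0 :: real"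
  let ?g = "qop E V x w - q * x w"
  let ?b = "q * nrm2 V ?z - qform E V ?z"
  have lin: "2 * e * ?g \<le> e\<^sup>2 * ?b" for e
  proof -
    have q1: "2 * qform E V (\<lambda>u. x u + e * ?z u) =
      2 * qform E V x + e\<^sup>2 * (2 * qform E V ?z) + 4 * e * qop E V x w"
    proof -
      have cross: "(\<Sum>u\<in>V. \<Sum>v\<in>nbhd E V u. (x u + x v) * (?z u + ?z v)) = 2 * qop E V x w"
      proof -
        have "(\<Sum>u\<in>V. \<Sum>v\<in>nbhd E V u. (x u + x v) * (?z u + ?z v)) =
          (\<Sum>u\<in>V. \<Sum>v\<in>nbhd E V u. (x u + x v) * ?z u) + (\<Sum>u\<in>V. \<Sum>v\<in>nbhd E V u. (x u + x v) * ?z v)"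
          by (simp only: distrib_left sum.distrib)
        also have "(\<Sum>u\<in>V. \<Sum>v\<in>nbhd E V u. (x u + x v) * ?z v) = (\<Sum>u\<in>V. \<Sum>v\<in>nbhd E V u. (x v + x u) * ?z u)"
          by (rule sum_nbhd_swap[OF fin sym])
        also have "(\<Sum>u\<in>V. \<Sum>v\<in>nbhd E V u. (x u + x v) * ?z u) = (\<Sum>u\<in>V. qop E V x u * ?z u)"
          by (simp only: qop_def sum_distrib_right)
        also have "(\<Sum>u\<in>V. \<Sum>v\<in>nbhd E V u. (x v + x u) * ?z u) = (\<Sum>u\<in>V. qop E V x u * ?z u)"
          by (simp only: qop_def sum_distrib_right add.commute)
        also have "(\<Sum>u\<in>V. qop E V x u * ?z u) = qop E V x w"
          using fin w by (simp add: if_distrib cong: if_cong)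
        finally show ?thesis by simp
      qed
      have "2 * qform E V (\<lambda>u. x u + e * ?z u) =
        (\<Sum>u\<in>V. \<Sum>v\<in>nbhd E V u. (x u + x v)\<^sup>2 + e\<^sup>2 * (?z u + ?z v)\<^sup>2 + 2 * e * ((x u + x v) * (?z u + ?z v)))"
        unfolding qform_edges[OF fin sym]
        by (intro sum.cong refl) (simp only: power2_eq_square, simp add: algebra_simps)
      also have "\<dots> = 2 * qform E V x + e\<^sup>2 * (2 * qform E V ?z) + 2 * e * (2 * qop E V x w)"
        unfolding qform_edges[OF fin sym] cross[symmetric]
        by (simp only: sum.distrib sum_distrib_left)
      finally show ?thesis by simp
    qed
    have n1: "nrm2 V (\<lambda>u. x u + e * ?z u) = nrm2 V x + e\<^sup>2 * nrm2 V ?z + 2 * e * x w"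
    proof -
      have "nrm2 V (\<lambda>u. x u + e * ?z u) = (\<Sum>u\<in>V. (x u)\<^sup>2 + e\<^sup>2 * (?z u)\<^sup>2 + 2 * e * (x u * ?z u))"
        unfolding nrm2_def by (intro sum.cong refl) (simp only: power2_eq_square, simp add: algebra_simps)
      also have "\<dots> = nrm2 V x + e\<^sup>2 * nrm2 V ?z + 2 * e * (\<Sum>u\<in>V. x u * ?z u)"
        unfolding nrm2_def by (simp only: sum.distrib sum_distrib_left)
      also have "(\<Sum>u\<in>V. x u * ?z u) = x w" using fin w by (simp add: if_distrib cong: if_cong)
      finally show ?thesis .
    qed
    have "qform E V (\<lambda>u. x u + e * ?z u) \<le> q * nrm2 V (\<lambda>u. x u + e * ?z u)" by (rule max)
    then show ?thesis using q1 n1 eq by (simp add: algebra_simps)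
  qed
  have b: "0 \<le> ?b" using max[of ?z] by simp
  show ?thesis
  proof (rule ccontr)
    assume "qop E V x w \<noteq> q * x w"
    then have g: "?g \<noteq> 0" by simp
    have "2 * (?g / (?b + 1)) * ?g \<le> (?g / (?b + 1))\<^sup>2 * ?b" by (rule lin)
    then have "2 * ?g\<^sup>2 * (?b + 1) \<le> ?g\<^sup>2 * ?b"
      using b by (simp add: power2_eq_square divide_simps split: if_splits) (simp add: algebra_simps)
    then have "?g\<^sup>2 * (?b + 2) \<le> 0" by (simp add: algebra_simps)
    moreover have "0 < ?g\<^sup>2 * (?b + 2)" using g b by (intro mult_pos_pos) auto
    ultimately show False by linarith
  qed
qed

text \<open>
  A unit vector may be taken to vanish outside \<open>V\<close>, because the form does not depend on these entries.
  Then all its entries lie in \<open>[-1, 1]\<close>, and the functions with this property form a compact set in the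
  product topology.
\<close>

lemma rayleigh_maximiser_exists:
  fixes E :: "'a \<Rightarrow> 'a \<Rightarrow> bool"
  assumes fin: "finite V" and ne: "V \<noteq> {}"
  shows "\<exists>x. nrm2 V x = 1 \<and> (\<forall>y. nrm2 V y = 1 \<longrightarrow> qform E V y \<le> qform E V x)"
proof -
  define K :: "('a \<Rightarrow> real) set" where "K = PiE UNIV (\<lambda>u. {-1..1})"
  have "compactin (product_topology (\<lambda>i::'a. euclideanreal) UNIV) K"
    unfolding K_def compactin_PiE by (simp add: compactin_euclidean_iff)
  then have cK: "compact K"
    by (simp add: euclidean_product_topology)
  have cont: "continuous_on UNIV (\<lambda>x::'a\<Rightarrow>real. x u)" for u
    by (rule continuous_on_product_coordinates)
  have contn: "continuous_on UNIV (\<lambda>x. nrm2 V x)"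
    unfolding nrm2_def by (intro continuous_intros cont)
  have contq: "continuous_on UNIV (\<lambda>x. qform E V x)"
    unfolding qform_def qop_def by (intro continuous_intros cont)
  let ?S = "K \<inter> {x. nrm2 V x = 1}"
  have "closed {x. nrm2 V x = 1}"
    by (rule closed_Collect_eq[OF contn continuous_on_const])
  then have cS: "compact ?S" using cK by (rule compact_Int_closed[rotated])
  obtain w where w: "w \<in> V" using ne by auto
  let ?z = "\<lambda>u. if u = w then 1 else 0 :: real"
  have "nrm2 V ?z = (\<Sum>u\<in>V. if u = w then 1 else 0)"
    unfolding nrm2_def by (intro sum.cong) auto
  then have "nrm2 V ?z = 1" using fin w by simp
  then have "?z \<in> ?S" by (auto simp: K_def)
  then have "?S \<noteq> {}" by blast
  with cS obtain x where x: "x \<in> ?S" and max: "\<And>y. y \<in> ?S \<Longrightarrow> qform E V y \<le> qform E V x"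
    using continuous_attains_sup[of ?S "qform E V"] continuous_on_subset[OF contq] by blast
  show ?thesis
  proof (intro exI conjI allI impI)
    show "nrm2 V x = 1" using x by simp
    fix y assume y: "nrm2 V y = 1"
    let ?y = "\<lambda>u. if u \<in> V then y u else 0"
    have "(y u)\<^sup>2 \<le> 1" if "u \<in> V" for u
      using member_le_sum[of u V "\<lambda>u. (y u)\<^sup>2"] fin that y by (simp add: nrm2_def)
    then have "\<bar>y u\<bar> \<le> 1" if "u \<in> V" for u
      using that abs_square_le_1 by blast
    then have "?y \<in> K" by (auto simp: K_def abs_le_iff minus_le_iff)
    moreover have "nrm2 V ?y = 1" using y nrm2_cong[of V ?y y] by simp
    ultimately have "qform E V ?y \<le> qform E V x" using max by simp
    moreover have "qform E V ?y = qform E V y" by (rule qform_cong) simp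
    ultimately show "qform E V y \<le> qform E V x" by simp
  qed
qed

text \<open>
  Replacing a maximiser of the Rayleigh quotient by its absolute value does not decrease any term
  \<open>(x u + x v)\<^sup>2\<close>, so a nonnegative maximiser exists, and a maximiser is an eigenvector.
\<close>

lemma perron_exists:
  assumes fin: "finite V" and ne: "V \<noteq> {}" and sym: "symp E"
  shows "\<exists>q x. perron E V q x"
proof -
  obtain x where x: "nrm2 V x = 1" and xm: "\<And>y. nrm2 V y = 1 \<Longrightarrow> qform E V y \<le> qform E V x"
    using rayleigh_maximiser_exists[OF fin ne, of E] by blast
  define q where "q = qform E V x"
  have max: "qform E V y \<le> q * nrm2 V y" for y
  proof (cases "nrm2 V y = 0")
    case True
    then have "\<forall>u\<in>V. y u = 0" using fin nrm2_eq_0 by blast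
    then have "qform E V y = 0" by (simp add: qform_def)
    then show ?thesis using True by simp
  next
    case False
    then have pos: "0 < nrm2 V y" using nrm2_nonneg[of V y] by linarith
    let ?c = "1 / sqrt (nrm2 V y)"
    have c: "?c\<^sup>2 = 1 / nrm2 V y" using pos by (simp add: power_divide)
    have "nrm2 V (\<lambda>u. ?c * y u) = 1" unfolding nrm2_scale c using pos by simp
    then have "qform E V (\<lambda>u. ?c * y u) \<le> q" using xm q_def by blast
    then show ?thesis unfolding qform_scale c using pos by (simp add: field_simps)
  qed
  let ?x = "\<lambda>u. \<bar>x u\<bar>"
  have n: "nrm2 V ?x = 1" using x by (simp add: nrm2_def)
  have "2 * qform E V x \<le> 2 * qform E V ?x"
    unfolding qform_edges[OF fin sym]
  proof (intro sum_mono)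
    fix u v
    have "\<bar>x u + x v\<bar>\<^sup>2 \<le> (\<bar>x u\<bar> + \<bar>x v\<bar>)\<^sup>2" by (intro power_mono) auto
    then show "(x u + x v)\<^sup>2 \<le> (\<bar>x u\<bar> + \<bar>x v\<bar>)\<^sup>2" by simp
  qed
  then have eq: "qform E V ?x = q * nrm2 V ?x"
    using max[of ?x] n unfolding q_def by simp
  have "perron E V q ?x"
    unfolding perron_def
  proof (intro conjI ballI allI)
    show "\<exists>u\<in>V. 0 < \<bar>x u\<bar>" using x nrm2_eq_0[OF fin, of x] by auto
    show "qop E V ?x u = q * ?x u" if "u \<in> V" for u
      by (rule maximiser_eigen[OF fin sym max eq that])
  qed (use max in auto)
  then show ?thesis by blast
qed

lemma perron_qidx:
  assumes "finite V" "V \<noteq> {}" "symp E"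
  shows "\<exists>x. perron E V (qidx E V) x"
proof -
  have "\<exists>!q. \<exists>x. perron E V q x"
    using perron_exists[OF assms] perron_unique[OF assms(1)] by blast
  then show ?thesis unfolding qidx_def by (rule theI')
qed

lemma qidx_eq: "finite V \<Longrightarrow> perron E V q x \<Longrightarrow> qidx E V = q"
  unfolding qidx_def using perron_unique by (intro the_equality) blast+

lemma rayleigh_le:
  assumes "finite V" "V \<noteq> {}" "symp E"
  shows "qform E V y \<le> qidx E V * nrm2 V y"
  using perron_qidx[OF assms] unfolding perron_def by blast

section \<open>Deleting a vertex with the smallest Perron entry\<close>

lemma perron_scale:
  assumes x: "perron E V q x" and c: "0 < c"
  shows "perron E V q (\<lambda>u. c * x u)"
proof -
  have "qop E V (\<lambda>u. c * x u) u = c * qop E V x u" for u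
    by (simp only: qop_def sum_distrib_left distrib_left)
  then show ?thesis using x c unfolding perron_def by (auto intro: bexI mult_pos_pos)
qed

lemma perron_normalised:
  assumes "finite V" "V \<noteq> {}" "symp E"
  shows "\<exists>x. perron E V (qidx E V) x \<and> nrm2 V x = 1"
proof -
  obtain x where x: "perron E V (qidx E V) x" using perron_qidx[OF assms] by blast
  have pos: "0 < nrm2 V x" by (rule perron_nrm2_pos[OF assms(1) x])
  define c where "c = 1 / sqrt (nrm2 V x)"
  have c: "0 < c" "c\<^sup>2 = 1 / nrm2 V x" using pos by (simp_all add: c_def power_divide)
  have "nrm2 V (\<lambda>u. c * x u) = 1" unfolding nrm2_scale c(2) using pos by simp
  moreover have "perron E V (qidx E V) (\<lambda>u. c * x u)" by (rule perron_scale[OF x c(1)])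
  ultimately show ?thesis by blast
qed

lemma qop_alt: "finite V \<Longrightarrow> qop E V x u = real (card (nbhd E V u)) * x u + sum x (nbhd E V u)"
  by (simp add: qop_def sum.distrib)

lemma perron_eq:
  assumes "finite V" "perron E V q x" "u \<in> V"
  shows "q * x u = real (card (nbhd E V u)) * x u + sum x (nbhd E V u)"
  using assms qop_alt[of V E x u] by (simp add: perron_def)

lemma card_nbhd_less:
  assumes "finite V" "irreflp E" "u \<in> V"
  shows "card (nbhd E V u) \<le> card V - 1"
proof -
  have "nbhd E V u \<subseteq> V - {u}" using assms(2) by (auto simp: nbhd_def irreflp_def)
  then have "card (nbhd E V u) \<le> card (V - {u})" using assms by (intro card_mono) auto
  then show ?thesis using assms by simp
qed

text \<open>
  The eigenvector equation at a vertex with the largest entry bounds \<open>q\<close> by twice its degree.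
\<close>

lemma qidx_upper:
  assumes "finite V" "V \<noteq> {}" "symp E" "irreflp E"
  shows "qidx E V \<le> 2 * (real (card V) - 1)"
proof -
  obtain x where x: "perron E V (qidx E V) x" using perron_qidx[OF assms(1-3)] by blast
  define M where "M = Max (x ` V)"
  have "M \<in> x ` V" unfolding M_def using assms by (intro Max_in) auto
  then obtain u where u: "u \<in> V" "x u = M" by auto
  have le: "x v \<le> M" if "v \<in> V" for v unfolding M_def using assms that by (intro Max_ge) auto
  have M: "0 < M" using x le unfolding perron_def by force
  have "qidx E V * M = (\<Sum>v\<in>nbhd E V u. x u + x v)"
    using x u by (metis perron_def qop_def)
  also have "\<dots> \<le> (\<Sum>v\<in>nbhd E V u. 2 * M)"
    using u le by (intro sum_mono) (auto simp: nbhd_def)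
  also have "\<dots> = (2 * real (card (nbhd E V u))) * M" by simp
  finally have "qidx E V \<le> 2 * real (card (nbhd E V u))" using M by simp
  also have "\<dots> \<le> 2 * (real (card V) - 1)"
  proof -
    have "1 \<le> card V" using assms(1,2) by (simp add: Suc_le_eq card_gt_0_iff)
    then have "real (card (nbhd E V u)) \<le> real (card V) - 1"
      using card_nbhd_less[OF assms(1,4) u(1)] by linarith
    then show ?thesis by simp
  qed
  finally show ?thesis .
qed

text \<open>
  Test the Rayleigh quotient on the constant vector.
\<close>

lemma qidx_lower:
  assumes "finite V" "V \<noteq> {}" "symp E" and deg: "\<And>u. u \<in> V \<Longrightarrow> D \<le> real (card (nbhd E V u))"
  shows "2 * D \<le> qidx E V"
proof -
  have "2 * D * real (card V) = (\<Sum>u\<in>V. 2 * D)" by simp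
  also have "\<dots> \<le> (\<Sum>u\<in>V. 2 * real (card (nbhd E V u)))" using deg by (intro sum_mono) auto
  also have "\<dots> = qform E V (\<lambda>_. 1)" by (simp add: qform_def qop_def mult.commute)
  also have "\<dots> \<le> qidx E V * nrm2 V (\<lambda>_. 1)" by (rule rayleigh_le[OF assms(1-3)])
  also have "nrm2 V (\<lambda>_. 1) = real (card V)" by (simp add: nrm2_def)
  finally show ?thesis using assms(1,2) by (simp add: card_gt_0_iff)
qed

lemma qform_remove:
  assumes fin: "finite V" and sym: "symp E" and irr: "irreflp E" and w: "w \<in> V"
  shows "qform E V x = qform E (V - {w}) x + (\<Sum>v\<in>nbhd E V w. (x w + x v)\<^sup>2)"
proof -
  let ?V = "V - {w}"
  let ?f = "\<lambda>u v. if E u v then (x u + x v)\<^sup>2 else 0"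
  have V: "V = insert w ?V" using w by auto
  have ww: "?f w w = 0" using irr by (simp add: irreflp_def)
  have swap: "(\<Sum>u\<in>?V. ?f u w) = (\<Sum>v\<in>?V. ?f w v)"
    using sympD[OF sym] by (intro sum.cong refl) (auto simp: add.commute)
  have row: "(\<Sum>v\<in>V. ?f u v) = ?f u w + (\<Sum>v\<in>?V. ?f u v)" for u
    by (rule sum.remove[OF fin w])
  have "2 * qform E V x = (\<Sum>u\<in>V. \<Sum>v\<in>V. ?f u v)"
    by (simp add: qform_edges[OF fin sym] sum_nbhd[OF fin])
  also have "\<dots> = (\<Sum>v\<in>V. ?f w v) + (\<Sum>u\<in>?V. \<Sum>v\<in>V. ?f u v)"
    by (rule sum.remove[OF fin w])
  also have "\<dots> = (\<Sum>v\<in>?V. ?f w v) + ((\<Sum>u\<in>?V. ?f u w) + (\<Sum>u\<in>?V. \<Sum>v\<in>?V. ?f u v))"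
    unfolding row using ww by (simp add: sum.distrib)
  also have "\<dots> = 2 * (\<Sum>v\<in>?V. ?f w v) + 2 * qform E ?V x"
    unfolding swap using fin by (simp add: qform_edges[OF _ sym] sum_nbhd)
  also have "(\<Sum>v\<in>?V. ?f w v) = (\<Sum>v\<in>V. ?f w v)" unfolding row using ww by simp
  also have "\<dots> = (\<Sum>v\<in>nbhd E V w. (x w + x v)\<^sup>2)" by (simp add: sum_nbhd[OF fin])
  finally show ?thesis by simp
qed

text \<open>
  Restrict the Perron vector to \<open>V - {w}\<close>. The lost edges contribute
  \<open>(2 q - d) (x w)\<^sup>2\<close> plus the square norm of \<open>x\<close> on the \<open>d\<close> neighbours of \<open>w\<close>, and that norm is at most
  \<open>1 - (n - d) (x w)\<^sup>2\<close> since all other entries are at least \<open>x w\<close>. The degree \<open>d\<close> cancels.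
\<close>

lemma deletion_bound:
  assumes fin: "finite V" and sym: "symp E" and irr: "irreflp E" and w: "w \<in> V"
    and card: "2 \<le> card V" and x: "perron E V q x" "nrm2 V x = 1"
    and min: "\<And>u. u \<in> V \<Longrightarrow> x w \<le> x u"
  shows "q - 1 - (2 * q - real (card V)) * (x w)\<^sup>2 \<le> qidx E (V - {w}) * (1 - (x w)\<^sup>2)"
proof -
  let ?N = "nbhd E V w" and ?d = "real (card (nbhd E V w))" and ?n = "real (card V)"
  have x0: "0 \<le> x w" using x w by (simp add: perron_def)
  have "(\<Sum>v\<in>?N. (x w + x v)\<^sup>2) = (\<Sum>v\<in>?N. (x w)\<^sup>2 + 2 * x w * x v + (x v)\<^sup>2)"
    by (intro sum.cong refl) (simp add: power2_sum)
  also have "\<dots> = ?d * (x w)\<^sup>2 + 2 * x w * sum x ?N + nrm2 ?N x"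
    by (simp add: sum.distrib sum_distrib_left nrm2_def)
  also have "sum x ?N = (q - ?d) * x w"
    using perron_eq[OF fin x(1) w] by (simp add: algebra_simps)
  finally have edges: "(\<Sum>v\<in>?N. (x w + x v)\<^sup>2) = (2 * q - ?d) * (x w)\<^sup>2 + nrm2 ?N x"
    by (simp add: algebra_simps power2_eq_square)
  have sub: "?N \<subseteq> V" by (rule nbhd_subset)
  have "nrm2 V x = nrm2 (V - ?N) x + nrm2 ?N x"
    unfolding nrm2_def by (rule sum.subset_diff[OF sub fin])
  moreover have "(?n - ?d) * (x w)\<^sup>2 \<le> nrm2 (V - ?N) x"
  proof -
    have "(?n - ?d) * (x w)\<^sup>2 = (\<Sum>u\<in>V - ?N. (x w)\<^sup>2)"
      using card_Diff_subset[OF finite_nbhd[OF fin] sub] card_mono[OF fin sub]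
      by (simp add: of_nat_diff)
    also have "\<dots> \<le> nrm2 (V - ?N) x"
      unfolding nrm2_def using x0 min by (intro sum_mono power_mono) auto
    finally show ?thesis .
  qed
  ultimately have S: "nrm2 ?N x \<le> 1 - (?n - ?d) * (x w)\<^sup>2" using x(2) by linarith
  have "card (V - {w}) = card V - 1" using fin w by simp
  then have "V - {w} \<noteq> {}" using card by fastforce
  then have "qform E (V - {w}) x \<le> qidx E (V - {w}) * nrm2 (V - {w}) x"
    using fin sym by (intro rayleigh_le) auto
  moreover have "nrm2 (V - {w}) x = 1 - (x w)\<^sup>2"
    using x(2) fin w by (simp add: nrm2_def sum_diff1)
  moreover have "qform E V x = q" using perron_qform[OF x(1)] x(2) by simp
  ultimately have "q - (\<Sum>v\<in>?N. (x w + x v)\<^sup>2) \<le> qidx E (V - {w}) * (1 - (x w)\<^sup>2)"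
    using qform_remove[OF fin sym irr w, of x] by simp
  then show ?thesis using edges S by (simp add: algebra_simps)
qed

text \<open>
  The bound of \<open>deletion_bound\<close> improves as \<open>(x w)\<^sup>2\<close> decreases (here \<open>n \<le> q\<close> enters), so
  \<open>(x w)\<^sup>2\<close> may be replaced by its upper bound \<open>\<theta> / n\<close>.
\<close>

lemma deletion_rate:
  assumes fin: "finite V" and sym: "symp E" and irr: "irreflp E" and w: "w \<in> V"
    and card: "2 \<le> card V" and x: "perron E V q x" "nrm2 V x = 1"
    and min: "\<And>u. u \<in> V \<Longrightarrow> x w \<le> x u"
    and b: "(x w)\<^sup>2 * real (card V) \<le> \<theta>" "\<theta> \<le> 1" and q: "real (card V) \<le> q"
  shows "q * (real (card V) - 2 * \<theta>) - real (card V) * (1 - \<theta>) \<le> qidx E (V - {w}) * (real (card V) - \<theta>)"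
proof -
  let ?n = "real (card V)" and ?a = "(x w)\<^sup>2"
  define b where "b = \<theta> / ?n"
  have n: "2 \<le> ?n" using card by simp
  have ab: "?a \<le> b" using b(1) n by (simp add: b_def field_simps)
  have b1: "b < 1" using b(2) n by (simp add: b_def)
  have "0 \<le> (b - ?a) * (q - ?n + 1)" using ab q by (intro mult_nonneg_nonneg) auto
  then have "(q - 1 - (2 * q - ?n) * b) * (1 - ?a) \<le> (q - 1 - (2 * q - ?n) * ?a) * (1 - b)"
    by (simp add: algebra_simps)
  also have "\<dots> \<le> (qidx E (V - {w}) * (1 - ?a)) * (1 - b)"
    using deletion_bound[OF fin sym irr w card x min] b1 by (intro mult_right_mono) auto
  finally have "(q - 1 - (2 * q - ?n) * b) * (1 - ?a) \<le> (qidx E (V - {w}) * (1 - b)) * (1 - ?a)"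
    by (simp add: mult_ac)
  then have "q - 1 - (2 * q - ?n) * b \<le> qidx E (V - {w}) * (1 - b)"
    using ab b1 by simp
  then have "?n * (q - 1 - (2 * q - ?n) * b) \<le> ?n * (qidx E (V - {w}) * (1 - b))"
    using n by (intro mult_left_mono) auto
  moreover have nbhd: "?n * b = \<theta>" using n by (simp add: b_def)
  have "?n * (q - 1 - (2 * q - ?n) * b) = ?n * (q - 1) - (2 * q - ?n) * (?n * b)"
    "?n * (qidx E (V - {w}) * (1 - b)) = qidx E (V - {w}) * (?n - ?n * b)"
    by (simp_all add: algebra_simps)
  then have "?n * (q - 1 - (2 * q - ?n) * b) = ?n * (q - 1) - (2 * q - ?n) * \<theta>"
    "?n * (qidx E (V - {w}) * (1 - b)) = qidx E (V - {w}) * (?n - \<theta>)"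
    unfolding nbhd .
  ultimately have "?n * (q - 1) - (2 * q - ?n) * \<theta> \<le> qidx E (V - {w}) * (?n - \<theta>)" by (simp only:)
  then show ?thesis by (simp add: algebra_simps)
qed

text \<open>
  For a constant unit vector the number \<open>(x u)\<^sup>2 * card V\<close> is \<open>1\<close>, and its average over \<open>V\<close> is always
  \<open>1\<close>; flatness says that no entry is much below this average.
\<close>

definition flat :: "real \<Rightarrow> ('a \<Rightarrow> 'a \<Rightarrow> bool) \<Rightarrow> 'a set \<Rightarrow> bool" where
  "flat \<eta> E V \<longleftrightarrow> (\<exists>x. perron E V (qidx E V) x \<and> nrm2 V x = 1 \<and>
     (\<forall>u\<in>V. 1 - \<eta> \<le> (x u)\<^sup>2 * real (card V)))"

text \<open>
  For \<open>\<eta> = 0\<close> this says that \<open>q / (n - 1)\<close> does not decrease when a suitable vertex is deleted. If the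
  Perron vector is not flat, its smallest entry is so small that there is a gain of order \<open>\<eta> / n\<close>.
\<close>

lemma deletion_step:
  assumes fin: "finite V" and sym: "symp E" and irr: "irreflp E"
    and card: "3 \<le> card V" and \<eta>: "0 \<le> \<eta>" "\<eta> \<le> 1" and nf: "\<eta> = 0 \<or> \<not> flat \<eta> E V"
    and q: "\<rho> * (real (card V) - 1) \<le> qidx E V" "real (card V) \<le> qidx E V"
  shows "\<exists>w\<in>V. \<rho> * (real (card V) - 2) + \<eta> * (\<rho> - 1) \<le> qidx E (V - {w})"
proof -
  let ?n = "real (card V)" and ?q = "qidx E V"
  have ne: "V \<noteq> {}" using card by auto
  obtain x where x: "perron E V ?q x" "nrm2 V x = 1" using perron_normalised[OF fin ne sym] by blast
  obtain w where w: "w \<in> V" "\<And>u. u \<in> V \<Longrightarrow> x w \<le> x u"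
    using ex_min_if_finite[of "x ` V"] fin ne by (metis (no_types, lifting) finite_imageI image_iff image_is_empty not_less)
  have x0: "0 \<le> x u" if "u \<in> V" for u using x that by (simp add: perron_def)
  have sq: "(x w)\<^sup>2 \<le> (x u)\<^sup>2" if "u \<in> V" for u using w that x0 by (intro power_mono) auto
  have "(x w)\<^sup>2 * ?n = (\<Sum>u\<in>V. (x w)\<^sup>2)" by simp
  also have "\<dots> \<le> 1" using sq x(2) unfolding nrm2_def[symmetric] x(2)[symmetric]
    by (simp only: nrm2_def) (intro sum_mono, auto)
  finally have le1: "(x w)\<^sup>2 * ?n \<le> 1" .
  have "(x w)\<^sup>2 * ?n \<le> 1 - \<eta>"
  proof (cases "\<eta> = 0")
    case False
    with nf x obtain u where u: "u \<in> V" "(x u)\<^sup>2 * ?n < 1 - \<eta>" unfolding flat_def by force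
    have "(x w)\<^sup>2 * ?n \<le> (x u)\<^sup>2 * ?n" using sq[OF u(1)] by (intro mult_right_mono) auto
    with u show ?thesis by simp
  qed (use le1 in simp)
  then have r: "?q * (?n - 2 * (1 - \<eta>)) - ?n * \<eta> \<le> qidx E (V - {w}) * (?n - (1 - \<eta>))"
    using deletion_rate[OF fin sym irr w(1) _ x w(2), of "1 - \<eta>"] card \<eta> q by simp
  have n: "3 \<le> ?n" using card by simp
  define s where "s = ?q / (?n - 1)"
  have qs: "?q = s * (?n - 1)" using n by (simp add: s_def)
  have s: "\<rho> \<le> s" using q(1) n by (simp add: s_def field_simps)
  have s1: "1 \<le> s" using q(2) n by (simp add: s_def field_simps)
  have "(s * (?n - 2) + \<eta> * (s - 1)) * (?n - 1 + \<eta>) \<le> ?q * (?n - 2 * (1 - \<eta>)) - ?n * \<eta>"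
  proof -
    have "0 \<le> \<eta> * (s - 1) * (1 - \<eta>)" using \<eta> s1 by simp
    then show ?thesis unfolding qs by (simp add: algebra_simps)
  qed
  with r have "(s * (?n - 2) + \<eta> * (s - 1)) * (?n - 1 + \<eta>) \<le> qidx E (V - {w}) * (?n - 1 + \<eta>)"
    by (simp add: algebra_simps)
  then have "s * (?n - 2) + \<eta> * (s - 1) \<le> qidx E (V - {w})"
    using n \<eta> by (simp add: mult_le_cancel_right)
  moreover have "\<rho> * (?n - 2) \<le> s * (?n - 2)" using s n by (intro mult_right_mono) auto
  moreover have "\<eta> * (\<rho> - 1) \<le> \<eta> * (s - 1)" using s \<eta> by (intro mult_left_mono) auto
  ultimately have "\<rho> * (?n - 2) + \<eta> * (\<rho> - 1) \<le> qidx E (V - {w})" by linarith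
  then show ?thesis using w(1) by blast
qed

text \<open>
  The eigenvector equation reads \<open>(q - d) x u =\<close> sum of \<open>x\<close> over the \<open>d\<close> neighbours of \<open>u\<close>. By the
  Cauchy-Schwarz inequality the right-hand side is at most the square root of \<open>d\<close> times the norm of \<open>x\<close> on
  the neighbours, and flatness controls both this norm and \<open>x u\<close>. For a constant vector the result is
  \<open>q \<le> 2 d\<close>.
\<close>

lemma flat_min_degree:
  assumes fin: "finite V" and sym: "symp E" and fl: "flat \<eta> E V" and \<eta>: "0 \<le> \<eta>" "\<eta> \<le> 1"
    and a: "0 \<le> a" "a \<le> 1" and q: "(2 * a - \<eta>) * real (card V) \<le> qidx E V" and u: "u \<in> V"
  shows "(a - 2 * \<eta>) * real (card V) \<le> real (card (nbhd E V u))"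
proof -
  let ?n = "real (card V)" and ?q = "qidx E V" and ?N = "nbhd E V u"
  let ?d = "real (card ?N)"
  obtain x where x: "perron E V ?q x" "nrm2 V x = 1" and
    fl: "\<And>u. u \<in> V \<Longrightarrow> 1 - \<eta> \<le> (x u)\<^sup>2 * ?n" using fl unfolding flat_def by blast
  have n: "0 < ?n" using u fin card_gt_0_iff by auto
  have sub: "?N \<subseteq> V" by (rule nbhd_subset)
  have dn: "?d \<le> ?n" using card_mono[OF fin sub] by simp
  have "(1 - \<eta>) * (?n - ?d) = (\<Sum>v\<in>V - ?N. 1 - \<eta>)"
    using card_Diff_subset[OF finite_nbhd[OF fin] sub] card_mono[OF fin sub] by (simp add: of_nat_diff)
  also have "\<dots> \<le> (\<Sum>v\<in>V - ?N. (x v)\<^sup>2 * ?n)" using fl by (intro sum_mono) auto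
  also have "\<dots> = nrm2 (V - ?N) x * ?n" by (simp add: nrm2_def sum_distrib_right)
  also have "nrm2 (V - ?N) x = 1 - nrm2 ?N x"
    using sum.subset_diff[OF sub fin, of "\<lambda>u. (x u)\<^sup>2"] x(2) by (simp add: nrm2_def)
  finally have S: "nrm2 ?N x * ?n \<le> \<eta> * ?n + (1 - \<eta>) * ?d" by (simp add: algebra_simps)
  have cs: "((?q - ?d) * x u)\<^sup>2 \<le> ?d * nrm2 ?N x"
  proof -
    have "(?q - ?d) * x u = (\<Sum>v\<in>?N. 1 * x v)"
      using perron_eq[OF fin x(1) u] by (simp add: algebra_simps)
    also have "\<dots>\<^sup>2 \<le> (\<Sum>v\<in>?N. 1\<^sup>2) * (\<Sum>v\<in>?N. (x v)\<^sup>2)"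
      by (rule Cauchy_Schwarz_ineq_sum)
    finally show ?thesis by (simp add: nrm2_def)
  qed
  have "(1 - \<eta>) * (?q - ?d)\<^sup>2 \<le> ((x u)\<^sup>2 * ?n) * (?q - ?d)\<^sup>2"
    using fl[OF u] by (intro mult_right_mono) auto
  also have "\<dots> \<le> ?d * (nrm2 ?N x * ?n)"
    using mult_right_mono[OF cs, of ?n] n by (simp add: power_mult_distrib mult_ac)
  also have "\<dots> \<le> ?d * (\<eta> * ?n + (1 - \<eta>) * ?d)" using S by (intro mult_left_mono) auto
  also have "\<dots> \<le> (?d + \<eta> * ?n) * (?d + \<eta> * ?n)"
  proof (intro mult_mono)
    show "\<eta> * ?n + (1 - \<eta>) * ?d \<le> ?d + \<eta> * ?n" using \<eta> by (simp add: algebra_simps)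
  qed (use \<eta> n in auto)
  finally have main: "(1 - \<eta>) * (?q - ?d)\<^sup>2 \<le> (?d + \<eta> * ?n)\<^sup>2" by (simp add: power2_eq_square)
  have "((1 - \<eta>) * (?q - ?d))\<^sup>2 \<le> (1 - \<eta>) * (?q - ?d)\<^sup>2"
  proof -
    have "(1 - \<eta>) * ((1 - \<eta>) * (?q - ?d)\<^sup>2) \<le> 1 * ((1 - \<eta>) * (?q - ?d)\<^sup>2)"
      using \<eta> by (intro mult_right_mono) auto
    then show ?thesis by (simp add: power2_eq_square mult_ac)
  qed
  with main have "((1 - \<eta>) * (?q - ?d))\<^sup>2 \<le> (?d + \<eta> * ?n)\<^sup>2" by linarith
  then have "(1 - \<eta>) * (?q - ?d) \<le> ?d + \<eta> * ?n"
    using \<eta> n by (intro power2_le_imp_le[of "(1 - \<eta>) * (?q - ?d)"]) auto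
  then have "(1 - \<eta>) * ?q \<le> ?d + \<eta> * ?n + (1 - \<eta>) * ?d" by (simp add: algebra_simps)
  also have "\<dots> \<le> 2 * ?d + \<eta> * ?n" using \<eta> by (simp add: algebra_simps)
  finally have 1: "(1 - \<eta>) * ?q \<le> 2 * ?d + \<eta> * ?n" .
  have 2: "(1 - \<eta>) * ((2 * a - \<eta>) * ?n) \<le> (1 - \<eta>) * ?q" using q \<eta> by (intro mult_left_mono) auto
  have 3: "(2 * a - 4 * \<eta>) * ?n \<le> (1 - \<eta>) * ((2 * a - \<eta>) * ?n) - \<eta> * ?n"
  proof -
    have "a * \<eta> \<le> 1 * \<eta>" using a \<eta> by (intro mult_right_mono) auto
    then have "2 * a - 4 * \<eta> \<le> (1 - \<eta>) * (2 * a - \<eta>) - \<eta>"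
      using \<eta> by (simp add: algebra_simps) (use zero_le_square[of \<eta>] in linarith)
    then have "(2 * a - 4 * \<eta>) * ?n \<le> ((1 - \<eta>) * (2 * a - \<eta>) - \<eta>) * ?n"
      using n by (intro mult_right_mono) auto
    then show ?thesis by (simp add: algebra_simps)
  qed
  show ?thesis using 1 2 3 by (simp add: algebra_simps)
qed

text \<open>
  The property \<open>Fr\<close> stands for being free of a fixed subgraph and \<open>a\<close> for \<open>1 - 1/r\<close>. The assumption
  \<open>dense\<close> is supplied by Turan graphs.
\<close>

locale hereditary =
  fixes Fr :: "('a \<Rightarrow> 'a \<Rightarrow> bool) \<Rightarrow> 'a set \<Rightarrow> bool" and a c :: real
  assumes hered: "Fr E V \<Longrightarrow> W \<subseteq> V \<Longrightarrow> Fr E W"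
    and a: "2 / 3 \<le> a" "a \<le> 1"
    and dense: "1 \<le> n \<Longrightarrow> \<exists>E V. finite V \<and> symp E \<and> irreflp E \<and> Fr E V \<and> card V = n \<and>
      2 * a * (real n - 1) - c \<le> qidx E V"
begin

definition dens :: "nat \<Rightarrow> real set" where
  "dens n = {qidx E V / (real n - 1) | E V. finite V \<and> symp E \<and> irreflp E \<and> Fr E V \<and> card V = n}"

lemma densE:
  assumes "d \<in> dens n"
  obtains E V where "finite V" "symp E" "irreflp E" "Fr E V" "card V = n" "d = qidx E V / (real n - 1)"
  using assms unfolding dens_def mem_Collect_eq by (elim exE conjE) (rule that)

lemma densI:
  "finite V \<Longrightarrow> symp E \<Longrightarrow> irreflp E \<Longrightarrow> Fr E V \<Longrightarrow> card V = n \<Longrightarrow> qidx E V / (real n - 1) \<in> dens n"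
  unfolding dens_def mem_Collect_eq by (intro exI[of _ E] exI[of _ V]) simp

lemma dens_le_2: "2 \<le> n \<Longrightarrow> d \<in> dens n \<Longrightarrow> d \<le> 2"
proof -
  assume n: "2 \<le> n" and "d \<in> dens n"
  then obtain E V where EV: "finite V" "symp E" "irreflp E" "card V = n" "d = qidx E V / (real n - 1)"
    and "Fr E V"
    by (elim densE)
  have "V \<noteq> {}" using n EV by auto
  from qidx_upper[OF EV(1) this EV(2,3)] have "qidx E V \<le> 2 * (real n - 1)" by (simp only: EV(4))
  then show "d \<le> 2" unfolding EV(5) using n by (simp add: pos_divide_le_eq)
qed

lemma bdd_dens: "2 \<le> n \<Longrightarrow> bdd_above (dens n)"
  using dens_le_2 by (intro bdd_aboveI[of _ 2]) auto

lemma Sup_dens_lower: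
  assumes "2 \<le> n" shows "2 * a - c / (real n - 1) \<le> Sup (dens n)" "dens n \<noteq> {}"
proof -
  obtain E V where EV: "finite V" "symp E" "irreflp E" "Fr E V" "card V = n"
    "2 * a * (real n - 1) - c \<le> qidx E V" using dense[of n] assms by force
  then have "qidx E V / (real n - 1) \<in> dens n" by (intro densI)
  then have "qidx E V / (real n - 1) \<le> Sup (dens n)" "dens n \<noteq> {}"
    using bdd_dens[OF assms] by (auto intro: cSup_upper)
  moreover have "2 * a - c / (real n - 1) \<le> qidx E V / (real n - 1)"
    using divide_right_mono[OF EV(6), of "real n - 1"] assms by (simp add: diff_divide_distrib)
  ultimately show "2 * a - c / (real n - 1) \<le> Sup (dens n)" "dens n \<noteq> {}" by auto
qed

text \<open>
  A graph with quotient above \<open>Sup (dens (n - 1))\<close> would keep this quotient after the deletion of a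
  vertex. The assumption \<open>big\<close> provides the inequality \<open>n \<le> q\<close> that \<open>deletion_step\<close> needs.
\<close>

lemma Sup_dens_mono:
  assumes n: "3 \<le> n" and big: "n / (real n - 1) < Sup (dens n)"
  shows "Sup (dens n) \<le> Sup (dens (n - 1))"
proof (rule ccontr)
  assume "\<not> ?thesis"
  then have "max (Sup (dens (n - 1))) (n / (real n - 1)) < Sup (dens n)" using big by simp
  moreover have "dens n \<noteq> {}" using Sup_dens_lower(2) n by simp
  ultimately obtain d where d: "d \<in> dens n" "max (Sup (dens (n - 1))) (n / (real n - 1)) < d"
    using less_cSupD by blast
  then obtain E V where EV: "finite V" "symp E" "irreflp E" "Fr E V" "card V = n"
    "d = qidx E V / (real n - 1)" by (elim densE)
  have "d * (real (card V) - 1) \<le> qidx E V" using EV n by simp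
  moreover have "real (card V) \<le> qidx E V"
  proof -
    have "real n / (real n - 1) < qidx E V / (real n - 1)" using d(2) EV(6) by simp
    then show ?thesis using n EV(5) by (simp add: divide_less_cancel)
  qed
  ultimately obtain w where w: "w \<in> V" "d * (real n - 2) \<le> qidx E (V - {w})"
    using deletion_step[OF EV(1-3), of 0 d] EV n by auto
  have "qidx E (V - {w}) / (real (n - 1) - 1) \<in> dens (n - 1)"
    using EV w(1) hered[OF EV(4), of "V - {w}"] by (intro densI) auto
  then have "qidx E (V - {w}) / (real (n - 1) - 1) \<le> Sup (dens (n - 1))"
    using n bdd_dens[of "n - 1"] by (intro cSup_upper) auto
  moreover have "d \<le> qidx E (V - {w}) / (real (n - 1) - 1)"
    using w(2) n by (simp add: field_simps of_nat_diff)
  ultimately show False using d(2) by simp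
qed

text \<open>
  The suprema are eventually decreasing and bounded below.
\<close>

lemma dens_limit:
  "\<exists>L\<ge>2 * a. \<exists>N0\<ge>4. (\<forall>n\<ge>N0. L \<le> Sup (dens n)) \<and> (\<forall>e>0. \<exists>N\<ge>N0. \<forall>n\<ge>N. Sup (dens n) \<le> L + e)"
proof -
  have lim: "(\<lambda>n. 2 * a - c / (real n - 1)) \<longlonglongrightarrow> 2 * a"
  proof -
    have "(\<lambda>n. c / (real n - 1)) \<longlonglongrightarrow> 0"
    proof (rule tendsto_divide_0[OF tendsto_const])
      have "filterlim (\<lambda>n. -1 + real n) at_top sequentially"
        by (rule filterlim_tendsto_add_at_top[OF tendsto_const filterlim_real_sequentially])
      then show "filterlim (\<lambda>n. real n - 1) at_infinity sequentially"
        by (intro filterlim_at_top_imp_at_infinity) simp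
    qed
    then show ?thesis using tendsto_diff[OF tendsto_const[of "2 * a"]] by fastforce
  qed
  have "eventually (\<lambda>n. 5/4 < 2 * a - c / (real n - 1)) sequentially"
    using lim a by (intro order_tendstoD(1)[OF lim]) auto
  then obtain N1 where N1: "\<And>n. n \<ge> N1 \<Longrightarrow> 5/4 < 2 * a - c / (real n - 1)"
    unfolding eventually_sequentially by blast
  define N0 where "N0 = max N1 6"
  have mono: "Sup (dens n) \<le> Sup (dens (n - 1))" if "n \<ge> N0" for n
  proof (rule Sup_dens_mono)
    have n: "6 \<le> n" "N1 \<le> n" using that by (auto simp: N0_def)
    then show "3 \<le> n" by simp
    have "real n / (real n - 1) \<le> 5/4" using n by (simp add: field_simps)
    also have "\<dots> < Sup (dens n)"
      by (rule less_le_trans[OF N1[OF n(2)] Sup_dens_lower(1)]) (use n in simp)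
    finally show "real n / (real n - 1) < Sup (dens n)" .
  qed
  define f where "f = (\<lambda>k. Sup (dens (N0 + k)))"
  have dec: "decseq f" unfolding f_def
    by (intro decseq_SucI) (use mono[of "N0 + Suc _"] in simp)
  have "0 \<le> f k" for k
  proof -
    have "5/4 < 2 * a - c / (real (N0 + k) - 1)" by (rule N1) (simp add: N0_def)
    moreover have "2 * a - c / (real (N0 + k) - 1) \<le> f k"
      unfolding f_def by (rule Sup_dens_lower) (simp add: N0_def)
    ultimately show ?thesis by linarith
  qed
  then obtain L where L: "f \<longlonglongrightarrow> L" "\<And>i. L \<le> f i"
    using decseq_convergent[OF dec] by blast
  have "2 * a \<le> L"
  proof (rule LIMSEQ_le[OF _ L(1)])
    show "(\<lambda>k. 2 * a - c / (real (N0 + k) - 1)) \<longlonglongrightarrow> 2 * a"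
      using LIMSEQ_ignore_initial_segment[OF lim, of N0] by (simp add: add.commute)
    show "\<exists>N. \<forall>k\<ge>N. 2 * a - c / (real (N0 + k) - 1) \<le> f k"
      unfolding f_def by (intro exI[of _ 0] allI impI Sup_dens_lower) (simp add: N0_def)
  qed
  moreover have "\<forall>n\<ge>N0. L \<le> Sup (dens n)"
  proof (intro allI impI)
    fix n assume "N0 \<le> n"
    then show "L \<le> Sup (dens n)" using L(2)[of "n - N0"] by (simp add: f_def)
  qed
  moreover have "\<exists>N\<ge>N0. \<forall>n\<ge>N. Sup (dens n) \<le> L + e" if "e > 0" for e
  proof -
    have "eventually (\<lambda>k. f k < L + e) sequentially"
      using that by (intro order_tendstoD(2)[OF L(1)]) auto
    then obtain K where K: "\<And>k. k \<ge> K \<Longrightarrow> f k < L + e" unfolding eventually_sequentially by blast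
    have "Sup (dens n) \<le> L + e" if "n \<ge> N0 + K" for n
    proof -
      have "K \<le> n - N0" using that by linarith
      from K[OF this] show ?thesis using that by (simp add: f_def)
    qed
    then show ?thesis by (intro exI[of _ "N0 + K"]) auto
  qed
  ultimately show ?thesis by (intro exI[of _ L] conjI exI[of _ N0]) (auto simp: N0_def)
qed

text \<open>
  Delete vertices one at a time, starting from an extremal graph, whose quotient \<open>q / (n - 1)\<close> is at
  least the limit \<open>L\<close> of the suprema. As long as no flat graph appears, each deletion raises the
  quotient by \<open>g = \<eta> (L - 1) / n\<close>. After \<open>\<kappa> n\<close> deletions the quotient would exceed \<open>L\<close> by a constant
  that does not depend on \<open>n\<close>, although the graph still has at least \<open>n / 2\<close> vertices. This
  contradicts the convergence of the suprema to \<open>L\<close>.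
\<close>

lemma flat_subgraph_exists:
  assumes \<kappa>: "0 < \<kappa>" "\<kappa> \<le> 1/2" and \<eta>: "0 < \<eta>" "\<eta> \<le> 1"
  shows "\<exists>N. \<forall>E V. finite V \<and> symp E \<and> irreflp E \<and> Fr E V \<and> N \<le> card V \<and>
     (\<forall>E' V'. finite V' \<and> symp E' \<and> irreflp E' \<and> Fr E' V' \<and> card V' = card V \<longrightarrow> qidx E' V' \<le> qidx E V) \<longrightarrow>
     (\<exists>W\<subseteq>V. (1 - \<kappa>) * real (card V) \<le> real (card W) \<and> flat \<eta> E W \<and>
        2 * a * (real (card W) - 1) \<le> qidx E W)"
proof -
  obtain L N0 where L: "2 * a \<le> L" "4 \<le> N0" "\<And>n. N0 \<le> n \<Longrightarrow> L \<le> Sup (dens n)"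
    and Lup: "\<And>e. 0 < e \<Longrightarrow> \<exists>N\<ge>N0. \<forall>n\<ge>N. Sup (dens n) \<le> L + e"
    using dens_limit by blast
  have L1: "4/3 \<le> L" using L(1) a by simp
  \<comment> \<open>half of the total gain that the deletions guarantee\<close>
  define e where "e = \<kappa> * \<eta> * (L - 1) / 4"
  have e: "0 < e" using \<kappa> \<eta> L1 by (simp add: e_def)
  obtain N where N: "N0 \<le> N" "\<And>n. N \<le> n \<Longrightarrow> Sup (dens n) \<le> L + e" using Lup[OF e] by blast
  \<comment> \<open>The chain of deletions below stops above half of the vertices, hence the factor \<open>2\<close>;
    the second summand makes rounding \<open>\<kappa> n\<close> down harmless.\<close>
  define N2 where "N2 = 2 * N + nat \<lceil>2 / \<kappa>\<rceil>"
  have "\<exists>W\<subseteq>V. (1 - \<kappa>) * real (card V) \<le> real (card W) \<and> flat \<eta> E W \<and>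
        2 * a * (real (card W) - 1) \<le> qidx E W"
    if fin: "finite V" and sym: "symp E" and irr: "irreflp E" and copy_free: "Fr E V" and big: "N2 \<le> card V"
      and max: "\<And>E' V'. \<lbrakk>finite V'; symp E'; irreflp E'; Fr E' V'; card V' = card V\<rbrakk> \<Longrightarrow> qidx E' V' \<le> qidx E V"
    for E V
  proof (rule ccontr)
    assume no: "\<not> ?thesis"
    let ?n = "real (card V)"
    define n where "n = card V"
    have nN: "2 * N \<le> n" "2 / \<kappa> \<le> real n" "4 \<le> n"
      using big N(1) L(2) unfolding n_def[symmetric] N2_def by linarith+
    have "Sup (dens n) \<le> qidx E V / (real n - 1)"
    proof (rule cSup_least)
      show "dens n \<noteq> {}" using Sup_dens_lower(2) nN by simp
      fix d assume "d \<in> dens n"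
      then obtain E' V' where "finite V'" "symp E'" "irreflp E'" "Fr E' V'" "card V' = n"
        "d = qidx E' V' / (real n - 1)" by (elim densE)
      then show "d \<le> qidx E V / (real n - 1)"
        using max[of V' E'] nN by (auto simp: n_def divide_right_mono)
    qed
    then have start: "L * (real n - 1) \<le> qidx E V"
    proof -
      have "L \<le> qidx E V / (real n - 1)"
        using \<open>Sup (dens n) \<le> qidx E V / (real n - 1)\<close> L(3)[of n] nN N(1) by linarith
      then show ?thesis using nN by (simp add: pos_le_divide_eq)
    qed
    define g where "g = \<eta> * (L - 1) / real n"
    have g: "0 \<le> g" using \<eta> L1 by (simp add: g_def)
    define J where "J = nat \<lfloor>\<kappa> * real n\<rfloor>"
    have Jle: "real J \<le> \<kappa> * real n" using \<kappa> by (simp add: J_def)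
    have Jge: "\<kappa> * real n / 2 \<le> real J"
    proof -
      have "\<kappa> * real n - 1 \<le> real J" unfolding J_def using \<kappa> by linarith
      moreover have "2 \<le> \<kappa> * real n" using nN(2) \<kappa> by (simp add: field_simps)
      ultimately show ?thesis by linarith
    qed
    have Jn: "2 * J \<le> n"
    proof -
      have "\<kappa> * real n \<le> 1/2 * real n" using \<kappa> by (intro mult_right_mono) auto
      then show ?thesis using Jle by linarith
    qed
    have chain: "\<exists>W\<subseteq>V. card W = n - j \<and> (L + real j * g) * (real (card W) - 1) \<le> qidx E W"
      if "j \<le> J" for j
      using that
    proof (induction j)
      case 0
      then show ?case using start by (intro exI[of _ V]) (simp add: n_def)
    next
      case (Suc j)
      then obtain W where W: "W \<subseteq> V" "card W = n - j"
        "(L + real j * g) * (real (card W) - 1) \<le> qidx E W" by auto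
      let ?m = "real (card W)"
      define \<rho> where "\<rho> = L + real j * g"
      have \<rho>: "L \<le> \<rho>" using g by (simp add: \<rho>_def)
      have j: "j < J" using Suc.prems by simp
      have cW: "2 * card W \<ge> n" "4 \<le> card W" "card W \<le> n"
      proof -
        show 1: "2 * card W \<ge> n" using W(2) j Jn by linarith
        show "card W \<le> n" using W(2) by simp
        have "2 * N \<le> n" "4 \<le> N" using nN N L by auto
        then show "4 \<le> card W" using 1 by linarith
      qed
      have finW: "finite W" using W(1) fin finite_subset by blast
      have "(1 - \<kappa>) * ?n \<le> ?m"
        using W(2) j Jn Jle unfolding n_def[symmetric] by (simp add: algebra_simps of_nat_diff)
      moreover have "2 * a * (?m - 1) \<le> qidx E W"
      proof -
        have "2 * a * (?m - 1) \<le> \<rho> * (?m - 1)" using \<rho> L(1) cW by (intro mult_right_mono) auto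
        then show ?thesis using W(3) \<rho>_def by simp
      qed
      ultimately have nf: "\<not> flat \<eta> E W" using no W(1) by blast
      have "?m \<le> 4/3 * (?m - 1)" using cW by simp
      also have "\<dots> \<le> \<rho> * (?m - 1)" using \<rho> L1 cW by (intro mult_right_mono) auto
      also have "\<dots> \<le> qidx E W" using W(3) by (simp add: \<rho>_def)
      finally have qm: "?m \<le> qidx E W" .
      obtain w where w: "w \<in> W" "\<rho> * (?m - 2) + \<eta> * (\<rho> - 1) \<le> qidx E (W - {w})"
        using deletion_step[OF finW sym irr, of \<eta> \<rho>] nf qm W(3) \<eta> cW unfolding \<rho>_def by auto
      have "g * (?m - 2) \<le> \<eta> * (\<rho> - 1)"
      proof -
        have "g * (?m - 2) \<le> g * real n" using g cW by (intro mult_left_mono) auto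
        also have "\<dots> = \<eta> * (L - 1)" using nN by (simp add: g_def)
        also have "\<dots> \<le> \<eta> * (\<rho> - 1)" using \<rho> \<eta> by (intro mult_left_mono) auto
        finally show ?thesis .
      qed
      with w(2) have "(\<rho> + g) * (?m - 2) \<le> qidx E (W - {w})" by (simp add: algebra_simps)
      moreover have "card (W - {w}) = n - Suc j" and cw: "real (card (W - {w})) - 1 = ?m - 2"
        using w(1) finW W(2) cW by (simp_all add: of_nat_diff)
      moreover have "\<rho> + g = L + real (Suc j) * g" by (simp add: \<rho>_def algebra_simps)
      ultimately have "W - {w} \<subseteq> V \<and> card (W - {w}) = n - Suc j \<and>
          (L + real (Suc j) * g) * (real (card (W - {w})) - 1) \<le> qidx E (W - {w})"
        using W(1) by (simp only:) blast
      then show ?case by blast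
    qed
    obtain W where W: "W \<subseteq> V" "card W = n - J" "(L + real J * g) * (real (card W) - 1) \<le> qidx E W"
      using chain[of J] by blast
    have cW: "N \<le> card W" using W(2) Jn nN by linarith
    have finW: "finite W" using W(1) fin finite_subset by blast
    have "qidx E W / (real (card W) - 1) \<in> dens (card W)"
      using finW sym irr hered[OF copy_free W(1)] by (intro densI) auto
    then have "qidx E W / (real (card W) - 1) \<le> Sup (dens (card W))"
      using bdd_dens[of "card W"] cW N L by (intro cSup_upper) auto
    also have "\<dots> \<le> L + e" using N cW by simp
    finally have 1: "qidx E W / (real (card W) - 1) \<le> L + e" .
    have 2: "L + real J * g \<le> qidx E W / (real (card W) - 1)"
      using W(3) cW N L by (simp add: field_simps)
    have "2 * e = (\<kappa> * real n / 2) * g" using nN by (simp add: e_def g_def field_simps)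
    also have "\<dots> \<le> real J * g" using Jge g by (intro mult_right_mono) auto
    finally show False using 1 2 e by linarith
  qed
  then show ?thesis by (intro exI[of _ N2]) blast
qed

end

section \<open>Complete multipartite subgraphs and the core\<close>

definition complete_parts :: "('a \<Rightarrow> 'a \<Rightarrow> bool) \<Rightarrow> (nat \<Rightarrow> 'a set) \<Rightarrow> nat \<Rightarrow> bool" where
  "complete_parts E T j \<longleftrightarrow> (\<forall>c<j. \<forall>d<j. c \<noteq> d \<longrightarrow> (\<forall>u\<in>T c. \<forall>v\<in>T d. E u v))"

text \<open>
  A matching with \<open>t\<close> edges, with the two ends of each edge named.
\<close>

definition disjoint_edges :: "('a \<Rightarrow> 'a \<Rightarrow> bool) \<Rightarrow> 'a set \<Rightarrow> nat \<Rightarrow> (nat \<Rightarrow> 'a) \<Rightarrow> (nat \<Rightarrow> 'a) \<Rightarrow> bool" where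
  "disjoint_edges E V t a b \<longleftrightarrow> (\<forall>l<t. a l \<in> V \<and> b l \<in> V \<and> E (a l) (b l)) \<and>
     inj_on a {..<t} \<and> inj_on b {..<t} \<and> a ` {..<t} \<inter> b ` {..<t} = {}"

text \<open>
  A complete \<open>r\<close>-partite graph with parts of at least \<open>m\<close> vertices, together with \<open>t\<close> disjoint edges
  that take the place of edges inside the part \<open>i\<close>: their ends are complete to all other parts. The
  ends may lie in the parts or outside of them.
\<close>

definition matching_blowup :: "('a \<Rightarrow> 'a \<Rightarrow> bool) \<Rightarrow> 'a set \<Rightarrow> nat \<Rightarrow> nat \<Rightarrow> nat \<Rightarrow> bool" where
  "matching_blowup E V r t m \<longleftrightarrow> (\<exists>i<r. \<exists>T a b. (\<forall>c<r. T c \<subseteq> V \<and> m \<le> card (T c)) \<and> complete_parts E T r \<and>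
     disjoint_edges E V t a b \<and>
     (\<forall>l<t. \<forall>c<r. c \<noteq> i \<longrightarrow> (\<forall>v\<in>T c. E (a l) v \<and> E (b l) v)))"

lemma matching_blowupI:
  assumes "i < r" "\<And>c. c < r \<Longrightarrow> T c \<subseteq> V" "\<And>c. c < r \<Longrightarrow> m \<le> card (T c)" "complete_parts E T r"
    "disjoint_edges E V t a b" "\<And>l c v. \<lbrakk>l < t; c < r; c \<noteq> i; v \<in> T c\<rbrakk> \<Longrightarrow> E (a l) v \<and> E (b l) v"
  shows "matching_blowup E V r t m"
  unfolding matching_blowup_def using assms by blast

lemma complete_parts_mono:
  "complete_parts E T j \<Longrightarrow> (\<And>c. c < j \<Longrightarrow> T' c \<subseteq> T c) \<Longrightarrow> complete_parts E T' j"
  unfolding complete_parts_def by blast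

lemma complete_parts_disjoint:
  "complete_parts E T j \<Longrightarrow> irreflp E \<Longrightarrow> c < j \<Longrightarrow> d < j \<Longrightarrow> c \<noteq> d \<Longrightarrow> T c \<inter> T d = {}"
  unfolding complete_parts_def irreflp_def by blast

lemma large_fibre:
  assumes "finite Y" "finite P" "f ` Y \<subseteq> P" "card P * m < card Y"
  shows "\<exists>p. m < card {y \<in> Y. f y = p}"
proof (rule ccontr)
  assume "\<not> ?thesis"
  then have le: "card {y \<in> Y. f y = p} \<le> m" for p by (simp add: not_less)
  have "card Y = (\<Sum>p\<in>f ` Y. card {y \<in> Y. f y = p})"
    using sum.image_gen[OF assms(1), of "\<lambda>_. 1::nat" f] by simp
  also have "\<dots> \<le> (\<Sum>p\<in>f ` Y. m)" using le by (intro sum_mono) auto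
  also have "\<dots> \<le> card P * m" using card_mono[OF assms(2,3)] by simp
  finally show False using assms(4) by simp
qed

text \<open>
  Each vertex of \<open>Y\<close> has a trace on the union of the parts. A class of more than \<open>m\<close> vertices with
  the same trace forms the new part, and \<open>m\<close> elements of that trace are kept in each old part.
\<close>

lemma complete_parts_extend:
  assumes fin: "finite V" and sym: "symp E" and irr: "irreflp E"
    and T: "\<And>c. c < j \<Longrightarrow> T c \<subseteq> V" "complete_parts E T j"
    and Y: "Y \<subseteq> V" "\<And>y c. y \<in> Y \<Longrightarrow> c < j \<Longrightarrow> m \<le> card (T c \<inter> nbhd E V y)"
    and big: "2 ^ card (\<Union>c<j. T c) * m < card Y"
  shows "\<exists>T'. (\<forall>c<Suc j. T' c \<subseteq> V \<and> card (T' c) = m) \<and> complete_parts E T' (Suc j)"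
proof -
  let ?TT = "\<Union>c<j. T c"
  have finT: "finite ?TT" using T(1) fin by (meson finite_UN_I finite_lessThan finite_subset lessThan_iff)
  have "card (Pow ?TT) * m < card Y" using big finT by (simp add: card_Pow)
  then obtain p where p: "m < card {y \<in> Y. nbhd E V y \<inter> ?TT = p}"
    using large_fibre[of Y "Pow ?TT" "\<lambda>y. nbhd E V y \<inter> ?TT" m] finT fin Y(1) finite_subset by blast
  let ?Y = "{y \<in> Y. nbhd E V y \<inter> ?TT = p}"
  obtain S where S: "S \<subseteq> ?Y" "card S = m" using p by (meson obtain_subset_with_card_n less_imp_le)
  have "\<exists>X\<subseteq>T c \<inter> p. card X = m" if c: "c < j" for c
  proof -
    have "?Y \<noteq> {}" using p by (metis card.empty not_less_zero)
    then obtain y where y: "y \<in> ?Y" by blast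
    then have "m \<le> card (T c \<inter> nbhd E V y)" using Y(2) c by blast
    also have "T c \<inter> nbhd E V y = T c \<inter> p" using y c by blast
    finally show ?thesis by (meson obtain_subset_with_card_n)
  qed
  then obtain X where X: "\<And>c. c < j \<Longrightarrow> X c \<subseteq> T c \<inter> p \<and> card (X c) = m" by metis
  define T' where "T' = X(j := S)"
  have SX: "E u v" if "u \<in> S" "v \<in> X c" "c < j" for u v c
  proof -
    have "v \<in> p" "u \<in> ?Y" using that X S by blast+
    then show ?thesis by (auto simp: nbhd_def)
  qed
  have XX: "E u v" if "c < j" "d < j" "c \<noteq> d" "u \<in> X c" "v \<in> X d" for c d u v
    using T(2) X that unfolding complete_parts_def by blast
  have "complete_parts E T' (Suc j)"
    unfolding complete_parts_def T'_def
    using SX XX sympD[OF sym] by (auto simp: less_Suc_eq)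
  moreover have "T' c \<subseteq> V \<and> card (T' c) = m" if "c < Suc j" for c
    using that X T(1) S Y(1) by (cases "c = j") (auto simp: T'_def less_Suc_eq, blast)
  ultimately show ?thesis by blast
qed

text \<open>
  Both sides count the edges with one end in \<open>T\<close>.
\<close>

lemma sum_nbhd_card_swap:
  assumes "finite V" "symp E" "T \<subseteq> V"
  shows "(\<Sum>v\<in>V. card (T \<inter> nbhd E V v)) = (\<Sum>u\<in>T. card (nbhd E V u))"
proof -
  have finT: "finite T" using assms finite_subset by blast
  have "(\<Sum>v\<in>V. card (T \<inter> nbhd E V v)) = (\<Sum>v\<in>V. \<Sum>u\<in>T. if E v u then 1 else 0)"
  proof (intro sum.cong refl)
    fix v assume "v \<in> V"
    have "T \<inter> nbhd E V v = {u \<in> T. E v u}" using assms(3) by (auto simp: nbhd_def)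
    then show "card (T \<inter> nbhd E V v) = (\<Sum>u\<in>T. if E v u then 1 else 0)"
      using finT by (simp add: sum.If_cases Int_def)
  qed
  also have "\<dots> = (\<Sum>u\<in>T. \<Sum>v\<in>V. if E v u then 1 else 0)" by (rule sum.swap)
  also have "\<dots> = (\<Sum>u\<in>T. card (nbhd E V u))"
  proof (intro sum.cong refl)
    fix u assume "u \<in> T"
    have "nbhd E V u = {v \<in> V. E v u}" using sympD[OF assms(2)] by (auto simp: nbhd_def)
    then show "(\<Sum>v\<in>V. if E v u then 1 else 0) = card (nbhd E V u)"
      using assms(1) by (simp add: sum.If_cases Int_def)
  qed
  finally show ?thesis .
qed

lemma card_UN_parts:
  assumes "\<And>c. c < j \<Longrightarrow> card (T c) = M" "\<And>c. c < j \<Longrightarrow> finite (T c)"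
    "complete_parts E T j" "irreflp E"
  shows "card (\<Union>c<j. T c) = j * M"
proof -
  have "card (\<Union>c<j. T c) = (\<Sum>c<j. card (T c))"
    using assms(2) complete_parts_disjoint[OF assms(3,4)] by (intro card_UN_disjoint) auto
  then show ?thesis using assms(1) by simp
qed

lemma card_trace_parts:
  assumes "\<And>c. c < j \<Longrightarrow> finite (T c)" "complete_parts E T j" "irreflp E"
  shows "card ((\<Union>c<j. T c) \<inter> A) = (\<Sum>c<j. card (T c \<inter> A))"
proof -
  have "(\<Union>c<j. T c) \<inter> A = (\<Union>c<j. T c \<inter> A)" by blast
  also have "card \<dots> = (\<Sum>c<j. card (T c \<inter> A))"
    using assms(1) complete_parts_disjoint[OF assms(2,3)] by (intro card_UN_disjoint) blast+
  finally show ?thesis .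
qed

lemma trace_bound:
  assumes T: "\<And>c. c < j \<Longrightarrow> finite (T c)" "\<And>c. c < j \<Longrightarrow> card (T c) = M"
    and c: "c < j" "card (T c \<inter> A) \<le> m"
  shows "(\<Sum>c<j. card (T c \<inter> A)) \<le> (j - 1) * M + m"
proof -
  have "(\<Sum>c<j. card (T c \<inter> A)) = card (T c \<inter> A) + (\<Sum>d\<in>{..<j} - {c}. card (T d \<inter> A))"
    using c by (intro sum.remove) auto
  also have "(\<Sum>d\<in>{..<j} - {c}. card (T d \<inter> A)) \<le> (\<Sum>d\<in>{..<j} - {c}. M)"
  proof (rule sum_mono)
    fix d assume "d \<in> {..<j} - {c}"
    then show "card (T d \<inter> A) \<le> M" using T card_mono[of "T d" "T d \<inter> A"] by auto
  qed
  also have "\<dots> = (j - 1) * M" using c by simp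
  finally show ?thesis using c by linarith
qed

text \<open>
  Induction on the number \<open>j\<close> of parts, as in the proof of the theorem of Erdos and Stone. Given \<open>j < r\<close>
  large parts of size \<open>M\<close>, the degree condition makes the average trace of a vertex on the parts
  exceed \<open>(j - 1) M + m\<close> by a fixed proportion of \<open>M\<close>, so a positive fraction of all vertices has at least \<open>m\<close>
  neighbours in each part, and \<open>complete_parts_extend\<close> applies.
\<close>

lemma complete_parts_exist:
  fixes r :: nat and \<epsilon> :: real
  assumes r: "1 \<le> r" and \<epsilon>: "4 * real r * real r * \<epsilon> \<le> 1"
  shows "j \<le> r \<Longrightarrow> \<exists>N. \<forall>(E::'a \<Rightarrow> 'a \<Rightarrow> bool) V. finite V \<and> symp E \<and> irreflp E \<and> N \<le> card V \<and>
     (\<forall>u\<in>V. (1 - 1 / real r - \<epsilon>) * real (card V) \<le> real (card (nbhd E V u))) \<longrightarrow>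
     (\<exists>T. (\<forall>c<j. T c \<subseteq> V \<and> card (T c) = m) \<and> complete_parts E T j)"
proof (induction j arbitrary: m)
  case 0
  then show ?case by (auto simp: complete_parts_def)
next
  case (Suc j)
  \<comment> \<open>\<open>m\<close> is negligible against the surplus \<open>M / r\<close> of the average trace.\<close>
  define M where "M = 4 * r * (m + 1)"
  obtain N where N: "\<And>(E::'a \<Rightarrow> 'a \<Rightarrow> bool) V. \<lbrakk>finite V; symp E; irreflp E; N \<le> card V;
     \<And>u. u\<in>V \<Longrightarrow> (1 - 1 / real r - \<epsilon>) * real (card V) \<le> real (card (nbhd E V u))\<rbrakk> \<Longrightarrow>
     \<exists>T. (\<forall>c<j. T c \<subseteq> V \<and> card (T c) = M) \<and> complete_parts E T j"
    using Suc.IH[of M] Suc.prems by (metis Suc_leD)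
  define N' where "N' = N + 2 * r * r * (2 ^ (r * M) * m + 1) + 1"
  have "\<exists>T. (\<forall>c<Suc j. T c \<subseteq> V \<and> card (T c) = m) \<and> complete_parts E T (Suc j)"
    if fin: "finite V" and sym: "symp E" and irr: "irreflp E" and big: "N' \<le> card V"
      and deg: "\<And>u. u\<in>V \<Longrightarrow> (1 - 1 / real r - \<epsilon>) * real (card V) \<le> real (card (nbhd E V u))"
    for E :: "'a \<Rightarrow> 'a \<Rightarrow> bool" and V
  proof -
    have "N \<le> card V" using big by (simp add: N'_def)
    then obtain T where T: "\<And>c. c < j \<Longrightarrow> T c \<subseteq> V" "\<And>c. c < j \<Longrightarrow> card (T c) = M"
      "complete_parts E T j" using N[OF fin sym irr _ deg] by blast
    let ?TT = "\<Union>c<j. T c" and ?n = "real (card V)"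
    define Y where "Y = {v \<in> V. \<forall>c<j. m \<le> card (T c \<inter> nbhd E V v)}"
    have finT: "finite (T c)" if "c < j" for c using T(1)[OF that] fin finite_subset by blast
    have cTT: "card ?TT = j * M" using card_UN_parts[OF T(2) finT T(3) irr] by blast
    have n: "1 \<le> ?n" using big by (simp add: N'_def)
    have M: "4 * real r * real m \<le> real M" "0 < real M" using r by (simp_all add: M_def add_pos_nonneg)
    have Ybig: "?n \<le> 2 * real r * real r * real (card Y)"
    proof (cases "j = 0")
      case True
      then have "Y = V" by (auto simp: Y_def)
      moreover have "1 * real (card V) \<le> (2 * real r * real r) * real (card V)"
      proof (intro mult_right_mono)
        have "1 * 1 \<le> real r * real r" using r by (intro mult_mono) auto
        then show "1 \<le> 2 * real r * real r" by simp
      qed auto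
      ultimately show ?thesis by simp
    next
      case False
      have up: "card (?TT \<inter> nbhd E V v) \<le> (if v \<in> Y then j * M else 0) + ((j - 1) * M + m)" if v: "v \<in> V" for v
      proof (cases "v \<in> Y")
        case True
        have "card (?TT \<inter> nbhd E V v) \<le> card ?TT" using finT by (intro card_mono) auto
        then show ?thesis using True cTT by simp
      next
        case False
        then obtain c where c: "c < j" "card (T c \<inter> nbhd E V v) \<le> m" using v unfolding Y_def by force
        have "card (?TT \<inter> nbhd E V v) = (\<Sum>c<j. card (T c \<inter> nbhd E V v))"
          by (rule card_trace_parts[OF finT T(3) irr])
        also have "\<dots> \<le> (j - 1) * M + m" by (rule trace_bound[where T = T and c = c, OF finT T(2) c])
        finally show ?thesis using False by simp
      qed
      have "real (j * M) * ((1 - 1 / real r - \<epsilon>) * ?n) = (\<Sum>u\<in>?TT. (1 - 1 / real r - \<epsilon>) * ?n)"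
        using cTT by simp
      also have "\<dots> \<le> (\<Sum>u\<in>?TT. real (card (nbhd E V u)))" using deg T(1) by (intro sum_mono) blast
      also have "\<dots> = real (\<Sum>v\<in>V. card (?TT \<inter> nbhd E V v))"
        using sum_nbhd_card_swap[OF fin sym, of ?TT] T(1) by (subst sum_nbhd_card_swap[OF fin sym]) auto
      also have "\<dots> \<le> real (\<Sum>v\<in>V. (if v \<in> Y then j * M else 0) + ((j - 1) * M + m))"
        by (intro of_nat_mono sum_mono up)
      also have "(\<Sum>v\<in>V. (if v \<in> Y then j * M else 0) + ((j - 1) * M + m)) = card Y * (j * M) + card V * ((j - 1) * M + m)"
      proof -
        have "(\<Sum>v\<in>V. if v \<in> Y then j * M else 0) = card Y * (j * M)"
          using fin by (simp add: sum.If_cases Y_def Int_def)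
        then show ?thesis by (simp add: sum.distrib)
      qed
      finally have main: "real j * real M * ((1 - 1 / real r - \<epsilon>) * ?n) \<le>
         real (card Y) * (real j * real M) + ?n * ((real j - 1) * real M + real m)"
        using False by (simp add: of_nat_diff)
      have c1: "real M / (2 * real r) \<le> real j * real M * (1 - 1 / real r - \<epsilon>) - ((real j - 1) * real M + real m)"
      proof -
        have j: "real j + 1 \<le> real r" using Suc.prems by linarith
        have r0: "0 < real r" using r by simp
        have e1: "real j * \<epsilon> \<le> 1 / (4 * real r)"
        proof (cases "\<epsilon> \<le> 0")
          case True
          then have "real j * \<epsilon> \<le> 0" by (simp add: mult_nonneg_nonpos)
          moreover have "0 \<le> 1 / (4 * real r)" using r0 by simp
          ultimately show ?thesis by linarith
        next
          case False
          then have "real j * \<epsilon> \<le> real r * \<epsilon>" using j by (intro mult_right_mono) auto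
          also have "\<dots> \<le> 1 / (4 * real r)" using \<epsilon> r0 by (simp add: field_simps)
          finally show ?thesis .
        qed
        have e2: "real m \<le> real M / (4 * real r)" using M r0 by (simp add: field_simps)
        have e3: "real j / real r \<le> 1 - 1 / real r" using j r0 by (simp add: field_simps)
        have "real M * (1 / (2 * real r)) \<le> real M * (1 - real j / real r - real j * \<epsilon> - 1 / (4 * real r))"
        proof (rule mult_left_mono)
          have "1 / (2 * real r) = 1 / (4 * real r) + 1 / (4 * real r)" "1 / real r = 4 * (1 / (4 * real r))" by simp_all
          then show "1 / (2 * real r) \<le> 1 - real j / real r - real j * \<epsilon> - 1 / (4 * real r)"
            using e1 e3 by linarith
        qed simp
        also have "\<dots> = real j * real M * (1 - 1 / real r - \<epsilon>) - (real j - 1) * real M - real M / (4 * real r)"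
          by (simp add: algebra_simps)
        finally show ?thesis using e2 by simp
      qed
      have "?n * (real M / (2 * real r)) \<le> ?n * (real j * real M * (1 - 1 / real r - \<epsilon>) - ((real j - 1) * real M + real m))"
        using c1 by (intro mult_left_mono) auto
      also have "\<dots> \<le> real (card Y) * (real j * real M)" using main by (simp add: algebra_simps)
      also have "\<dots> \<le> real (card Y) * (real r * real M)"
        using Suc.prems by (intro mult_left_mono mult_right_mono) auto
      finally have "real M * (?n / (2 * real r)) \<le> real M * (real (card Y) * real r)" by (simp add: mult_ac)
      then have "?n / (2 * real r) \<le> real (card Y) * real r" by (rule mult_left_le_imp_le[OF _ M(2)])
      then show ?thesis using r by (simp add: field_simps)
    qed
    have "2 * r * r * (2 ^ (r * M) * m + 1) < card V" using big by (simp add: N'_def)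
    then have "real (2 * r * r * (2 ^ (r * M) * m + 1)) < ?n" by (simp only: of_nat_less_iff)
    also have "\<dots> \<le> real (2 * r * r * card Y)" using Ybig by simp
    finally have "2 * r * r * (2 ^ (r * M) * m + 1) < 2 * r * r * card Y" by (simp only: of_nat_less_iff)
    then have "2 ^ (r * M) * m + 1 < card Y" unfolding mult_less_cancel1 by blast
    then have "2 ^ (r * M) * m < card Y" by linarith
    moreover have "2 ^ card ?TT \<le> (2::nat) ^ (r * M)"
      unfolding cTT using Suc.prems by (intro power_increasing mult_right_mono) auto
    ultimately have "2 ^ card ?TT * m < card Y"
      by (meson le_less_trans mult_le_mono1)
    then show ?thesis
      by (intro complete_parts_extend[OF fin sym irr T(1) T(3), of Y]) (auto simp: Y_def)
  qed
  then show ?case by (intro exI[of _ N']) blast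
qed

text \<open>
  Take the ends of the edges of a maximal matching.
\<close>

lemma matching_cover:
  assumes "finite W" "irreflp E" "symp E" "\<not> (\<exists>a b. disjoint_edges E W t a b)"
  shows "\<exists>C\<subseteq>W. card C \<le> 2 * t \<and> (\<forall>u\<in>W - C. \<forall>v\<in>W - C. \<not> E u v)"
  using assms(1,4)
proof (induction t arbitrary: W)
  case 0
  then show ?case by (auto simp: disjoint_edges_def)
next
  case (Suc t)
  show ?case
  proof (cases "\<exists>u\<in>W. \<exists>v\<in>W. E u v")
    case True
    then obtain u v where uv: "u \<in> W" "v \<in> W" "E u v" by blast
    have uv': "u \<noteq> v" using uv assms(2) by (auto simp: irreflp_def)
    have "\<not> (\<exists>a b. disjoint_edges E (W - {u, v}) t a b)"
    proof
      assume "\<exists>a b. disjoint_edges E (W - {u, v}) t a b"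
      then obtain a b where ab: "disjoint_edges E (W - {u, v}) t a b" by blast
      have "disjoint_edges E W (Suc t) (a(t := u)) (b(t := v))"
        using ab uv uv' unfolding disjoint_edges_def lessThan_Suc
        by (auto simp: inj_on_def less_Suc_eq)
      then show False using Suc.prems by blast
    qed
    then obtain C where C: "C \<subseteq> W - {u, v}" "card C \<le> 2 * t"
      "\<forall>x\<in>W - {u, v} - C. \<forall>y\<in>W - {u, v} - C. \<not> E x y"
      using Suc.IH[of "W - {u, v}"] Suc.prems(1) by blast
    have finC: "finite C" using C(1) Suc.prems(1) finite_subset by blast
    have "card (C \<union> {u, v}) \<le> card C + card {u, v}" by (rule card_Un_le)
    also have "\<dots> \<le> 2 * Suc t" using C(2) card_2_iff' uv' by simp
    finally show ?thesis using C uv by (intro exI[of _ "C \<union> {u, v}"]) blast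
  next
    case False
    then show ?thesis by (intro exI[of _ "{}"]) auto
  qed
qed

lemma card_Int_nbhd_inter:
  fixes x :: "nat \<Rightarrow> 'a" and e :: real
  assumes fin: "finite S" and miss: "\<And>l. l < k \<Longrightarrow> real (card (S - A l)) \<le> e"
  shows "real (card S) - real k * e \<le> real (card (S \<inter> (\<Inter>l<k. A l)))"
proof -
  have "S = (S \<inter> (\<Inter>l<k. A l)) \<union> (\<Union>l<k. S - A l)" by blast
  then have "card S \<le> card (S \<inter> (\<Inter>l<k. A l)) + card (\<Union>l<k. S - A l)"
    by (metis card_Un_le)
  also have "card (\<Union>l<k. S - A l) \<le> (\<Sum>l<k. card (S - A l))" by (intro card_UN_le) auto
  finally have "real (card S) \<le> real (card (S \<inter> (\<Inter>l<k. A l))) + (\<Sum>l<k. real (card (S - A l)))"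
    by (simp flip: of_nat_sum of_nat_add)
  also have "(\<Sum>l<k. real (card (S - A l))) \<le> (\<Sum>l<k. e)" using miss by (intro sum_mono) auto
  finally show ?thesis by simp
qed

text \<open>
  The join of the complete graph on \<open>B\<close> with the complete multipartite graph whose parts are the
  fibres of \<open>\<pi>\<close> outside \<open>B\<close>. For \<open>B = {}\<close> it is a complete multipartite graph.
\<close>

definition hub_join :: "'a set \<Rightarrow> ('a \<Rightarrow> nat) \<Rightarrow> 'a \<Rightarrow> 'a \<Rightarrow> bool" where
  "hub_join B \<pi> u v \<longleftrightarrow> u \<noteq> v \<and> (u \<in> B \<or> v \<in> B \<or> \<pi> u \<noteq> \<pi> v)"

text \<open>
  The forbidden graph has the vertices \<open>0, \<dots>, s - 1\<close> and the adjacency \<open>A\<close>; the copies need not be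
  induced.
\<close>

definition copy_free :: "nat \<Rightarrow> (nat \<Rightarrow> nat \<Rightarrow> bool) \<Rightarrow> ('a \<Rightarrow> 'a \<Rightarrow> bool) \<Rightarrow> 'a set \<Rightarrow> bool" where
  "copy_free s A E V \<longleftrightarrow> \<not> (\<exists>f. inj_on f {..<s} \<and> f ` {..<s} \<subseteq> V \<and> (\<forall>u<s. \<forall>v<s. A u v \<longrightarrow> E (f u) (f v)))"

text \<open>
  The sets \<open>U c\<close> for \<open>c < r\<close> are a complete \<open>r\<close>-partite graph with almost equal parts, up to an error \<open>e\<close>:
  every vertex of a part misses at most \<open>e n\<close> vertices of any other part. The parts need not cover \<open>V\<close>,
  but by their sizes they miss at most \<open>r e n\<close> vertices (\<open>core_sizes\<close>).
\<close>

definition core :: "('a \<Rightarrow> 'a \<Rightarrow> bool) \<Rightarrow> 'a set \<Rightarrow> nat \<Rightarrow> real \<Rightarrow> (nat \<Rightarrow> 'a set) \<Rightarrow> bool" where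
  "core E V r e U \<longleftrightarrow> (\<forall>c<r. U c \<subseteq> V) \<and> (\<forall>c<r. \<forall>d<r. c \<noteq> d \<longrightarrow> U c \<inter> U d = {}) \<and>
     (\<forall>c<r. \<forall>u\<in>U c. \<forall>v\<in>U c. \<not> E u v) \<and>
     (\<forall>c<r. (1 / real r - e) * real (card V) \<le> real (card (U c))) \<and>
     (\<forall>c<r. \<forall>d<r. c \<noteq> d \<longrightarrow> (\<forall>u\<in>U c. real (card (U d - nbhd E V u)) \<le> e * real (card V)))"

text \<open>
  A forbidden graph that is contained in every \<open>matching_blowup\<close> of \<open>r\<close> parts and \<open>t\<close> edges, but not
  in an \<open>r\<close>-partite graph with fewer than \<open>t\<close> additional vertices. The first property bounds free
  graphs from above, the second one supplies the free graphs with which they are compared.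
\<close>

locale forbidden =
  fixes s r t m :: nat and A :: "nat \<Rightarrow> nat \<Rightarrow> bool"
  assumes r3: "3 \<le> r" and t1: "1 \<le> t"
    and blowup: "\<And>(E::nat \<Rightarrow> nat \<Rightarrow> bool) V. \<lbrakk>finite V; symp E; irreflp E; matching_blowup E V r t m\<rbrakk> \<Longrightarrow> \<not> copy_free s A E V"
    and hub_join_free: "\<And>(V::nat set) B \<pi>. \<lbrakk>finite V; B \<subseteq> V; card B < t; \<And>u. u \<in> V - B \<Longrightarrow> \<pi> u < r\<rbrakk> \<Longrightarrow> copy_free s A (hub_join B \<pi>) V"
begin

lemma copy_free_hered: "copy_free s A E V \<Longrightarrow> W \<subseteq> V \<Longrightarrow> copy_free s A E W"
  unfolding copy_free_def by (meson subset_trans)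

text \<open>
  Between a part with the index \<open>r\<close> and the part \<open>0\<close> there are \<open>t\<close> disjoint edges, which take the
  place of edges inside the part \<open>0\<close>.
\<close>

lemma no_extra_part:
  fixes E :: "nat \<Rightarrow> nat \<Rightarrow> bool"
  assumes fin: "finite V" and sym: "symp E" and irr: "irreflp E" and copy_free: "copy_free s A E V"
    and T: "\<And>c. c < Suc r \<Longrightarrow> T c \<subseteq> V \<and> card (T c) = m + t" "complete_parts E T (Suc r)"
  shows False
proof -
  have finT: "finite (T c)" if "c < Suc r" for c using T(1)[OF that] fin finite_subset by blast
  obtain a where a: "bij_betw a {0..<card (T r)} (T r)" using ex_bij_betw_nat_finite[OF finT[of r]] by auto
  obtain b where b: "bij_betw b {0..<card (T 0)} (T 0)" using ex_bij_betw_nat_finite[OF finT[of 0]] by auto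
  have am: "a l \<in> T r" "b l \<in> T 0" if "l < t" for l
    using a b T(1)[of r] T(1)[of 0] that by (auto simp: bij_betw_def)
  have sub: "{..<t} \<subseteq> {0..<card (T r)}" "{..<t} \<subseteq> {0..<card (T 0)}" using T(1)[of r] T(1)[of 0] by auto
  have inj: "inj_on a {..<t}" "inj_on b {..<t}"
    using a b sub inj_on_subset unfolding bij_betw_def by blast+
  have disj: "T r \<inter> T 0 = {}" using complete_parts_disjoint[OF T(2) irr, of r 0] r3 by simp
  have cp: "E u v" if "c < Suc r" "d < Suc r" "c \<noteq> d" "u \<in> T c" "v \<in> T d" for c d u v
    using T(2) that unfolding complete_parts_def by blast
  have "matching_blowup E V r t m"
  proof (rule matching_blowupI[of 0 r T])
    show "disjoint_edges E V t a b"
      unfolding disjoint_edges_def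
    proof (intro conjI allI impI inj)
      fix l assume l: "l < t"
      show "a l \<in> V" "b l \<in> V" using am[OF l] T(1)[of r] T(1)[of 0] r3 by auto
      show "E (a l) (b l)" using cp[of r 0] am[OF l] r3 by simp
    next
      have "a ` {..<t} \<subseteq> T r" "b ` {..<t} \<subseteq> T 0" using am by auto
      then show "a ` {..<t} \<inter> b ` {..<t} = {}" using disj by blast
    qed
    show "complete_parts E T r" using T(2) unfolding complete_parts_def by (meson less_SucI)
    fix l c v assume "l < t" "c < r" "c \<noteq> 0" "v \<in> T c"
    then show "E (a l) v \<and> E (b l) v" using am[of l] cp[of r c] cp[of 0 c] by simp
  qed (use r3 T(1) in auto)
  then show False using blowup[OF fin sym irr] copy_free by blast
qed

text \<open>
  Take a complete \<open>r\<close>-partite subgraph \<open>T\<close> with large constant parts of size \<open>M\<close>. Few vertices have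
  \<open>m0 = m + t\<close> neighbours in each \<open>T c\<close> (the set \<open>Y\<close>), since otherwise there would be an additional
  part. By the degree condition, few vertices have noticeably less than \<open>(r - 1) M\<close> neighbours in \<open>T\<close>
  (the set \<open>R\<close>). Every other vertex has almost no neighbours in one part \<open>T c\<close>, and therefore misses
  little of the remaining parts; it is put into \<open>U0 c\<close>. A matching with \<open>t\<close> edges in \<open>U0 c\<close> would give a
  \<open>matching_blowup\<close>, so \<open>U0 c\<close> becomes independent after the removal of \<open>2 t\<close> vertices. Since an
  independent set has at most \<open>(1/r + \<epsilon>1) n\<close> vertices and the sets cover almost everything, all of them
  have about \<open>n / r\<close> vertices, and the degree condition shows that they are almost completely joined.
\<close>

lemma core_exists:
  assumes \<epsilon>: "0 < \<epsilon>"
  shows "\<exists>\<epsilon>1>0. \<exists>N. \<forall>(E::nat \<Rightarrow> nat \<Rightarrow> bool) V. finite V \<and> symp E \<and> irreflp E \<and> copy_free s A E V \<and> N \<le> card V \<and>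
     (\<forall>u\<in>V. (1 - 1 / real r - \<epsilon>1) * real (card V) \<le> real (card (nbhd E V u))) \<longrightarrow> (\<exists>U. core E V r \<epsilon> U)"
proof -
  have r0: "3 \<le> real r" and t0: "1 \<le> real t" using r3 t1 by simp_all
  define e0 where "e0 = \<epsilon> / 2"
  \<comment> \<open>Each end of an edge may miss \<open>2 \<theta> M\<close> vertices of a part, so \<open>t\<close> edges together miss at most half of it.\<close>
  define \<theta> where "\<theta> = 1 / (8 * real t)"
  define m0 where "m0 = m + t"
  have e0: "0 < e0" using \<epsilon> by (simp add: e0_def)
  have \<theta>: "0 < \<theta>" "\<theta> \<le> 1/8" "4 * real t * \<theta> = 1/2" using t0 by (simp_all add: \<theta>_def field_simps)
  define \<epsilon>1 where "\<epsilon>1 = min (1 / (4 * real r * real r)) (min (\<theta> * e0 / (4 * real r)) (\<epsilon> / (2 * real r)))"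
  have \<epsilon>1: "0 < \<epsilon>1" using r0 \<theta> e0 \<epsilon> by (simp add: \<epsilon>1_def)
  have \<epsilon>1a: "4 * real r * real r * \<epsilon>1 \<le> 1" "real r * \<epsilon>1 \<le> \<theta> * e0 / 4" "real r * \<epsilon>1 \<le> \<epsilon> / 2"
  proof -
    have "\<epsilon>1 \<le> 1 / (4 * real r * real r)" "\<epsilon>1 \<le> \<theta> * e0 / (4 * real r)" "\<epsilon>1 \<le> \<epsilon> / (2 * real r)"
      unfolding \<epsilon>1_def by simp_all
    then show "4 * real r * real r * \<epsilon>1 \<le> 1" "real r * \<epsilon>1 \<le> \<theta> * e0 / 4" "real r * \<epsilon>1 \<le> \<epsilon> / 2"
      using r0 by (simp_all add: field_simps)
  qed
  obtain M :: nat where Mbig: "(real m0 + 1) * (4 / (\<theta> * e0) + 1 / \<theta> + 2) < real M"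
    using reals_Archimedean2 by blast
  have pos: "0 \<le> 4 / (\<theta> * e0)" "0 \<le> 1 / \<theta>" using \<theta> e0 by simp_all
  have Mge: "real m0 * c \<le> real M" if "0 \<le> c" "c \<le> 4 / (\<theta> * e0) + 1 / \<theta> + 2" for c
  proof -
    have "real m0 * c \<le> (real m0 + 1) * (4 / (\<theta> * e0) + 1 / \<theta> + 2)"
      using that by (intro mult_mono) auto
    then show ?thesis using Mbig by linarith
  qed
  have M1: "real m0 \<le> \<theta> * e0 / 4 * real M"
  proof -
    have "real m0 * (4 / (\<theta> * e0)) \<le> real M" by (rule Mge) (use pos in linarith)+
    then show ?thesis using \<theta>(1) e0 by (simp add: field_simps)
  qed
  have M2: "real m0 \<le> \<theta> * real M"
  proof -
    have "real m0 * (1 / \<theta>) \<le> real M" by (rule Mge) (use pos in linarith)+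
    then show ?thesis using \<theta>(1) by (simp add: field_simps)
  qed
  have M3: "2 * real m0 \<le> real M" using Mge[of 2] pos by simp
  have M0: "0 < real M" using M3 t1 by (simp add: m0_def)
  \<comment> \<open>a bound, independent of \<open>V\<close>, for the number of vertices in \<open>Y\<close> and the parts\<close>
  define K where "K = 2 ^ (r * M) * m0 + r * M"
  have "\<exists>N. \<forall>(E::nat \<Rightarrow> nat \<Rightarrow> bool) V. finite V \<and> symp E \<and> irreflp E \<and> N \<le> card V \<and>
     (\<forall>u\<in>V. (1 - 1 / real r - \<epsilon>1) * real (card V) \<le> real (card (nbhd E V u))) \<longrightarrow>
     (\<exists>T. (\<forall>c<r. T c \<subseteq> V \<and> card (T c) = M) \<and> complete_parts E T r)"
    by (rule complete_parts_exist[OF _ \<epsilon>1a(1)]) (use r3 in auto)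
  then obtain N where N0: "\<forall>(E::nat \<Rightarrow> nat \<Rightarrow> bool) V. finite V \<and> symp E \<and> irreflp E \<and> N \<le> card V \<and>
     (\<forall>u\<in>V. (1 - 1 / real r - \<epsilon>1) * real (card V) \<le> real (card (nbhd E V u))) \<longrightarrow>
     (\<exists>T. (\<forall>c<r. T c \<subseteq> V \<and> card (T c) = M) \<and> complete_parts E T r)" ..
  have N: "\<exists>T. (\<forall>c<r. T c \<subseteq> V \<and> card (T c) = M) \<and> complete_parts E T r"
    if "finite V" "symp E" "irreflp E" "N \<le> card V"
     "\<And>u. u\<in>V \<Longrightarrow> (1 - 1 / real r - \<epsilon>1) * real (card V) \<le> real (card (nbhd E V u))"
    for E :: "nat \<Rightarrow> nat \<Rightarrow> bool" and V
    using N0 that by blast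
  define X where "X = 2 * (real K + real r * real K / \<theta> + 2 * real t * real r) / e0"
  define N' where "N' = max N (nat \<lceil>X\<rceil>)"
  have "\<exists>U. core E V r \<epsilon> U"
    if fin: "finite V" and sym: "symp E" and irr: "irreflp E" and copy_free: "copy_free s A E V" and big: "N' \<le> card V"
      and deg: "\<And>u. u\<in>V \<Longrightarrow> (1 - 1 / real r - \<epsilon>1) * real (card V) \<le> real (card (nbhd E V u))"
    for E :: "nat \<Rightarrow> nat \<Rightarrow> bool" and V
  proof -
    let ?n = "real (card V)"
    have "N \<le> card V" using big by (simp add: N'_def)
    then obtain T where T: "\<And>c. c < r \<Longrightarrow> T c \<subseteq> V" "\<And>c. c < r \<Longrightarrow> card (T c) = M"
      "complete_parts E T r" using N[OF fin sym irr _ deg] by blast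
    have "X \<le> ?n" using big unfolding N'_def by linarith
    then have nbig: "real K + real r * real K / \<theta> + 2 * real t * real r \<le> e0 / 2 * ?n"
      unfolding X_def using e0 by (simp add: pos_divide_le_eq algebra_simps)
    let ?TT = "\<Union>c<r. T c"
    have finT: "finite (T c)" if "c < r" for c using T(1)[OF that] fin finite_subset by blast
    have cTT: "card ?TT = r * M" using card_UN_parts[OF T(2) finT T(3) irr] by blast
    have TTV: "?TT \<subseteq> V" using T(1) by blast
    define tr where "tr v c = card (T c \<inter> nbhd E V v)" for v c
    have trtot: "card (?TT \<inter> nbhd E V v) = (\<Sum>c<r. tr v c)" for v
      unfolding tr_def by (rule card_trace_parts[OF finT T(3) irr])
    have trM: "tr v c \<le> M" if "c < r" for v c
      unfolding tr_def using card_mono[OF finT[OF that], of "T c \<inter> nbhd E V v"] T(2)[OF that] by simp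
    define Y where "Y = {v \<in> V - ?TT. \<forall>c<r. m0 \<le> tr v c}"
    define R where "R = {v \<in> V. real (\<Sum>c<r. tr v c) < (real r - 1 - \<theta>) * real M}"
    have cY: "card Y \<le> 2 ^ (r * M) * m0"
    proof (rule ccontr)
      assume "\<not> ?thesis"
      then have bigY: "2 ^ card ?TT * m0 < card Y" using cTT by simp
      have "\<exists>T'. (\<forall>c<Suc r. T' c \<subseteq> V \<and> card (T' c) = m0) \<and> complete_parts E T' (Suc r)"
        by (rule complete_parts_extend[OF fin sym irr T(1) T(3) _ _ bigY]) (auto simp: Y_def tr_def)
      then show False using no_extra_part[OF fin sym irr copy_free] unfolding m0_def by blast
    qed
    have finY: "finite Y" "finite R" using fin by (simp_all add: Y_def R_def)
    have cYT: "card (Y \<union> ?TT) \<le> K"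
      using card_Un_le[of Y ?TT] cY cTT by (simp add: K_def)
    have up: "real (\<Sum>c<r. tr v c) \<le> (if v \<in> Y \<union> ?TT then real r * real M else 0) +
        ((real r - 1) * real M + real m0) - (if v \<in> R then \<theta> * real M else 0)" if v: "v \<in> V" for v
    proof (cases "v \<in> Y \<union> ?TT")
      case True
      have "(\<Sum>c<r. tr v c) \<le> (\<Sum>c<r. M)" using trM by (intro sum_mono) auto
      then have "real (\<Sum>c<r. tr v c) \<le> real (r * M)" by (simp only: of_nat_le_iff) simp
      moreover have "\<theta> * real M \<le> (real r - 1) * real M" using \<theta> r0 by (intro mult_right_mono) auto
      moreover have "0 \<le> \<theta> * real M" using \<theta>(1) by simp
      ultimately have "real (\<Sum>c<r. tr v c) \<le> real r * real M + ((real r - 1) * real M + real m0) - \<theta> * real M"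
        "0 \<le> \<theta> * real M" by simp_all
      then show ?thesis using True by auto
    next
      case False
      show ?thesis
      proof (cases "v \<in> R")
        case True
        then have "real (\<Sum>c<r. tr v c) \<le> (real r - 1 - \<theta>) * real M" by (simp add: R_def)
        then show ?thesis using True False by (simp add: algebra_simps)
      next
        case vR: False
        obtain c where c: "c < r" "tr v c \<le> m0" using False v unfolding Y_def by force
        have "(\<Sum>c<r. tr v c) \<le> (r - 1) * M + m0"
          unfolding tr_def by (rule trace_bound[where T = T and c = c, OF finT T(2) c[unfolded tr_def]])
        then have "real (\<Sum>c<r. tr v c) \<le> real ((r - 1) * M + m0)" by (simp only: of_nat_le_iff)
        then show ?thesis using False vR r3 by (simp add: of_nat_diff)
      qed
    qed
    have cR: "real (card R) \<le> real r * real K / \<theta> + e0 / 2 * ?n"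
    proof -
      have "real (r * M) * ((1 - 1 / real r - \<epsilon>1) * ?n) = (\<Sum>u\<in>?TT. (1 - 1 / real r - \<epsilon>1) * ?n)"
        using cTT by simp
      also have "\<dots> \<le> (\<Sum>u\<in>?TT. real (card (nbhd E V u)))" using deg T(1) by (intro sum_mono) blast
      also have "\<dots> = real (\<Sum>v\<in>V. card (?TT \<inter> nbhd E V v))"
        by (subst sum_nbhd_card_swap[OF fin sym TTV]) simp
      also have "\<dots> = (\<Sum>v\<in>V. real (\<Sum>c<r. tr v c))" using trtot by simp
      also have "\<dots> \<le> (\<Sum>v\<in>V. (if v \<in> Y \<union> ?TT then real r * real M else 0) +
        ((real r - 1) * real M + real m0) - (if v \<in> R then \<theta> * real M else 0))"
        by (intro sum_mono up)
      also have "\<dots> = (\<Sum>v\<in>V. if v \<in> Y \<union> ?TT then real r * real M else 0) +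
         ?n * ((real r - 1) * real M + real m0) - (\<Sum>v\<in>V. if v \<in> R then \<theta> * real M else 0)"
        by (simp add: sum.distrib sum_subtractf)
      also have "(\<Sum>v\<in>V. if v \<in> R then \<theta> * real M else 0) = real (card R) * (\<theta> * real M)"
      proof -
        have "V \<inter> R = R" by (auto simp: R_def)
        then show ?thesis using fin by (simp add: sum.If_cases)
      qed
      also have "(\<Sum>v\<in>V. if v \<in> Y \<union> ?TT then real r * real M else 0) = real (card (Y \<union> ?TT)) * (real r * real M)"
      proof -
        have "V \<inter> (Y \<union> ?TT) = Y \<union> ?TT" using TTV by (auto simp: Y_def)
        then show ?thesis using fin by (simp add: sum.If_cases del: Un_iff)
      qed
      also have "real (card (Y \<union> ?TT)) * (real r * real M) \<le> real K * (real r * real M)"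
        using cYT by (intro mult_right_mono) auto
      finally have "real (card R) * (\<theta> * real M) \<le> real K * (real r * real M) + ?n * ((real r - 1) * real M + real m0) -
          real (r * M) * ((1 - 1 / real r - \<epsilon>1) * ?n)" by simp
      also have "\<dots> = real M * (real r * real K) + ?n * real m0 + real M * (real r * \<epsilon>1 * ?n)"
        using r0 by (simp add: field_simps)
      also have "\<dots> \<le> real M * (real r * real K) + ?n * (\<theta> * e0 / 4 * real M) + real M * (\<theta> * e0 / 4 * ?n)"
        using M1 \<epsilon>1a(2) by (intro add_mono mult_left_mono mult_right_mono) auto
      finally have "real M * (real (card R) * \<theta>) \<le> real M * (real r * real K + \<theta> * e0 / 2 * ?n)"
        by (simp add: algebra_simps)
      then have "real (card R) * \<theta> \<le> real r * real K + \<theta> * e0 / 2 * ?n" using M0 by simp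
      then show ?thesis using \<theta>(1) by (simp add: field_simps)
    qed
    define U0 where "U0 c = {v \<in> V - (R \<union> Y \<union> ?TT). tr v c < m0}" for c
    have full: "real (card (T d - nbhd E V v)) \<le> 2 * \<theta> * real M" "real M - 2 * \<theta> * real M \<le> real (tr v d)"
      if "c < r" "d < r" "c \<noteq> d" "v \<in> U0 c" for c d v
    proof -
      have "(\<Sum>c<r. tr v c) = tr v c + (tr v d + (\<Sum>e\<in>{..<r} - {c} - {d}. tr v e))"
        using that by (subst sum.remove[of _ c]) (auto simp: sum.remove[of _ d])
      also have "(\<Sum>e\<in>{..<r} - {c} - {d}. tr v e) \<le> (\<Sum>e\<in>{..<r} - {c} - {d}. M)"
        using trM by (intro sum_mono) auto
      also have "\<dots> = (r - 2) * M" using that by (simp add: numeral_2_eq_2)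
      finally have "real (\<Sum>c<r. tr v c) \<le> real (tr v c + (tr v d + (r - 2) * M))"
        by (simp only: of_nat_le_iff)
      moreover have "(real r - 1 - \<theta>) * real M \<le> real (\<Sum>c<r. tr v c)" "real (tr v c) \<le> real m0"
        using that(4) by (auto simp: U0_def R_def not_less)
      ultimately have "(real r - 1 - \<theta>) * real M \<le> real m0 + real (tr v d) + (real r - 2) * real M"
        using r3 by (simp add: of_nat_diff)
      then show 1: "real M - 2 * \<theta> * real M \<le> real (tr v d)" using M2 by (simp add: algebra_simps)
      have "card (T d - nbhd E V v) + tr v d = M"
        unfolding tr_def using T(2)[OF that(2)] finT[OF that(2)]
        by (metis add.commute card_Int_Diff)
      then have "real (card (T d - nbhd E V v)) + real (tr v d) = real M" by linarith
      with 1 show "real (card (T d - nbhd E V v)) \<le> 2 * \<theta> * real M" by linarith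
    qed
    have quarter: "2 * \<theta> * real M \<le> real M / 4" using \<theta>(2) M0 by simp
    have U0disj: "U0 c \<inter> U0 d = {}" if "c < r" "d < r" "c \<noteq> d" for c d
    proof (rule ccontr)
      assume "U0 c \<inter> U0 d \<noteq> {}"
      then obtain v where v: "v \<in> U0 c" "v \<in> U0 d" by blast
      then have "tr v d < m0" by (simp add: U0_def)
      then show False using full(2)[OF that v(1)] quarter M3 M0 by linarith
    qed
    have nomatch: "\<not> (\<exists>a b. disjoint_edges E (U0 i) t a b)" if i: "i < r" for i
    proof
      assume "\<exists>a b. disjoint_edges E (U0 i) t a b"
      then obtain a b where ab: "disjoint_edges E (U0 i) t a b" by blast
      have abU: "a l \<in> U0 i" "b l \<in> U0 i" if "l < t" for l
        using ab that unfolding disjoint_edges_def by auto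
      define T' where "T' d = (if d = i then T d else T d \<inter> (\<Inter>l<t. nbhd E V (a l) \<inter> nbhd E V (b l)))" for d
      have T'T: "T' d \<subseteq> T d" for d by (auto simp: T'_def)
      have "m \<le> card (T' d)" if d: "d < r" for d
      proof (cases "d = i")
        case True
        have "real m \<le> real M" using M3 by (simp add: m0_def)
        then show ?thesis using True T(2)[OF i] by (simp add: T'_def)
      next
        case False
        have "real (card (T d - nbhd E V (a l) \<inter> nbhd E V (b l))) \<le> 4 * \<theta> * real M" if l: "l < t" for l
        proof -
          have "T d - nbhd E V (a l) \<inter> nbhd E V (b l) = (T d - nbhd E V (a l)) \<union> (T d - nbhd E V (b l))" by blast
          then have "card (T d - nbhd E V (a l) \<inter> nbhd E V (b l)) \<le> card (T d - nbhd E V (a l)) + card (T d - nbhd E V (b l))"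
            by (metis card_Un_le)
          then show ?thesis using full(1)[OF i d _ abU(1)[OF l]] full(1)[OF i d _ abU(2)[OF l]] False
            by linarith
        qed
        from card_Int_nbhd_inter[OF finT[OF d] this]
        have "real (card (T d)) - real t * (4 * \<theta> * real M) \<le> real (card (T' d))"
          using False by (simp add: T'_def)
        moreover have "real t * (4 * \<theta> * real M) = real M / 2"
          using arg_cong[OF \<theta>(3), of "\<lambda>x. x * real M"] by (simp add: mult_ac)
        ultimately have "real M / 2 \<le> real (card (T' d))" using T(2)[OF d] by simp
        then have "real m0 \<le> real (card (T' d))" using M3 by linarith
        then show ?thesis by (simp add: m0_def)
      qed
      moreover have "complete_parts E T' r" by (rule complete_parts_mono[OF T(3) T'T])
      moreover have "disjoint_edges E V t a b" using ab unfolding disjoint_edges_def U0_def by blast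
      moreover have "E (a l) v \<and> E (b l) v" if "l < t" "c < r" "c \<noteq> i" "v \<in> T' c" for l c v
        using that by (auto simp: T'_def nbhd_def)
      ultimately have "matching_blowup E V r t m"
        using i T(1) T'T by (intro matching_blowupI[of i r T']) blast+
      then show False using blowup[OF fin sym irr] copy_free by blast
    qed
    have finU0: "finite (U0 c)" for c using fin by (simp add: U0_def)
    have "\<exists>C\<subseteq>U0 c. card C \<le> 2 * t \<and> (\<forall>u\<in>U0 c - C. \<forall>v\<in>U0 c - C. \<not> E u v)" if "c < r" for c
      by (rule matching_cover[OF finU0 irr sym nomatch[OF that]])
    then obtain C where C: "\<And>c. c < r \<Longrightarrow> C c \<subseteq> U0 c" "\<And>c. c < r \<Longrightarrow> card (C c) \<le> 2 * t"
      "\<And>c u v. \<lbrakk>c < r; u \<in> U0 c - C c; v \<in> U0 c - C c\<rbrakk> \<Longrightarrow> \<not> E u v" by metis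
    define U where "U c = U0 c - C c" for c
    have UV: "U c \<subseteq> V" for c by (auto simp: U_def U0_def)
    have finU: "finite (U c)" for c using finU0 by (simp add: U_def)
    have Uup: "real (card (U c)) \<le> (1 / real r + \<epsilon>1) * ?n" if c: "c < r" for c
    proof (cases "U c = {}")
      case True
      then show ?thesis using \<epsilon>1 by simp
    next
      case False
      then obtain u where u: "u \<in> U c" by blast
      have "nbhd E V u \<subseteq> V - U c" using C(3)[OF c] u by (auto simp: nbhd_def U_def)
      then have "card (nbhd E V u) \<le> card (V - U c)" using fin by (intro card_mono) auto
      also have "\<dots> = card V - card (U c)" using UV finU by (simp add: card_Diff_subset)
      finally have "real (card (nbhd E V u)) \<le> ?n - real (card (U c))"
        using card_mono[OF fin UV[of c]] by linarith
      moreover have "(1 - 1 / real r - \<epsilon>1) * ?n \<le> real (card (nbhd E V u))" using deg u UV by blast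
      ultimately show ?thesis by (simp add: algebra_simps)
    qed
    have cover: "?n \<le> e0 * ?n + (\<Sum>c<r. real (card (U c)))"
    proof -
      have "V \<subseteq> R \<union> (Y \<union> ?TT) \<union> ((\<Union>c<r. C c) \<union> (\<Union>c<r. U c))"
      proof
        fix v assume v: "v \<in> V"
        show "v \<in> R \<union> (Y \<union> ?TT) \<union> ((\<Union>c<r. C c) \<union> (\<Union>c<r. U c))"
        proof (cases "v \<in> R \<union> (Y \<union> ?TT)")
          case False
          then have "\<exists>c<r. tr v c < m0" using v unfolding Y_def by force
          then show ?thesis using False v by (auto simp: U_def U0_def)
        qed blast
      qed
      moreover have "finite (C c)" if "c < r" for c using C(1)[OF that] finU0 finite_subset by blast
      ultimately have "card V \<le> card (R \<union> (Y \<union> ?TT) \<union> ((\<Union>c<r. C c) \<union> (\<Union>c<r. U c)))"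
        using finY finT finU by (intro card_mono) auto
      also have "\<dots> \<le> card (R \<union> (Y \<union> ?TT)) + card ((\<Union>c<r. C c) \<union> (\<Union>c<r. U c))" by (rule card_Un_le)
      also have "\<dots> \<le> (card R + card (Y \<union> ?TT)) + (card (\<Union>c<r. C c) + card (\<Union>c<r. U c))"
        by (intro add_mono card_Un_le)
      also have "\<dots> \<le> (card R + K) + ((\<Sum>c<r. card (C c)) + (\<Sum>c<r. card (U c)))"
        using cYT by (intro add_mono card_UN_le order_refl) auto
      also have "(\<Sum>c<r. card (C c)) \<le> (\<Sum>c<r. 2 * t)" using C(2) by (intro sum_mono) auto
      finally have "card V \<le> card R + K + r * (2 * t) + (\<Sum>c<r. card (U c))" by simp
      then have "?n \<le> real (card R + K + r * (2 * t) + (\<Sum>c<r. card (U c)))" by (simp only: of_nat_le_iff)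
      then have "?n \<le> real (card R) + real K + 2 * real t * real r + (\<Sum>c<r. real (card (U c)))"
        by (simp add: mult_ac)
      then show ?thesis using cR nbig by linarith
    qed
    have Ulow: "(1 / real r - (e0 + (real r - 1) * \<epsilon>1)) * ?n \<le> real (card (U c))" if c: "c < r" for c
    proof -
      have "(\<Sum>c<r. real (card (U c))) = real (card (U c)) + (\<Sum>d\<in>{..<r} - {c}. real (card (U d)))"
        using c by (intro sum.remove) auto
      also have "(\<Sum>d\<in>{..<r} - {c}. real (card (U d))) \<le> (\<Sum>d\<in>{..<r} - {c}. (1 / real r + \<epsilon>1) * ?n)"
        using Uup by (intro sum_mono) auto
      also have "\<dots> = (real r - 1) * ((1 / real r + \<epsilon>1) * ?n)" using c by (simp add: of_nat_diff)
      finally have "?n \<le> e0 * ?n + real (card (U c)) + (real r - 1) * ((1 / real r + \<epsilon>1) * ?n)"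
        using cover by linarith
      then have "?n - e0 * ?n - (real r - 1) * ((1 / real r + \<epsilon>1) * ?n) \<le> real (card (U c))" by linarith
      moreover have "?n - e0 * ?n - (real r - 1) * ((1 / real r + \<epsilon>1) * ?n) = (1 / real r - (e0 + (real r - 1) * \<epsilon>1)) * ?n"
        using r0 by (simp add: field_simps)
      ultimately show ?thesis by simp
    qed
    have small: "e0 + real r * \<epsilon>1 \<le> \<epsilon>" using \<epsilon>1a(3) by (simp add: e0_def)
    have "core E V r \<epsilon> U"
      unfolding core_def
    proof (intro conjI allI impI ballI)
      fix c assume c: "c < r"
      show "U c \<subseteq> V" by (rule UV)
      have "(1 / real r - \<epsilon>) * ?n \<le> (1 / real r - (e0 + (real r - 1) * \<epsilon>1)) * ?n"
        using small \<epsilon>1 by (intro mult_right_mono) (auto simp: algebra_simps)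
      then show "(1 / real r - \<epsilon>) * ?n \<le> real (card (U c))" using Ulow[OF c] by linarith
      show "\<not> E u v" if "u \<in> U c" "v \<in> U c" for u v using C(3)[OF c] that by (simp add: U_def)
      fix d assume d: "d < r" "c \<noteq> d"
      show "U c \<inter> U d = {}" using U0disj[OF c d] by (auto simp: U_def)
      fix u assume u: "u \<in> U c"
      have "U d - nbhd E V u \<subseteq> (V - U c) - nbhd E V u" using U0disj[OF c d] UV by (auto simp: U_def)
      then have "card (U d - nbhd E V u) \<le> card ((V - U c) - nbhd E V u)" using fin by (intro card_mono) auto
      also have "\<dots> = card (V - U c) - card (nbhd E V u)"
      proof -
        have "nbhd E V u \<subseteq> V - U c" using C(3)[OF c] u by (auto simp: nbhd_def U_def)
        then show ?thesis using fin by (simp add: card_Diff_subset)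
      qed
      also have "card (V - U c) = card V - card (U c)" using UV finU by (simp add: card_Diff_subset)
      finally have 1: "card (U d - nbhd E V u) \<le> card V - card (U c) - card (nbhd E V u)" .
      show "real (card (U d - nbhd E V u)) \<le> \<epsilon> * ?n"
      proof (cases "card (U d - nbhd E V u) = 0")
        case True
        then show ?thesis using \<epsilon> by simp
      next
        case False
        then have "real (card (U d - nbhd E V u)) \<le> ?n - real (card (U c)) - real (card (nbhd E V u))"
          using 1 by linarith
        also have "\<dots> \<le> ?n - (1 / real r - (e0 + (real r - 1) * \<epsilon>1)) * ?n - (1 - 1 / real r - \<epsilon>1) * ?n"
        proof -
          have "u \<in> V" using u UV by blast
          then show ?thesis using Ulow[OF c] deg[of u] by linarith
        qed
        also have "\<dots> = (e0 + real r * \<epsilon>1) * ?n" by (simp add: algebra_simps)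
        also have "\<dots> \<le> \<epsilon> * ?n" using small by (intro mult_right_mono) auto
        finally show ?thesis .
      qed
    qed
    then show ?thesis by blast
  qed
  then show ?thesis using \<epsilon>1 by (intro exI[of _ \<epsilon>1] conjI exI[of _ N']) blast+
qed

end

section \<open>The core of an extremal graph and the minimum degree\<close>

lemma symp_hub_join: "symp (hub_join B \<pi>)"
  by (auto simp: hub_join_def symp_def)

lemma irreflp_hub_join: "irreflp (hub_join B \<pi>)"
  by (auto simp: hub_join_def irreflp_def)

lemma card_residue_class: "card {v. v < n \<and> v mod r = i} \<le> n div r + 1" for n r i :: nat
proof -
  have "card {v. v < n \<and> v mod r = i} \<le> card {..n div r}"
  proof (rule card_inj_on_le[of "\<lambda>v. v div r"])
    show "inj_on (\<lambda>v. v div r) {v. v < n \<and> v mod r = i}"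
      by (rule inj_onI) (metis (mono_tags, lifting) div_mult_mod_eq mem_Collect_eq)
    show "(\<lambda>v. v div r) ` {v. v < n \<and> v mod r = i} \<subseteq> {..n div r}"
      by (auto intro: div_le_mono)
  qed simp
  then show ?thesis by simp
qed

text \<open>
  The competitors have arbitrary vertex sets of the same size, so that they can be built on any
  convenient set.
\<close>

definition extremal :: "nat \<Rightarrow> (nat \<Rightarrow> nat \<Rightarrow> bool) \<Rightarrow> (nat \<Rightarrow> nat \<Rightarrow> bool) \<Rightarrow> nat set \<Rightarrow> bool" where
  "extremal s A E V \<longleftrightarrow> finite V \<and> symp E \<and> irreflp E \<and> copy_free s A E V \<and>
     (\<forall>(E'::nat \<Rightarrow> nat \<Rightarrow> bool) V'. finite V' \<and> symp E' \<and> irreflp E' \<and> copy_free s A E' V' \<and> card V' = card V \<longrightarrow> qidx E' V' \<le> qidx E V)"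

lemma coreD:
  assumes "core E V r e U"
  shows "c < r \<Longrightarrow> U c \<subseteq> V"
    "c < r \<Longrightarrow> d < r \<Longrightarrow> c \<noteq> d \<Longrightarrow> U c \<inter> U d = {}"
    "c < r \<Longrightarrow> u \<in> U c \<Longrightarrow> v \<in> U c \<Longrightarrow> \<not> E u v"
    "c < r \<Longrightarrow> (1 / real r - e) * real (card V) \<le> real (card (U c))"
    "c < r \<Longrightarrow> d < r \<Longrightarrow> c \<noteq> d \<Longrightarrow> u \<in> U c \<Longrightarrow> real (card (U d - nbhd E V u)) \<le> e * real (card V)"
proof -
  note a = assms[unfolded core_def]
  note a1 = a[THEN conjunct1] and a2 = a[THEN conjunct2, THEN conjunct1]
    and a3 = a[THEN conjunct2, THEN conjunct2, THEN conjunct1]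
    and a4 = a[THEN conjunct2, THEN conjunct2, THEN conjunct2, THEN conjunct1]
    and a5 = a[THEN conjunct2, THEN conjunct2, THEN conjunct2, THEN conjunct2]
  show "c < r \<Longrightarrow> U c \<subseteq> V" using a1 by simp
  show "c < r \<Longrightarrow> d < r \<Longrightarrow> c \<noteq> d \<Longrightarrow> U c \<inter> U d = {}" using a2 by simp
  show "c < r \<Longrightarrow> u \<in> U c \<Longrightarrow> v \<in> U c \<Longrightarrow> \<not> E u v" using a3 by simp
  show "c < r \<Longrightarrow> (1 / real r - e) * real (card V) \<le> real (card (U c))" using a4 by simp
  show "c < r \<Longrightarrow> d < r \<Longrightarrow> c \<noteq> d \<Longrightarrow> u \<in> U c \<Longrightarrow> real (card (U d - nbhd E V u)) \<le> e * real (card V)"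
    using a5 by simp
qed

lemma core_card_UN:
  assumes fin: "finite V" and core: "core E V r e U" and I: "I \<subseteq> {..<r}"
  shows "real (card I) * ((1 / real r - e) * real (card V)) \<le> real (card (\<Union>c\<in>I. U c))"
proof -
  have finI: "finite I" using I finite_subset by blast
  have finU: "finite (U c)" if "c \<in> I" for c using coreD(1)[OF core] fin that I finite_subset by blast
  have "real (card I) * ((1 / real r - e) * real (card V)) = (\<Sum>c\<in>I. (1 / real r - e) * real (card V))" by simp
  also have "\<dots> \<le> (\<Sum>c\<in>I. real (card (U c)))" using coreD(4)[OF core] I by (intro sum_mono) auto
  also have "\<dots> = real (\<Sum>c\<in>I. card (U c))" by simp
  also have "(\<Sum>c\<in>I. card (U c)) = card (\<Union>c\<in>I. U c)"
    using finI finU coreD(2)[OF core] I by (intro card_UN_disjoint[symmetric]) blast+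
  finally show ?thesis .
qed

lemma core_sizes:
  assumes fin: "finite V" and core: "core E V r e U" and r: "1 \<le> r" and e: "0 \<le> e"
  shows "real (card (V - (\<Union>c<r. U c))) \<le> real r * e * real (card V)"
    "c < r \<Longrightarrow> real (card (U c)) \<le> (1 / real r + real r * e) * real (card V)"
    "c < r \<Longrightarrow> u \<in> U c \<Longrightarrow> real (card (V - U c - nbhd E V u)) \<le> 2 * (real r * e) * real (card V)"
proof -
  let ?n = "real (card V)"
  have sub: "(\<Union>c<r. U c) \<subseteq> V" using coreD(1)[OF core] by blast
  have "card (V - (\<Union>c<r. U c)) + card (\<Union>c<r. U c) = card V"
    using sub fin by (metis card_Diff_subset card_mono finite_subset le_add_diff_inverse2)
  then have 1: "real (card (V - (\<Union>c<r. U c))) = ?n - real (card (\<Union>c<r. U c))" by linarith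
  have "real r * ((1 / real r - e) * ?n) \<le> real (card (\<Union>c<r. U c))"
    using core_card_UN[OF fin core, of "{..<r}"] by simp
  moreover have "real r * ((1 / real r - e) * ?n) = ?n - real r * e * ?n" using r by (simp add: field_simps)
  ultimately show W: "real (card (V - (\<Union>c<r. U c))) \<le> real r * e * ?n" using 1 by linarith
  show "real (card (U c)) \<le> (1 / real r + real r * e) * ?n" if c: "c < r"
  proof -
    let ?R = "\<Union>d\<in>{..<r} - {c}. U d"
    have "real (card ({..<r} - {c})) * ((1 / real r - e) * ?n) \<le> real (card ?R)"
      by (rule core_card_UN[OF fin core]) auto
    then have R: "(real r - 1) * ((1 / real r - e) * ?n) \<le> real (card ?R)" using c by (simp add: of_nat_diff)
    have "U c \<inter> ?R = {}" using coreD(2)[OF core c] by auto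
    moreover have "finite ?R" by (rule finite_subset[OF _ fin]) (use sub in blast)
    moreover have "finite (U c)" by (rule finite_subset[OF coreD(1)[OF core c] fin])
    ultimately have "card (U c) + card ?R = card (U c \<union> ?R)" by (simp add: card_Un_disjoint)
    also have "\<dots> \<le> card V" using sub c by (intro card_mono fin) auto
    finally have "real (card (U c)) + real (card ?R) \<le> ?n" by linarith
    moreover have "?n - (real r - 1) * ((1 / real r - e) * ?n) = (1 / real r + (real r - 1) * e) * ?n"
      using r by (simp add: field_simps)
    moreover have "(1 / real r + (real r - 1) * e) * ?n \<le> (1 / real r + real r * e) * ?n"
      using e by (intro mult_right_mono add_mono) auto
    ultimately show ?thesis using R by linarith
  qed
  show "real (card (V - U c - nbhd E V u)) \<le> 2 * (real r * e) * ?n" if c: "c < r" "u \<in> U c"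
  proof -
    have "V - U c - nbhd E V u \<subseteq> (V - (\<Union>c<r. U c)) \<union> (\<Union>d\<in>{..<r} - {c}. U d - nbhd E V u)" by blast
    moreover have "finite (U d)" if "d < r" for d using coreD(1)[OF core that] fin finite_subset by blast
    ultimately have "card (V - U c - nbhd E V u) \<le> card ((V - (\<Union>c<r. U c)) \<union> (\<Union>d\<in>{..<r} - {c}. U d - nbhd E V u))"
      using fin by (intro card_mono) auto
    also have "\<dots> \<le> card (V - (\<Union>c<r. U c)) + card (\<Union>d\<in>{..<r} - {c}. U d - nbhd E V u)" by (rule card_Un_le)
    also have "card (\<Union>d\<in>{..<r} - {c}. U d - nbhd E V u) \<le> (\<Sum>d\<in>{..<r} - {c}. card (U d - nbhd E V u))"
      by (intro card_UN_le) auto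
    finally have "real (card (V - U c - nbhd E V u)) \<le>
        real (card (V - (\<Union>c<r. U c)) + (\<Sum>d\<in>{..<r} - {c}. card (U d - nbhd E V u)))" by (simp only: of_nat_le_iff)
    also have "\<dots> = real (card (V - (\<Union>c<r. U c))) + (\<Sum>d\<in>{..<r} - {c}. real (card (U d - nbhd E V u)))" by simp
    also have "(\<Sum>d\<in>{..<r} - {c}. real (card (U d - nbhd E V u))) \<le> (\<Sum>d\<in>{..<r} - {c}. e * ?n)"
      using coreD(5)[OF core c(1)] c(2) by (intro sum_mono) auto
    also have "\<dots> = (real r - 1) * (e * ?n)" using c(1) by (simp add: of_nat_diff)
    also have "\<dots> \<le> real r * (e * ?n)" using e by (intro mult_right_mono) auto
    finally show ?thesis using W by simp
  qed
qed

text \<open>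
  Here the entries of \<open>x\<close> add up to \<open>n = card V\<close>. Let \<open>l = q / n\<close>, let \<open>\<alpha> = 1 - 1/r\<close> and let \<open>y i\<close>
  be the sum of \<open>x\<close> over \<open>U i\<close>, divided by \<open>n\<close>. The eigenvector equation at \<open>u \<in> U i\<close> reads \<open>(l - \<alpha>) x u = 1 - y i\<close> up to an
  error of order \<open>r \<epsilon>\<close>. Summing over \<open>U i\<close> shows that all \<open>y i\<close> are close to the same number; as they
  nearly add up to \<open>1\<close>, they are close to \<open>1 / r\<close>, which determines \<open>l\<close> and then \<open>x u\<close>. The bound \<open>4\<close> holds
  because \<open>q\<close> exceeds every degree by at least \<open>n / 4\<close>.
\<close>

lemma core_near_uniform:
  fixes r :: nat and x :: "'a \<Rightarrow> real"
  assumes fin: "finite V" and sym: "symp E" and irr: "irreflp E"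
    and core: "core E V r \<epsilon> U" and r3: "3 \<le> r" and \<epsilon>: "0 \<le> \<epsilon>"
    and x: "perron E V q x" "sum x V = real (card V)"
    and q: "5/4 * real (card V) \<le> q" "q \<le> 2 * real (card V)"
  shows "w \<in> V \<Longrightarrow> x w \<le> 4"
    and "i < r \<Longrightarrow> u \<in> U i \<Longrightarrow> \<bar>x u - 1\<bar> \<le> 256 * (real r)\<^sup>2 * \<epsilon>"
proof -
  let ?n = "real (card V)" and ?\<alpha> = "1 - 1 / real r"
  define e where "e = real r * \<epsilon>"
  have e: "0 \<le> e" using \<epsilon> by (simp add: e_def)
  have r0: "3 \<le> real r" using r3 by simp
  have x0: "0 \<le> x u" if "u \<in> V" for u using x(1) that by (simp add: perron_def)
  have "V \<noteq> {}" using x(1) by (auto simp: perron_def)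
  then have n: "0 < ?n" using fin by (simp add: card_gt_0_iff)
  have sub_le: "sum x S \<le> ?n" if "S \<subseteq> V" for S
    using sum_mono2[OF fin that, of x] x0 x(2) by auto
  show x4: "x w \<le> 4" if w: "w \<in> V" for w
  proof -
    have "real (card (nbhd E V w)) \<le> ?n" using card_mono[OF fin nbhd_subset] by simp
    then have "1/4 * ?n \<le> q - real (card (nbhd E V w))" using q by linarith
    then have "1/4 * ?n * x w \<le> (q - real (card (nbhd E V w))) * x w" using x0[OF w] by (rule mult_right_mono)
    also have "\<dots> = sum x (nbhd E V w)" using perron_eq[OF fin x(1) w] by (simp add: algebra_simps)
    also have "\<dots> \<le> ?n" by (rule sub_le[OF nbhd_subset])
    finally have "?n * x w \<le> ?n * 4" by (simp add: algebra_simps)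
    then show ?thesis using n by simp
  qed
  have sum4: "sum x S \<le> 4 * real (card S)" if "S \<subseteq> V" for S
    using sum_bounded_above[of S x 4] x4 that by (auto simp: mult.commute)
  define y where "y i = sum x (U i) / ?n" for i
  define l where "l = q / ?n"
  have l: "5/4 \<le> l" "l \<le> 2" using q n by (simp_all add: l_def field_simps)
  have y01: "0 \<le> y i" "y i \<le> 1" if "i < r" for i
    using x0 sub_le[OF coreD(1)[OF core that]] coreD(1)[OF core that] n
    by (auto simp: y_def intro!: sum_nonneg divide_nonneg_pos)
  have finU: "finite (U i)" if "i < r" for i using coreD(1)[OF core that] fin finite_subset by blast
  note sizes = core_sizes[OF fin core _ \<epsilon>, folded e_def]
  have sz: "\<bar>real (card (U i)) / ?n - 1 / real r\<bar> \<le> e" if i: "i < r" for i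
  proof -
    have "(1 / real r - \<epsilon>) * ?n \<le> real (card (U i))" by (rule coreD(4)[OF core i])
    moreover have "real (card (U i)) \<le> (1 / real r + e) * ?n" using sizes(2)[OF _ i] r3 by simp
    ultimately have "1 / real r - \<epsilon> \<le> real (card (U i)) / ?n" "real (card (U i)) / ?n \<le> 1 / real r + e"
      using n by (simp_all add: pos_le_divide_eq pos_divide_le_eq)
    moreover have "\<epsilon> \<le> e" using \<epsilon> r0 mult_right_mono[of 1 "real r" \<epsilon>] by (simp add: e_def)
    ultimately show ?thesis by linarith
  qed
  have loc: "\<bar>x u * (l - ?\<alpha>) - (1 - y i)\<bar> \<le> 20 * e" if i: "i < r" and u: "u \<in> U i" for i u
  proof -
    have uV: "u \<in> V" using coreD(1)[OF core i] u by blast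
    let ?M = "V - U i - nbhd E V u"
    have nbs: "nbhd E V u \<subseteq> V - U i" using coreD(3)[OF core i u] by (auto simp: nbhd_def)
    have M: "real (card ?M) \<le> 2 * e * ?n" using sizes(3)[OF _ i u] r3 by simp
    have parts: "V = U i \<union> (?M \<union> nbhd E V u)" using coreD(1)[OF core i] nbs by blast
    have dj: "U i \<inter> (?M \<union> nbhd E V u) = {}" "?M \<inter> nbhd E V u = {}" using nbs by blast+
    have s1: "sum f V = sum f (U i) + (sum f ?M + sum f (nbhd E V u))" for f :: "'a \<Rightarrow> real"
    proof -
      have "sum f V = sum f (U i \<union> (?M \<union> nbhd E V u))" using parts by simp
      also have "\<dots> = sum f (U i) + sum f (?M \<union> nbhd E V u)"
        by (rule sum.union_disjoint) (use dj fin finU[OF i] in auto)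
      also have "sum f (?M \<union> nbhd E V u) = sum f ?M + sum f (nbhd E V u)"
        by (rule sum.union_disjoint) (use dj fin in auto)
      finally show ?thesis .
    qed
    have c: "?n = real (card (U i)) + (real (card ?M) + real (card (nbhd E V u)))"
      using s1[of "\<lambda>_. 1"] by simp
    have sx: "?n = sum x (U i) + (sum x ?M + sum x (nbhd E V u))" using s1[of x] x(2) by simp
    have sM: "0 \<le> sum x ?M" "sum x ?M \<le> 8 * e * ?n"
    proof -
      show "0 \<le> sum x ?M" using x0 by (intro sum_nonneg) auto
      have "sum x ?M \<le> 4 * real (card ?M)" by (rule sum4) blast
      then show "sum x ?M \<le> 8 * e * ?n" using M by linarith
    qed
    have eq: "x u * (q - real (card (nbhd E V u))) = ?n - sum x (U i) - sum x ?M"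
      using perron_eq[OF fin x(1) uV] sx by (simp add: algebra_simps)
    define D where "D = real (card (nbhd E V u)) / ?n"
    define \<mu> where "\<mu> = sum x ?M / ?n"
    have \<mu>: "0 \<le> \<mu>" "\<mu> \<le> 8 * e" using sM n by (simp_all add: \<mu>_def field_simps)
    have "x u * (q - real (card (nbhd E V u))) / ?n = (?n - sum x (U i) - sum x ?M) / ?n" using eq by simp
    then have eq': "x u * (l - D) = 1 - y i - \<mu>"
      using n by (simp add: l_def D_def y_def \<mu>_def diff_divide_distrib right_diff_distrib)
    have Dd: "D = 1 - real (card (U i)) / ?n - real (card ?M) / ?n"
    proof -
      have nbv: "real (card (nbhd E V u)) = ?n - real (card (U i)) - real (card ?M)" using c by linarith
      show ?thesis unfolding D_def nbv diff_divide_distrib using n by simp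
    qed
    have "0 \<le> real (card ?M) / ?n" "real (card ?M) / ?n \<le> 2 * e" using M n by (simp_all add: field_simps)
    then have D: "\<bar>D - ?\<alpha>\<bar> \<le> 3 * e" using Dd sz[OF i] by linarith
    have "\<bar>x u * (D - ?\<alpha>)\<bar> \<le> 4 * (3 * e)"
      unfolding abs_mult using x0[OF uV] x4[OF uV] D by (intro mult_mono) auto
    moreover have "x u * (l - ?\<alpha>) - (1 - y i) = x u * (D - ?\<alpha>) - \<mu>" using eq' by (simp add: algebra_simps)
    ultimately show ?thesis using \<mu> by linarith
  qed
  have ybal: "\<bar>y i * (l - ?\<alpha> + 1 / real r) - 1 / real r\<bar> \<le> 21 * e" if i: "i < r" for i
  proof -
    have "\<bar>(\<Sum>u\<in>U i. x u * (l - ?\<alpha>) - (1 - y i))\<bar> \<le> (\<Sum>u\<in>U i. 20 * e)"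
      by (rule order_trans[OF sum_abs]) (intro sum_mono loc i)
    also have "\<dots> \<le> ?n * (20 * e)"
      using card_mono[OF fin coreD(1)[OF core i]] e by (simp add: mult_right_mono)
    also have "(\<Sum>u\<in>U i. x u * (l - ?\<alpha>) - (1 - y i)) = sum x (U i) * (l - ?\<alpha>) - real (card (U i)) * (1 - y i)"
      by (simp add: sum_subtractf sum_distrib_right)
    also have "\<dots> = ?n * (y i * (l - ?\<alpha>) - real (card (U i)) / ?n * (1 - y i))"
      using n by (simp add: y_def right_diff_distrib)
    finally have "?n * \<bar>y i * (l - ?\<alpha>) - real (card (U i)) / ?n * (1 - y i)\<bar> \<le> ?n * (20 * e)"
      using n by (simp add: abs_mult)
    then have 1: "\<bar>y i * (l - ?\<alpha>) - real (card (U i)) / ?n * (1 - y i)\<bar> \<le> 20 * e"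
      by (rule mult_left_le_imp_le[OF _ n])
    have "\<bar>(real (card (U i)) / ?n - 1 / real r) * (1 - y i)\<bar> \<le> e * 1"
      unfolding abs_mult using sz[OF i] y01[OF i] e by (intro mult_mono) auto
    moreover have "y i * (l - ?\<alpha> + 1 / real r) - 1 / real r = (y i * (l - ?\<alpha>) - real (card (U i)) / ?n * (1 - y i))
       + (real (card (U i)) / ?n - 1 / real r) * (1 - y i)"
    proof -
      have "a * (b + k) - k = (a * b - g * (1 - a)) + (g - k) * (1 - a)" for a b g k :: real
        by (simp add: algebra_simps)
      then show ?thesis .
    qed
    moreover have "\<bar>P\<bar> \<le> 21 * e" if "\<bar>R\<bar> \<le> e * 1" "P = Q + R" "\<bar>Q\<bar> \<le> 20 * e" for P Q R :: real
      using that by linarith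
    ultimately show ?thesis using 1 by blast
  qed
  define \<nu> where "\<nu> = l - ?\<alpha> + 1 / real r"
  have ir: "0 \<le> 1 / real r" "1 / real r \<le> 1/3" using r0 by (simp_all add: field_simps)
  have \<nu>: "0 \<le> \<nu>" "\<nu> \<le> 2" using l ir unfolding \<nu>_def by linarith+
  have er: "e \<le> real r * e / 3" using mult_right_mono[OF r0 e] by simp
  have ysum: "1 - 4 * e \<le> sum y {..<r}" "sum y {..<r} \<le> 1"
  proof -
    let ?W = "V - (\<Union>c<r. U c)"
    have "(\<Union>c<r. U c) \<subseteq> V" using coreD(1)[OF core] by blast
    then have "?n = sum x ?W + sum x (\<Union>c<r. U c)" using sum.subset_diff[OF _ fin] x(2) by metis
    also have "sum x (\<Union>c<r. U c) = (\<Sum>c<r. sum x (U c))"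
      using finU coreD(2)[OF core] by (intro sum.UNION_disjoint) auto
    also have "(\<Sum>c<r. sum x (U c)) = (\<Sum>c<r. ?n * y c)" using n by (simp add: y_def)
    also have "\<dots> = ?n * sum y {..<r}" by (rule sum_distrib_left[symmetric])
    finally have eq: "?n = sum x ?W + ?n * sum y {..<r}" .
    have "0 \<le> sum x ?W" "sum x ?W \<le> 4 * (e * ?n)"
      using x0 sum4[of ?W] sizes(1) r3 by (auto intro: sum_nonneg)
    then have "?n * (1 - 4 * e) \<le> ?n * sum y {..<r}" "?n * sum y {..<r} \<le> ?n * 1"
      using eq by (simp_all add: algebra_simps)
    then show "1 - 4 * e \<le> sum y {..<r}" "sum y {..<r} \<le> 1" using mult_left_le_imp_le[OF _ n] by blast+
  qed
  have \<nu>1: "\<bar>\<nu> - 1\<bar> \<le> 25 * (real r * e)"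
  proof -
    have "\<bar>(\<Sum>i<r. y i * \<nu> - 1 / real r)\<bar> \<le> (\<Sum>i<r. 21 * e)"
      using ybal by (intro order_trans[OF sum_abs] sum_mono) (auto simp: \<nu>_def)
    then have 1: "\<bar>sum y {..<r} * \<nu> - 1\<bar> \<le> 21 * (real r * e)"
    proof -
      have "(\<Sum>i<r. y i * \<nu> - 1 / real r) = sum y {..<r} * \<nu> - 1"
        unfolding sum_subtractf sum_distrib_right[symmetric] using r0 by simp
      with \<open>\<bar>(\<Sum>i<r. y i * \<nu> - 1 / real r)\<bar> \<le> (\<Sum>i<r. 21 * e)\<close> show ?thesis by (simp add: mult_ac)
    qed
    have "0 \<le> (1 - sum y {..<r}) * \<nu>" using ysum \<nu> by simp
    moreover have "(1 - sum y {..<r}) * \<nu> \<le> (4 * e) * 2"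
      by (rule mult_mono) (use ysum \<nu> e in auto)
    ultimately have "0 \<le> \<nu> - sum y {..<r} * \<nu>" "\<nu> - sum y {..<r} * \<nu> \<le> 8 * e" by (simp_all add: algebra_simps)
    then show ?thesis using 1 er e by linarith
  qed
  have re0: "0 \<le> real r * e" using e by simp
  show "\<bar>x u - 1\<bar> \<le> 256 * (real r)\<^sup>2 * \<epsilon>" if i: "i < r" and u: "u \<in> U i" for i u
  proof -
    have uV: "u \<in> V" using coreD(1)[OF core i] u by blast
    have "\<bar>y i * (\<nu> - 1)\<bar> \<le> 1 * (25 * (real r * e))"
      unfolding abs_mult using y01[OF i] \<nu>1 by (intro mult_mono) auto
    then have yi: "\<bar>y i - 1 / real r\<bar> \<le> 25 * (real r * e) + 21 * e"
      using ybal[OF i] unfolding \<nu>_def[symmetric] by (simp add: algebra_simps)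
    have xi: "\<bar>x u * (\<nu> - 1)\<bar> \<le> 4 * (25 * (real r * e))"
      unfolding abs_mult using x0[OF uV] x4[OF uV] \<nu>1 by (intro mult_mono) auto
    have "(x u - 1) * ?\<alpha> = (x u * (l - ?\<alpha>) - (1 - y i)) - x u * (\<nu> - 1) - (y i - 1 / real r)"
      by (simp add: \<nu>_def algebra_simps diff_divide_distrib)
    then have "\<bar>(x u - 1) * ?\<alpha>\<bar> \<le> 20 * e + 100 * (real r * e) + (25 * (real r * e) + 21 * e)"
      using loc[OF i u] xi yi by linarith
    also have "\<dots> \<le> 140 * (real r * e)" using er re0 by linarith
    finally have "\<bar>x u - 1\<bar> * ?\<alpha> \<le> 140 * (real r * e)" using ir by (simp add: abs_mult)
    moreover have "\<bar>x u - 1\<bar> * (2/3) \<le> \<bar>x u - 1\<bar> * ?\<alpha>" using ir by (intro mult_left_mono) auto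
    ultimately have "\<bar>x u - 1\<bar> * (2/3) \<le> 140 * (real r * e)" by (rule order_trans[rotated])
    then have "3/2 * (\<bar>x u - 1\<bar> * (2/3)) \<le> 3/2 * (140 * (real r * e))" by (rule mult_left_mono) simp
    then have "\<bar>x u - 1\<bar> \<le> 210 * (real r * e)" by (simp add: mult_ac)
    also have "\<dots> \<le> 256 * (real r * e)" using re0 by linarith
    finally show ?thesis by (simp add: e_def power2_eq_square mult_ac)
  qed
qed

context forbidden
begin

lemma alpha_bounds: "2 / 3 \<le> 1 - 1 / real r" "1 - 1 / real r \<le> 1"
  using r3 by (simp_all add: field_simps)

text \<open>
  A vertex misses only its residue class, which has at most \<open>n / r + 1\<close> elements; \<open>qidx_lower\<close> turns
  this degree bound into a bound on the index.
\<close>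

lemma turan_dense:
  assumes n: "1 \<le> n"
  shows "copy_free s A (hub_join {} (\<lambda>v. v mod r)) {..<n}"
    "2 * (1 - 1 / real r) * real n - 2 \<le> qidx (hub_join {} (\<lambda>v. v mod r)) {..<n}"
proof -
  let ?E = "hub_join {} (\<lambda>v. v mod r)"
  show "copy_free s A ?E {..<n}" using r3 t1 by (intro hub_join_free) auto
  have "real n * (1 - 1 / real r) - 1 \<le> real (card (nbhd ?E {..<n} u))" if u: "u < n" for u
  proof -
    have "nbhd ?E {..<n} u = {..<n} - {v. v < n \<and> v mod r = u mod r}" by (auto simp: nbhd_def hub_join_def)
    then have "card (nbhd ?E {..<n} u) = card {..<n} - card {v. v < n \<and> v mod r = u mod r}"
      by (simp add: card_Diff_subset subset_iff)
    then have "real n - real (n div r + 1) \<le> real (card (nbhd ?E {..<n} u))"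
      using card_residue_class[of n r "u mod r"] by simp
    moreover have "real (n div r) \<le> real n / real r"
    proof -
      have "real (n div r * r) \<le> real n" by (simp only: of_nat_le_iff) simp
      then show ?thesis using r3 by (simp add: field_simps)
    qed
    moreover have "real n * (1 - 1 / real r) = real n - real n / real r" by (simp add: algebra_simps)
    ultimately show ?thesis by simp
  qed
  then have "2 * (real n * (1 - 1 / real r) - 1) \<le> qidx ?E {..<n}"
    using n by (intro qidx_lower) (auto simp: symp_hub_join lessThan_empty_iff)
  then show "2 * (1 - 1 / real r) * real n - 2 \<le> qidx ?E {..<n}" by (simp add: algebra_simps)
qed

lemma extremal_lower:
  assumes "extremal s A E V" "1 \<le> card V"
  shows "2 * (1 - 1 / real r) * real (card V) - 2 \<le> qidx E V"
proof -
  have "qidx (hub_join {} (\<lambda>v. v mod r)) {..<card V} \<le> qidx E V"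
    using assms turan_dense(1)[of "card V"] symp_hub_join irreflp_hub_join unfolding extremal_def by fastforce
  then show ?thesis using turan_dense(2)[of "card V"] assms(2) by linarith
qed

lemma hereditary_copy_free: "hereditary (copy_free s A :: (nat \<Rightarrow> nat \<Rightarrow> bool) \<Rightarrow> nat set \<Rightarrow> bool) (1 - 1 / real r) 2"
proof
  show "copy_free s A E V \<Longrightarrow> W \<subseteq> V \<Longrightarrow> copy_free s A E W" for E :: "nat \<Rightarrow> nat \<Rightarrow> bool" and V W by (rule copy_free_hered)
  fix n :: nat assume n: "1 \<le> n"
  have "2 * (1 - 1 / real r) * (real n - 1) - 2 \<le> 2 * (1 - 1 / real r) * real n - 2"
    using alpha_bounds by (intro diff_mono mult_left_mono) auto
  also have "\<dots> \<le> qidx (hub_join {} (\<lambda>v. v mod r)) {..<n}" by (rule turan_dense(2)[OF n])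
  finally show "\<exists>(E::nat \<Rightarrow> nat \<Rightarrow> bool) V. finite V \<and> symp E \<and> irreflp E \<and> copy_free s A E V \<and> card V = n \<and>
      2 * (1 - 1 / real r) * (real n - 1) - 2 \<le> qidx E V"
    using turan_dense(1)[OF n] symp_hub_join irreflp_hub_join
    by (intro exI[of _ "hub_join {} (\<lambda>v. v mod r)"] exI[of _ "{..<n}"]) auto
qed (use alpha_bounds in auto)

text \<open>
  The flat subgraph provided by \<open>flat_subgraph_exists\<close> contains almost all vertices and has minimum
  degree close to \<open>(1 - 1/r) n\<close>, so it has a core, which is also a core of the whole graph with a slightly
  larger error.
\<close>

lemma core_of_extremal:
  assumes \<epsilon>: "0 < \<epsilon>"
  shows "\<exists>N. \<forall>E V. extremal s A E V \<and> N \<le> card V \<longrightarrow> (\<exists>U. core E V r \<epsilon> U)"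
proof -
  let ?\<alpha> = "1 - 1 / real r"
  obtain \<epsilon>1 N1 where \<epsilon>1: "0 < \<epsilon>1" and N1: "\<forall>(E::nat \<Rightarrow> nat \<Rightarrow> bool) V. finite V \<and> symp E \<and> irreflp E \<and> copy_free s A E V \<and> N1 \<le> card V \<and>
     (\<forall>u\<in>V. (?\<alpha> - \<epsilon>1) * real (card V) \<le> real (card (nbhd E V u))) \<longrightarrow> (\<exists>U. core E V r (\<epsilon> / 2) U)"
    using core_exists[of "\<epsilon> / 2"] \<epsilon> by (auto simp del: One_nat_def)
  define \<eta> where "\<eta> = min 1 (\<epsilon>1 / 2)"
  define \<kappa> where "\<kappa> = min (1/2) (\<epsilon> / 2)"
  have \<eta>: "0 < \<eta>" "\<eta> \<le> 1" "2 * \<eta> \<le> \<epsilon>1" using \<epsilon>1 by (auto simp: \<eta>_def)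
  have \<kappa>: "0 < \<kappa>" "\<kappa> \<le> 1/2" "\<kappa> \<le> \<epsilon> / 2" using \<epsilon> by (auto simp: \<kappa>_def)
  obtain N2 where N2: "\<forall>(E::nat \<Rightarrow> nat \<Rightarrow> bool) V. finite V \<and> symp E \<and> irreflp E \<and> copy_free s A E V \<and> N2 \<le> card V \<and>
     (\<forall>(E'::nat \<Rightarrow> nat \<Rightarrow> bool) V'. finite V' \<and> symp E' \<and> irreflp E' \<and> copy_free s A E' V' \<and> card V' = card V \<longrightarrow> qidx E' V' \<le> qidx E V) \<longrightarrow>
     (\<exists>W\<subseteq>V. (1 - \<kappa>) * real (card V) \<le> real (card W) \<and> flat \<eta> E W \<and>
        2 * ?\<alpha> * (real (card W) - 1) \<le> qidx E W)"
    using hereditary.flat_subgraph_exists[OF hereditary_copy_free \<kappa>(1,2) \<eta>(1,2)] ..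
  define N where "N = max N2 (2 * max N1 (nat \<lceil>2 / \<eta>\<rceil>))"
  have "\<exists>U. core E V r \<epsilon> U" if ext: "extremal s A E V" and big: "N \<le> card V" for E V
  proof -
    let ?n = "real (card V)"
    have EV: "finite V" "symp E" "irreflp E" "copy_free s A E V" using ext by (auto simp: extremal_def)
    have "N2 \<le> card V" using big by (simp add: N_def)
    then have "finite V \<and> symp E \<and> irreflp E \<and> copy_free s A E V \<and> N2 \<le> card V \<and>
     (\<forall>(E'::nat \<Rightarrow> nat \<Rightarrow> bool) V'. finite V' \<and> symp E' \<and> irreflp E' \<and> copy_free s A E' V' \<and> card V' = card V \<longrightarrow>
        qidx E' V' \<le> qidx E V)"
      using ext unfolding extremal_def by (elim conjE) (intro conjI)
    from N2[THEN spec, THEN spec, THEN mp, OF this]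
    obtain W where W: "W \<subseteq> V" "(1 - \<kappa>) * ?n \<le> real (card W)" "flat \<eta> E W"
      "2 * ?\<alpha> * (real (card W) - 1) \<le> qidx E W"
      by (elim exE conjE)
    have "1/2 * ?n \<le> (1 - \<kappa>) * ?n" using \<kappa> by (intro mult_right_mono) auto
    then have half: "1/2 * ?n \<le> real (card W)" using W(2) by linarith
    have W1: "N1 \<le> card W" "2 / \<eta> \<le> real (card W)"
    proof -
      have "2 * N1 \<le> card V" "2 * nat \<lceil>2 / \<eta>\<rceil> \<le> card V" using big by (auto simp: N_def)
      then show "N1 \<le> card W" "2 / \<eta> \<le> real (card W)" using half by linarith+
    qed
    have finW: "finite W" using W(1) EV(1) finite_subset by blast
    have WV: "real (card W) \<le> ?n" using card_mono[OF EV(1) W(1)] by simp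
    have "(2 * ?\<alpha> - \<eta>) * real (card W) \<le> qidx E W"
    proof -
      have "2 \<le> \<eta> * real (card W)" using W1(2) \<eta> by (simp add: field_simps)
      moreover have "2 * ?\<alpha> \<le> 2 * 1" using alpha_bounds(2) by (intro mult_left_mono) auto
      ultimately have "2 * ?\<alpha> \<le> \<eta> * real (card W)" by linarith
      moreover have "(2 * ?\<alpha> - \<eta>) * real (card W) = 2 * ?\<alpha> * (real (card W) - 1) + 2 * ?\<alpha> - \<eta> * real (card W)"
        by (simp only: left_diff_distrib right_diff_distrib mult_1_right)
      ultimately show ?thesis using W(4) by linarith
    qed
    then have deg: "(?\<alpha> - 2 * \<eta>) * real (card W) \<le> real (card (nbhd E W u))" if "u \<in> W" for u
      using flat_min_degree[OF finW EV(2) W(3), of ?\<alpha> u] \<eta> alpha_bounds that by simp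
    have "(?\<alpha> - \<epsilon>1) * real (card W) \<le> real (card (nbhd E W u))" if "u \<in> W" for u
    proof -
      have "(?\<alpha> - \<epsilon>1) * real (card W) \<le> (?\<alpha> - 2 * \<eta>) * real (card W)"
        using \<eta> by (intro mult_right_mono) auto
      then show ?thesis using deg[OF that] by linarith
    qed
    then obtain U where U: "core E W r (\<epsilon> / 2) U"
      using N1 finW EV copy_free_hered[OF EV(4) W(1)] W1(1) by blast
    have "core E V r \<epsilon> U"
      unfolding core_def
    proof (intro conjI allI impI ballI)
      fix c assume c: "c < r"
      show "U c \<subseteq> V" using coreD(1)[OF U c] W(1) by blast
      show "\<not> E u v" if "u \<in> U c" "v \<in> U c" for u v using coreD(3)[OF U c that] .
      show "(1 / real r - \<epsilon>) * ?n \<le> real (card (U c))"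
      proof -
        let ?x = "1 / real r - \<epsilon> / 2"
        have "(1 / real r - \<epsilon>) * ?n \<le> ?x * real (card W)"
        proof (cases "0 \<le> ?x")
          case True
          have "1 / real r \<le> 1" using r3 by simp
          then have "?x \<le> 1" using \<epsilon> by linarith
          then have "?x * \<kappa> \<le> 1 * \<kappa>" using \<kappa> by (intro mult_right_mono) auto
          moreover have "?x * (1 - \<kappa>) = ?x - ?x * \<kappa>" by (simp only: right_diff_distrib mult_1_right)
          ultimately have "1 / real r - \<epsilon> \<le> ?x * (1 - \<kappa>)" using \<kappa> by linarith
          then have "(1 / real r - \<epsilon>) * ?n \<le> ?x * (1 - \<kappa>) * ?n" by (intro mult_right_mono) auto
          also have "\<dots> \<le> ?x * real (card W)" using mult_left_mono[OF W(2) True] by (simp add: mult.assoc)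
          finally show ?thesis .
        next
          case False
          have "(1 / real r - \<epsilon>) * ?n \<le> ?x * ?n" using \<epsilon> by (intro mult_right_mono) auto
          also have "\<dots> \<le> ?x * real (card W)" using WV False by (intro mult_left_mono_neg) auto
          finally show ?thesis .
        qed
        then show ?thesis using coreD(4)[OF U c] by linarith
      qed
      fix d assume d: "d < r" "c \<noteq> d"
      show "U c \<inter> U d = {}" by (rule coreD(2)[OF U c d])
      fix u assume u: "u \<in> U c"
      have "U d - nbhd E V u = U d - nbhd E W u" using coreD(1)[OF U d(1)] W(1) by (auto simp: nbhd_def)
      then have "real (card (U d - nbhd E V u)) \<le> \<epsilon> / 2 * real (card W)" using coreD(5)[OF U c d u] by simp
      also have "\<dots> \<le> \<epsilon> * ?n" using WV \<epsilon> by (intro mult_mono) auto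
      finally show "real (card (U d - nbhd E V u)) \<le> \<epsilon> * ?n" .
    qed
    then show ?thesis by blast
  qed
  then show ?thesis by blast
qed

text \<open>
  Give \<open>w\<close> the neighbourhood of an ideal vertex of the part \<open>0\<close>. A copy of the forbidden graph that
  uses \<open>w\<close> contains at most \<open>s\<close> vertices of \<open>N\<close>; these have a common neighbour in \<open>U 0\<close> outside the
  copy, and it can replace \<open>w\<close>. So the original graph would contain a copy as well.
\<close>

lemma clone_free:
  fixes E :: "nat \<Rightarrow> nat \<Rightarrow> bool" and w :: nat
  assumes fin: "finite V" and sym: "symp E" and copy_free: "copy_free s A E V"
    and core: "core E V r \<epsilon> U" and \<epsilon>: "2 * real r * (real s + 1) * \<epsilon> \<le> 1" "0 \<le> \<epsilon>"
    and big: "2 * real r * real s < real (card V)"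
  defines "N \<equiv> (\<Union>c\<in>{1..<r}. U c) - {w}"
  shows "copy_free s A (\<lambda>u v. if u = w then v \<in> N else if v = w then u \<in> N else E u v) V"
proof (rule ccontr)
  let ?E = "\<lambda>u v. if u = w then v \<in> N else if v = w then u \<in> N else E u v"
  assume "\<not> ?thesis"
  then obtain f where f: "inj_on f {..<s}" "f ` {..<s} \<subseteq> V"
    "\<And>u v. \<lbrakk>u < s; v < s; A u v\<rbrakk> \<Longrightarrow> ?E (f u) (f v)" unfolding copy_free_def by blast
  have "\<exists>z<s. f z = w"
  proof (rule ccontr)
    assume no: "\<not> ?thesis"
    have "\<forall>u<s. \<forall>v<s. A u v \<longrightarrow> E (f u) (f v)"
    proof (intro allI impI)
      fix u v assume uv: "u < s" "v < s" "A u v"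
      then have "f u \<noteq> w" "f v \<noteq> w" using no by blast+
      then show "E (f u) (f v)" using f(3)[OF uv] by simp
    qed
    then show False using copy_free f(1,2) unfolding copy_free_def by blast
  qed
  then obtain z where z: "z < s" "f z = w" by blast
  let ?S = "f ` {..<s}"
  define D where "D u = (if u \<in> N then U 0 - nbhd E V u else {})" for u
  have "U 0 \<subseteq> V" using coreD(1)[OF core, of 0] r3 by simp
  then have finU0: "finite (U 0)" by (rule finite_subset[OF _ fin])
  have cS: "card ?S \<le> s" using card_image_le[of "{..<s}" f] by simp
  have Dle: "real (card (D u)) \<le> \<epsilon> * real (card V)" for u
  proof (cases "u \<in> N")
    case True
    then obtain c where c: "c < r" "c \<noteq> 0" "u \<in> U c" unfolding N_def by auto
    then show ?thesis using coreD(5)[OF core c(1) _ c(2,3), of] r3 True by (simp add: D_def)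
  next
    case False
    then show ?thesis using \<epsilon> by (simp add: D_def)
  qed
  have "\<exists>v'\<in>U 0. v' \<notin> ?S \<and> (\<forall>u\<in>?S. v' \<notin> D u)"
  proof (rule ccontr)
    assume "\<not> ?thesis"
    then have "U 0 \<subseteq> ?S \<union> (\<Union>u\<in>?S. D u)" by blast
    moreover have "finite (D u)" for u using finU0 by (simp add: D_def)
    ultimately have "card (U 0) \<le> card (?S \<union> (\<Union>u\<in>?S. D u))" by (intro card_mono) auto
    also have "\<dots> \<le> card ?S + card (\<Union>u\<in>?S. D u)" by (rule card_Un_le)
    also have "\<dots> \<le> s + (\<Sum>u\<in>?S. card (D u))" using cS by (intro add_mono card_UN_le) auto
    finally have "real (card (U 0)) \<le> real s + (\<Sum>u\<in>?S. real (card (D u)))"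
      by (simp flip: of_nat_sum of_nat_add)
    also have "(\<Sum>u\<in>?S. real (card (D u))) \<le> (\<Sum>u\<in>?S. \<epsilon> * real (card V))" using Dle by (intro sum_mono) auto
    also have "\<dots> = real (card ?S) * (\<epsilon> * real (card V))" by simp
    also have "\<dots> \<le> real s * (\<epsilon> * real (card V))" using cS \<epsilon> by (intro mult_right_mono) auto
    finally have "real (card (U 0)) \<le> real s + real s * (\<epsilon> * real (card V))" by simp
    moreover have "(1 / real r - \<epsilon>) * real (card V) \<le> real (card (U 0))" using coreD(4)[OF core] r3 by simp
    ultimately have "(1 / real r - (real s + 1) * \<epsilon>) * real (card V) \<le> real s" by (simp add: algebra_simps)
    moreover have "1 / (2 * real r) \<le> 1 / real r - (real s + 1) * \<epsilon>"
      using \<epsilon>(1) r3 by (simp add: field_simps)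
    then have "1 / (2 * real r) * real (card V) \<le> (1 / real r - (real s + 1) * \<epsilon>) * real (card V)"
      by (intro mult_right_mono) auto
    ultimately have "1 / (2 * real r) * real (card V) \<le> real s" by linarith
    then show False using big r3 by (simp add: field_simps)
  qed
  then obtain v' where v': "v' \<in> U 0" "v' \<notin> ?S" "\<And>u. u \<in> ?S \<Longrightarrow> v' \<notin> D u" by blast
  have v'V: "v' \<in> V" using v'(1) coreD(1)[OF core, of 0] r3 by auto
  have adj: "E (f u) v'" if "u < s" "f u \<in> N" for u
    using v'(1) v'(3)[of "f u"] that by (auto simp: D_def nbhd_def)
  let ?f = "f(z := v')"
  have "inj_on ?f {..<s}" using f(1) v'(2) by (auto simp: inj_on_def)
  moreover have "?f ` {..<s} \<subseteq> V" using f(2) v'V by auto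
  moreover have "\<forall>u<s. \<forall>v<s. A u v \<longrightarrow> E (?f u) (?f v)"
  proof (intro allI impI)
    fix u v assume uv: "u < s" "v < s" "A u v"
    have wz: "f y = w \<longleftrightarrow> y = z" if "y < s" for y using f(1) z that by (auto dest: inj_onD)
    have E: "?E (f u) (f v)" by (rule f(3)[OF uv])
    have wN: "w \<notin> N" by (simp add: N_def)
    consider "u = z" "v = z" | "u = z" "v \<noteq> z" | "u \<noteq> z" "v = z" | "u \<noteq> z" "v \<noteq> z" by blast
    then show "E (?f u) (?f v)"
    proof cases
      case 1 then show ?thesis using E z wN by simp
    next
      case 2
      then have "f v \<in> N" using E z by simp
      then show ?thesis using adj[OF uv(2)] sympD[OF sym] 2 by simp
    next
      case 3
      then have "f u \<in> N" using E z wz[OF uv(1)] by simp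
      then show ?thesis using adj[OF uv(1)] 3 by simp
    next
      case 4 then show ?thesis using E wz[OF uv(1)] wz[OF uv(2)] by simp
    qed
  qed
  ultimately show False using copy_free unfolding copy_free_def by blast
qed

text \<open>
  Replacing the neighbourhood of \<open>w\<close> by \<open>N\<close> keeps the graph free (\<open>clone_free\<close>), so it does not
  increase the form at \<open>x\<close>. As \<open>x\<close> is almost \<open>1\<close> on the core, each edge at \<open>w\<close> contributes about
  \<open>(x w + 1)\<^sup>2\<close>, before and after the replacement; hence \<open>w\<close> has almost as many neighbours as \<open>N\<close> has elements.
\<close>

lemma extremal_min_degree:
  assumes ext: "extremal s A E V" and core: "core E V r \<epsilon> U"
    and \<epsilon>: "2 * real r * (real s + 1) * \<epsilon> \<le> 1" "0 < \<epsilon>" "256 * (real r)\<^sup>2 * \<epsilon> \<le> 1"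
    and big: "2 * real r * real s < real (card V)" "1 \<le> 256 * (real r)\<^sup>2 * \<epsilon> * real (card V)"
    and x: "perron E V (qidx E V) x"
    and x4: "\<And>w. w \<in> V \<Longrightarrow> x w \<le> 4"
    and x1: "\<And>i u. i < r \<Longrightarrow> u \<in> U i \<Longrightarrow> \<bar>x u - 1\<bar> \<le> 256 * (real r)\<^sup>2 * \<epsilon>"
    and w: "w \<in> V"
  shows "(1 - 1 / real r - 24 * (256 * (real r)\<^sup>2 * \<epsilon>)) * real (card V) \<le> real (card (nbhd E V w))"
proof -
  let ?n = "real (card V)"
  define \<sigma> where "\<sigma> = 256 * (real r)\<^sup>2 * \<epsilon>"
  define e where "e = real r * \<epsilon>"
  have fin: "finite V" and sym: "symp E" and irr: "irreflp E" and copy_free: "copy_free s A E V"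
    using ext by (auto simp: extremal_def)
  have r0: "3 \<le> real r" using r3 by simp
  have \<sigma>: "0 < \<sigma>" "\<sigma> \<le> 1" using \<epsilon> r0 by (simp_all add: \<sigma>_def)
  have e: "0 \<le> e" "65 * e \<le> \<sigma>"
  proof -
    show "0 \<le> e" using \<epsilon> by (simp add: e_def)
    have "65 * e \<le> 256 * (real r * e)" using mult_right_mono[OF r0 \<open>0 \<le> e\<close>] \<open>0 \<le> e\<close> by linarith
    then show "65 * e \<le> \<sigma>" by (simp add: \<sigma>_def e_def power2_eq_square mult_ac)
  qed
  define N where "N = (\<Union>c\<in>{1..<r}. U c) - {w}"
  define E' where "E' = (\<lambda>u v. if u = w then v \<in> N else if v = w then u \<in> N else E u v)"
  have copy_free': "copy_free s A E' V"
    unfolding E'_def N_def by (rule clone_free[OF fin sym copy_free core \<epsilon>(1) _ big(1)]) (use \<epsilon> in auto)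
  have sym': "symp E'" using sym by (auto simp: E'_def symp_def)
  have irr': "irreflp E'" using irr by (auto simp: E'_def irreflp_def N_def)
  have q': "qidx E' V \<le> qidx E V" using ext fin sym' irr' copy_free' unfolding extremal_def by blast
  have "V \<noteq> {}" using w by blast
  have "qform E' V x \<le> qidx E' V * nrm2 V x" by (rule rayleigh_le[OF fin \<open>V \<noteq> {}\<close> sym'])
  also have "\<dots> \<le> qidx E V * nrm2 V x" using q' nrm2_nonneg by (rule mult_right_mono)
  also have "\<dots> = qform E V x" using perron_qform[OF x] by simp
  finally have le: "qform E' V x \<le> qform E V x" .
  have "nbhd E' (V - {w}) u = nbhd E (V - {w}) u" if "u \<in> V - {w}" for u
    using that by (auto simp: nbhd_def E'_def)
  then have same: "qform E' (V - {w}) x = qform E (V - {w}) x" by (simp add: qform_def qop_def)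
  have "U c \<subseteq> V" if "c \<in> {1..<r}" for c using coreD(1)[OF core] that by simp
  then have NV: "N \<subseteq> V" unfolding N_def by blast
  have "nbhd E' V w = N" using NV by (auto simp: nbhd_def E'_def)
  then have main: "(\<Sum>v\<in>N. (x w + x v)\<^sup>2) \<le> (\<Sum>v\<in>nbhd E V w. (x w + x v)\<^sup>2)"
    using le same qform_remove[OF fin sym irr w, of x] qform_remove[OF fin sym' irr' w, of x] by simp
  let ?y = "x w" and ?d = "real (card (nbhd E V w))"
  have y: "0 \<le> ?y" "?y \<le> 4" using x4[OF w] x w by (auto simp: perron_def)
  have x0: "0 \<le> x v" if "v \<in> V" for v using x that by (simp add: perron_def)
  have cN: "(1 - 1 / real r - e) * ?n - 1 \<le> real (card N)"
  proof -
    have "real (card {1..<r}) * ((1 / real r - \<epsilon>) * ?n) \<le> real (card (\<Union>c\<in>{1..<r}. U c))"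
      by (rule core_card_UN[OF fin core]) auto
    moreover have "card (\<Union>c\<in>{1..<r}. U c) \<le> card N + 1"
      unfolding N_def by (metis One_nat_def add.commute card.empty card.insert card_Diff1_le diff_card_le_card_Diff
          empty_iff finite.emptyI finite_insert le_diff_conv plus_1_eq_Suc)
    moreover have "real (card {1..<r}) * ((1 / real r - \<epsilon>) * ?n) = (1 - 1 / real r - (real r - 1) * \<epsilon>) * ?n"
      using r0 by (simp add: of_nat_diff field_simps)
    moreover have "(1 - 1 / real r - e) * ?n \<le> (1 - 1 / real r - (real r - 1) * \<epsilon>) * ?n"
      using \<epsilon> by (intro mult_right_mono) (auto simp: e_def algebra_simps)
    ultimately show ?thesis by linarith
  qed
  have N_low: "real (card N) * ((?y + 1)\<^sup>2 - 10 * \<sigma>) \<le> (\<Sum>v\<in>N. (x w + x v)\<^sup>2)"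
  proof -
    have "(?y + 1)\<^sup>2 - 10 * \<sigma> \<le> (x w + x v)\<^sup>2" if "v \<in> N" for v
    proof -
      have "\<bar>x v - 1\<bar> \<le> \<sigma>" using that x1 unfolding N_def \<sigma>_def by auto
      then have "(?y + 1 - \<sigma>)\<^sup>2 \<le> (x w + x v)\<^sup>2" using y \<sigma> by (intro power_mono) auto
      moreover have "(?y + 1)\<^sup>2 - 2 * (?y + 1) * \<sigma> + \<sigma>\<^sup>2 = (?y + 1 - \<sigma>)\<^sup>2" by (simp add: power2_eq_square algebra_simps)
      moreover have "2 * (?y + 1) * \<sigma> \<le> 10 * \<sigma>" using y \<sigma> by (intro mult_right_mono) auto
      moreover have "0 \<le> \<sigma>\<^sup>2" by simp
      ultimately show ?thesis by linarith
    qed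
    then show ?thesis using sum_mono[of N "\<lambda>_. (?y + 1)\<^sup>2 - 10 * \<sigma>" "\<lambda>v. (x w + x v)\<^sup>2"] by simp
  qed
  have nbhd_up: "(\<Sum>v\<in>nbhd E V w. (x w + x v)\<^sup>2) \<le> ?d * ((?y + 1)\<^sup>2 + 11 * \<sigma>) + 64 * (e * ?n)"
  proof -
    let ?UU = "\<Union>c<r. U c"
    have part_of: "(x w + x v)\<^sup>2 \<le> ((?y + 1)\<^sup>2 + 11 * \<sigma>) + (if v \<in> ?UU then 0 else 64)" if "v \<in> nbhd E V w" for v
    proof (cases "v \<in> ?UU")
      case True
      then have "\<bar>x v - 1\<bar> \<le> \<sigma>" using x1 unfolding \<sigma>_def by auto
      moreover have "v \<in> V" using that by (simp add: nbhd_def)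
      ultimately have "(x w + x v)\<^sup>2 \<le> (?y + 1 + \<sigma>)\<^sup>2" using y x0 by (intro power_mono) auto
      moreover have "(?y + 1)\<^sup>2 + 2 * (?y + 1) * \<sigma> + \<sigma> * \<sigma> = (?y + 1 + \<sigma>)\<^sup>2" by (simp add: power2_eq_square algebra_simps)
      moreover have "2 * (?y + 1) * \<sigma> \<le> 10 * \<sigma>" using y \<sigma> by (intro mult_right_mono) auto
      moreover have "\<sigma> * \<sigma> \<le> 1 * \<sigma>" using \<sigma> by (intro mult_right_mono) auto
      ultimately show ?thesis using True by simp
    next
      case False
      have "v \<in> V" using that by (simp add: nbhd_def)
      then have "(x w + x v)\<^sup>2 \<le> 8\<^sup>2" using x4[OF w] x4[of v] x0[OF w] x0[of v] by (intro power_mono) auto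
      then show ?thesis using False \<sigma> by (simp add: add_increasing)
    qed
    have "(\<Sum>v\<in>nbhd E V w. (x w + x v)\<^sup>2) \<le> (\<Sum>v\<in>nbhd E V w. ((?y + 1)\<^sup>2 + 11 * \<sigma>) + (if v \<in> ?UU then 0 else 64))"
      by (rule sum_mono[OF part_of])
    also have "\<dots> = ?d * ((?y + 1)\<^sup>2 + 11 * \<sigma>) + (\<Sum>v\<in>nbhd E V w. if v \<in> ?UU then 0 else 64)"
      by (simp add: sum.distrib)
    also have "(\<Sum>v\<in>nbhd E V w. if v \<in> ?UU then 0 else 64) \<le> (\<Sum>v\<in>V. if v \<in> ?UU then 0 else 64::real)"
      by (intro sum_mono2 fin nbhd_subset) auto
    also have "\<dots> = 64 * real (card (V - ?UU))"
    proof -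
      have "(\<Sum>v\<in>V. if v \<in> ?UU then 0 else 64::real) = (\<Sum>v\<in>V - ?UU. 64)"
        using fin by (intro sum.mono_neutral_cong_right) auto
      then show ?thesis by simp
    qed
    also have "\<dots> \<le> 64 * (e * ?n)" using core_sizes(1)[OF fin core] \<epsilon> r3 by (simp add: e_def)
    finally show ?thesis by simp
  qed
  have dn: "?d \<le> ?n" using card_mono[OF fin nbhd_subset] by simp
  have cNn: "real (card N) \<le> ?n" using card_mono[OF fin NV] by simp
  let ?Y = "(?y + 1)\<^sup>2"
  have Y1: "1 \<le> ?Y" using y by (simp add: power2_eq_square algebra_simps)
  have "real (card N) * ?Y - 10 * (\<sigma> * ?n) \<le> real (card N) * (?Y - 10 * \<sigma>)"
    using mult_left_mono[OF cNn, of "10 * \<sigma>"] \<sigma> by (simp add: algebra_simps)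
  also have "\<dots> \<le> ?d * (?Y + 11 * \<sigma>) + 64 * (e * ?n)" using N_low main nbhd_up by linarith
  also have "\<dots> \<le> ?d * ?Y + 11 * (\<sigma> * ?n) + 64 * (e * ?n)"
    using mult_left_mono[OF dn, of "11 * \<sigma>"] \<sigma> by (simp add: algebra_simps)
  finally have "real (card N) * ?Y \<le> ?d * ?Y + (21 * \<sigma> + 64 * e) * ?n" by (simp add: algebra_simps)
  also have "\<dots> \<le> ?d * ?Y + ((21 * \<sigma> + 64 * e) * ?n) * ?Y"
    using mult_left_mono[OF Y1, of "(21 * \<sigma> + 64 * e) * ?n"] \<sigma> e by simp
  finally have "?Y * real (card N) \<le> ?Y * (?d + (21 * \<sigma> + 64 * e) * ?n)" by (simp add: algebra_simps)
  then have "real (card N) \<le> ?d + (21 * \<sigma> + 64 * e) * ?n"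
    by (rule mult_left_le_imp_le) (use Y1 in linarith)
  then have "(1 - 1 / real r - e) * ?n - 1 - (21 * \<sigma> + 64 * e) * ?n \<le> ?d" using cN by linarith
  moreover have "1 \<le> \<sigma> * ?n" using big(2) by (simp add: \<sigma>_def)
  moreover have "65 * e * ?n \<le> \<sigma> * ?n" using e by (intro mult_right_mono) auto
  ultimately show ?thesis unfolding \<sigma>_def[symmetric] using \<sigma> by (simp add: algebra_simps)
qed

end

section \<open>Vertices with many neighbours in every part\<close>

lemma large_fibre_mult:
  assumes "finite Y" "Y \<noteq> {}" "finite P" "f ` Y \<subseteq> P"
  shows "\<exists>p\<in>f ` Y. card Y \<le> card P * card {y \<in> Y. f y = p}"
proof (rule ccontr)
  assume "\<not> ?thesis"
  then have lt: "card P * card {y \<in> Y. f y = p} < card Y" if "p \<in> f ` Y" for p using that by (auto simp: not_le)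
  have "card P * card Y = (\<Sum>p\<in>f ` Y. card P * card {y \<in> Y. f y = p})"
    using sum.image_gen[OF assms(1), of "\<lambda>_. 1::nat" f] by (simp add: sum_distrib_left)
  also have "\<dots> < (\<Sum>p\<in>f ` Y. card Y)" using assms lt by (intro sum_strict_mono) auto
  also have "\<dots> \<le> card P * card Y" using card_mono[OF assms(3,4)] by simp
  finally show False by simp
qed

text \<open>
  A trivial case of Hall's theorem: choose greedily.
\<close>

lemma distinct_representatives:
  assumes "\<And>l. l < k \<Longrightarrow> finite (P l)" "\<And>l. l < k \<Longrightarrow> k \<le> card (P l)"
  shows "\<exists>b. inj_on b {..<k} \<and> (\<forall>l<k. b l \<in> P l)"
proof -
  have "j \<le> k \<Longrightarrow> \<exists>b. inj_on b {..<j} \<and> (\<forall>l<j. b l \<in> P l)" for j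
  proof (induction j)
    case 0
    then show ?case by simp
  next
    case (Suc j)
    then obtain b where b: "inj_on b {..<j}" "\<forall>l<j. b l \<in> P l" by auto
    have "card (b ` {..<j}) \<le> j" using card_image_le[of "{..<j}" b] by simp
    then have "card (b ` {..<j}) < card (P j)" using assms(2)[of j] Suc.prems by simp
    then have "\<not> P j \<subseteq> b ` {..<j}" by (meson card_mono finite_imageI finite_lessThan not_less)
    then obtain y where y: "y \<in> P j" "y \<notin> b ` {..<j}" by blast
    have "inj_on (b(j := y)) {..<Suc j}" using b(1) y(2) by (auto simp: inj_on_def less_Suc_eq)
    moreover have "\<forall>l<Suc j. (b(j := y)) l \<in> P l" using b(2) y(1) by (auto simp: less_Suc_eq)
    ultimately show ?case by blast
  qed
  then show ?thesis by simp
qed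

lemma top_subset:
  fixes x :: "'a \<Rightarrow> real"
  assumes "finite B" "k \<le> card B" "\<And>w. w \<in> B \<Longrightarrow> 0 \<le> x w \<and> x w \<le> M" "0 \<le> M"
  shows "\<exists>S\<subseteq>B. card S = k \<and> (\<exists>\<zeta>. 0 \<le> \<zeta> \<and> \<zeta> \<le> M \<and> (\<forall>w\<in>S. \<zeta> \<le> x w) \<and> (\<forall>w\<in>B - S. x w \<le> \<zeta>))"
  using assms(2)
proof (induction k)
  case 0
  then show ?case using assms by (intro exI[of _ "{}"] conjI exI[of _ M]) auto
next
  case (Suc k)
  then obtain S \<zeta> where S: "S \<subseteq> B" "card S = k" "\<forall>w\<in>S. \<zeta> \<le> x w" "\<forall>w\<in>B - S. x w \<le> \<zeta>" by auto
  have "card S < card B" using Suc.prems S(2) by simp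
  then have "B - S \<noteq> {}" using S(1) by (metis Diff_eq_empty_iff less_irrefl subset_antisym)
  then have "Max (x ` (B - S)) \<in> x ` (B - S)" using assms(1) by (intro Max_in) auto
  then obtain w where w: "w \<in> B - S" "x w = Max (x ` (B - S))" by (elim imageE) simp
  have wmax: "x v \<le> x w" if "v \<in> B - S" for v
    unfolding w(2) using that assms(1) by (intro Max_ge) auto
  have "card (insert w S) = Suc k" using w(1) S(1,2) assms(1) by (simp add: finite_subset card_insert_disjoint)
  moreover have "x w \<le> x v" if "v \<in> S" for v
    using S(3,4) that w(1) by (meson order_trans)
  moreover have "0 \<le> x w" "x w \<le> M" using assms(3) w(1) by auto
  ultimately show ?case using S(1) w(1) wmax
    by (intro exI[of _ "insert w S"] conjI exI[of _ "x w"]) auto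
qed

text \<open>
  Choose the sets \<open>T c\<close> one after the other. A chosen vertex misses at most \<open>\<epsilon> n\<close> vertices of each later
  part, and at most \<open>r m\<close> vertices have been chosen before.
\<close>

lemma core_selection:
  assumes fin: "finite V" and sym: "symp E" and core: "core E V r \<epsilon> U" and \<epsilon>: "0 \<le> \<epsilon>"
    and X: "\<And>c. c < r \<Longrightarrow> X c \<subseteq> U c"
      "\<And>c. c < r \<Longrightarrow> real m + real r * real m * (\<epsilon> * real (card V)) \<le> real (card (X c))"
  shows "\<exists>T. (\<forall>c<r. T c \<subseteq> X c \<and> card (T c) = m) \<and> complete_parts E T r"
proof -
  let ?n = "real (card V)"
  have finX: "finite (X c)" if "c < r" for c
    by (rule finite_subset[OF subset_trans[OF X(1)[OF that] coreD(1)[OF core that]] fin])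
  have "j \<le> r \<Longrightarrow> \<exists>T. (\<forall>c<j. T c \<subseteq> X c \<and> card (T c) = m) \<and> complete_parts E T j" for j
  proof (induction j)
    case 0
    then show ?case by (simp add: complete_parts_def)
  next
    case (Suc j)
    then obtain T where T: "\<And>c. c < j \<Longrightarrow> T c \<subseteq> X c \<and> card (T c) = m" "complete_parts E T j" by auto
    have j: "j < r" using Suc.prems by simp
    let ?TT = "\<Union>c<j. T c"
    let ?Bad = "\<Union>u\<in>?TT. X j - nbhd E V u"
    have finT: "finite (T c)" if "c < j" for c using T(1)[OF that] finX[of c] that j by (meson finite_subset less_trans)
    have "card ?TT \<le> (\<Sum>c<j. card (T c))" by (intro card_UN_le) auto
    also have "\<dots> \<le> (\<Sum>c<j. m)" using T(1) by (intro sum_mono) auto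
    also have "\<dots> \<le> r * m" using j by simp
    finally have cTT: "card ?TT \<le> r * m" .
    have "real (card (X j - nbhd E V u)) \<le> \<epsilon> * ?n" if u: "u \<in> ?TT" for u
    proof -
      obtain c where c: "c < j" "u \<in> T c" using u by blast
      have "u \<in> U c" using c T(1) X(1) j by (meson less_trans subsetD)
      then have "real (card (U j - nbhd E V u)) \<le> \<epsilon> * ?n"
        using coreD(5)[OF core _ j, of c u] c(1) j by simp
      moreover have "card (X j - nbhd E V u) \<le> card (U j - nbhd E V u)"
        using X(1)[OF j] coreD(1)[OF core j] fin by (intro card_mono) (auto intro: finite_subset)
      ultimately show ?thesis by linarith
    qed
    then have "(\<Sum>u\<in>?TT. real (card (X j - nbhd E V u))) \<le> (\<Sum>u\<in>?TT. \<epsilon> * ?n)" by (intro sum_mono)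
    also have "\<dots> = real (card ?TT) * (\<epsilon> * ?n)" by simp
    also have "\<dots> \<le> real (r * m) * (\<epsilon> * ?n)" using cTT \<epsilon> by (intro mult_right_mono) (simp_all only: of_nat_le_iff, simp)
    finally have s: "(\<Sum>u\<in>?TT. real (card (X j - nbhd E V u))) \<le> real r * real m * (\<epsilon> * ?n)" by simp
    have "card ?Bad \<le> (\<Sum>u\<in>?TT. card (X j - nbhd E V u))" using finT by (intro card_UN_le) auto
    then have "real (card ?Bad) \<le> real (\<Sum>u\<in>?TT. card (X j - nbhd E V u))" by (simp only: of_nat_le_iff)
    then have bad: "real (card ?Bad) \<le> real r * real m * (\<epsilon> * ?n)" using s by simp
    have "?Bad \<subseteq> X j" by blast
    then have "card (X j - ?Bad) = card (X j) - card ?Bad" "card ?Bad \<le> card (X j)"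
      using finX[OF j] by (auto simp: card_Diff_subset finite_subset intro: card_mono)
    then have "real m \<le> real (card (X j - ?Bad))" using bad X(2)[OF j] by (simp add: of_nat_diff)
    then obtain S where S: "S \<subseteq> X j - ?Bad" "card S = m" by (meson obtain_subset_with_card_n of_nat_le_iff)
    have TS: "E u v" if "c < j" "u \<in> T c" "v \<in> S" for c u v
    proof -
      have "v \<in> nbhd E V u" using S(1) that by blast
      then show ?thesis by (simp add: nbhd_def)
    qed
    have TT: "E u v" if "c < j" "d < j" "c \<noteq> d" "u \<in> T c" "v \<in> T d" for c d u v
      using T(2) that unfolding complete_parts_def by blast
    have "complete_parts E (T(j := S)) (Suc j)"
      unfolding complete_parts_def using TS TT sympD[OF sym] by (auto simp: less_Suc_eq)
    moreover have "\<forall>c<Suc j. (T(j := S)) c \<subseteq> X c \<and> card ((T(j := S)) c) = m"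
      using T(1) S by (auto simp: less_Suc_eq)
    ultimately show ?case by blast
  qed
  then show ?thesis by simp
qed

text \<open>
  An extremal graph with a core, with its Perron vector \<open>x\<close> scaled so as to be close to \<open>1\<close> on the
  core, and with constants chosen in the order \<open>\<delta>\<close>, \<open>C\<close>, \<open>\<kappa>\<close>, \<open>\<epsilon>\<close>, and then \<open>card V\<close>. Here \<open>\<delta>\<close> is the proportion of neighbours in a
  part that counts as many, \<open>C\<close> bounds the number of hubs, \<open>\<kappa>\<close> is the proportion from which on a type of
  adjacency to the hubs counts as abundant, \<open>\<epsilon>\<close> is the error of the core and \<open>\<sigma>\<close> the resulting error of \<open>x\<close>.
\<close>

locale core_setting = forbidden +
  fixes E :: "nat \<Rightarrow> nat \<Rightarrow> bool" and V :: "nat set" and U :: "nat \<Rightarrow> nat set" and x :: "nat \<Rightarrow> real"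
    and \<epsilon> \<sigma> \<delta> \<kappa> :: real and C :: nat
  assumes ext: "extremal s A E V" and core: "core E V r \<epsilon> U"
    and perr: "perron E V (qidx E V) x"
    and x4: "\<And>w. w \<in> V \<Longrightarrow> x w \<le> 4"
    and x1: "\<And>i u. i < r \<Longrightarrow> u \<in> U i \<Longrightarrow> \<bar>x u - 1\<bar> \<le> \<sigma>"
    and deg: "\<And>w. w \<in> V \<Longrightarrow> (1 - 1 / real r - 24 * \<sigma>) * real (card V) \<le> real (card (nbhd E V w))"
    and \<epsilon>pos: "0 < \<epsilon>" and \<sigma>_def: "\<sigma> = 256 * (real r)\<^sup>2 * \<epsilon>"
    and \<delta>: "0 < \<delta>" "8192 * (real r)\<^sup>2 * (real t)\<^sup>2 * \<delta> \<le> 1"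
    and C: "real t \<le> (\<delta> / 2) ^ r * real C"
    and \<kappa>: "0 < \<kappa>" "2 ^ (C + 1) * \<kappa> \<le> \<delta>" "8 * (real r)\<^sup>2 * real C * 2 ^ C * \<kappa> \<le> 1"
    and \<epsilon>\<kappa>: "2 * (real r * real m + real t) * \<epsilon> \<le> \<kappa>"
    and \<sigma>small: "32 * 650 * real r * real t * (real t + real C) * \<sigma> \<le> 1"
    and n\<kappa>: "2 * real m \<le> \<kappa> * real (card V)"
    and nC: "32 * 25 * real r * (real t)\<^sup>2 * (real t + real C) \<le> real (card V)"
    and n\<delta>: "real t + 2 \<le> \<delta> * real (card V)"
begin

abbreviation "nn \<equiv> real (card V)"
abbreviation "UU \<equiv> \<Union>c<r. U c"

lemma fin: "finite V" and sym: "symp E" and irr: "irreflp E" and free: "copy_free s A E V"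
  using ext by (auto simp: extremal_def)

lemma r0: "3 \<le> real r" and t0: "1 \<le> real t" using r3 t1 by simp_all

lemma C1: "1 \<le> real C"
proof -
  have "0 < (\<delta> / 2) ^ r * real C" using C t0 by linarith
  then have "C \<noteq> 0" by (metis less_irrefl mult_zero_right of_nat_0)
  then show ?thesis by simp
qed

lemma n_pos: "0 < nn"
proof -
  have "0 < \<delta> * nn" using n\<delta> by linarith
  then show ?thesis using \<delta>(1) by (simp add: zero_less_mult_iff)
qed

definition "e = real r * \<epsilon>"

lemma e_bounds: "0 < e" "\<epsilon> \<le> e" "768 * e \<le> \<sigma>" "256 * (real r * e) \<le> \<sigma>" "0 < \<sigma>"
proof -
  show e0: "0 < e" using r0 \<epsilon>pos by (simp add: e_def)
  show "\<epsilon> \<le> e" using r0 \<epsilon>pos by (simp add: e_def)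
  show 1: "256 * (real r * e) \<le> \<sigma>" by (simp add: \<sigma>_def e_def power2_eq_square)
  have "3 * e \<le> real r * e" using r0 e0 by (intro mult_right_mono) auto
  then show "768 * e \<le> \<sigma>" using 1 by linarith
  show "0 < \<sigma>" using r0 \<epsilon>pos by (simp add: \<sigma>_def)
qed

lemma rt: "3 \<le> real r * real t"
  using mult_mono[OF r0 t0] by simp

lemma \<sigma>_bounds: "650 * (real t + real C) * \<sigma> \<le> 1 / (32 * real r * real t)" "1000 * \<sigma> \<le> 1 / (real r * real t)"
proof -
  have p: "0 < 32 * real r * real t" using rt by linarith
  have "(32 * real r * real t) * (650 * (real t + real C) * \<sigma>) \<le> 1" using \<sigma>small by (simp add: mult_ac)
  then show 1: "650 * (real t + real C) * \<sigma> \<le> 1 / (32 * real r * real t)"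
    using p by (simp add: pos_le_divide_eq mult.commute)
  have "1300 * \<sigma> \<le> 650 * (real t + real C) * \<sigma>" using t0 C1 e_bounds(5) by (intro mult_right_mono) auto
  then have "32 * (1300 * \<sigma>) \<le> 1 / (real r * real t)" using 1 by simp
  then show "1000 * \<sigma> \<le> 1 / (real r * real t)" using e_bounds(5) by linarith
qed

lemma inv_rt: "1 / (real r * real t) \<le> 1 / real r" "1 / (real r * real t) \<le> 1 / 3" "0 < 1 / (real r * real t)"
proof -
  show "1 / (real r * real t) \<le> 1 / real r" using r0 t0 by (simp add: field_simps)
  show "1 / (real r * real t) \<le> 1 / 3" using rt by (intro divide_left_mono) auto
  show "0 < 1 / (real r * real t)" using r3 t1 by simp
qed

lemma \<delta>_bound: "8192 * real r * real t * \<delta> \<le> 1 / (real r * real t)" "1000 * \<delta> \<le> 1 / (real r * real t)"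
proof -
  have p: "0 < real r * real t" using rt by linarith
  have "(8192 * real r * real t * \<delta>) * (real r * real t) \<le> 1" using \<delta>(2) by (simp add: power2_eq_square mult_ac)
  then show 1: "8192 * real r * real t * \<delta> \<le> 1 / (real r * real t)" using p by (simp add: pos_le_divide_eq)
  have "8192 * \<delta> * 3 \<le> 8192 * \<delta> * (real r * real t)" using rt \<delta>(1) by (intro mult_left_mono) auto
  then have "8192 * \<delta> * 3 \<le> 1 / (real r * real t)" using 1 by (simp add: mult_ac)
  then show "1000 * \<delta> \<le> 1 / (real r * real t)" using \<delta>(1) by linarith
qed

lemma scale: "a \<le> b \<Longrightarrow> a * nn \<le> b * nn" for a b :: real
  using n_pos by (simp add: mult_right_mono)

lemma need_le: "real m + real r * real m * (\<epsilon> * nn) \<le> (\<kappa> - real t * \<epsilon>) * nn"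
proof -
  have "real r * real m * \<epsilon> + real t * \<epsilon> \<le> \<kappa> / 2" using \<epsilon>\<kappa> by (simp add: algebra_simps)
  from scale[OF this] show ?thesis using n\<kappa> by (simp add: algebra_simps)
qed

lemma \<kappa>_small: "\<kappa> \<le> 1 / (100 * real r)" "real t * \<epsilon> \<le> \<kappa>"
proof -
  have "2 * \<kappa> \<le> 2 ^ (C + 1) * \<kappa>" using \<kappa>(1) by (intro mult_right_mono) auto
  then have "2 * \<kappa> \<le> \<delta>" using \<kappa>(2) by linarith
  then have "1000 * \<kappa> \<le> 1 / real r" using \<delta>_bound(2) inv_rt \<kappa>(1) by linarith
  then have "100 * \<kappa> \<le> 1 / real r" using \<kappa>(1) by linarith
  then show "\<kappa> \<le> 1 / (100 * real r)" by simp
  have "0 \<le> real r * real m * \<epsilon>" "0 \<le> real t * \<epsilon>" using \<epsilon>pos by simp_all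
  then show "real t * \<epsilon> \<le> \<kappa>" using \<epsilon>\<kappa> by (simp add: algebra_simps)
qed

lemma finU: "c < r \<Longrightarrow> finite (U c)"
  by (rule finite_subset[OF coreD(1)[OF core] fin])

lemma finUU: "finite UU" using finU by blast

lemma UUV: "UU \<subseteq> V" using coreD(1)[OF core] by blast

lemma U_lower: "c < r \<Longrightarrow> (1 / real r - \<epsilon>) * nn \<le> real (card (U c))"
  by (rule coreD(4)[OF core])

lemmas sizes = core_sizes[OF fin core _ less_imp_le[OF \<epsilon>pos], folded e_def]

lemma rest_small: "real (card (V - UU)) \<le> e * nn" using sizes(1) r3 by simp

lemma U_upper: "c < r \<Longrightarrow> real (card (U c)) \<le> (1 / real r + e) * nn" using sizes(2) r3 by simp

text \<open>
  The common neighbourhoods are large enough for \<open>core_selection\<close>, which yields a \<open>matching_blowup\<close>.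
\<close>

lemma no_matching:
  assumes i: "i < r" and ab: "disjoint_edges E V t a b"
    and common: "\<And>d. d < r \<Longrightarrow> d \<noteq> i \<Longrightarrow>
      (\<kappa> - real t * \<epsilon>) * nn \<le> real (card (U d \<inter> (\<Inter>l<t. nbhd E V (a l) \<inter> nbhd E V (b l))))"
  shows False
proof -
  define X where "X d = (if d = i then U d else U d \<inter> (\<Inter>l<t. nbhd E V (a l) \<inter> nbhd E V (b l)))" for d
  have "real m + real r * real m * (\<epsilon> * nn) \<le> real (card (X d))" if d: "d < r" for d
  proof (cases "d = i")
    case True
    have "\<kappa> - real t * \<epsilon> \<le> 1 / real r - \<epsilon>"
    proof -
      have "\<epsilon> \<le> real t * \<epsilon>" using t0 \<epsilon>pos by simp
      moreover have "100 * \<kappa> \<le> 1 / real r" using \<kappa>_small(1) r0 by (simp add: field_simps)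
      ultimately show ?thesis using \<kappa>_small(2) \<kappa>(1) \<epsilon>pos by linarith
    qed
    from scale[OF this] show ?thesis using need_le U_lower[OF d] True by (simp add: X_def)
  next
    case False
    then show ?thesis using need_le common[OF d] by (simp add: X_def)
  qed
  then have "\<exists>T. (\<forall>c<r. T c \<subseteq> X c \<and> card (T c) = m) \<and> complete_parts E T r"
    by (intro core_selection[OF fin sym core less_imp_le[OF \<epsilon>pos]]) (auto simp: X_def)
  then obtain T where T: "\<And>c. c < r \<Longrightarrow> T c \<subseteq> X c \<and> card (T c) = m" "complete_parts E T r" by blast
  have TV: "T c \<subseteq> V" if "c < r" for c
    using T(1)[OF that] coreD(1)[OF core that] by (auto simp: X_def split: if_splits)
  have adj: "E (a l) v \<and> E (b l) v" if "l < t" "c < r" "c \<noteq> i" "v \<in> T c" for l c v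
    using T(1)[of c] that by (auto simp: X_def nbhd_def)
  have "matching_blowup E V r t m"
    by (rule matching_blowupI[of i r T]) (use i TV T ab adj in auto)
  then show False using blowup[OF fin sym irr] free by blast
qed

text \<open>
  The vertices with many neighbours in every part, called hubs below. In the graphs
  \<open>K\<^bsub>t-1\<^esub>\<close> joined to an \<open>r\<close>-partite graph they are the vertices of \<open>K\<^bsub>t-1\<^esub>\<close>.
\<close>

definition "hub_set = {w \<in> V. \<forall>c<r. \<delta> * nn \<le> real (card (U c \<inter> nbhd E V w))}"

lemma hub_set_V: "hub_set \<subseteq> V" and finBB: "finite hub_set" using fin by (auto simp: hub_set_def)

lemma hub_set_U: "hub_set \<inter> UU = {}"
proof (rule ccontr)
  assume "hub_set \<inter> UU \<noteq> {}"
  then obtain w c where w: "w \<in> hub_set" "c < r" "w \<in> U c" by blast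
  then have "U c \<inter> nbhd E V w = {}" using coreD(3)[OF core w(2,3)] by (auto simp: nbhd_def)
  then have "\<delta> * nn \<le> 0" using w(1,2) unfolding hub_set_def by force
  then show False using n\<delta> t0 by linarith
qed

text \<open>
  Each of the \<open>t\<close> hubs has many neighbours in \<open>U i\<close>, so there are disjoint edges from the hubs to \<open>U i\<close>.
  The ends in \<open>U i\<close> miss little of the other parts, and \<open>no_matching\<close> applies.
\<close>

lemma no_common_core:
  assumes S: "S \<subseteq> hub_set" "card S = t" and i: "i < r"
    and common: "\<And>d. d < r \<Longrightarrow> d \<noteq> i \<Longrightarrow> \<kappa> * nn \<le> real (card (U d \<inter> (\<Inter>w\<in>S. nbhd E V w)))"
  shows False
proof -
  have finS: "finite S" by (rule finite_subset[OF S(1) finBB])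
  obtain a where a: "bij_betw a {0..<t} S" using ex_bij_betw_nat_finite[OF finS] S(2) by auto
  have aS: "a l \<in> S" if "l < t" for l using a that by (auto simp: bij_betw_def)
  have aim: "a ` {..<t} = S" and ainj: "inj_on a {..<t}"
    using a by (auto simp: bij_betw_def atLeast0LessThan)
  have "\<exists>b. inj_on b {..<t} \<and> (\<forall>l<t. b l \<in> U i \<inter> nbhd E V (a l))"
  proof (rule distinct_representatives)
    fix l assume l: "l < t"
    show "finite (U i \<inter> nbhd E V (a l))" using finU[OF i] by blast
    have "a l \<in> hub_set" using aS[OF l] S(1) by blast
    then have "\<delta> * nn \<le> real (card (U i \<inter> nbhd E V (a l)))" using i by (simp add: hub_set_def)
    then show "t \<le> card (U i \<inter> nbhd E V (a l))" using n\<delta> by linarith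
  qed
  then obtain b where b: "inj_on b {..<t}" "\<And>l. l < t \<Longrightarrow> b l \<in> U i \<inter> nbhd E V (a l)" by blast
  have de: "disjoint_edges E V t a b"
    unfolding disjoint_edges_def
  proof (intro conjI allI impI)
    show "a l \<in> V" if "l < t" for l using aS[OF that] S(1) hub_set_V by blast
    show "b l \<in> V" if "l < t" for l using b(2)[OF that] coreD(1)[OF core i] by blast
    show "E (a l) (b l)" if "l < t" for l using b(2)[OF that] by (simp add: nbhd_def)
    have "b ` {..<t} \<subseteq> UU" using b(2) i by blast
    then show "a ` {..<t} \<inter> b ` {..<t} = {}" using aim S(1) hub_set_U by blast
  qed (use ainj b in auto)
  show False
  proof (rule no_matching[OF i de])
    fix d assume d: "d < r" "d \<noteq> i"
    let ?W = "U d \<inter> (\<Inter>w\<in>S. nbhd E V w)"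
    have miss: "real (card (?W - nbhd E V (b l))) \<le> \<epsilon> * nn" if "l < t" for l
    proof -
      have "card (?W - nbhd E V (b l)) \<le> card (U d - nbhd E V (b l))" using finU[OF d(1)] by (intro card_mono) auto
      then show ?thesis using coreD(5)[OF core i d(1) d(2)[symmetric], of "b l"] b(2)[OF that] by auto
    qed
    have "real (card ?W) - real t * (\<epsilon> * nn) \<le> real (card (?W \<inter> (\<Inter>l<t. nbhd E V (b l))))"
      by (rule card_Int_nbhd_inter) (use finU[OF d(1)] miss in auto)
    moreover have "?W \<inter> (\<Inter>l<t. nbhd E V (b l)) = U d \<inter> (\<Inter>l<t. nbhd E V (a l) \<inter> nbhd E V (b l))"
      using aim by auto
    ultimately show "(\<kappa> - real t * \<epsilon>) * nn \<le> real (card (U d \<inter> (\<Inter>l<t. nbhd E V (a l) \<inter> nbhd E V (b l))))"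
      using common[OF d] by (simp add: algebra_simps)
  qed
qed

text \<open>
  By double counting, many vertices of \<open>U c\<close> are adjacent to a proportion of at least \<open>\<delta> / 2\<close> of the
  hubs in \<open>S\<close>; there are at most \<open>2\<^sup>C\<close> possible traces on \<open>S\<close>, so one of them occurs often.
\<close>

lemma popular_subset:
  assumes S: "S \<subseteq> hub_set" "S \<noteq> {}" "card S \<le> C" and c: "c < r"
  shows "\<exists>S'\<subseteq>S. \<delta> / 2 * real (card S) \<le> real (card S') \<and> \<kappa> * nn \<le> real (card (U c \<inter> (\<Inter>w\<in>S'. nbhd E V w)))"
proof -
  have finS: "finite S" by (rule finite_subset[OF S(1) finBB])
  have cS: "0 < real (card S)" using S(2) finS by (simp add: card_gt_0_iff)
  have SV: "S \<subseteq> V" using S(1) hub_set_V by blast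
  define G where "G = {v \<in> U c. \<delta> / 2 * real (card S) \<le> real (card (S \<inter> nbhd E V v))}"
  have finG: "finite G" using finU[OF c] by (simp add: G_def)
  have cU: "real (card (U c)) \<le> nn" using card_mono[OF fin coreD(1)[OF core c]] by simp
  have "real (card S) * (\<delta> * nn) = (\<Sum>w\<in>S. \<delta> * nn)" by simp
  also have "\<dots> \<le> (\<Sum>w\<in>S. real (card (U c \<inter> nbhd E V w)))"
    using S(1) c by (intro sum_mono) (auto simp: hub_set_def)
  also have "\<dots> = (\<Sum>w\<in>S. \<Sum>v\<in>U c. if E w v then 1 else 0)"
  proof (intro sum.cong refl)
    fix w assume "w \<in> S"
    have "U c \<inter> nbhd E V w = {v \<in> U c. E w v}" using coreD(1)[OF core c] by (auto simp: nbhd_def)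
    then show "real (card (U c \<inter> nbhd E V w)) = (\<Sum>v\<in>U c. if E w v then 1 else 0)"
      using finU[OF c] by (simp add: sum.If_cases Int_def)
  qed
  also have "\<dots> = (\<Sum>v\<in>U c. \<Sum>w\<in>S. if E w v then 1 else 0)" by (rule sum.swap)
  also have "\<dots> = (\<Sum>v\<in>U c. real (card (S \<inter> nbhd E V v)))"
  proof (intro sum.cong refl)
    fix v assume "v \<in> U c"
    have "S \<inter> nbhd E V v = {w \<in> S. E w v}" using SV sympD[OF sym] by (auto simp: nbhd_def)
    then show "(\<Sum>w\<in>S. if E w v then 1 else 0) = real (card (S \<inter> nbhd E V v))"
      using finS by (simp add: sum.If_cases Int_def)
  qed
  also have "\<dots> \<le> (\<Sum>v\<in>U c. (if v \<in> G then real (card S) else 0) + \<delta> / 2 * real (card S))"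
  proof (rule sum_mono)
    fix v assume v: "v \<in> U c"
    have "real (card (S \<inter> nbhd E V v)) \<le> real (card S)" using card_mono[OF finS, of "S \<inter> nbhd E V v"] by simp
    then show "real (card (S \<inter> nbhd E V v)) \<le> (if v \<in> G then real (card S) else 0) + \<delta> / 2 * real (card S)"
      using v \<delta>(1) by (auto simp: G_def add_increasing2)
  qed
  also have "\<dots> = (\<Sum>v\<in>U c. if v \<in> G then real (card S) else 0) + real (card (U c)) * (\<delta> / 2 * real (card S))"
    by (simp add: sum.distrib)
  also have "(\<Sum>v\<in>U c. if v \<in> G then real (card S) else 0) = real (card G) * real (card S)"
  proof -
    have "(\<Sum>v\<in>U c. if v \<in> G then real (card S) else 0) = (\<Sum>v\<in>G. real (card S))"
      using finU[OF c] by (intro sum.mono_neutral_cong_right) (auto simp: G_def)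
    then show ?thesis by simp
  qed
  also have "real (card (U c)) * (\<delta> / 2 * real (card S)) \<le> nn * (\<delta> / 2 * real (card S))"
    using cU \<delta>(1) by (intro mult_right_mono) auto
  finally have "real (card S) * (\<delta> / 2 * nn) \<le> real (card S) * real (card G)" by (simp add: algebra_simps)
  then have Gbig: "\<delta> / 2 * nn \<le> real (card G)" by (rule mult_left_le_imp_le[OF _ cS])
  have "0 < \<delta> / 2 * nn" using \<delta>(1) n_pos by simp
  then have Gne: "G \<noteq> {}" using Gbig by auto
  obtain p where p: "p \<in> (\<lambda>v. S \<inter> nbhd E V v) ` G"
    "card G \<le> card (Pow S) * card {v \<in> G. S \<inter> nbhd E V v = p}"
    using large_fibre_mult[OF finG Gne, of "Pow S" "\<lambda>v. S \<inter> nbhd E V v"] finS by blast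
  let ?F = "{v \<in> G. S \<inter> nbhd E V v = p}"
  have pS: "p \<subseteq> S" "\<delta> / 2 * real (card S) \<le> real (card p)" using p(1) by (auto simp: G_def)
  have "?F \<subseteq> U c \<inter> (\<Inter>w\<in>p. nbhd E V w)"
    using sympD[OF sym] coreD(1)[OF core c] by (auto simp: G_def nbhd_def)
  then have F: "card ?F \<le> card (U c \<inter> (\<Inter>w\<in>p. nbhd E V w))" using finU[OF c] by (intro card_mono) auto
  have "card (Pow S) \<le> 2 ^ C" using finS S(3) by (simp add: card_Pow power_increasing)
  then have "card G \<le> 2 ^ C * card ?F" using p(2) by (meson mult_le_mono1 order_trans)
  then have "real (card G) \<le> real (2 ^ C * card ?F)" by (simp only: of_nat_le_iff)
  then have "\<delta> / 2 * nn \<le> 2 ^ C * real (card ?F)" using Gbig by simp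
  moreover have "2 ^ C * \<kappa> * nn \<le> \<delta> / 2 * nn" using \<kappa>(2) by (intro scale) simp
  ultimately have "2 ^ C * \<kappa> * nn \<le> 2 ^ C * real (card ?F)" by linarith
  then have "2 ^ C * (\<kappa> * nn) \<le> 2 ^ C * real (card ?F)" by (simp only: mult.assoc)
  then have "\<kappa> * nn \<le> real (card ?F)" by (rule mult_left_le_imp_le) simp
  then show ?thesis using F pS by (intro exI[of _ p]) linarith
qed

text \<open>
  Starting from \<open>C\<close> hubs and passing to a popular subset once for each part leaves at least
  \<open>(\<delta> / 2)\<^sup>r C \<ge> t\<close> hubs with many common neighbours in all parts,
  contrary to \<open>no_common_core\<close>.
\<close>

lemma card_hub_set: "card hub_set < C"
proof (rule ccontr)
  assume "\<not> ?thesis"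
  then obtain S where S: "S \<subseteq> hub_set" "card S = C" by (meson not_less obtain_subset_with_card_n)
  have "j \<le> r \<Longrightarrow> \<exists>S'\<subseteq>S. (\<delta> / 2) ^ j * real C \<le> real (card S') \<and>
     (\<forall>c<j. \<kappa> * nn \<le> real (card (U c \<inter> (\<Inter>w\<in>S'. nbhd E V w))))" for j
  proof (induction j)
    case 0
    then show ?case using S by auto
  next
    case (Suc j)
    then obtain S' where S': "S' \<subseteq> S" "(\<delta> / 2) ^ j * real C \<le> real (card S')"
     "\<And>c. c < j \<Longrightarrow> \<kappa> * nn \<le> real (card (U c \<inter> (\<Inter>w\<in>S'. nbhd E V w)))" by auto
    have "0 < (\<delta> / 2) ^ j * real C" using \<delta>(1) C1 by simp
    then have ne: "S' \<noteq> {}" using S'(2) by auto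
    have "finite S" by (rule finite_subset[OF S(1) finBB])
    then have "card S' \<le> C" using card_mono[of S S'] S'(1) S(2) by simp
    then obtain S'' where S'': "S'' \<subseteq> S'" "\<delta> / 2 * real (card S') \<le> real (card S'')"
      "\<kappa> * nn \<le> real (card (U j \<inter> (\<Inter>w\<in>S''. nbhd E V w)))"
      using popular_subset[of S' j] S'(1) S(1) ne Suc.prems by auto
    have "\<delta> / 2 * ((\<delta> / 2) ^ j * real C) \<le> \<delta> / 2 * real (card S')" using S'(2) \<delta>(1) by (intro mult_left_mono) auto
    then have 1: "(\<delta> / 2) ^ Suc j * real C \<le> real (card S'')" using S''(2) by simp
    have 2: "\<kappa> * nn \<le> real (card (U c \<inter> (\<Inter>w\<in>S''. nbhd E V w)))" if "c < Suc j" for c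
    proof (cases "c = j")
      case True
      then show ?thesis using S''(3) by simp
    next
      case False
      then have c: "c < j" using that by simp
      have "card (U c \<inter> (\<Inter>w\<in>S'. nbhd E V w)) \<le> card (U c \<inter> (\<Inter>w\<in>S''. nbhd E V w))"
        using finU[of c] c Suc.prems S''(1) by (intro card_mono) auto
      then show ?thesis using S'(3)[OF c] by linarith
    qed
    show ?case using 1 2 S''(1) S'(1) by (intro exI[of _ S'']) auto
  qed
  then obtain S' where S': "S' \<subseteq> S" "(\<delta> / 2) ^ r * real C \<le> real (card S')"
     "\<And>c. c < r \<Longrightarrow> \<kappa> * nn \<le> real (card (U c \<inter> (\<Inter>w\<in>S'. nbhd E V w)))" by blast
  have "t \<le> card S'" using C S'(2) by linarith
  then obtain R where R: "R \<subseteq> S'" "card R = t" by (meson obtain_subset_with_card_n)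
  show False
  proof (rule no_common_core[of R 0])
    fix d assume d: "d < r" "d \<noteq> 0"
    have "card (U d \<inter> (\<Inter>w\<in>S'. nbhd E V w)) \<le> card (U d \<inter> (\<Inter>w\<in>R. nbhd E V w))"
      using finU[OF d(1)] R(1) by (intro card_mono) auto
    then show "\<kappa> * nn \<le> real (card (U d \<inter> (\<Inter>w\<in>R. nbhd E V w)))" using S'(3)[OF d(1)] by linarith
  qed (use R S' S r3 in auto)
qed

text \<open>
  Among the traces \<open>P\<close> on the hubs that occur at \<open>\<kappa> n\<close> or more vertices of \<open>U c\<close>, take one that misses as few hubs
  as possible. All but \<open>2\<^sup>C \<kappa> n\<close> vertices of \<open>U c\<close> have an abundant trace and so miss at least
  \<open>card (hub_set - P)\<close> hubs; the right-hand side counts the missing edges.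
\<close>

lemma abundant_trace:
  assumes c: "c < r"
  shows "\<exists>P\<subseteq>hub_set. \<kappa> * nn \<le> real (card {v \<in> U c. hub_set \<inter> nbhd E V v = P}) \<and>
     real (card (hub_set - P)) * (real (card (U c)) - 2 ^ C * \<kappa> * nn) \<le> (\<Sum>w\<in>hub_set. real (card (U c - nbhd E V w)))"
proof -
  define ty where "ty P = {v \<in> U c. hub_set \<inter> nbhd E V v = P}" for P
  define Ab where "Ab = {P \<in> Pow hub_set. \<kappa> * nn \<le> real (card (ty P))}"
  have finty: "finite (ty P)" for P using finU[OF c] by (simp add: ty_def)
  have pow: "real (card (Pow hub_set)) \<le> 2 ^ C"
  proof -
    have "card (Pow hub_set) \<le> 2 ^ C" using finBB card_hub_set by (simp add: card_Pow power_increasing)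
    then have "real (card (Pow hub_set)) \<le> real (2 ^ C)" by (simp only: of_nat_le_iff)
    then show ?thesis by simp
  qed
  let ?rare = "\<Union>P\<in>Pow hub_set - Ab. ty P"
  have rare: "real (card ?rare) \<le> 2 ^ C * \<kappa> * nn"
  proof -
    have "card ?rare \<le> (\<Sum>P\<in>Pow hub_set - Ab. card (ty P))" using finBB by (intro card_UN_le) auto
    then have "real (card ?rare) \<le> real (\<Sum>P\<in>Pow hub_set - Ab. card (ty P))" by (simp only: of_nat_le_iff)
    also have "\<dots> = (\<Sum>P\<in>Pow hub_set - Ab. real (card (ty P)))" by simp
    also have "\<dots> \<le> (\<Sum>P\<in>Pow hub_set - Ab. \<kappa> * nn)" by (intro sum_mono) (auto simp: Ab_def)
    also have "\<dots> = real (card (Pow hub_set - Ab)) * (\<kappa> * nn)" by simp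
    also have "\<dots> \<le> real (card (Pow hub_set)) * (\<kappa> * nn)"
      using finBB \<kappa>(1) n_pos card_mono[of "Pow hub_set" "Pow hub_set - Ab"] by (intro mult_right_mono) auto
    also have "\<dots> \<le> 2 ^ C * (\<kappa> * nn)" using pow \<kappa>(1) n_pos by (intro mult_right_mono) auto
    finally show ?thesis by (simp add: mult.assoc)
  qed
  have rareU: "?rare \<subseteq> U c" by (auto simp: ty_def)
  have rest: "real (card (U c)) - 2 ^ C * \<kappa> * nn \<le> real (card (U c - ?rare))"
  proof -
    have "card (U c - ?rare) = card (U c) - card ?rare" "card ?rare \<le> card (U c)"
      using finU[OF c] rareU by (auto simp: card_Diff_subset finite_subset intro: card_mono)
    then show ?thesis using rare by (simp add: of_nat_diff)
  qed
  have "2 ^ C * \<kappa> * nn < real (card (U c))"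
  proof -
    have "8 * (real r)\<^sup>2 * 1 * (2 ^ C * \<kappa>) \<le> 8 * (real r)\<^sup>2 * real C * (2 ^ C * \<kappa>)"
      using C1 \<kappa>(1) by (intro mult_right_mono mult_left_mono) auto
    then have "8 * (real r)\<^sup>2 * (2 ^ C * \<kappa>) \<le> 1" using \<kappa>(3) by (simp add: mult.assoc)
    moreover have "8 * (real r * 1) * (2 ^ C * \<kappa>) \<le> 8 * (real r * real r) * (2 ^ C * \<kappa>)"
      using r0 \<kappa>(1) by (intro mult_right_mono mult_left_mono) auto
    ultimately have "8 * real r * (2 ^ C * \<kappa>) \<le> 1" by (simp add: power2_eq_square)
    then have 1: "2 ^ C * \<kappa> \<le> 1 / (8 * real r)" using r0 by (simp add: field_simps)
    have "1000 * \<epsilon> \<le> 1 / real r" using e_bounds \<sigma>_bounds(2) inv_rt(1) by linarith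
    moreover have "1 / (8 * real r) = 1 / real r / 8" by simp
    ultimately have "1 / (8 * real r) < 1 / real r - \<epsilon>" using \<epsilon>pos by linarith
    with 1 have "2 ^ C * \<kappa> < 1 / real r - \<epsilon>" by linarith
    then have "2 ^ C * \<kappa> * nn < (1 / real r - \<epsilon>) * nn" using n_pos by (rule mult_strict_right_mono)
    then show ?thesis using U_lower[OF c] by linarith
  qed
  then have "0 < real (card (U c - ?rare))" using rest by linarith
  then have "U c - ?rare \<noteq> {}" by (metis card.empty less_irrefl of_nat_0)
  then obtain v where v: "v \<in> U c" "v \<notin> ?rare" by blast
  then have "hub_set \<inter> nbhd E V v \<in> Ab" by (auto simp: ty_def Ab_def)
  then obtain P where P: "P \<in> Ab" "\<And>P'. P' \<in> Ab \<Longrightarrow> card (hub_set - P) \<le> card (hub_set - P')"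
    using ex_has_least_nat[of "\<lambda>P. P \<in> Ab" _ "\<lambda>P. card (hub_set - P)"] by blast
  have "real (card (hub_set - P)) * (real (card (U c)) - 2 ^ C * \<kappa> * nn) \<le> real (card (hub_set - P)) * real (card (U c - ?rare))"
    using rest by (intro mult_left_mono) auto
  also have "\<dots> = (\<Sum>v\<in>U c - ?rare. real (card (hub_set - P)))" by simp
  also have "\<dots> \<le> (\<Sum>v\<in>U c - ?rare. real (card (hub_set - nbhd E V v)))"
  proof (rule sum_mono)
    fix v assume v: "v \<in> U c - ?rare"
    then have "hub_set \<inter> nbhd E V v \<in> Ab" by (auto simp: ty_def Ab_def)
    then have "card (hub_set - P) \<le> card (hub_set - (hub_set \<inter> nbhd E V v))" by (rule P(2))
    then show "real (card (hub_set - P)) \<le> real (card (hub_set - nbhd E V v))" by (simp add: Diff_Int_distrib Diff_Int)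
  qed
  also have "\<dots> \<le> (\<Sum>v\<in>U c. real (card (hub_set - nbhd E V v)))" using finU[OF c] by (intro sum_mono2) auto
  also have "\<dots> = (\<Sum>v\<in>U c. \<Sum>w\<in>hub_set. if E w v then 0 else 1)"
  proof (intro sum.cong refl)
    fix v assume "v \<in> U c"
    have "hub_set - nbhd E V v = {w \<in> hub_set. \<not> E w v}" using hub_set_V sympD[OF sym] by (auto simp: nbhd_def)
    then have "real (card (hub_set - nbhd E V v)) = (\<Sum>w\<in>{w \<in> hub_set. \<not> E w v}. 1)" by simp
    also have "\<dots> = (\<Sum>w\<in>hub_set. if E w v then 0 else 1)"
      using finBB by (intro sum.mono_neutral_cong_left) auto
    finally show "real (card (hub_set - nbhd E V v)) = (\<Sum>w\<in>hub_set. if E w v then 0 else 1)" .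
  qed
  also have "\<dots> = (\<Sum>w\<in>hub_set. \<Sum>v\<in>U c. if E w v then 0 else 1)" by (rule sum.swap)
  also have "\<dots> = (\<Sum>w\<in>hub_set. real (card (U c - nbhd E V w)))"
  proof (intro sum.cong refl)
    fix w assume "w \<in> hub_set"
    have "U c - nbhd E V w = {v \<in> U c. \<not> E w v}" using coreD(1)[OF core c] by (auto simp: nbhd_def)
    then have "real (card (U c - nbhd E V w)) = (\<Sum>v\<in>{v \<in> U c. \<not> E w v}. 1)" by simp
    also have "\<dots> = (\<Sum>v\<in>U c. if E w v then 0 else 1)"
      using finU[OF c] by (intro sum.mono_neutral_cong_left) auto
    finally show "(\<Sum>v\<in>U c. if E w v then 0 else 1) = real (card (U c - nbhd E V w))" by simp
  qed
  finally show ?thesis using P(1) by (intro exI[of _ P]) (auto simp: Ab_def ty_def)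
qed

end

section \<open>Assigning the vertices to parts\<close>

context core_setting
begin

definition "ir = 1 / real r"

lemma ir: "real r * ir = 1" "0 < ir" using r0 by (simp_all add: ir_def)

text \<open>
  A vertex outside the core that is not a hub belongs to a part in which it has few neighbours. Hubs are
  put into the part \<open>0\<close>, an arbitrary choice that matters only in the comparison with a join in which
  they are ordinary vertices.
\<close>

definition "part_of w = (SOME c. c < r \<and> (if w \<in> UU then w \<in> U c else if w \<in> hub_set then c = 0
   else real (card (U c \<inter> nbhd E V w)) < \<delta> * nn))"

lemma part_of_props:
  assumes "w \<in> V"
  shows "part_of w < r \<and> (if w \<in> UU then w \<in> U (part_of w) else if w \<in> hub_set then part_of w = 0
   else real (card (U (part_of w) \<inter> nbhd E V w)) < \<delta> * nn)"
  unfolding part_of_def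
proof (rule someI_ex)
  show "\<exists>c<r. if w \<in> UU then w \<in> U c else if w \<in> hub_set then c = 0
   else real (card (U c \<inter> nbhd E V w)) < \<delta> * nn"
  proof (cases "w \<in> UU")
    case False
    show ?thesis
    proof (cases "w \<in> hub_set")
      case True
      then show ?thesis using False r3 by (intro exI[of _ 0]) auto
    next
      case nB: False
      then obtain c where "c < r" "real (card (U c \<inter> nbhd E V w)) < \<delta> * nn"
        using assms by (auto simp: hub_set_def not_le)
      then show ?thesis using False nB by auto
    qed
  qed auto
qed

lemma part_of_less: "w \<in> V \<Longrightarrow> part_of w < r"
  using part_of_props by blast

lemma part_of_U: assumes "c < r" "w \<in> U c" shows "part_of w = c"
proof (rule ccontr)
  assume "part_of w \<noteq> c"
  have wV: "w \<in> V" using coreD(1)[OF core assms(1)] assms(2) by blast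
  have "w \<in> UU" using assms by blast
  then have "w \<in> U (part_of w)" using part_of_props[OF wV] by simp
  then show False using coreD(2)[OF core assms(1) part_of_less[OF wV]] \<open>part_of w \<noteq> c\<close> assms(2) by blast
qed

lemma part_of_hub_set: assumes "w \<in> hub_set" shows "part_of w = 0"
proof -
  have "w \<notin> UU" using assms hub_set_U by blast
  then show ?thesis using part_of_props[of w] assms hub_set_V by auto
qed

lemma part_of_few: assumes w: "w \<in> V - hub_set" shows "real (card (U (part_of w) \<inter> nbhd E V w)) \<le> \<delta> * nn"
proof (cases "w \<in> UU")
  case True
  then have "w \<in> U (part_of w)" using part_of_props[of w] w by simp
  then have "U (part_of w) \<inter> nbhd E V w = {}" using coreD(3)[OF core part_of_less] w by (auto simp: nbhd_def)
  then show ?thesis using \<delta>(1) by simp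
next
  case False
  then show ?thesis using part_of_props[of w] w by simp
qed

text \<open>
  A vertex with few neighbours in its own part reaches the minimum degree only if it is adjacent to
  almost everything else.
\<close>

lemma part_of_missing:
  assumes w: "w \<in> V - hub_set" and d: "d < r" "d \<noteq> part_of w"
  shows "real (card (U d - nbhd E V w)) \<le> (25 * \<sigma> + \<delta>) * nn"
proof -
  have c: "part_of w < r" using part_of_less w by blast
  let ?R = "\<Union>i\<in>{..<r} - {part_of w} - {d}. U i"
  have "nbhd E V w \<subseteq> (V - UU) \<union> (U (part_of w) \<inter> nbhd E V w) \<union> ((U d \<inter> nbhd E V w) \<union> ?R)"
    using nbhd_subset[of E V w] by blast
  then have "card (nbhd E V w) \<le> card ((V - UU) \<union> (U (part_of w) \<inter> nbhd E V w) \<union> ((U d \<inter> nbhd E V w) \<union> ?R))"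
    using fin finU c d by (intro card_mono) auto
  also have "\<dots> \<le> card ((V - UU) \<union> (U (part_of w) \<inter> nbhd E V w)) + card ((U d \<inter> nbhd E V w) \<union> ?R)" by (rule card_Un_le)
  also have "\<dots> \<le> (card (V - UU) + card (U (part_of w) \<inter> nbhd E V w)) + (card (U d \<inter> nbhd E V w) + card ?R)"
    by (intro add_mono card_Un_le)
  also have "card ?R \<le> (\<Sum>i\<in>{..<r} - {part_of w} - {d}. card (U i))" by (intro card_UN_le) auto
  finally have "real (card (nbhd E V w)) \<le> real ((card (V - UU) + card (U (part_of w) \<inter> nbhd E V w)) +
      (card (U d \<inter> nbhd E V w) + (\<Sum>i\<in>{..<r} - {part_of w} - {d}. card (U i))))"
    by (simp only: of_nat_le_iff)
  also have "\<dots> = (real (card (V - UU)) + real (card (U (part_of w) \<inter> nbhd E V w))) +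
      (real (card (U d \<inter> nbhd E V w)) + (\<Sum>i\<in>{..<r} - {part_of w} - {d}. real (card (U i))))" by simp
  also have "(\<Sum>i\<in>{..<r} - {part_of w} - {d}. real (card (U i))) \<le> (\<Sum>i\<in>{..<r} - {part_of w} - {d}. (1 / real r + e) * nn)"
    using U_upper by (intro sum_mono) auto
  also have "\<dots> = (real r - 2) * ((1 / real r + e) * nn)"
    using c d r3 by (simp add: of_nat_diff)
  finally have 1: "real (card (nbhd E V w)) \<le> (real (card (V - UU)) + real (card (U (part_of w) \<inter> nbhd E V w))) +
      (real (card (U d \<inter> nbhd E V w)) + (real r - 2) * ((1 / real r + e) * nn))" by simp
  have "card (U d \<inter> nbhd E V w) + card (U d - nbhd E V w) = card (U d)"
    using finU[OF d(1)] by (metis card_Int_Diff)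
  then have 2: "real (card (U d \<inter> nbhd E V w)) + real (card (U d - nbhd E V w)) \<le> (1 / real r + e) * nn"
    using U_upper[OF d(1)] by linarith
  have 3: "(1 - 1 / real r - 24 * \<sigma>) * nn \<le> real (card (nbhd E V w))" using deg w by blast
  have "real (card (U d - nbhd E V w)) \<le> e * nn + \<delta> * nn + (real r - 2) * ((1 / real r + e) * nn) + (1 / real r + e) * nn
      - (1 - 1 / real r - 24 * \<sigma>) * nn"
    using 1 2 3 rest_small part_of_few[OF w] by linarith
  also have "\<dots> = (e + \<delta> + (real r - 2) * (1 / real r + e) + (1 / real r + e) - (1 - 1 / real r - 24 * \<sigma>)) * nn"
    by (simp only: distrib_right left_diff_distrib mult.assoc)
  also have "\<dots> \<le> (25 * \<sigma> + \<delta>) * nn"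
  proof (rule scale)
    have "(real r - 2) * (ir + e) = real r * ir - 2 * ir + (real r * e - 2 * e)"
      by (simp add: algebra_simps)
    then show "e + \<delta> + (real r - 2) * (1 / real r + e) + (1 / real r + e) - (1 - 1 / real r - 24 * \<sigma>) \<le> 25 * \<sigma> + \<delta>"
      unfolding ir_def[symmetric] using e_bounds ir by linarith
  qed
  finally show ?thesis .
qed

lemma t_small: "real t * \<sigma> \<le> ir / 1000" "real t * \<delta> \<le> ir / 1000" "real t * \<epsilon> \<le> ir / 100"
  "\<epsilon> \<le> ir / 1000" "\<kappa> \<le> ir / 100"
proof -
  have t: "real t * (1 / (real r * real t)) = ir" using t0 by (simp add: ir_def)
  have "real t * (1000 * \<sigma>) \<le> real t * (1 / (real r * real t))" using \<sigma>_bounds(2) by (intro mult_left_mono) auto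
  then show "real t * \<sigma> \<le> ir / 1000" unfolding t by simp
  have "real t * (1000 * \<delta>) \<le> real t * (1 / (real r * real t))" using \<delta>_bound(2) by (intro mult_left_mono) auto
  then show "real t * \<delta> \<le> ir / 1000" unfolding t by simp
  show "\<kappa> \<le> ir / 100" using \<kappa>_small(1) by (simp add: ir_def)
  then show "real t * \<epsilon> \<le> ir / 100" using \<kappa>_small(2) by linarith
  show "\<epsilon> \<le> ir / 1000" using e_bounds \<sigma>_bounds(2) inv_rt(1)[folded ir_def] by linarith
qed

text \<open>
  The form of \<open>no_matching\<close> that is convenient for edges whose ends miss little of the other parts.
\<close>

lemma no_matching_missing:
  assumes i: "i < r" and ab: "disjoint_edges E V t a b"
    and miss: "\<And>l d. \<lbrakk>l < t; d < r; d \<noteq> i\<rbrakk> \<Longrightarrow>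
       real (card (U d - nbhd E V (a l) \<inter> nbhd E V (b l))) \<le> \<mu> * nn"
    and \<mu>: "real t * \<mu> \<le> ir / 2"
  shows False
proof (rule no_matching[OF i ab])
  fix d assume d: "d < r" "d \<noteq> i"
  have "real (card (U d)) - real t * (\<mu> * nn) \<le> real (card (U d \<inter> (\<Inter>l<t. nbhd E V (a l) \<inter> nbhd E V (b l))))"
    by (rule card_Int_nbhd_inter[OF finU[OF d(1)] miss]) (use d in auto)
  moreover have "real t * (\<mu> * nn) \<le> (ir / 2) * nn" using scale[OF \<mu>] by (simp add: mult.assoc)
  moreover have "(\<kappa> - real t * \<epsilon>) * nn \<le> (1 / real r - \<epsilon>) * nn - (ir / 2) * nn"
  proof -
    have "0 \<le> real t * \<epsilon>" using \<epsilon>pos by simp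
    then have "\<kappa> - real t * \<epsilon> \<le> (ir - \<epsilon>) - ir / 2" using t_small ir(2) by linarith
    from scale[OF this] show ?thesis unfolding ir_def[symmetric] by (simp only: left_diff_distrib)
  qed
  ultimately show "(\<kappa> - real t * \<epsilon>) * nn \<le> real (card (U d \<inter> (\<Inter>l<t. nbhd E V (a l) \<inter> nbhd E V (b l))))"
    using U_lower[OF d(1)] by linarith
qed

definition "part_cell c = {w \<in> V - hub_set. part_of w = c}"

lemma card_Diff_Int_le:
  assumes "finite (S::nat set)" shows "real (card (S - P \<inter> Q)) \<le> real (card (S - P)) + real (card (S - Q))"
proof -
  have "S - P \<inter> Q = (S - P) \<union> (S - Q)" by blast
  then have "card (S - P \<inter> Q) \<le> card (S - P) + card (S - Q)" by (metis card_Un_le)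
  then show ?thesis by linarith
qed

text \<open>
  A matching with \<open>t\<close> edges inside a part is impossible by \<open>no_matching_missing\<close> and
  \<open>part_of_missing\<close>, so \<open>matching_cover\<close> applies.
\<close>

lemma part_cell_cover:
  assumes c: "c < r"
  shows "\<exists>K\<subseteq>part_cell c. card K \<le> 2 * t \<and> (\<forall>u\<in>part_cell c - K. \<forall>v\<in>part_cell c - K. \<not> E u v)"
proof (rule matching_cover[OF _ irr sym])
  show "finite (part_cell c)" using fin by (simp add: part_cell_def)
  show "\<not> (\<exists>a b. disjoint_edges E (part_cell c) t a b)"
  proof
    assume "\<exists>a b. disjoint_edges E (part_cell c) t a b"
    then obtain a b where ab: "disjoint_edges E (part_cell c) t a b" by blast
    have abZ: "a l \<in> part_cell c" "b l \<in> part_cell c" if "l < t" for l using ab that by (auto simp: disjoint_edges_def)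
    have "disjoint_edges E V t a b" using ab by (auto simp: disjoint_edges_def part_cell_def)
    then show False
    proof (rule no_matching_missing[OF c])
      fix l d assume l: "l < t" and d: "d < r" "d \<noteq> c"
      have "real (card (U d - nbhd E V (a l))) \<le> (25 * \<sigma> + \<delta>) * nn" "real (card (U d - nbhd E V (b l))) \<le> (25 * \<sigma> + \<delta>) * nn"
        using part_of_missing[of "a l" d] part_of_missing[of "b l" d] abZ[OF l] d by (auto simp: part_cell_def)
      then show "real (card (U d - nbhd E V (a l) \<inter> nbhd E V (b l))) \<le> (2 * (25 * \<sigma> + \<delta>)) * nn"
        using card_Diff_Int_le[OF finU[OF d(1)], of "nbhd E V (a l)" "nbhd E V (b l)"] by linarith
    next
      have "real t * (2 * (25 * \<sigma> + \<delta>)) = 50 * (real t * \<sigma>) + 2 * (real t * \<delta>)" by (simp add: algebra_simps)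
      then show "real t * (2 * (25 * \<sigma> + \<delta>)) \<le> ir / 2" using t_small ir(2) by linarith
    qed
  qed
qed

text \<open>
  All edges inside a part have an end in a set of \<open>2 t\<close> vertices, and each of these vertices has few
  neighbours in the part. So the edges inside the parts are negligible in the comparison.
\<close>

lemma inner_edges:
  "(\<Sum>u\<in>V - hub_set. real (card {v \<in> V - hub_set. E u v \<and> part_of u = part_of v})) \<le> 1 / (1920 * real r * real t) * nn"
proof -
  have inner: "real (card (part_cell c \<inter> nbhd E V u)) \<le> (\<delta> + e) * nn" if c: "c < r" and u: "u \<in> part_cell c" for c u
  proof -
    have "part_cell c \<inter> nbhd E V u \<subseteq> (U c \<inter> nbhd E V u) \<union> (V - UU)"
      using part_of_U by (auto simp: part_cell_def)
    then have "card (part_cell c \<inter> nbhd E V u) \<le> card ((U c \<inter> nbhd E V u) \<union> (V - UU))"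
      using finU[OF c] fin by (intro card_mono) auto
    also have "\<dots> \<le> card (U c \<inter> nbhd E V u) + card (V - UU)" by (rule card_Un_le)
    finally have "real (card (part_cell c \<inter> nbhd E V u)) \<le> real (card (U c \<inter> nbhd E V u)) + real (card (V - UU))" by linarith
    moreover have "real (card (U c \<inter> nbhd E V u)) \<le> \<delta> * nn" using part_of_few[of u] u by (auto simp: part_cell_def)
    ultimately show ?thesis using rest_small by (simp add: algebra_simps)
  qed
  have de: "0 \<le> (\<delta> + e) * nn" using \<delta>(1) e_bounds n_pos by simp
  have finZ: "finite (part_cell c)" for c using fin by (simp add: part_cell_def)
  have part: "(\<Sum>u\<in>part_cell c. real (card (part_cell c \<inter> nbhd E V u))) \<le> 4 * real t * ((\<delta> + e) * nn)" if c: "c < r" for c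
  proof -
    obtain K where K: "K \<subseteq> part_cell c" "card K \<le> 2 * t" "\<forall>u\<in>part_cell c - K. \<forall>v\<in>part_cell c - K. \<not> E u v"
      using part_cell_cover[OF c] by blast
    have finK: "finite K" by (rule finite_subset[OF K(1) finZ])
    have ZV: "part_cell c \<subseteq> V" by (auto simp: part_cell_def)
    have "(\<Sum>u\<in>part_cell c. real (card (part_cell c \<inter> nbhd E V u))) \<le>
      (\<Sum>u\<in>part_cell c. (if u \<in> K then real (card (part_cell c \<inter> nbhd E V u)) else 0) + real (card (K \<inter> nbhd E V u)))"
    proof (rule sum_mono)
      fix u assume u: "u \<in> part_cell c"
      show "real (card (part_cell c \<inter> nbhd E V u)) \<le> (if u \<in> K then real (card (part_cell c \<inter> nbhd E V u)) else 0) + real (card (K \<inter> nbhd E V u))"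
      proof (cases "u \<in> K")
        case False
        then have "part_cell c \<inter> nbhd E V u \<subseteq> K \<inter> nbhd E V u" using K(3) u by (auto simp: nbhd_def)
        then have "card (part_cell c \<inter> nbhd E V u) \<le> card (K \<inter> nbhd E V u)" using finK by (intro card_mono) auto
        then show ?thesis using False by simp
      qed simp
    qed
    also have "\<dots> = (\<Sum>u\<in>part_cell c. if u \<in> K then real (card (part_cell c \<inter> nbhd E V u)) else 0) + (\<Sum>u\<in>part_cell c. real (card (K \<inter> nbhd E V u)))"
      by (rule sum.distrib)
    also have "(\<Sum>u\<in>part_cell c. if u \<in> K then real (card (part_cell c \<inter> nbhd E V u)) else 0) = (\<Sum>u\<in>K. real (card (part_cell c \<inter> nbhd E V u)))"
      using K(1) finZ by (intro sum.mono_neutral_cong_right) auto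
    also have "(\<Sum>u\<in>part_cell c. real (card (K \<inter> nbhd E V u))) = (\<Sum>u\<in>K. real (card (part_cell c \<inter> nbhd E V u)))"
    proof -
      have "(\<Sum>u\<in>part_cell c. real (card (K \<inter> nbhd E V u))) = (\<Sum>u\<in>part_cell c. \<Sum>v\<in>K. if E u v then 1 else 0)"
      proof (intro sum.cong refl)
        fix u assume "u \<in> part_cell c"
        have "K \<inter> nbhd E V u = {v \<in> K. E u v}" using K(1) ZV by (auto simp: nbhd_def)
        then show "real (card (K \<inter> nbhd E V u)) = (\<Sum>v\<in>K. if E u v then 1 else 0)"
          using finK by (simp add: sum.If_cases Int_def)
      qed
      also have "\<dots> = (\<Sum>v\<in>K. \<Sum>u\<in>part_cell c. if E u v then 1 else 0)" by (rule sum.swap)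
      also have "\<dots> = (\<Sum>v\<in>K. real (card (part_cell c \<inter> nbhd E V v)))"
      proof (intro sum.cong refl)
        fix v assume "v \<in> K"
        have "part_cell c \<inter> nbhd E V v = {u \<in> part_cell c. E u v}" using ZV sympD[OF sym] by (auto simp: nbhd_def)
        then show "(\<Sum>u\<in>part_cell c. if E u v then 1 else 0) = real (card (part_cell c \<inter> nbhd E V v))"
          using finZ by (simp add: sum.If_cases Int_def)
      qed
      finally show ?thesis .
    qed
    also have "(\<Sum>u\<in>K. real (card (part_cell c \<inter> nbhd E V u))) \<le> (\<Sum>u\<in>K. (\<delta> + e) * nn)"
      using inner[OF c] K(1) by (intro sum_mono) auto
    also have "\<dots> = real (card K) * ((\<delta> + e) * nn)" by simp
    also have "\<dots> \<le> (2 * real t) * ((\<delta> + e) * nn)" using K(2) de by (intro mult_right_mono) auto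
    finally show ?thesis by (simp add: mult_ac)
  qed
  have "(\<Sum>u\<in>V - hub_set. real (card {v \<in> V - hub_set. E u v \<and> part_of u = part_of v})) =
     (\<Sum>u\<in>(\<Union>c<r. part_cell c). real (card {v \<in> V - hub_set. E u v \<and> part_of u = part_of v}))"
    using part_of_less by (intro sum.cong) (auto simp: part_cell_def)
  also have "\<dots> = (\<Sum>c<r. \<Sum>u\<in>part_cell c. real (card {v \<in> V - hub_set. E u v \<and> part_of u = part_of v}))"
    using finZ by (intro sum.UNION_disjoint) (auto simp: part_cell_def)
  also have "\<dots> = (\<Sum>c<r. \<Sum>u\<in>part_cell c. real (card (part_cell c \<inter> nbhd E V u)))"
  proof (intro sum.cong refl)
    fix c u assume "u \<in> part_cell c"
    then have "{v \<in> V - hub_set. E u v \<and> part_of u = part_of v} = part_cell c \<inter> nbhd E V u" by (auto simp: part_cell_def nbhd_def)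
    then show "real (card {v \<in> V - hub_set. E u v \<and> part_of u = part_of v}) = real (card (part_cell c \<inter> nbhd E V u))" by simp
  qed
  also have "\<dots> \<le> (\<Sum>c<r. 4 * real t * ((\<delta> + e) * nn))" using part by (intro sum_mono) auto
  also have "\<dots> = (4 * real r * real t * \<delta> + 4 * real t * (real r * e)) * nn" by (simp add: algebra_simps)
  also have "\<dots> \<le> 1 / (1920 * real r * real t) * nn"
  proof (rule scale)
    define q where "q = 1 / (real r * real t)"
    have q: "0 < q" using inv_rt by (simp add: q_def)
    have 1: "8192 * (real r * real t * \<delta>) \<le> q" using \<delta>_bound(1) by (simp add: q_def mult.assoc)
    have "real t * (256 * (real r * e)) \<le> real t * \<sigma>" using e_bounds(4) by (intro mult_left_mono) auto
    moreover have "650 * (real t * \<sigma>) \<le> 650 * (real t + real C) * \<sigma>" using e_bounds(5) by (simp add: algebra_simps)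
    moreover have "650 * (real t + real C) * \<sigma> \<le> q / 32" using \<sigma>_bounds(1) by (simp add: q_def)
    ultimately have "256 * (real t * (real r * e)) \<le> q / 32 / 650" by simp
    moreover have "1 / (1920 * real r * real t) = q / 1920" by (simp add: q_def)
    ultimately show "4 * real r * real t * \<delta> + 4 * real t * (real r * e) \<le> 1 / (1920 * real r * real t)"
      using 1 q by (simp add: mult.assoc)
  qed
  finally show ?thesis .
qed

end

section \<open>Comparison with the join of a complete graph and a multipartite graph\<close>

context core_setting
begin

lemma x0: "w \<in> V \<Longrightarrow> 0 \<le> x w"
  using perr by (simp add: perron_def)

text \<open>
  The join is free and has the same vertex set, so its index is at most that of the extremal graph; test
  it on the Perron vector of the latter.
\<close>

lemma compare:
  assumes S: "S \<subseteq> V" "card S = t - 1"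
  shows "qform (hub_join S part_of) V x \<le> qform E V x"
proof -
  have "copy_free s A (hub_join S part_of) V"
    using S t1 part_of_less by (intro hub_join_free[OF fin S(1)]) auto
  then have q: "qidx (hub_join S part_of) V \<le> qidx E V"
    using ext fin symp_hub_join irreflp_hub_join unfolding extremal_def by blast
  have "V \<noteq> {}" using n_pos by auto
  then have "qform (hub_join S part_of) V x \<le> qidx (hub_join S part_of) V * nrm2 V x" using fin symp_hub_join by (intro rayleigh_le) auto
  also have "\<dots> \<le> qidx E V * nrm2 V x" using q nrm2_nonneg by (rule mult_right_mono)
  also have "\<dots> = qform E V x" using perron_qform[OF perr] by simp
  finally show ?thesis .
qed

definition "edge_weight u v = (x u + x v)\<^sup>2"

lemma edge_weight: "0 \<le> edge_weight u v" "edge_weight u v = edge_weight v u"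
  by (simp_all add: edge_weight_def add.commute)

lemma edge_weight_64: "u \<in> V \<Longrightarrow> v \<in> V \<Longrightarrow> edge_weight u v \<le> 64"
proof -
  assume "u \<in> V" "v \<in> V"
  then have "(x u + x v)\<^sup>2 \<le> 8\<^sup>2" using x4[of u] x4[of v] x0[of u] x0[of v] by (intro power_mono) auto
  then show ?thesis by (simp add: edge_weight_def)
qed

lemma \<sigma>1: "\<sigma> \<le> 1 / 10"
  using \<sigma>_bounds(2) inv_rt(2) by linarith

text \<open>
  On the core the entries of \<open>x\<close> are \<open>1\<close> up to \<open>\<sigma>\<close>, so the weight of an edge to the core depends
  almost only on its other end.
\<close>

lemma edge_weight_core:
  assumes w: "w \<in> V" and v: "v \<in> UU"
  shows "(x w + 1)\<^sup>2 - 10 * \<sigma> \<le> edge_weight w v" "edge_weight w v \<le> (x w + 1)\<^sup>2 + 11 * \<sigma>"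
proof -
  have xv: "\<bar>x v - 1\<bar> \<le> \<sigma>" using v x1 by auto
  have y: "0 \<le> x w" "x w \<le> 4" using x0[OF w] x4[OF w] by auto
  have s: "0 < \<sigma>" "\<sigma> \<le> 1" using e_bounds(5) \<sigma>1 by auto
  have y10: "2 * (x w + 1) * \<sigma> \<le> 10 * \<sigma>" using y s by (intro mult_right_mono) auto
  have "(x w + 1 - \<sigma>)\<^sup>2 \<le> edge_weight w v" unfolding edge_weight_def using xv y s by (intro power_mono) auto
  moreover have "(x w + 1)\<^sup>2 - 2 * (x w + 1) * \<sigma> + \<sigma>\<^sup>2 = (x w + 1 - \<sigma>)\<^sup>2" by (simp add: power2_eq_square algebra_simps)
  moreover have "0 \<le> \<sigma>\<^sup>2" by simp
  ultimately show "(x w + 1)\<^sup>2 - 10 * \<sigma> \<le> edge_weight w v" using y10 by linarith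
  have "edge_weight w v \<le> (x w + 1 + \<sigma>)\<^sup>2" unfolding edge_weight_def using xv y s by (intro power_mono) auto
  moreover have "(x w + 1)\<^sup>2 + 2 * (x w + 1) * \<sigma> + \<sigma> * \<sigma> = (x w + 1 + \<sigma>)\<^sup>2" by (simp add: power2_eq_square algebra_simps)
  moreover have "\<sigma> * \<sigma> \<le> 1 * \<sigma>" using s by (intro mult_right_mono) auto
  ultimately show "edge_weight w v \<le> (x w + 1)\<^sup>2 + 11 * \<sigma>" using y10 by linarith
qed

lemma sq_bounds: "w \<in> V \<Longrightarrow> 1 \<le> (x w + 1)\<^sup>2" "w \<in> V \<Longrightarrow> (x w + 1)\<^sup>2 \<le> 25"
proof -
  assume w: "w \<in> V"
  have "1\<^sup>2 \<le> (x w + 1)\<^sup>2" using x0[OF w] by (intro power_mono) auto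
  then show "1 \<le> (x w + 1)\<^sup>2" by simp
  have "(x w + 1)\<^sup>2 \<le> 5\<^sup>2" using x0[OF w] x4[OF w] by (intro power_mono) auto
  then show "(x w + 1)\<^sup>2 \<le> 25" by simp
qed

definition "deficit w = real (card (UU - nbhd E V w))"

text \<open>
  A lower bound, split into rows indexed by \<open>u\<close>, for the change of the form when \<open>E\<close> is replaced by
  \<open>hub_join S part_of\<close>. A vertex of \<open>S\<close> gains its missing edges to the core. A hub outside
  \<open>S\<close> loses its edges to the part \<open>0\<close> and gains its missing edges to the other parts of the core. Any other vertex loses
  its edges inside its part. Gains are counted at one end of a pair only; losses may be counted at both ends, which
  keeps the bound valid.
\<close>

definition "gain S u v =
  (if u \<in> S then (if v \<in> UU - S \<and> \<not> E u v then edge_weight u v else 0)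
   else if u \<in> hub_set then (if v \<notin> S \<and> E u v \<and> part_of v = 0 then - edge_weight u v
      else if v \<in> UU - S \<and> part_of v \<noteq> 0 \<and> \<not> E u v then edge_weight u v else 0)
   else (if v \<notin> S \<and> v \<notin> hub_set \<and> E u v \<and> part_of u = part_of v then - edge_weight u v else 0))"

text \<open>
  Twice the sum of \<open>gain\<close> is at most the difference of the two forms, each counted over ordered pairs,
  by a comparison of the contributions of \<open>(u, v)\<close> and \<open>(v, u)\<close>; by \<open>compare\<close> this difference is not positive.
\<close>

lemma gain_sum:
  assumes S: "S \<subseteq> V" "card S = t - 1"
  shows "(\<Sum>u\<in>V. \<Sum>v\<in>V. gain S u v) \<le> 0"
proof -
  let ?E = "hub_join S part_of"
  have part_of: "gain S u v + gain S v u \<le> (if ?E u v then edge_weight u v else 0) - (if E u v then edge_weight u v else 0)"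
    if u: "u \<in> V" and v: "v \<in> V" for u v
  proof (cases "u = v")
    case True
    then show ?thesis using irr hub_set_U by (auto simp: gain_def hub_join_def irreflp_def)
  next
    case False
    have Esym: "E v u \<longleftrightarrow> E u v" using sympD[OF sym] by blast
    have BBu: "u \<in> hub_set \<Longrightarrow> u \<notin> UU \<and> part_of u = 0" and BBv: "v \<in> hub_set \<Longrightarrow> v \<notin> UU \<and> part_of v = 0"
      using hub_set_U part_of_hub_set by blast+
    show ?thesis using False edge_weight(1)[of u v] BBu BBv
      unfolding gain_def hub_join_def Esym edge_weight(2)[of v u] by (auto simp: eq_commute[of "part_of v" "part_of u"])
  qed
  have "2 * (\<Sum>u\<in>V. \<Sum>v\<in>V. gain S u v) = (\<Sum>u\<in>V. \<Sum>v\<in>V. gain S u v) + (\<Sum>u\<in>V. \<Sum>v\<in>V. gain S v u)"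
    by (subst (2) sum.swap) simp
  also have "\<dots> = (\<Sum>u\<in>V. \<Sum>v\<in>V. gain S u v + gain S v u)" by (simp add: sum.distrib)
  also have "\<dots> \<le> (\<Sum>u\<in>V. \<Sum>v\<in>V. (if ?E u v then edge_weight u v else 0) - (if E u v then edge_weight u v else 0))"
    by (intro sum_mono part_of)
  also have "\<dots> = 2 * qform ?E V x - 2 * qform E V x"
    unfolding qform_edges[OF fin symp_hub_join] qform_edges[OF fin sym] sum_nbhd[OF fin] edge_weight_def
    by (simp add: sum_subtractf)
  finally show ?thesis using compare[OF S] by linarith
qed

lemma row_S:
  assumes S: "S \<subseteq> V" "card S = t - 1" and u: "u \<in> S"
  shows "deficit u * (x u + 1)\<^sup>2 - 25 * real t - 22 * \<sigma> * nn \<le> (\<Sum>v\<in>V. gain S u v)"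
proof -
  have uV: "u \<in> V" using u S by blast
  have finS: "finite S" by (rule finite_subset[OF S(1) fin])
  let ?P = "UU - S - nbhd E V u"
  have eq: "(\<Sum>v\<in>V. gain S u v) = (\<Sum>v\<in>?P. edge_weight u v)"
    using fin UUV u by (intro sum.mono_neutral_cong_right) (auto simp: gain_def nbhd_def)
  have "(\<Sum>v\<in>?P. (x u + 1)\<^sup>2 - 10 * \<sigma>) \<le> (\<Sum>v\<in>?P. edge_weight u v)"
    using edge_weight_core(1)[OF uV] by (intro sum_mono) blast
  then have 1: "real (card ?P) * ((x u + 1)\<^sup>2 - 10 * \<sigma>) \<le> (\<Sum>v\<in>V. gain S u v)" using eq by simp
  have "UU - nbhd E V u \<subseteq> ?P \<union> S" by blast
  then have "card (UU - nbhd E V u) \<le> card (?P \<union> S)" using finUU finS by (intro card_mono) auto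
  also have "\<dots> \<le> card ?P + card S" by (rule card_Un_le)
  finally have 2: "deficit u - real t \<le> real (card ?P)" using S(2) by (simp add: deficit_def)
  have "card ?P \<le> card V" using UUV by (intro card_mono[OF fin]) blast
  then have 3: "real (card ?P) \<le> nn" by simp
  have "(deficit u - real t) * (x u + 1)\<^sup>2 \<le> real (card ?P) * (x u + 1)\<^sup>2" using 2 by (intro mult_right_mono) auto
  moreover have "real t * (x u + 1)\<^sup>2 \<le> real t * 25" using sq_bounds(2)[OF uV] by (intro mult_left_mono) auto
  moreover have "real (card ?P) * (10 * \<sigma>) \<le> nn * (10 * \<sigma>)" using 3 e_bounds(5) by (intro mult_right_mono) auto
  moreover have "0 \<le> nn * (12 * \<sigma>)" using e_bounds(5) by simp
  ultimately show ?thesis using 1 by (simp add: algebra_simps)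
qed

text \<open>
  If the hub has \<open>d\<close> neighbours in \<open>U 0\<close>, it loses about \<open>d\<close> edges and gains its missing
  edges outside \<open>U 0\<close>, which are \<open>deficit u - (card (U 0) - d)\<close>. The number \<open>d\<close> cancels.
\<close>

lemma row_B:
  assumes S: "S \<subseteq> V" "card S = t - 1" and u: "u \<in> hub_set - S"
  shows "(deficit u - real (card (U 0))) * (x u + 1)\<^sup>2 - 25 * real t - 22 * \<sigma> * nn \<le> (\<Sum>v\<in>V. gain S u v)"
proof -
  let ?Y = "(x u + 1)\<^sup>2"
  have uV: "u \<in> V" using u hub_set_V by blast
  have finS: "finite S" by (rule finite_subset[OF S(1) fin])
  have z: "0 < r" using r3 by simp
  let ?P = "UU - U 0 - S - nbhd E V u" and ?Q = "{v \<in> V - S. E u v \<and> part_of v = 0}"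
  have U0: "v \<in> UU \<Longrightarrow> part_of v = 0 \<longleftrightarrow> v \<in> U 0" for v
    using part_of_U by (metis UN_iff lessThan_iff z)
  have eq: "(\<Sum>v\<in>V. gain S u v) = (\<Sum>v\<in>V. (if v \<in> ?P then edge_weight u v else 0) - (if v \<in> ?Q then edge_weight u v else 0))"
    using u U0 part_of_U[OF z] by (intro sum.cong refl) (auto simp: gain_def nbhd_def)
  also have "\<dots> = (\<Sum>v\<in>V. if v \<in> ?P then edge_weight u v else 0) - (\<Sum>v\<in>V. if v \<in> ?Q then edge_weight u v else 0)"
    by (rule sum_subtractf)
  also have "(\<Sum>v\<in>V. if v \<in> ?P then edge_weight u v else 0) = (\<Sum>v\<in>?P. edge_weight u v)"
    using fin UUV by (intro sum.mono_neutral_cong_right) auto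
  also have "(\<Sum>v\<in>V. if v \<in> ?Q then edge_weight u v else 0) = (\<Sum>v\<in>?Q. edge_weight u v)"
    using fin by (intro sum.mono_neutral_cong_right) auto
  finally have total: "(\<Sum>v\<in>V. gain S u v) = (\<Sum>v\<in>?P. edge_weight u v) - (\<Sum>v\<in>?Q. edge_weight u v)" .
  have "(\<Sum>v\<in>?P. ?Y - 10 * \<sigma>) \<le> (\<Sum>v\<in>?P. edge_weight u v)"
    using edge_weight_core(1)[OF uV] by (intro sum_mono) blast
  then have 1: "real (card ?P) * (?Y - 10 * \<sigma>) \<le> (\<Sum>v\<in>?P. edge_weight u v)" by simp
  let ?N = "U 0 \<inter> nbhd E V u"
  have "(\<Sum>v\<in>?Q. edge_weight u v) \<le> (\<Sum>v\<in>?N \<union> (V - UU). edge_weight u v)"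
    using U0 fin finU[OF z] edge_weight(1) by (intro sum_mono2) (auto simp: nbhd_def)
  also have "\<dots> = (\<Sum>v\<in>?N. edge_weight u v) + (\<Sum>v\<in>V - UU. edge_weight u v)"
    using fin finU[OF z] z by (intro sum.union_disjoint) auto
  also have "(\<Sum>v\<in>?N. edge_weight u v) \<le> (\<Sum>v\<in>?N. ?Y + 11 * \<sigma>)"
    using edge_weight_core(2)[OF uV] z by (intro sum_mono) blast
  also have "(\<Sum>v\<in>V - UU. edge_weight u v) \<le> (\<Sum>v\<in>V - UU. 64)" using edge_weight_64[OF uV] by (intro sum_mono) blast
  finally have 2: "(\<Sum>v\<in>?Q. edge_weight u v) \<le> real (card ?N) * (?Y + 11 * \<sigma>) + 64 * real (card (V - UU))" by simp
  have "UU - nbhd E V u \<union> ?N \<subseteq> ?P \<union> S \<union> U 0" by blast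
  then have "card (UU - nbhd E V u \<union> ?N) \<le> card (?P \<union> S \<union> U 0)" using finUU finS finU[OF z] by (intro card_mono) auto
  also have "\<dots> \<le> card ?P + card S + card (U 0)" by (meson add_mono card_Un_le order_refl order_trans)
  also have "card (UU - nbhd E V u \<union> ?N) = card (UU - nbhd E V u) + card ?N"
    using finUU finU[OF z] by (intro card_Un_disjoint) auto
  finally have 3: "deficit u + real (card ?N) - real t - real (card (U 0)) \<le> real (card ?P)"
    using S(2) by (simp add: deficit_def)
  have "card ?P \<le> card V" "card ?N \<le> card V" using UUV by (auto intro!: card_mono[OF fin] simp: nbhd_def)
  then have 4: "real (card ?P) \<le> nn" "real (card ?N) \<le> nn" by simp_all
  have "(deficit u + real (card ?N) - real t - real (card (U 0))) * ?Y \<le> real (card ?P) * ?Y" using 3 by (intro mult_right_mono) auto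
  moreover have "real t * ?Y \<le> real t * 25" using sq_bounds(2)[OF uV] by (intro mult_left_mono) auto
  moreover have "real (card ?P) * (10 * \<sigma>) \<le> nn * (10 * \<sigma>)" using 4 e_bounds(5) by (intro mult_right_mono) auto
  moreover have "real (card ?N) * (11 * \<sigma>) \<le> nn * (11 * \<sigma>)" using 4 e_bounds(5) by (intro mult_right_mono) auto
  moreover have "64 * real (card (V - UU)) \<le> nn * \<sigma>"
  proof -
    have "64 * e \<le> \<sigma>" using e_bounds by linarith
    from scale[OF this] show ?thesis using rest_small by (simp add: mult.commute)
  qed
  ultimately show ?thesis using 1 2 total by (simp add: algebra_simps)
qed

lemma rows_Z:
  assumes S: "S \<subseteq> V"
  shows "- (1 / (30 * real r * real t) * nn) \<le> (\<Sum>u\<in>V - hub_set - S. \<Sum>v\<in>V. gain S u v)"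
proof -
  have row: "- 64 * real (card {v \<in> V - hub_set. E u v \<and> part_of u = part_of v}) \<le> (\<Sum>v\<in>V. gain S u v)" if u: "u \<in> V - hub_set - S" for u
  proof -
    have "- 64 * real (card {v \<in> V - hub_set. E u v \<and> part_of u = part_of v}) = (\<Sum>v\<in>{v \<in> V - hub_set. E u v \<and> part_of u = part_of v}. -64)" by simp
    also have "\<dots> = (\<Sum>v\<in>V. if v \<in> {v \<in> V - hub_set. E u v \<and> part_of u = part_of v} then -64 else 0)"
      using fin by (intro sum.mono_neutral_cong_left) auto
    also have "\<dots> \<le> (\<Sum>v\<in>V. gain S u v)"
      using u edge_weight_64 by (intro sum_mono) (auto simp: gain_def)
    finally show ?thesis .
  qed
  have "- (1 / (30 * real r * real t) * nn) = - 64 * (1 / (1920 * real r * real t) * nn)" by simp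
  also have "\<dots> \<le> - 64 * (\<Sum>u\<in>V - hub_set. real (card {v \<in> V - hub_set. E u v \<and> part_of u = part_of v}))"
    using inner_edges by simp
  also have "\<dots> \<le> - 64 * (\<Sum>u\<in>V - hub_set - S. real (card {v \<in> V - hub_set. E u v \<and> part_of u = part_of v}))"
    using fin by (simp add: sum_mono2)
  also have "\<dots> = (\<Sum>u\<in>V - hub_set - S. - 64 * real (card {v \<in> V - hub_set. E u v \<and> part_of u = part_of v}))"
    by (rule sum_distrib_left)
  also have "\<dots> \<le> (\<Sum>u\<in>V - hub_set - S. \<Sum>v\<in>V. gain S u v)" by (rule sum_mono[OF row])
  finally show ?thesis .
qed

text \<open>
  By the minimum degree a vertex misses at most about \<open>n / r\<close> vertices, which is the size of a part.
\<close>

lemma deficit_upper: "w \<in> V \<Longrightarrow> deficit w - real (card (U 0)) \<le> 26 * \<sigma> * nn"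
proof -
  assume w: "w \<in> V"
  have "nbhd E V w \<subseteq> (V - (UU - nbhd E V w))" using nbhd_subset[of E V w] by blast
  then have "card (nbhd E V w) \<le> card (V - (UU - nbhd E V w))" using fin by (intro card_mono) auto
  also have "\<dots> = card V - card (UU - nbhd E V w)" using UUV finUU by (intro card_Diff_subset) auto
  finally have "real (card (nbhd E V w)) \<le> nn - deficit w"
    using card_mono[OF fin, of "UU - nbhd E V w"] UUV unfolding deficit_def by (simp add: subset_iff)
  moreover have "(1 - 1 / real r - 24 * \<sigma>) * nn \<le> real (card (nbhd E V w))" by (rule deg[OF w])
  moreover have "(1 / real r - \<epsilon>) * nn \<le> real (card (U 0))" using U_lower r3 by simp
  ultimately have "deficit w - real (card (U 0)) \<le> nn - (1 - 1 / real r - 24 * \<sigma>) * nn - (1 / real r - \<epsilon>) * nn" by linarith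
  also have "\<dots> = (24 * \<sigma> + \<epsilon>) * nn" by (simp add: left_diff_distrib distrib_right)
  also have "\<dots> \<le> 26 * \<sigma> * nn" using e_bounds by (intro scale) linarith
  finally show ?thesis .
qed

text \<open>
  In the rows of \<open>gain\<close> the deficits of the vertices of \<open>S\<close> have the weights \<open>(x u + 1)\<^sup>2 \<ge> (\<zeta> + 1)\<^sup>2\<close>, and the
  differences \<open>deficit u - card (U 0)\<close> for hubs outside \<open>S\<close>, which are at most slightly positive, have weights
  \<open>(x u + 1)\<^sup>2 \<le> (\<zeta> + 1)\<^sup>2\<close>. So all weights may be replaced by \<open>(\<zeta> + 1)\<^sup>2\<close>, which is at least \<open>1\<close>
  and can be cancelled.
\<close>

lemma deficiency:
  assumes S: "S \<subseteq> V" "card S = t - 1" and SB: "S \<subseteq> hub_set \<or> hub_set \<subseteq> S"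
    and \<zeta>: "0 \<le> \<zeta>" "\<zeta> \<le> 4" "\<And>w. w \<in> S \<Longrightarrow> \<zeta> \<le> x w" "\<And>w. w \<in> hub_set - S \<Longrightarrow> x w \<le> \<zeta>"
  shows "(\<Sum>w\<in>hub_set \<union> S. deficit w) - real (card (hub_set - S)) * real (card (U 0)) \<le> nn * (1 / (10 * real r * real t))"
proof -
  let ?u0 = "real (card (U 0))" and ?Y = "(\<zeta> + 1)\<^sup>2"
  have finS: "finite S" by (rule finite_subset[OF S(1) fin])
  have Y: "1 \<le> ?Y" "?Y \<le> 25"
  proof -
    have "1\<^sup>2 \<le> (\<zeta> + 1)\<^sup>2" "(\<zeta> + 1)\<^sup>2 \<le> 5\<^sup>2" using \<zeta> by (intro power_mono; simp)+
    then show "1 \<le> ?Y" "?Y \<le> 25" by simp_all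
  qed
  have cBS: "real (card (hub_set - S)) \<le> real C"
    using card_hub_set card_mono[OF finBB, of "hub_set - S"] by simp
  define err where "err = 25 * real t + 22 * \<sigma> * nn"
  have err0: "0 \<le> err" "0 \<le> \<sigma> * nn" using e_bounds(5) n_pos by (simp_all add: err_def)
  have V: "V = S \<union> ((hub_set - S) \<union> (V - hub_set - S))" using S(1) hub_set_V by blast
  have "(\<Sum>u\<in>V. \<Sum>v\<in>V. gain S u v) = (\<Sum>u\<in>S. \<Sum>v\<in>V. gain S u v) + ((\<Sum>u\<in>hub_set - S. \<Sum>v\<in>V. gain S u v) + (\<Sum>u\<in>V - hub_set - S. \<Sum>v\<in>V. gain S u v))"
  proof -
    have "(\<Sum>u\<in>V. h u) = (\<Sum>u\<in>S. h u) + ((\<Sum>u\<in>hub_set - S. h u) + (\<Sum>u\<in>V - hub_set - S. h u))" for h :: "nat \<Rightarrow> real"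
    proof -
      have "(\<Sum>u\<in>V. h u) = (\<Sum>u\<in>S \<union> ((hub_set - S) \<union> (V - hub_set - S)). h u)" using V by simp
      also have "\<dots> = (\<Sum>u\<in>S. h u) + (\<Sum>u\<in>(hub_set - S) \<union> (V - hub_set - S). h u)"
        using fin finS finBB by (intro sum.union_disjoint) auto
      also have "(\<Sum>u\<in>(hub_set - S) \<union> (V - hub_set - S). h u) = (\<Sum>u\<in>hub_set - S. h u) + (\<Sum>u\<in>V - hub_set - S. h u)"
        using fin finBB by (intro sum.union_disjoint) auto
      finally show ?thesis .
    qed
    then show ?thesis .
  qed
  moreover have "(\<Sum>u\<in>S. deficit u * ?Y - err) \<le> (\<Sum>u\<in>S. \<Sum>v\<in>V. gain S u v)"
  proof (rule sum_mono)
    fix u assume u: "u \<in> S"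
    have "(\<zeta> + 1)\<^sup>2 \<le> (x u + 1)\<^sup>2" using \<zeta>(1) \<zeta>(3)[OF u] by (intro power_mono) auto
    then have "deficit u * ?Y \<le> deficit u * (x u + 1)\<^sup>2" by (intro mult_left_mono) (auto simp: deficit_def)
    then show "deficit u * ?Y - err \<le> (\<Sum>v\<in>V. gain S u v)" using row_S[OF S u] by (simp add: err_def)
  qed
  moreover have "(\<Sum>u\<in>hub_set - S. (deficit u - ?u0) * ?Y - err - 624 * (\<sigma> * nn)) \<le> (\<Sum>u\<in>hub_set - S. \<Sum>v\<in>V. gain S u v)"
  proof (rule sum_mono)
    fix u assume u: "u \<in> hub_set - S"
    have uV: "u \<in> V" using u hub_set_V by blast
    have yY: "(x u + 1)\<^sup>2 \<le> (\<zeta> + 1)\<^sup>2" using x0[OF uV] \<zeta>(4)[OF u] by (intro power_mono) auto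
    have "(deficit u - ?u0) * (?Y - (x u + 1)\<^sup>2) \<le> (26 * \<sigma> * nn) * (?Y - (x u + 1)\<^sup>2)"
      using deficit_upper[OF uV] yY by (intro mult_right_mono) auto
    also have "\<dots> \<le> (26 * \<sigma> * nn) * 24"
      using Y sq_bounds(1)[OF uV] err0 by (intro mult_left_mono) auto
    finally have "(deficit u - ?u0) * ?Y - 624 * (\<sigma> * nn) \<le> (deficit u - ?u0) * (x u + 1)\<^sup>2" by (simp add: algebra_simps)
    then show "(deficit u - ?u0) * ?Y - err - 624 * (\<sigma> * nn) \<le> (\<Sum>v\<in>V. gain S u v)"
      using row_B[OF S u] by (simp add: err_def)
  qed
  ultimately have "(\<Sum>u\<in>S. deficit u * ?Y - err) + (\<Sum>u\<in>hub_set - S. (deficit u - ?u0) * ?Y - err - 624 * (\<sigma> * nn))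
      - 1 / (30 * real r * real t) * nn \<le> 0"
    using gain_sum[OF S] rows_Z[OF S(1)] by linarith
  moreover have "(\<Sum>u\<in>S. deficit u * ?Y - err) = (\<Sum>u\<in>S. deficit u) * ?Y - real (card S) * err"
    by (simp add: sum_subtractf sum_distrib_right)
  moreover have "(\<Sum>u\<in>hub_set - S. (deficit u - ?u0) * ?Y - err - 624 * (\<sigma> * nn)) =
     ((\<Sum>u\<in>hub_set - S. deficit u) - real (card (hub_set - S)) * ?u0) * ?Y - real (card (hub_set - S)) * (err + 624 * (\<sigma> * nn))"
    by (simp add: sum_subtractf sum_distrib_right[symmetric] algebra_simps)
  moreover have "(\<Sum>w\<in>hub_set \<union> S. deficit w) = (\<Sum>u\<in>S. deficit u) + (\<Sum>u\<in>hub_set - S. deficit u)"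
  proof -
    have "(\<Sum>w\<in>hub_set \<union> S. deficit w) = (\<Sum>w\<in>S \<union> (hub_set - S). deficit w)" by (rule sum.cong) auto
    also have "\<dots> = (\<Sum>u\<in>S. deficit u) + (\<Sum>u\<in>hub_set - S. deficit u)"
      by (rule sum.union_disjoint) (use finS finBB in auto)
    finally show ?thesis .
  qed
  ultimately have 1: "((\<Sum>w\<in>hub_set \<union> S. deficit w) - real (card (hub_set - S)) * ?u0) * ?Y \<le>
     real (card S) * err + real (card (hub_set - S)) * (err + 624 * (\<sigma> * nn)) + 1 / (30 * real r * real t) * nn"
    by (simp add: algebra_simps)
  define p where "p = 1 / (real r * real t)"
  have p: "0 < p" using inv_rt by (simp add: p_def)
  have e1: "real (card S) * err \<le> real t * err" using S(2) err0 by (intro mult_right_mono) auto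
  have e2: "real (card (hub_set - S)) * (err + 624 * (\<sigma> * nn)) \<le> real C * (err + 624 * (\<sigma> * nn))"
    using cBS err0 by (intro mult_right_mono) auto
  have "real t * err + real C * (err + 624 * (\<sigma> * nn)) \<le> (real t + real C) * (25 * real t) + 650 * (real t + real C) * (\<sigma> * nn)"
  proof -
    have "0 \<le> real t * (\<sigma> * nn)" using err0 by simp
    moreover have "0 \<le> real C * (\<sigma> * nn)" using err0 by simp
    ultimately show ?thesis by (simp add: err_def algebra_simps)
  qed
  also have "650 * (real t + real C) * (\<sigma> * nn) \<le> p / 32 * nn"
    using scale[OF \<sigma>_bounds(1)] by (simp add: p_def mult_ac)
  also have "(real t + real C) * (25 * real t) \<le> p / 32 * nn"
  proof -
    have "(32 * (real r * real t)) * ((real t + real C) * (25 * real t)) \<le> nn" using nC by (simp add: power2_eq_square mult_ac)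
    moreover have "0 < 32 * (real r * real t)" using rt by linarith
    ultimately have "(real t + real C) * (25 * real t) \<le> nn / (32 * (real r * real t))"
      by (simp add: pos_le_divide_eq mult.commute)
    then show ?thesis by (simp add: p_def)
  qed
  finally have 2: "real t * err + real C * (err + 624 * (\<sigma> * nn)) \<le> p / 16 * nn" by simp
  have e3: "1 / (30 * real r * real t) * nn = p / 30 * nn" "nn * (1 / (10 * real r * real t)) = p / 10 * nn"
    by (simp_all add: p_def)
  have "0 < p * nn" using p n_pos by simp
  then have 3: "((\<Sum>w\<in>hub_set \<union> S. deficit w) - real (card (hub_set - S)) * ?u0) * ?Y \<le> p / 10 * nn"
    using 1 e1 e2 2 unfolding e3 by simp
  show ?thesis
  proof (cases "0 \<le> (\<Sum>w\<in>hub_set \<union> S. deficit w) - real (card (hub_set - S)) * ?u0")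
    case True
    then have "((\<Sum>w\<in>hub_set \<union> S. deficit w) - real (card (hub_set - S)) * ?u0) * 1 \<le> ((\<Sum>w\<in>hub_set \<union> S. deficit w) - real (card (hub_set - S)) * ?u0) * ?Y"
      using Y by (intro mult_left_mono) auto
    from order_trans[OF this 3] show ?thesis unfolding e3 by simp
  next
    case False
    then show ?thesis using \<open>0 < p * nn\<close> unfolding e3 by simp
  qed
qed

end

section \<open>The hubs and the independence of the parts\<close>

context core_setting
begin

lemma deficit_parts: "deficit w = (\<Sum>c<r. real (card (U c - nbhd E V w)))"
proof -
  have "UU - nbhd E V w = (\<Union>c<r. U c - nbhd E V w)" by blast
  then have "card (UU - nbhd E V w) = card (\<Union>c<r. U c - nbhd E V w)" by simp
  also have "\<dots> = (\<Sum>c<r. card (U c - nbhd E V w))"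
  proof (rule card_UN_disjoint)
    show "\<forall>c\<in>{..<r}. finite (U c - nbhd E V w)" using finU by simp
    show "\<forall>c\<in>{..<r}. \<forall>d\<in>{..<r}. c \<noteq> d \<longrightarrow> (U c - nbhd E V w) \<inter> (U d - nbhd E V w) = {}"
      using coreD(2)[OF core] by blast
  qed simp
  finally show ?thesis by (simp add: deficit_def)
qed

text \<open>
  Suppose first that there are at least \<open>t - 1\<close> hubs, and let \<open>S\<close> consist of \<open>t - 1\<close> hubs with the largest
  entries of \<open>x\<close>. Let \<open>k c\<close> be the number of hubs outside the abundant trace \<open>P c\<close> of \<open>abundant_trace\<close>.
  Counting missing edges, the deficits of the hubs add up to about \<open>\<Sum>c<r. k c\<close> times \<open>n / r\<close> or more, and
  by \<open>deficiency\<close> to at most about \<open>card hub_set - (t - 1)\<close> times \<open>n / r\<close>. As these are integers,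
  \<open>\<Sum>c<r. k c \<le> card hub_set - (t - 1)\<close>. For each part \<open>i\<close> the hubs that lie in \<open>P c\<close> for all \<open>c \<noteq> i\<close> have
  many common neighbours in \<open>r - 1\<close> parts, so by \<open>no_common_core\<close> there are at most \<open>t - 1\<close> of them, that is
  \<open>card hub_set - (t - 1)\<close> is at most the sum of the \<open>k c\<close> with \<open>c \<noteq> i\<close>. Together this forces
  \<open>k i = 0\<close> for all \<open>i\<close> and hence \<open>card hub_set = t - 1\<close>; the deficits are then small by \<open>deficiency\<close>.

  If there are fewer than \<open>t - 1\<close> hubs, complete them to a set of \<open>t - 1\<close> vertices. By \<open>deficiency\<close> the added
  vertices would be adjacent to almost the whole core, although they have few neighbours in some part.
\<close>

lemma hubs:
  "card hub_set = t - 1" "w \<in> hub_set \<Longrightarrow> deficit w \<le> nn * (1 / (10 * real r * real t))"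
proof -
  define q where "q = 1 / (10 * real r * real t)"
  have q: "0 < q" "q \<le> ir / 10"
  proof -
    have "q = 1 / (real r * real t) / 10" by (simp add: q_def)
    then show "0 < q" "q \<le> ir / 10" using inv_rt(1,3) by (simp_all add: ir_def)
  qed
  have "card hub_set = t - 1 \<and> (\<forall>w\<in>hub_set. deficit w \<le> nn * q)"
  proof (cases "t - 1 \<le> card hub_set")
    case True
    obtain S \<zeta> where S: "S \<subseteq> hub_set" "card S = t - 1" "0 \<le> \<zeta>" "\<zeta> \<le> 4"
      "\<And>w. w \<in> S \<Longrightarrow> \<zeta> \<le> x w" "\<And>w. w \<in> hub_set - S \<Longrightarrow> x w \<le> \<zeta>"
    proof -
      have "\<exists>S\<subseteq>hub_set. card S = t - 1 \<and> (\<exists>\<zeta>. 0 \<le> \<zeta> \<and> \<zeta> \<le> 4 \<and> (\<forall>w\<in>S. \<zeta> \<le> x w) \<and> (\<forall>w\<in>hub_set - S. x w \<le> \<zeta>))"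
        by (rule top_subset[OF finBB True]) (use x0 x4 hub_set_V in auto)
      then show ?thesis using that by blast
    qed
    have finS: "finite S" by (rule finite_subset[OF S(1) finBB])
    let ?Q = "\<lambda>c P. P \<subseteq> hub_set \<and> \<kappa> * nn \<le> real (card {v \<in> U c. hub_set \<inter> nbhd E V v = P}) \<and>
     real (card (hub_set - P)) * (real (card (U c)) - 2 ^ C * \<kappa> * nn) \<le> (\<Sum>w\<in>hub_set. real (card (U c - nbhd E V w)))"
    define P where "P c = (SOME P. ?Q c P)" for c
    have "?Q c (P c)" if "c < r" for c
      unfolding P_def by (rule someI_ex) (rule abundant_trace[OF that])
    then have P: "\<And>c. c < r \<Longrightarrow> P c \<subseteq> hub_set"
      "\<And>c. c < r \<Longrightarrow> \<kappa> * nn \<le> real (card {v \<in> U c. hub_set \<inter> nbhd E V v = P c})"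
      "\<And>c. c < r \<Longrightarrow> real (card (hub_set - P c)) * (real (card (U c)) - 2 ^ C * \<kappa> * nn) \<le> (\<Sum>w\<in>hub_set. real (card (U c - nbhd E V w)))"
      by simp_all
    define k where "k c = card (hub_set - P c)" for c
    have kC: "k c \<le> C" for c
      using card_mono[OF finBB, of "hub_set - P c"] card_hub_set by (simp add: k_def)
    have rare: "real r * real C * (2 ^ C * \<kappa>) \<le> ir / 8"
    proof -
      have "real r * (8 * (real r * real C * (2 ^ C * \<kappa>))) \<le> 1" using \<kappa>(3) by (simp add: power2_eq_square mult_ac)
      then have "ir * (real r * (8 * (real r * real C * (2 ^ C * \<kappa>)))) \<le> ir * 1"
        using ir(2) by (intro mult_left_mono) auto
      moreover have "ir * (real r * (8 * (real r * real C * (2 ^ C * \<kappa>)))) = (real r * ir) * (8 * (real r * real C * (2 ^ C * \<kappa>)))"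
        by (simp only: mult_ac)
      ultimately show ?thesis unfolding ir(1) by linarith
    qed
    have Ce: "real C * e \<le> ir / 1000"
    proof -
      have "real C * (768 * e) \<le> real C * \<sigma>" using e_bounds(3) by (intro mult_left_mono) auto
      moreover have "650 * (real C * \<sigma>) \<le> 650 * (real t + real C) * \<sigma>" using e_bounds(5) by (simp add: algebra_simps)
      moreover have "650 * (real t + real C) * \<sigma> \<le> 1 / (real r * real t) / 32" using \<sigma>_bounds(1) by simp
      moreover have "1 / (real r * real t) / 32 \<le> ir / 32" using inv_rt(1) by (simp add: ir_def)
      ultimately have "650 * (real C * \<sigma>) \<le> ir / 32" "real C * (768 * e) \<le> real C * \<sigma>" by (meson order_trans)+
      moreover have "real C * (768 * e) = 768 * (real C * e)" by simp
      moreover have "0 \<le> real C * e" using e_bounds(1) by simp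
      ultimately show ?thesis using ir(2) by linarith
    qed
    have low: "((\<Sum>c<r. real (k c)) * ir - ir / 8 - ir / 1000) * nn \<le> (\<Sum>w\<in>hub_set. deficit w)"
    proof -
      have step: "(real (k c) * ir - real C * (\<epsilon> + 2 ^ C * \<kappa>)) * nn \<le> (\<Sum>w\<in>hub_set. real (card (U c - nbhd E V w)))" if c: "c < r" for c
      proof -
        have "real (k c) * (\<epsilon> + 2 ^ C * \<kappa>) \<le> real C * (\<epsilon> + 2 ^ C * \<kappa>)"
          using kC \<epsilon>pos \<kappa>(1) by (intro mult_right_mono) auto
        then have "real (k c) * ir - real C * (\<epsilon> + 2 ^ C * \<kappa>) \<le> real (k c) * (ir - \<epsilon> - 2 ^ C * \<kappa>)"
          by (simp add: algebra_simps)
        then have "(real (k c) * ir - real C * (\<epsilon> + 2 ^ C * \<kappa>)) * nn \<le> real (k c) * (ir - \<epsilon> - 2 ^ C * \<kappa>) * nn" by (rule scale)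
        also have "\<dots> = real (k c) * ((ir - \<epsilon>) * nn - 2 ^ C * \<kappa> * nn)" by (simp add: algebra_simps)
        also have "\<dots> \<le> real (k c) * (real (card (U c)) - 2 ^ C * \<kappa> * nn)"
          using U_lower[OF c] by (intro mult_left_mono) (auto simp: ir_def)
        also have "\<dots> \<le> (\<Sum>w\<in>hub_set. real (card (U c - nbhd E V w)))" using P(3)[OF c] by (simp add: k_def)
        finally show ?thesis .
      qed
      have "(\<Sum>c<r. (real (k c) * ir - real C * (\<epsilon> + 2 ^ C * \<kappa>)) * nn) \<le> (\<Sum>c<r. \<Sum>w\<in>hub_set. real (card (U c - nbhd E V w)))"
        using step by (intro sum_mono) auto
      also have "\<dots> = (\<Sum>w\<in>hub_set. deficit w)" unfolding deficit_parts by (rule sum.swap)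
      also have "(\<Sum>c<r. (real (k c) * ir - real C * (\<epsilon> + 2 ^ C * \<kappa>)) * nn) =
         ((\<Sum>c<r. real (k c)) * ir - real r * (real C * (\<epsilon> + 2 ^ C * \<kappa>))) * nn"
        by (simp add: sum_subtractf sum_distrib_right left_diff_distrib)
      finally have 1: "((\<Sum>c<r. real (k c)) * ir - real r * (real C * (\<epsilon> + 2 ^ C * \<kappa>))) * nn \<le> (\<Sum>w\<in>hub_set. deficit w)" .
      have "real r * (real C * (\<epsilon> + 2 ^ C * \<kappa>)) = real C * e + real r * real C * (2 ^ C * \<kappa>)"
        by (simp add: e_def algebra_simps)
      then have "(\<Sum>c<r. real (k c)) * ir - ir / 8 - ir / 1000 \<le> (\<Sum>c<r. real (k c)) * ir - real r * (real C * (\<epsilon> + 2 ^ C * \<kappa>))"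
        using rare Ce by linarith
      from scale[OF this] 1 show ?thesis by linarith
    qed
    have SV: "S \<subseteq> V" using S(1) hub_set_V by blast
    have "(\<Sum>w\<in>hub_set \<union> S. deficit w) - real (card (hub_set - S)) * real (card (U 0)) \<le> nn * q"
      unfolding q_def by (rule deficiency[OF SV S(2)]) (use S in auto)
    moreover have "hub_set \<union> S = hub_set" using S(1) by blast
    ultimately have def: "(\<Sum>w\<in>hub_set. deficit w) - real (card (hub_set - S)) * real (card (U 0)) \<le> nn * q" by simp
    have cBS: "card (hub_set - S) = card hub_set - (t - 1)" using S(1,2) finS by (simp add: card_Diff_subset)
    have up0: "real (card (hub_set - S)) * real (card (U 0)) \<le> (real (card (hub_set - S)) * ir + ir / 1000) * nn"
    proof -
      have "real (card (hub_set - S)) * real (card (U 0)) \<le> real (card (hub_set - S)) * ((ir + e) * nn)"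
        using U_upper[of 0] r3 by (intro mult_left_mono) (auto simp: ir_def)
      also have "\<dots> = (real (card (hub_set - S)) * ir + real (card (hub_set - S)) * e) * nn" by (simp add: algebra_simps)
      also have "\<dots> \<le> (real (card (hub_set - S)) * ir + ir / 1000) * nn"
      proof (rule scale)
        have "real (card (hub_set - S)) \<le> real C" using card_hub_set cBS by simp
        then have "real (card (hub_set - S)) * e \<le> real C * e" using e_bounds(1) by (intro mult_right_mono) auto
        then show "real (card (hub_set - S)) * ir + real (card (hub_set - S)) * e \<le> real (card (hub_set - S)) * ir + ir / 1000"
          using Ce by linarith
      qed
      finally show ?thesis .
    qed
    have "((\<Sum>c<r. real (k c)) * ir - ir / 8 - ir / 1000 - (real (card (hub_set - S)) * ir + ir / 1000)) * nn \<le> q * nn"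
    proof -
      have "a1 - a4 \<le> q * nn" if "a1 \<le> a2" "a2 - a3 \<le> nn * q" "a3 \<le> a4" for a1 a2 a3 a4 :: real
        using that by (simp add: mult.commute)
      from this[OF low def up0] show ?thesis
        by (simp only: left_diff_distrib[of _ "real (card (hub_set - S)) * ir + ir / 1000" nn])
    qed
    then have "(\<Sum>c<r. real (k c)) * ir - ir / 8 - ir / 1000 - (real (card (hub_set - S)) * ir + ir / 1000) \<le> q"
      by (rule mult_right_le_imp_le[OF _ n_pos])
    then have "ir * ((\<Sum>c<r. real (k c)) - real (card (hub_set - S))) < ir * 1"
      using q ir(2) by (simp add: algebra_simps)
    then have "(\<Sum>c<r. real (k c)) - real (card (hub_set - S)) < 1" using ir(2) by (simp only: mult_less_cancel_left_pos)
    then have "real (\<Sum>c<r. k c) < real (card (hub_set - S) + 1)" by simp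
    then have ksum: "(\<Sum>c<r. k c) \<le> card hub_set - (t - 1)" unfolding cBS by (simp only: of_nat_less_iff)
    have rest: "card hub_set - (\<Sum>c\<in>{..<r} - {i}. k c) \<le> t - 1" if i: "i < r" for i
    proof (rule ccontr)
      assume big: "\<not> ?thesis"
      let ?S = "hub_set - (\<Union>c\<in>{..<r} - {i}. hub_set - P c)"
      have "card (\<Union>c\<in>{..<r} - {i}. hub_set - P c) \<le> (\<Sum>c\<in>{..<r} - {i}. k c)"
        unfolding k_def by (intro card_UN_le) auto
      moreover have "card hub_set - card (\<Union>c\<in>{..<r} - {i}. hub_set - P c) \<le> card ?S"
        using finBB by (intro diff_card_le_card_Diff) (auto intro: finite_subset[OF _ finBB])
      ultimately have "t \<le> card ?S" using big by linarith
      then obtain R where R: "R \<subseteq> ?S" "card R = t" by (meson obtain_subset_with_card_n)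
      show False
      proof (rule no_common_core[OF _ R(2) i])
        show "R \<subseteq> hub_set" using R(1) by blast
        fix d assume d: "d < r" "d \<noteq> i"
        have "R \<subseteq> P d" using R(1) d by blast
        have "{v \<in> U d. hub_set \<inter> nbhd E V v = P d} \<subseteq> U d \<inter> (\<Inter>w\<in>R. nbhd E V w)"
        proof (intro subsetI IntI INT_I)
          fix v w assume v: "v \<in> {v \<in> U d. hub_set \<inter> nbhd E V v = P d}" and "w \<in> R"
          then have "w \<in> nbhd E V v" using \<open>R \<subseteq> P d\<close> by blast
          then show "v \<in> nbhd E V w"
            using v coreD(1)[OF core d(1)] sympD[OF sym] by (auto simp: nbhd_def)
        qed auto
        then have "card {v \<in> U d. hub_set \<inter> nbhd E V v = P d} \<le> card (U d \<inter> (\<Inter>w\<in>R. nbhd E V w))"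
          using finU[OF d(1)] by (intro card_mono) auto
        then show "\<kappa> * nn \<le> real (card (U d \<inter> (\<Inter>w\<in>R. nbhd E V w)))" using P(2)[OF d(1)] by linarith
      qed
    qed
    have k0: "k i = 0" if i: "i < r" for i
    proof -
      have "(\<Sum>c<r. k c) = k i + (\<Sum>c\<in>{..<r} - {i}. k c)" using i by (intro sum.remove) auto
      then show ?thesis using ksum rest[OF i] by linarith
    qed
    then have "card hub_set \<le> t - 1" using rest[of 0] r3 by simp
    then have cB: "card hub_set = t - 1" using True by simp
    have "card (hub_set - S) = 0" using cBS cB by simp
    then have tot: "(\<Sum>w\<in>hub_set. deficit w) \<le> nn * q" using def by simp
    have "deficit w \<le> nn * q" if "w \<in> hub_set" for w
    proof -
      have "deficit w \<le> (\<Sum>w\<in>hub_set. deficit w)" using that finBB by (intro member_le_sum) (auto simp: deficit_def)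
      then show ?thesis using tot by linarith
    qed
    then show ?thesis using cB by blast
  next
    case False
    have "t + 2 \<le> card V"
    proof -
      have "\<delta> \<le> 1" using \<delta>_bound(2) inv_rt(2) \<delta>(1) by linarith
      from scale[OF this] show ?thesis using n\<delta> by simp
    qed
    then have "t - 1 - card hub_set \<le> card (V - hub_set)" using hub_set_V finBB by (simp add: card_Diff_subset)
    then obtain D where D: "D \<subseteq> V - hub_set" "card D = t - 1 - card hub_set" by (meson obtain_subset_with_card_n)
    have finD: "finite D" using D(1) fin by (meson finite_Diff finite_subset)
    have cS: "card (hub_set \<union> D) = t - 1" using D finBB finD False by (subst card_Un_disjoint) auto
    have SV: "hub_set \<union> D \<subseteq> V" using D(1) hub_set_V by blast
    have "(\<Sum>w\<in>hub_set \<union> (hub_set \<union> D). deficit w) - real (card (hub_set - (hub_set \<union> D))) * real (card (U 0)) \<le> nn * q"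
      unfolding q_def by (rule deficiency[OF SV cS, where \<zeta> = 0]) (use x0 SV in auto)
    moreover have "hub_set \<union> (hub_set \<union> D) = hub_set \<union> D" "hub_set - (hub_set \<union> D) = {}" by blast+
    ultimately have tot: "(\<Sum>w\<in>hub_set \<union> D. deficit w) \<le> nn * q" by simp
    have "D \<noteq> {}" using D(2) False by auto
    then obtain w where w: "w \<in> D" by blast
    then have "w \<in> V - hub_set" using D(1) by blast
    then obtain c where c: "c < r" "real (card (U c \<inter> nbhd E V w)) < \<delta> * nn" by (auto simp: hub_set_def not_le)
    have "card (U c \<inter> nbhd E V w) + card (U c - nbhd E V w) = card (U c)" using finU[OF c(1)] by (metis card_Int_Diff)
    then have "real (card (U c)) - \<delta> * nn \<le> real (card (U c - nbhd E V w))" using c(2) by linarith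
    also have "\<dots> \<le> deficit w" unfolding deficit_def using c(1) finUU by (intro of_nat_mono card_mono) auto
    also have "\<dots> \<le> (\<Sum>w\<in>hub_set \<union> D. deficit w)" using w finBB finD by (intro member_le_sum) (auto simp: deficit_def)
    also note tot
    finally have "(ir - \<epsilon> - \<delta>) * nn \<le> q * nn" using U_lower[OF c(1)] by (simp add: ir_def algebra_simps)
    then have "ir - \<epsilon> - \<delta> \<le> q" by (rule mult_right_le_imp_le[OF _ n_pos])
    moreover have "\<delta> \<le> ir / 1000" using \<delta>_bound(2) inv_rt(1) by (simp add: ir_def)
    ultimately have False using q ir(2) t_small(4) by linarith
    then show ?thesis ..
  qed
  then show "card hub_set = t - 1" "w \<in> hub_set \<Longrightarrow> deficit w \<le> nn * (1 / (10 * real r * real t))" by (auto simp: q_def)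
qed

text \<open>
  The \<open>t - 1\<close> hubs have distinct neighbours in the part of the supposed edge. Together with that edge
  this gives \<open>t\<close> disjoint edges, whose ends miss little of the other parts.
\<close>

lemma parts_independent:
  assumes uv: "u \<in> V - hub_set" "v \<in> V - hub_set" "part_of u = part_of v"
  shows "\<not> E u v"
proof
  assume E: "E u v"
  define c where "c = part_of u"
  have c: "c < r" "part_of u = c" "part_of v = c" using uv part_of_less by (auto simp: c_def)
  define q where "q = 1 / (10 * real r * real t)"
  have tq: "real t * q = ir / 10" using t0 by (simp add: q_def ir_def)
  have q0: "0 \<le> q" by (simp add: q_def)
  obtain a0 where a0: "bij_betw a0 {0..<card hub_set} hub_set" using ex_bij_betw_nat_finite[OF finBB] by blast
  have a0': "inj_on a0 {..<t - 1}" "a0 ` {..<t - 1} = hub_set"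
    using a0 hubs(1) by (auto simp: bij_betw_def atLeast0LessThan)
  have "\<exists>b. inj_on b {..<t - 1} \<and> (\<forall>l<t - 1. b l \<in> (U c \<inter> nbhd E V (a0 l)) - {u, v})"
  proof (rule distinct_representatives)
    fix l assume l: "l < t - 1"
    show "finite (U c \<inter> nbhd E V (a0 l) - {u, v})" using finU[OF c(1)] by blast
    have "a0 l \<in> hub_set" using a0'(2) l by blast
    then have "real t + 2 \<le> real (card (U c \<inter> nbhd E V (a0 l)))" using c(1) n\<delta> unfolding hub_set_def by force
    then have "t + 2 \<le> card (U c \<inter> nbhd E V (a0 l))" by linarith
    moreover have "card (U c \<inter> nbhd E V (a0 l)) - card {u, v} \<le> card (U c \<inter> nbhd E V (a0 l) - {u, v})"
      by (intro diff_card_le_card_Diff) auto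
    moreover have "card {u, v} \<le> 2" by (simp add: card_insert_if)
    ultimately show "t - 1 \<le> card (U c \<inter> nbhd E V (a0 l) - {u, v})" by linarith
  qed
  then obtain b0 where b0: "inj_on b0 {..<t - 1}" "\<And>l. l < t - 1 \<Longrightarrow> b0 l \<in> (U c \<inter> nbhd E V (a0 l)) - {u, v}" by blast
  define a where "a = a0(t - 1 := u)"
  define b where "b = b0(t - 1 := v)"
  have tt: "{..<t} = insert (t - 1) {..<t - 1}" using t1 by auto
  have uv': "u \<noteq> v" using E irr by (auto simp: irreflp_def)
  have aB: "a l \<in> hub_set" if "l < t - 1" for l using a0'(2) that by (auto simp: a_def)
  have bU: "b l \<in> U c - {u, v}" "E (a l) (b l)" if "l < t - 1" for l
    using b0(2)[OF that] that by (auto simp: a_def b_def nbhd_def)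
  have al: "a (t - 1) = u" "b (t - 1) = v" by (simp_all add: a_def b_def)
  have BBU: "w \<notin> U c" if "w \<in> hub_set" for w using hub_set_U c(1) that by blast
  have de: "disjoint_edges E V t a b"
    unfolding disjoint_edges_def
  proof (intro conjI allI impI)
    have "inj_on a {..<t - 1}" using a0'(1) by (auto simp: a_def inj_on_def)
    moreover have "a ` ({..<t - 1} - {t - 1}) \<subseteq> hub_set" using aB by auto
    ultimately show "inj_on a {..<t}" unfolding tt inj_on_insert al using uv(1) by blast
    have "inj_on b {..<t - 1}" using b0(1) by (auto simp: b_def inj_on_def)
    moreover have "b ` ({..<t - 1} - {t - 1}) \<subseteq> U c - {u, v}" using bU(1) by auto
    ultimately show "inj_on b {..<t}" unfolding tt inj_on_insert al by blast
    fix l assume "l < t"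
    then consider "l < t - 1" | "l = t - 1" by linarith
    then have "a l \<in> V \<and> b l \<in> V \<and> E (a l) (b l)"
    proof cases
      case 1
      then show ?thesis using aB[OF 1] bU[OF 1] hub_set_V coreD(1)[OF core c(1)] by blast
    next
      case 2
      then show ?thesis using al uv E by simp
    qed
    then show "a l \<in> V" "b l \<in> V" "E (a l) (b l)" by simp_all
  next
    show "a ` {..<t} \<inter> b ` {..<t} = {}"
      unfolding tt image_insert al using aB bU uv uv' BBU by fastforce
  qed
  show False
  proof (rule no_matching_missing[OF c(1) de])
    fix l d assume l: "l < t" and d: "d < r" "d \<noteq> c"
    have "real (card (U d - nbhd E V (a l))) + real (card (U d - nbhd E V (b l))) \<le> (q + \<epsilon> + 2 * (25 * \<sigma> + \<delta>)) * nn"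
    proof (cases "l = t - 1")
      case True
      have "real (card (U d - nbhd E V u)) \<le> (25 * \<sigma> + \<delta>) * nn" "real (card (U d - nbhd E V v)) \<le> (25 * \<sigma> + \<delta>) * nn"
        using part_of_missing[OF uv(1) d(1)] part_of_missing[OF uv(2) d(1)] d(2) c by auto
      moreover have "0 \<le> (q + \<epsilon>) * nn" using q0 \<epsilon>pos n_pos by simp
      ultimately show ?thesis using True al by (simp add: algebra_simps)
    next
      case False
      then have l': "l < t - 1" using l by linarith
      have "card (U d - nbhd E V (a l)) \<le> card (UU - nbhd E V (a l))" using finUU d(1) by (intro card_mono) auto
      then have 1: "real (card (U d - nbhd E V (a l))) \<le> nn * q" using hubs(2)[OF aB[OF l']] by (simp add: deficit_def q_def)
      have 2: "real (card (U d - nbhd E V (b l))) \<le> \<epsilon> * nn" using coreD(5)[OF core c(1) d(1)] d(2) bU(1)[OF l'] by auto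
      have "0 \<le> (2 * (25 * \<sigma> + \<delta>)) * nn" using e_bounds(5) \<delta>(1) n_pos by simp
      then show ?thesis using 1 2 by (simp add: algebra_simps)
    qed
    then show "real (card (U d - nbhd E V (a l) \<inter> nbhd E V (b l))) \<le> (q + \<epsilon> + 2 * (25 * \<sigma> + \<delta>)) * nn"
      using card_Diff_Int_le[OF finU[OF d(1)], of "nbhd E V (a l)" "nbhd E V (b l)"] by linarith
  next
    have "real t * (q + \<epsilon> + 2 * (25 * \<sigma> + \<delta>)) = real t * q + real t * \<epsilon> + 50 * (real t * \<sigma>) + 2 * (real t * \<delta>)"
      by (simp add: algebra_simps)
    then show "real t * (q + \<epsilon> + 2 * (25 * \<sigma> + \<delta>)) \<le> ir / 2" using tq t_small ir(2) by linarith
  qed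
qed

lemma hub_structure:
  "\<exists>B \<pi>. B \<subseteq> V \<and> card B = t - 1 \<and> (\<forall>u\<in>V. \<pi> u < r) \<and> (\<forall>u\<in>V. \<forall>v\<in>V. E u v \<longrightarrow> hub_join B \<pi> u v)"
proof (intro exI conjI ballI impI)
  show "hub_set \<subseteq> V" by (rule hub_set_V)
  show "card hub_set = t - 1" by (rule hubs(1))
  show "part_of u < r" if "u \<in> V" for u by (rule part_of_less[OF that])
  show "hub_join hub_set part_of u v" if "u \<in> V" "v \<in> V" "E u v" for u v
    using parts_independent[of u v] that irr by (auto simp: hub_join_def irreflp_def)
qed

end

context forbidden
begin

text \<open>
  It remains to choose the constants of \<open>core_setting\<close> and to rescale the Perron vector.
\<close>

lemma extremal_structure:
  "\<exists>N. \<forall>E V. extremal s A E V \<and> N \<le> card V \<longrightarrow>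
    (\<exists>B \<pi>. B \<subseteq> V \<and> card B = t - 1 \<and> (\<forall>u\<in>V. \<pi> u < r) \<and> (\<forall>u\<in>V. \<forall>v\<in>V. E u v \<longrightarrow> hub_join B \<pi> u v))"
proof -
  have r0: "3 \<le> real r" and t0: "1 \<le> real t" using r3 t1 by simp_all
  define \<delta> where "\<delta> = 1 / (8192 * (real r)\<^sup>2 * (real t)\<^sup>2)"
  have \<delta>: "0 < \<delta>" "8192 * (real r)\<^sup>2 * (real t)\<^sup>2 * \<delta> \<le> 1" using r0 t0 by (simp_all add: \<delta>_def)
  obtain C :: nat where "real t / (\<delta> / 2) ^ r < real C" using reals_Archimedean2 by blast
  then have C: "real t \<le> (\<delta> / 2) ^ r * real C" using \<delta>(1) by (simp add: pos_divide_less_eq mult.commute)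
  have C0: "0 < C" using C t0 by (cases C) auto
  define \<kappa> where "\<kappa> = min (\<delta> / 2 ^ (C + 1)) (1 / (8 * (real r)\<^sup>2 * real C * 2 ^ C))"
  have \<kappa>: "0 < \<kappa>" using \<delta> r0 C0 by (simp add: \<kappa>_def)
  have \<kappa>2: "2 ^ (C + 1) * \<kappa> \<le> \<delta>"
  proof -
    have "\<kappa> \<le> \<delta> / 2 ^ (C + 1)" by (simp add: \<kappa>_def)
    then show ?thesis by (simp add: pos_le_divide_eq mult.commute)
  qed
  have \<kappa>3: "8 * (real r)\<^sup>2 * real C * 2 ^ C * \<kappa> \<le> 1"
  proof -
    have "\<kappa> \<le> 1 / (8 * (real r)\<^sup>2 * real C * 2 ^ C)" by (simp add: \<kappa>_def)
    moreover have "0 < 8 * (real r)\<^sup>2 * real C * 2 ^ C" using r0 C0 by simp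
    ultimately show ?thesis by (simp add: pos_le_divide_eq mult.commute)
  qed
  \<comment> \<open>The three upper bounds for \<open>\<epsilon>\<close> come from the choice of \<open>m\<close> vertices in common neighbourhoods, from
    the error terms of the comparison, and from the cloning of a vertex.\<close>
  define a1 where "a1 = 2 * (real r * real m + real t)"
  define a2 where "a2 = 32 * 650 * real r * real t * (real t + real C) * (256 * (real r)\<^sup>2)"
  define a3 where "a3 = 2 * real r * (real s + 1)"
  have a: "0 < a1" "0 < a2" "0 < a3" using r0 t0 by (auto simp: a1_def a2_def a3_def intro!: mult_pos_pos add_nonneg_pos)
  define \<epsilon> where "\<epsilon> = min (\<kappa> / a1) (min (1 / a2) (1 / a3))"
  have \<epsilon>: "0 < \<epsilon>" using a \<kappa> by (simp add: \<epsilon>_def)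
  have "\<epsilon> \<le> \<kappa> / a1" "\<epsilon> \<le> 1 / a2" "\<epsilon> \<le> 1 / a3" by (simp_all add: \<epsilon>_def)
  then have \<epsilon>a: "a1 * \<epsilon> \<le> \<kappa>" "a2 * \<epsilon> \<le> 1" "a3 * \<epsilon> \<le> 1" using a by (simp_all add: pos_le_divide_eq mult.commute)
  define \<sigma> where "\<sigma> = 256 * (real r)\<^sup>2 * \<epsilon>"
  have \<sigma>0: "0 < \<sigma>" using r0 \<epsilon> by (simp add: \<sigma>_def)
  have \<sigma>small: "32 * 650 * real r * real t * (real t + real C) * \<sigma> \<le> 1"
    using \<epsilon>a(2) by (simp add: a2_def \<sigma>_def mult_ac)
  have \<sigma>1: "\<sigma> \<le> 1"
  proof -
    have "1 * 1 \<le> real r * real t" using r0 t0 by (intro mult_mono) auto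
    then have "1 * 1 \<le> (real r * real t) * (real t + real C)" using t0 by (intro mult_mono) auto
    then have "1 * \<sigma> \<le> ((real r * real t) * (real t + real C)) * \<sigma>"
      using \<sigma>0 by (intro mult_right_mono) auto
    moreover have "32 * 650 * real r * real t * (real t + real C) * \<sigma> = 20800 * (((real r * real t) * (real t + real C)) * \<sigma>)"
      by simp
    ultimately show ?thesis using \<sigma>small \<sigma>0 by linarith
  qed
  obtain N1 where N1: "\<And>E V. extremal s A E V \<Longrightarrow> N1 \<le> card V \<Longrightarrow> \<exists>U. core E V r \<epsilon> U"
    using core_of_extremal[OF \<epsilon>] by blast
  obtain N2 :: nat where N2: "2 * real m / \<kappa> + 32 * 25 * real r * (real t)\<^sup>2 * (real t + real C) + (real t + 2) / \<delta>
      + 2 * real r * real s + 1 / \<sigma> + 24 < real N2" using reals_Archimedean2 by blast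
  have "\<exists>B \<pi>. B \<subseteq> V \<and> card B = t - 1 \<and> (\<forall>u\<in>V. \<pi> u < r) \<and> (\<forall>u\<in>V. \<forall>v\<in>V. E u v \<longrightarrow> hub_join B \<pi> u v)"
    if ext: "extremal s A E V" and big: "max N1 N2 \<le> card V" for E V
  proof -
    let ?n = "real (card V)"
    obtain U where core: "core E V r \<epsilon> U" using N1[OF ext] big by auto
    have EV: "finite V" "symp E" "irreflp E" using ext by (auto simp: extremal_def)
    have nn: "0 \<le> 2 * real m / \<kappa>" "0 \<le> 32 * 25 * real r * (real t)\<^sup>2 * (real t + real C)" "0 \<le> (real t + 2) / \<delta>"
      "0 \<le> 2 * real r * real s" "0 \<le> 1 / \<sigma>" using \<kappa> \<delta>(1) \<sigma>0 by simp_all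
    have n: "2 * real m / \<kappa> \<le> ?n" "32 * 25 * real r * (real t)\<^sup>2 * (real t + real C) \<le> ?n" "(real t + 2) / \<delta> \<le> ?n"
      "2 * real r * real s < ?n" "1 / \<sigma> \<le> ?n" "24 \<le> ?n"
      using nn N2 big by linarith+
    have n1: "2 * real m \<le> \<kappa> * ?n" "real t + 2 \<le> \<delta> * ?n" "1 \<le> \<sigma> * ?n"
      using n(1,3,5) \<kappa> \<delta>(1) \<sigma>0 by (simp_all add: pos_divide_le_eq mult.commute)
    have ne: "V \<noteq> {}" using n(6) by auto
    obtain x0 where x0: "perron E V (qidx E V) x0" using perron_qidx[OF EV(1) ne EV(2)] by blast
    have sp: "0 < sum x0 V"
    proof -
      obtain u where u: "u \<in> V" "0 < x0 u" using x0 by (auto simp: perron_def)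
      have "x0 u \<le> sum x0 V" using u EV(1) x0 by (intro member_le_sum) (auto simp: perron_def)
      then show ?thesis using u by linarith
    qed
    define x where "x u = ?n / sum x0 V * x0 u" for u
    have pc: "0 < ?n / sum x0 V" using sp n by simp
    have x: "perron E V (qidx E V) x"
      unfolding x_def by (rule perron_scale[OF x0 pc])
    have "sum x V = ?n / sum x0 V * sum x0 V" unfolding x_def by (rule sum_distrib_left[symmetric])
    then have xs: "sum x V = ?n" using sp by simp
    have q: "5/4 * ?n \<le> qidx E V" "qidx E V \<le> 2 * ?n"
    proof -
      have "2 * (1 - 1 / real r) * ?n - 2 \<le> qidx E V" using extremal_lower[OF ext] n by simp
      moreover have "4/3 * ?n \<le> 2 * (1 - 1 / real r) * ?n" using alpha_bounds(1) by (intro mult_right_mono) auto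
      ultimately show "5/4 * ?n \<le> qidx E V" using n(6) by linarith
      show "qidx E V \<le> 2 * ?n" by (rule order_trans[OF qidx_upper[OF EV(1) ne EV(2,3)]]) simp
    qed
    have x4: "x w \<le> 4" if "w \<in> V" for w
      using core_near_uniform(1)[OF EV core r3 _ x xs q] \<epsilon> that by simp
    have x1: "\<bar>x u - 1\<bar> \<le> \<sigma>" if "i < r" "u \<in> U i" for i u
      using core_near_uniform(2)[OF EV core r3 _ x xs q] \<epsilon> that by (simp add: \<sigma>_def)
    have deg: "(1 - 1 / real r - 24 * \<sigma>) * ?n \<le> real (card (nbhd E V w))" if "w \<in> V" for w
      unfolding \<sigma>_def
      by (rule extremal_min_degree[OF ext core])
        (use \<epsilon>a(3) \<epsilon> \<sigma>1 n n1 x x4 x1 that in \<open>auto simp: a3_def \<sigma>_def\<close>)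
    interpret core_setting s r t m A E V U x \<epsilon> \<sigma> \<delta> \<kappa> C
      by unfold_locales
        (use ext core x x4 x1 deg \<epsilon> \<sigma>_def \<delta> C \<kappa> \<kappa>2 \<kappa>3 \<epsilon>a(1) \<sigma>small n1 n in \<open>auto simp: a1_def\<close>)
    show ?thesis by (rule hub_structure)
  qed
  then show ?thesis by blast
qed

end

section \<open>Balancing the parts of a complete multipartite graph\<close>

lemma qop_iso:
  assumes g: "bij_betw g V W" and E: "\<And>u v. u \<in> V \<Longrightarrow> v \<in> V \<Longrightarrow> E u v \<longleftrightarrow> E' (g u) (g v)" and u: "u \<in> V"
  shows "qop E V (\<lambda>v. y (g v)) u = qop E' W y (g u)"
proof -
  have "bij_betw g (nbhd E V u) (nbhd E' W (g u))"
  proof (rule bij_betw_subset[OF g nbhd_subset])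
    show "g ` nbhd E V u = nbhd E' W (g u)"
      using E[OF u] g by (auto simp: nbhd_def bij_betw_def)
  qed
  then show ?thesis unfolding qop_def by (rule sum.reindex_bij_betw)
qed

lemma qform_iso:
  assumes g: "bij_betw g V W" and E: "\<And>u v. u \<in> V \<Longrightarrow> v \<in> V \<Longrightarrow> E u v \<longleftrightarrow> E' (g u) (g v)"
  shows "qform E V (\<lambda>v. y (g v)) = qform E' W y" "nrm2 V (\<lambda>v. y (g v)) = nrm2 W y"
proof -
  have "qform E V (\<lambda>v. y (g v)) = (\<Sum>u\<in>V. y (g u) * qop E' W y (g u))"
    unfolding qform_def by (intro sum.cong refl) (simp add: qop_iso[where g = g and E = E and E' = E', OF g E])
  also have "\<dots> = qform E' W y" unfolding qform_def by (rule sum.reindex_bij_betw[OF g])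
  finally show "qform E V (\<lambda>v. y (g v)) = qform E' W y" .
  show "nrm2 V (\<lambda>v. y (g v)) = nrm2 W y" unfolding nrm2_def by (rule sum.reindex_bij_betw[OF g])
qed

lemma perron_iso:
  assumes g: "bij_betw g V W" and E: "\<And>u v. u \<in> V \<Longrightarrow> v \<in> V \<Longrightarrow> E u v \<longleftrightarrow> E' (g u) (g v)"
    and y: "perron E' W q y"
  shows "perron E V q (\<lambda>v. y (g v))"
proof -
  have gW: "g u \<in> W" if "u \<in> V" for u using g that by (auto simp: bij_betw_def)
  have max: "qform E V z \<le> q * nrm2 V z" for z
  proof -
    let ?z = "\<lambda>w. z (inv_into V g w)"
    have inv: "?z (g u) = z u" if "u \<in> V" for u using g that by (simp add: bij_betw_inv_into_left)
    have "qform E V z = qform E V (\<lambda>u. ?z (g u))" "nrm2 V z = nrm2 V (\<lambda>u. ?z (g u))"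
      using inv by (auto intro: qform_cong nrm2_cong)
    then show ?thesis using y qform_iso[where g = g and E = E and E' = E' and y = ?z, OF g E] by (simp add: perron_def)
  qed
  obtain w where w: "w \<in> W" "0 < y w" using y by (auto simp: perron_def)
  then obtain u where "u \<in> V" "g u = w" using g by (auto simp: bij_betw_def)
  then have "\<exists>u\<in>V. 0 < y (g u)" using w by blast
  then show ?thesis
    unfolding perron_def using max y gW by (auto simp: perron_def qop_iso[where g = g and E = E and E' = E', OF g E])
qed

lemma qidx_iso:
  assumes "finite V" "V \<noteq> {}" "symp E'" and g: "bij_betw g V W" and E: "\<And>u v. u \<in> V \<Longrightarrow> v \<in> V \<Longrightarrow> E u v \<longleftrightarrow> E' (g u) (g v)"
  shows "qidx E V = qidx E' W"
proof -
  have "finite W" "W \<noteq> {}" using bij_betw_finite[OF g] g assms(1,2) by (auto simp: bij_betw_def)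
  then obtain y where "perron E' W (qidx E' W) y" using perron_qidx assms(3) by blast
  from perron_iso[where g = g and E = E and E' = E', OF g E this] show ?thesis by (rule qidx_eq[OF assms(1)])
qed

lemma qidx_cong:
  assumes "finite V" "V \<noteq> {}" "symp E'" "\<And>u v. u \<in> V \<Longrightarrow> v \<in> V \<Longrightarrow> E u v \<longleftrightarrow> E' u v"
  shows "qidx E V = qidx E' V"
  by (rule qidx_iso[OF assms(1-3), of id]) (use assms(4) in auto)

lemma copy_free_iso:
  assumes g: "bij_betw g V W" and E: "\<And>u v. u \<in> V \<Longrightarrow> v \<in> V \<Longrightarrow> E u v \<longleftrightarrow> E' (g u) (g v)"
    and copy_free: "copy_free s A E' W"
  shows "copy_free s A E V"
  unfolding copy_free_def
proof
  assume "\<exists>f. inj_on f {..<s} \<and> f ` {..<s} \<subseteq> V \<and> (\<forall>u<s. \<forall>v<s. A u v \<longrightarrow> E (f u) (f v))"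
  then obtain f where f: "inj_on f {..<s}" "f ` {..<s} \<subseteq> V" "\<And>u v. \<lbrakk>u < s; v < s; A u v\<rbrakk> \<Longrightarrow> E (f u) (f v)" by blast
  have "inj_on (g \<circ> f) {..<s}" using f(1,2) g by (meson bij_betw_def comp_inj_on inj_on_subset)
  moreover have "(g \<circ> f) ` {..<s} \<subseteq> W" using f(2) g by (auto simp: bij_betw_def)
  moreover have "\<forall>u<s. \<forall>v<s. A u v \<longrightarrow> E' ((g \<circ> f) u) ((g \<circ> f) v)"
  proof (intro allI impI)
    fix u v assume uv: "u < s" "v < s" "A u v"
    have "f u \<in> V" "f v \<in> V" using f(2) uv by auto
    then show "E' ((g \<circ> f) u) ((g \<circ> f) v)" using E f(3)[OF uv] by simp
  qed
  ultimately show False using copy_free unfolding copy_free_def by blast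
qed

text \<open>
  A vertex with a label of its own is adjacent to all others, so joins with a complete graph are covered.
\<close>

definition multipartite :: "('a \<Rightarrow> nat) \<Rightarrow> 'a \<Rightarrow> 'a \<Rightarrow> bool" where
  "multipartite lab u v \<longleftrightarrow> lab u \<noteq> lab v"

definition label_class :: "('a \<Rightarrow> nat) \<Rightarrow> 'a set \<Rightarrow> nat \<Rightarrow> 'a set" where
  "label_class lab V l = {v \<in> V. lab v = l}"

lemma symp_multipartite: "symp (multipartite lab)" and irreflp_multipartite: "irreflp (multipartite lab)"
  by (auto simp: multipartite_def symp_def irreflp_def)

lemma qop_multipartite:
  assumes fin: "finite V" and u: "u \<in> V"
  shows "qop (multipartite lab) V x u = (real (card V) - real (card (label_class lab V (lab u)))) * x u + sum x V - sum x (label_class lab V (lab u))"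
proof -
  have sub: "label_class lab V (lab u) \<subseteq> V" by (auto simp: label_class_def)
  have nbhd: "nbhd (multipartite lab) V u = V - label_class lab V (lab u)" by (auto simp: nbhd_def multipartite_def label_class_def)
  have "finite (label_class lab V (lab u))" using sub fin by (rule finite_subset)
  then have "card (nbhd (multipartite lab) V u) = card V - card (label_class lab V (lab u))" unfolding nbhd using sub by (simp add: card_Diff_subset)
  then have "real (card (nbhd (multipartite lab) V u)) = real (card V) - real (card (label_class lab V (lab u)))"
    using card_mono[OF fin sub] by (simp add: of_nat_diff)
  moreover have "sum x (nbhd (multipartite lab) V u) = sum x V - sum x (label_class lab V (lab u))"
    unfolding nbhd using sum.subset_diff[OF sub fin, of x] by linarith
  ultimately show ?thesis by (simp add: qop_alt[OF fin])
qed

text \<open>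
  The eigenvector equation says that \<open>x u\<close> depends only on the size of the class of \<open>u\<close>.
\<close>

lemma multipartite_eigenvector:
  assumes fin: "finite V" and x: "\<And>u. u \<in> V \<Longrightarrow> qop (multipartite lab) V x u = q * x u"
    and q: "real (card V) < q" and u: "u \<in> V"
  shows "x u * (q - real (card V) + 2 * real (card (label_class lab V (lab u)))) = sum x V"
proof -
  let ?c = "label_class lab V (lab u)"
  have eq: "x v * (q - real (card V) + real (card ?c)) = sum x V - sum x ?c" if "v \<in> ?c" for v
  proof -
    have "v \<in> V" "lab v = lab u" using that by (auto simp: label_class_def)
    then show ?thesis using x[of v] qop_multipartite[OF fin, of v lab x] by (simp add: algebra_simps)
  qed
  have uc: "u \<in> ?c" using u by (simp add: label_class_def)
  have "x v = x u" if "v \<in> ?c" for v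
  proof -
    have "x v * (q - real (card V) + real (card ?c)) = x u * (q - real (card V) + real (card ?c))"
      using eq[OF that] eq[OF uc] by simp
    then show ?thesis using q by simp
  qed
  then have "sum x ?c = real (card ?c) * x u" by simp
  then show ?thesis using eq[OF uc] by (simp add: algebra_simps)
qed

text \<open>
  Solve the equation of \<open>multipartite_eigenvector\<close> for \<open>x u\<close> and sum over all vertices.
\<close>

lemma multipartite_perron_sum:
  assumes fin: "finite V" and p: "perron (multipartite lab) V q x" and q: "real (card V) < q"
  shows "(\<Sum>u\<in>V. 1 / (q - real (card V) + 2 * real (card (label_class lab V (lab u))))) = 1"
    "u \<in> V \<Longrightarrow> 0 < x u"
proof -
  let ?s = "\<lambda>u. q - real (card V) + 2 * real (card (label_class lab V (lab u)))"
  have s: "0 < ?s u" for u using q by simp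
  have eq: "x u * ?s u = sum x V" if "u \<in> V" for u
    by (rule multipartite_eigenvector[OF fin _ q that]) (use p in \<open>simp add: perron_def\<close>)
  have "\<exists>u\<in>V. 0 < x u" "\<forall>u\<in>V. 0 \<le> x u" using p by (auto simp: perron_def)
  then have X: "0 < sum x V" using fin by (meson sum_pos2)
  have xu: "x u = sum x V * (1 / ?s u)" if "u \<in> V" for u using eq[OF that] s[of u] by (simp add: field_simps)
  have "sum x V = (\<Sum>u\<in>V. sum x V * (1 / ?s u))" by (rule sum.cong[OF refl xu])
  also have "\<dots> = sum x V * (\<Sum>u\<in>V. 1 / ?s u)" by (rule sum_distrib_left[symmetric])
  finally show "(\<Sum>u\<in>V. 1 / ?s u) = 1" using X by simp
  show "0 < x u" if "u \<in> V" using xu[OF that] X s[of u] by simp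
qed

text \<open>
  The left-hand side of the equation in \<open>multipartite_perron_sum\<close> decreases in \<open>q\<close>, so a value above
  \<open>1\<close> means that \<open>q\<close> is too small. Concretely, the summands form a test vector with a Rayleigh quotient above \<open>q\<close>.
\<close>

lemma multipartite_improve:
  assumes fin: "finite V" and ne: "V \<noteq> {}" and q: "real (card V) < q"
    and big: "1 < (\<Sum>u\<in>V. 1 / (q - real (card V) + 2 * real (card (label_class lab V (lab u)))))"
  shows "q < qidx (multipartite lab) V"
proof -
  let ?s = "\<lambda>u. q - real (card V) + 2 * real (card (label_class lab V (lab u)))"
  define z where "z u = 1 / ?s u" for u
  have s: "0 < ?s u" for u using q by simp
  have z0: "0 < z u" for u using s by (simp add: z_def)
  have Z: "1 < sum z V" using big by (simp add: z_def)
  have qz: "qop (multipartite lab) V z u = q * z u + (sum z V - 1)" if u: "u \<in> V" for u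
  proof -
    have "sum z (label_class lab V (lab u)) = (\<Sum>v\<in>label_class lab V (lab u). z u)"
      by (intro sum.cong refl) (auto simp: z_def label_class_def)
    then have "sum z (label_class lab V (lab u)) = real (card (label_class lab V (lab u))) * z u" by simp
    moreover have "?s u * z u = 1" using s[of u] by (simp add: z_def)
    ultimately show ?thesis using qop_multipartite[OF fin u, of lab z] by (simp add: algebra_simps)
  qed
  have "qform (multipartite lab) V z = (\<Sum>u\<in>V. q * (z u)\<^sup>2 + (sum z V - 1) * z u)"
    unfolding qform_def by (intro sum.cong refl) (simp add: qz power2_eq_square algebra_simps)
  also have "\<dots> = q * nrm2 V z + (sum z V - 1) * sum z V"
    unfolding nrm2_def by (simp only: sum.distrib sum_distrib_left)
  finally have "qform (multipartite lab) V z = q * nrm2 V z + (sum z V - 1) * sum z V" .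
  moreover have "0 < (sum z V - 1) * sum z V" using Z by (intro mult_pos_pos) auto
  ultimately have "q * nrm2 V z < qidx (multipartite lab) V * nrm2 V z"
    using rayleigh_le[OF fin ne symp_multipartite, of lab z] by linarith
  then show ?thesis using nrm2_nonneg[of V z] by (simp add: mult_less_cancel_right)
qed

text \<open>
  Strict concavity of \<open>m / (c + 2 m)\<close>.
\<close>

lemma share_concave:
  fixes c :: real and a b :: nat
  assumes c: "0 < c" and ab: "b + 2 \<le> a"
  shows "real a / (c + 2 * real a) + real b / (c + 2 * real b) <
    real (a - 1) / (c + 2 * real (a - 1)) + real (b + 1) / (c + 2 * real (b + 1))"
proof -
  have \<phi>: "real y / (c + 2 * real y) = 1/2 - c / 2 * (1 / (c + 2 * real y))" for y :: nat
  proof -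
    have "0 < c + 2 * real y" using c by simp
    then show ?thesis by (simp add: field_simps)
  qed
  define A where "A = c + 2 * real a"
  define B where "B = c + 2 * real b"
  have AB: "0 < B" "B + 4 \<le> A" using c ab by (auto simp: A_def B_def)
  have "1 / (A - 2) + 1 / (B + 2) < 1 / A + 1 / B"
  proof -
    have "1 / (A - 2) + 1 / (B + 2) = (A + B) / ((A - 2) * (B + 2))" using AB by (simp add: field_simps)
    also have "\<dots> < (A + B) / (A * B)"
    proof (rule divide_strict_left_mono)
      have "0 < 2 * A - 2 * B - 4" using AB by linarith
      then show "A * B < (A - 2) * (B + 2)" by (simp add: algebra_simps)
      show "0 < A + B" using AB by linarith
      show "0 < (A - 2) * (B + 2) * (A * B)" using AB by (intro mult_pos_pos) auto
    qed
    also have "\<dots> = 1 / A + 1 / B" using AB by (simp add: field_simps)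
    finally show ?thesis .
  qed
  then have "c / 2 * (1 / (A - 2) + 1 / (B + 2)) < c / 2 * (1 / A + 1 / B)" using c by (intro mult_strict_left_mono) auto
  moreover have "c + 2 * real (a - 1) = A - 2" "c + 2 * real (b + 1) = B + 2" using ab by (auto simp: A_def B_def of_nat_diff)
  ultimately have "real a / (c + 2 * real a) = 1/2 - c / 2 * (1 / A)" "real b / (c + 2 * real b) = 1/2 - c / 2 * (1 / B)"
    "real (a - 1) / (c + 2 * real (a - 1)) = 1/2 - c / 2 * (1 / (A - 2))"
    "real (b + 1) / (c + 2 * real (b + 1)) = 1/2 - c / 2 * (1 / (B + 2))"
    using \<phi>[of a] \<phi>[of b] \<phi>[of "a - 1"] \<phi>[of "b + 1"] unfolding A_def B_def by metis+
  moreover have "1/2 - w + (1/2 - y) < 1/2 - w' + (1/2 - y')" if "w' + y' < w + y" for w y w' y' :: real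
    using that by simp
  ultimately show ?thesis using \<open>c / 2 * (1 / (A - 2) + 1 / (B + 2)) < c / 2 * (1 / A + 1 / B)\<close>
    by (simp only: distrib_left)
qed

lemma share_by_class:
  fixes c :: real
  assumes fin: "finite V" and L: "finite L" "lab ` V \<subseteq> L"
  shows "(\<Sum>u\<in>V. 1 / (c + 2 * real (card (label_class lab V (lab u))))) =
    (\<Sum>l\<in>L. real (card (label_class lab V l)) / (c + 2 * real (card (label_class lab V l))))"
proof -
  have "(\<Sum>u\<in>V. 1 / (c + 2 * real (card (label_class lab V (lab u))))) =
    (\<Sum>l\<in>L. \<Sum>u\<in>{u \<in> V. lab u = l}. 1 / (c + 2 * real (card (label_class lab V (lab u)))))"
    by (rule sum.group[OF fin L, symmetric])
  also have "\<dots> = (\<Sum>l\<in>L. real (card (label_class lab V l)) / (c + 2 * real (card (label_class lab V l))))"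
  proof (intro sum.cong refl)
    fix l
    have "(\<Sum>u\<in>{u \<in> V. lab u = l}. 1 / (c + 2 * real (card (label_class lab V (lab u))))) =
      (\<Sum>u\<in>label_class lab V l. 1 / (c + 2 * real (card (label_class lab V l))))" by (intro sum.cong) (auto simp: label_class_def)
    then show "(\<Sum>u\<in>{u \<in> V. lab u = l}. 1 / (c + 2 * real (card (label_class lab V (lab u))))) =
      real (card (label_class lab V l)) / (c + 2 * real (card (label_class lab V l)))" by simp
  qed
  finally show ?thesis .
qed

text \<open>
  Moving a vertex from a class to one that is smaller by at least two raises the sum of
  \<open>multipartite_perron_sum\<close> above \<open>1\<close>.
\<close>

lemma multipartite_move:
  assumes fin: "finite V" and v: "v \<in> V" and j: "j \<noteq> lab v"
    and ab: "card (label_class lab V j) + 2 \<le> card (label_class lab V (lab v))"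
    and q: "real (card V) < qidx (multipartite lab) V"
  shows "qidx (multipartite lab) V < qidx (multipartite (lab(v := j))) V"
proof (rule multipartite_improve[OF fin _ q])
  let ?q = "qidx (multipartite lab) V" and ?l = "lab(v := j)" and ?i = "lab v"
  let ?L = "insert j (lab ` V)"
  define c where "c = ?q - real (card V)"
  define \<phi> where "\<phi> m = real m / (c + 2 * real m)" for m :: nat
  show ne: "V \<noteq> {}" using v by blast
  have c: "0 < c" using q by (simp add: c_def)
  have finc: "finite (label_class lab V l)" for l using fin by (simp add: label_class_def)
  have cj: "label_class ?l V j = insert v (label_class lab V j)" using v by (auto simp: label_class_def)
  have ci: "label_class ?l V ?i = label_class lab V ?i - {v}" using j by (auto simp: label_class_def)
  have co: "label_class ?l V l = label_class lab V l" if "l \<noteq> j" "l \<noteq> ?i" for l using that by (auto simp: label_class_def)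
  have cards: "card (label_class ?l V j) = card (label_class lab V j) + 1" "card (label_class ?l V ?i) = card (label_class lab V ?i) - 1"
    unfolding cj ci using finc v j by (auto simp: label_class_def)
  have split: "(\<Sum>l\<in>?L. h l) = h ?i + (h j + (\<Sum>l\<in>?L - {?i} - {j}. h l))" for h :: "nat \<Rightarrow> real"
  proof -
    have "(\<Sum>l\<in>?L. h l) = h ?i + (\<Sum>l\<in>?L - {?i}. h l)" using fin v by (intro sum.remove) auto
    also have "(\<Sum>l\<in>?L - {?i}. h l) = h j + (\<Sum>l\<in>?L - {?i} - {j}. h l)" using fin j by (intro sum.remove) auto
    finally show ?thesis .
  qed
  obtain x where x: "perron (multipartite lab) V ?q x" using perron_qidx[OF fin ne symp_multipartite] by blast
  have "1 = (\<Sum>l\<in>?L. \<phi> (card (label_class lab V l)))"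
    using multipartite_perron_sum(1)[OF fin x q] share_by_class[OF fin, of ?L lab c] fin by (auto simp: c_def \<phi>_def)
  also have "\<dots> = \<phi> (card (label_class lab V ?i)) + (\<phi> (card (label_class lab V j)) + (\<Sum>l\<in>?L - {?i} - {j}. \<phi> (card (label_class lab V l))))" by (rule split)
  also have "\<dots> < \<phi> (card (label_class ?l V ?i)) + (\<phi> (card (label_class ?l V j)) + (\<Sum>l\<in>?L - {?i} - {j}. \<phi> (card (label_class lab V l))))"
    using share_concave[OF c ab] unfolding cards \<phi>_def by simp
  also have "(\<Sum>l\<in>?L - {?i} - {j}. \<phi> (card (label_class lab V l))) = (\<Sum>l\<in>?L - {?i} - {j}. \<phi> (card (label_class ?l V l)))"
    by (intro sum.cong refl) (simp add: co)
  also have "\<phi> (card (label_class ?l V ?i)) + (\<phi> (card (label_class ?l V j)) + \<dots>) = (\<Sum>l\<in>?L. \<phi> (card (label_class ?l V l)))" by (rule split[symmetric])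
  also have "\<dots> = (\<Sum>u\<in>V. 1 / (c + 2 * real (card (label_class ?l V (?l u)))))"
    unfolding \<phi>_def using fin by (intro share_by_class[symmetric]) auto
  finally show "1 < (\<Sum>u\<in>V. 1 / (?q - real (card V) + 2 * real (card (label_class ?l V (?l u)))))" by (simp add: c_def)
qed

context forbidden
begin

text \<open>
  By \<open>extremal_structure\<close> the graph is a subgraph of a join, and the join is free. Its index is therefore
  the same, so the Perron vector of the graph is also one of the join. There all its entries are positive, and no edge of
  the join can be missing. If the parts were not balanced, moving a vertex would increase the index.
\<close>

lemma extremal_is_balanced_multipartite:
  "\<exists>N. \<forall>E V. extremal s A E V \<and> N \<le> card V \<longrightarrow>
    (\<exists>B \<pi>. B \<subseteq> V \<and> card B = t - 1 \<and> (\<forall>u\<in>V. \<pi> u < r) \<and> (\<forall>u\<in>V. \<forall>v\<in>V. E u v \<longleftrightarrow> hub_join B \<pi> u v) \<and>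
      (\<forall>i<r. \<forall>j<r. card {v \<in> V - B. \<pi> v = i} \<le> card {v \<in> V - B. \<pi> v = j} + 1))"
proof -
  obtain N where N0: "\<forall>E V. extremal s A E V \<and> N \<le> card V \<longrightarrow>
    (\<exists>B \<pi>. B \<subseteq> V \<and> card B = t - 1 \<and> (\<forall>u\<in>V. \<pi> u < r) \<and> (\<forall>u\<in>V. \<forall>v\<in>V. E u v \<longrightarrow> hub_join B \<pi> u v))"
    using extremal_structure ..
  have N: "\<exists>B \<pi>. B \<subseteq> V \<and> card B = t - 1 \<and> (\<forall>u\<in>V. \<pi> u < r) \<and> (\<forall>u\<in>V. \<forall>v\<in>V. E u v \<longrightarrow> hub_join B \<pi> u v)"
    if "extremal s A E V" "N \<le> card V" for E V
    using N0[THEN spec, THEN spec, THEN mp, OF conjI[OF that]] .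
  have "\<exists>B \<pi>. B \<subseteq> V \<and> card B = t - 1 \<and> (\<forall>u\<in>V. \<pi> u < r) \<and> (\<forall>u\<in>V. \<forall>v\<in>V. E u v \<longleftrightarrow> hub_join B \<pi> u v) \<and>
      (\<forall>i<r. \<forall>j<r. card {v \<in> V - B. \<pi> v = i} \<le> card {v \<in> V - B. \<pi> v = j} + 1)"
    if ext: "extremal s A E V" and big: "max N 7 \<le> card V" for E V
  proof -
    have EV: "finite V" "symp E" "irreflp E" "copy_free s A E V" using ext by (auto simp: extremal_def)
    have ne: "V \<noteq> {}" using big by auto
    have "N \<le> card V" using big by simp
    obtain B \<pi> where B: "B \<subseteq> V" "card B = t - 1" and \<pi>0: "\<forall>u\<in>V. \<pi> u < r"
      and sub0: "\<forall>u\<in>V. \<forall>v\<in>V. E u v \<longrightarrow> hub_join B \<pi> u v" using N[OF ext \<open>N \<le> card V\<close>] by (elim exE conjE)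
    have \<pi>: "\<pi> u < r" if "u \<in> V" for u using \<pi>0 that by blast
    have sub: "hub_join B \<pi> u v" if "u \<in> V" "v \<in> V" "E u v" for u v using sub0 that by blast
    let ?q = "qidx E V"
    have maxq: "qidx E' V \<le> ?q" if "symp E'" "irreflp E'" "copy_free s A E' V" for E'
      using ext EV(1) that unfolding extremal_def by blast
    have cBt: "card B < t" using B(2) t1 by simp
    \<comment> \<open>The vertices of \<open>B\<close> receive distinct labels that are not used by the parts.\<close>
    define lb where "lb \<rho> u = (if u \<in> B then r + u else \<rho> u)" for \<rho> :: "nat \<Rightarrow> nat" and u
    have lbm: "multipartite (lb \<rho>) u v \<longleftrightarrow> hub_join B \<rho> u v" if "u \<in> V" "v \<in> V" "\<And>u. u \<in> V \<Longrightarrow> \<rho> u < r" for \<rho> u v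
      using that(3)[OF that(1)] that(3)[OF that(2)] by (auto simp: lb_def multipartite_def hub_join_def)
    have cmq: "qidx (multipartite (lb \<rho>)) V \<le> ?q" if \<rho>: "\<And>u. u \<in> V \<Longrightarrow> \<rho> u < r" for \<rho>
    proof -
      have "qidx (multipartite (lb \<rho>)) V = qidx (hub_join B \<rho>) V"
        by (rule qidx_cong[OF EV(1) ne symp_hub_join]) (use lbm \<rho> in blast)
      also have "\<dots> \<le> ?q" by (rule maxq[OF symp_hub_join irreflp_hub_join hub_join_free[OF EV(1) B(1) cBt]]) (use \<rho> in auto)
      finally show ?thesis .
    qed
    obtain x where x: "perron E V ?q x" using perron_qidx[OF EV(1) ne EV(2)] by blast
    have xpos: "0 < nrm2 V x" by (rule perron_nrm2_pos[OF EV(1) x])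
    let ?C = "multipartite (lb \<pi>)"
    have subC: "?C u v" if "u \<in> V" "v \<in> V" "E u v" for u v using sub[OF that] lbm[where \<rho> = \<pi>, OF that(1,2) \<pi>] by simp
    have diff: "2 * qform ?C V x - 2 * qform E V x = (\<Sum>u\<in>V. \<Sum>v\<in>V. if ?C u v \<and> \<not> E u v then (x u + x v)\<^sup>2 else 0)"
    proof -
      have "2 * qform ?C V x - 2 * qform E V x = (\<Sum>u\<in>V. \<Sum>v\<in>V. (if ?C u v then (x u + x v)\<^sup>2 else 0) - (if E u v then (x u + x v)\<^sup>2 else 0))"
        unfolding qform_edges[OF EV(1) symp_multipartite] qform_edges[OF EV(1,2)] sum_nbhd[OF EV(1)] by (simp add: sum_subtractf)
      also have "\<dots> = (\<Sum>u\<in>V. \<Sum>v\<in>V. if ?C u v \<and> \<not> E u v then (x u + x v)\<^sup>2 else 0)"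
        using subC by (intro sum.cong refl) auto
      finally show ?thesis .
    qed
    have nonneg: "0 \<le> (\<Sum>u\<in>V. \<Sum>v\<in>V. if ?C u v \<and> \<not> E u v then (x u + x v)\<^sup>2 else 0)"
      by (intro sum_nonneg) auto
    have ray: "qform ?C V y \<le> ?q * nrm2 V y" for y
    proof -
      have "qform ?C V y \<le> qidx ?C V * nrm2 V y" by (rule rayleigh_le[OF EV(1) ne symp_multipartite])
      also have "\<dots> \<le> ?q * nrm2 V y" using cmq[OF \<pi>] nrm2_nonneg by (rule mult_right_mono)
      finally show ?thesis .
    qed
    have eqx: "qform ?C V x = ?q * nrm2 V x"
      using ray[of x] diff nonneg perron_qform[OF x] by linarith
    have eig: "qop ?C V x u = ?q * x u" if "u \<in> V" for u
      by (rule maximiser_eigen[OF EV(1) symp_multipartite ray eqx that])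
    have pC: "perron ?C V ?q x" using x eig ray unfolding perron_def by blast
    have qC: "qidx ?C V = ?q" by (rule qidx_eq[OF EV(1) pC])
    have qn: "real (card V) < ?q"
    proof -
      have "2 * (1 - 1 / real r) * real (card V) - 2 \<le> ?q" using extremal_lower[OF ext] big by simp
      moreover have "2 * (2/3) * real (card V) \<le> 2 * (1 - 1 / real r) * real (card V)"
        using alpha_bounds(1) by (intro mult_right_mono) auto
      moreover have "7 \<le> real (card V)" using big by simp
      ultimately show ?thesis by linarith
    qed
    have xp: "0 < x u" if "u \<in> V" for u by (rule multipartite_perron_sum(2)[OF EV(1) pC qn that])
    have all: "E u v" if uv: "u \<in> V" "v \<in> V" "?C u v" for u v
    proof (rule ccontr)
      assume nE: "\<not> E u v"
      have "(\<Sum>u\<in>V. \<Sum>v\<in>V. if ?C u v \<and> \<not> E u v then (x u + x v)\<^sup>2 else 0) = 0"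
        using diff eqx perron_qform[OF x] by simp
      then have "(\<Sum>v\<in>V. if ?C u v \<and> \<not> E u v then (x u + x v)\<^sup>2 else 0) = 0"
        using sum_nonneg_eq_0_iff[OF EV(1), of "\<lambda>u. \<Sum>v\<in>V. if ?C u v \<and> \<not> E u v then (x u + x v)\<^sup>2 else 0"] uv(1)
        by (auto simp: sum_nonneg)
      then have "(if ?C u v \<and> \<not> E u v then (x u + x v)\<^sup>2 else 0) = 0"
        using sum_nonneg_eq_0_iff[OF EV(1), of "\<lambda>v. if ?C u v \<and> \<not> E u v then (x u + x v)\<^sup>2 else 0"] uv(2) by auto
      then show False using uv nE xp[OF uv(1)] xp[OF uv(2)] by simp
    qed
    have iff: "E u v \<longleftrightarrow> hub_join B \<pi> u v" if "u \<in> V" "v \<in> V" for u v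
      using all[OF that] subC[OF that] lbm[where \<rho> = \<pi>, OF that \<pi>] by blast
    have bal: "card {v \<in> V - B. \<pi> v = i} \<le> card {v \<in> V - B. \<pi> v = j} + 1" if ij: "i < r" "j < r" for i j
    proof (rule ccontr)
      assume nbhd: "\<not> ?thesis"
      have cl: "label_class (lb \<pi>) V l = {v \<in> V - B. \<pi> v = l}" if "l < r" for l
        using that by (auto simp: label_class_def lb_def)
      have ab: "card (label_class (lb \<pi>) V j) + 2 \<le> card (label_class (lb \<pi>) V i)" using nbhd cl ij by simp
      then have "label_class (lb \<pi>) V i \<noteq> {}" by auto
      then obtain v where v: "v \<in> V" "v \<notin> B" "\<pi> v = i" using cl[OF ij(1)] by blast
      have lv: "lb \<pi> v = i" using v by (simp add: lb_def)
      have "j \<noteq> i" using ab by auto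
      then have "qidx ?C V < qidx (multipartite ((lb \<pi>)(v := j))) V"
        using multipartite_move[OF EV(1) v(1), of j "lb \<pi>"] ab qn qC lv by simp
      moreover have "(lb \<pi>)(v := j) = lb (\<pi>(v := j))" using v(2) by (auto simp: lb_def)
      ultimately have "?q < qidx (multipartite (lb (\<pi>(v := j)))) V" using qC by simp
      moreover have "qidx (multipartite (lb (\<pi>(v := j)))) V \<le> ?q" by (rule cmq) (use \<pi> ij in auto)
      ultimately show False by simp
    qed
    show ?thesis using B \<pi> iff bal by (intro exI[of _ B] exI[of _ \<pi>]) auto
  qed
  then show ?thesis by blast
qed

end

lemma balanced_sizes:
  fixes p :: "nat \<Rightarrow> nat"
  assumes r: "0 < r" and bal: "\<And>i j. i < r \<Longrightarrow> j < r \<Longrightarrow> p i \<le> p j + 1"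
  defines "N \<equiv> \<Sum>i<r. p i"
  shows "card {i. i < r \<and> p i = N div r + 1} = N mod r" "i < r \<Longrightarrow> p i = N div r \<or> p i = N div r + 1"
proof -
  define m where "m = Min (p ` {..<r})"
  have "m \<in> p ` {..<r}" unfolding m_def using r by (intro Min_in) auto
  then obtain i0 where i0: "i0 < r" "p i0 = m" by auto
  have ge: "m \<le> p i" if "i < r" for i unfolding m_def using that by (intro Min_le) auto
  have val: "p i = m \<or> p i = m + 1" if "i < r" for i using ge[OF that] bal[OF that i0(1)] i0(2) by linarith
  let ?K = "{i. i < r \<and> p i = m + 1}"
  have "?K \<subseteq> {..<r} - {i0}" using i0 by auto
  then have "card ?K \<le> card ({..<r} - {i0})" by (intro card_mono) auto
  then have K: "card ?K < r" using i0 by simp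
  have "N = (\<Sum>i<r. m + (if p i = m + 1 then 1 else 0))" unfolding N_def using val by (intro sum.cong) auto
  also have "\<dots> = r * m + card ?K"
  proof -
    have "(\<Sum>i<r. if p i = m + 1 then 1 else 0) = card ({..<r} \<inter> {i. p i = m + 1})" by (simp add: sum.If_cases)
    moreover have "{..<r} \<inter> {i. p i = m + 1} = ?K" by auto
    ultimately show ?thesis by (simp add: sum.distrib)
  qed
  finally have "N = r * m + card ?K" .
  then have "N div r = m" "N mod r = card ?K" using K by simp_all
  then show "card {i. i < r \<and> p i = N div r + 1} = N mod r" "i < r \<Longrightarrow> p i = N div r \<or> p i = N div r + 1"
    using val by simp_all
qed

lemma balanced_sizes_permute:
  fixes p p' :: "nat \<Rightarrow> nat"
  assumes r: "0 < r" and bal: "\<And>i j. i < r \<Longrightarrow> j < r \<Longrightarrow> p i \<le> p j + 1"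
    and bal': "\<And>i j. i < r \<Longrightarrow> j < r \<Longrightarrow> p' i \<le> p' j + 1" and eq: "(\<Sum>i<r. p i) = (\<Sum>i<r. p' i)"
  shows "\<exists>\<sigma>. bij_betw \<sigma> {..<r} {..<r} \<and> (\<forall>i<r. p' (\<sigma> i) = p i)"
proof -
  let ?N = "\<Sum>i<r. p i"
  define K where "K f = {i. i < r \<and> f i = ?N div r + 1}" for f :: "nat \<Rightarrow> nat"
  have c: "card (K p) = card (K p')"
    unfolding K_def using balanced_sizes(1)[where p = p, OF r bal] balanced_sizes(1)[where p = p', OF r bal'] eq by simp
  have val: "p i = ?N div r \<or> p i = ?N div r + 1" "p' i = ?N div r \<or> p' i = ?N div r + 1" if "i < r" for i
    subgoal by (rule balanced_sizes(2)[where p = p, OF r bal that])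
    subgoal unfolding eq by (rule balanced_sizes(2)[where p = p', OF r bal' that])
    done
  have fin: "finite (K f)" "K f \<subseteq> {..<r}" for f by (auto simp: K_def)
  have "\<exists>g. bij_betw g (K p) (K p')" by (rule finite_same_card_bij[OF fin(1) fin(1) c])
  then obtain g where g: "bij_betw g (K p) (K p')" ..
  have "card ({..<r} - K p) = card ({..<r} - K p')" using c fin by (simp add: card_Diff_subset)
  then have "\<exists>g. bij_betw g ({..<r} - K p) ({..<r} - K p')" by (intro finite_same_card_bij) auto
  then obtain g' where g': "bij_betw g' ({..<r} - K p) ({..<r} - K p')" ..
  define \<sigma> where "\<sigma> i = (if i \<in> K p then g i else g' i)" for i
  have "bij_betw \<sigma> (K p \<union> ({..<r} - K p)) (K p' \<union> ({..<r} - K p'))"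
  proof (rule bij_betw_combine)
    show "bij_betw \<sigma> (K p) (K p')" using g by (simp add: \<sigma>_def cong: bij_betw_cong)
    have "bij_betw \<sigma> ({..<r} - K p) ({..<r} - K p') \<longleftrightarrow> bij_betw g' ({..<r} - K p) ({..<r} - K p')"
      by (rule bij_betw_cong) (simp add: \<sigma>_def)
    then show "bij_betw \<sigma> ({..<r} - K p) ({..<r} - K p')" using g' by simp
  qed auto
  moreover have "K p \<union> ({..<r} - K p) = {..<r}" "K p' \<union> ({..<r} - K p') = {..<r}" using fin by blast+
  ultimately have "bij_betw \<sigma> {..<r} {..<r}" by simp
  moreover have "p' (\<sigma> i) = p i" if i: "i < r" for i
  proof (cases "i \<in> K p")
    case True
    then have "g i \<in> K p'" using g by (auto simp: bij_betw_def)
    then show ?thesis using True by (simp add: \<sigma>_def K_def)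
  next
    case False
    then have "g' i \<in> {..<r} - K p'" using g' i by (auto simp: bij_betw_def)
    then have "p' (g' i) = ?N div r" using val(2)[of "g' i"] by (auto simp: K_def)
    moreover have "p i = ?N div r" using False val(1)[OF i] i by (auto simp: K_def)
    ultimately show ?thesis using False by (simp add: \<sigma>_def)
  qed
  ultimately show ?thesis by blast
qed

lemma sum_card_classes:
  fixes \<pi> :: "'a \<Rightarrow> nat"
  assumes "finite W" "\<And>v. v \<in> W \<Longrightarrow> \<pi> v < r"
  shows "(\<Sum>i<r. card {v \<in> W. \<pi> v = i}) = card W"
proof -
  have "(\<Sum>i<r. card {v \<in> W. \<pi> v = i}) = (\<Sum>i\<in>{..<r}. \<Sum>v\<in>{v \<in> W. \<pi> v = i}. 1)" by simp
  also have "\<dots> = (\<Sum>v\<in>W. 1)" using assms by (intro sum.group) auto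
  finally show ?thesis by simp
qed

text \<open>
  Balanced partitions of equally large sets into \<open>r\<close> parts agree up to a bijection; the residue classes modulo
  \<open>r\<close> are the parts of the Turan graph.
\<close>

lemma balanced_bijection:
  fixes \<pi> :: "'a \<Rightarrow> nat"
  assumes r: "0 < r" and fin: "finite W" and \<pi>: "\<And>v. v \<in> W \<Longrightarrow> \<pi> v < r"
    and bal: "\<And>i j. i < r \<Longrightarrow> j < r \<Longrightarrow> card {v \<in> W. \<pi> v = i} \<le> card {v \<in> W. \<pi> v = j} + 1"
  shows "\<exists>f. bij_betw f W {..<card W} \<and> (\<forall>u\<in>W. \<forall>v\<in>W. f u mod r = f v mod r \<longleftrightarrow> \<pi> u = \<pi> v)"
proof -
  let ?N = "card W"
  define R where "R i = {v. v < ?N \<and> v mod r = i}" for i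
  define Z where "Z i = {v \<in> W. \<pi> v = i}" for i
  have "(\<Sum>i<r. card (Z i)) = ?N" unfolding Z_def by (rule sum_card_classes[OF fin \<pi>])
  moreover have "(\<Sum>i<r. card (R i)) = ?N"
    using sum_card_classes[of "{..<?N}" "\<lambda>v. v mod r" r] r by (simp add: R_def)
  ultimately obtain \<sigma> where \<sigma>: "bij_betw \<sigma> {..<r} {..<r}" "\<And>i. i < r \<Longrightarrow> card (R (\<sigma> i)) = card (Z i)"
    using balanced_sizes_permute[OF r, of "\<lambda>i. card (Z i)" "\<lambda>i. card (R i)"] bal turan_parts_balanced
    unfolding Z_def R_def by auto
  have "\<exists>g. bij_betw g (Z i) (R (\<sigma> i))" if "i < r" for i
    by (rule finite_same_card_bij) (use fin \<sigma>(2)[OF that] in \<open>auto simp: Z_def R_def\<close>)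
  then obtain g where g: "\<And>i. i < r \<Longrightarrow> bij_betw (g i) (Z i) (R (\<sigma> i))" by metis
  define f where "f v = g (\<pi> v) v" for v
  have fR: "f v \<in> R (\<sigma> (\<pi> v))" if "v \<in> W" for v
    using g[OF \<pi>[OF that]] that by (auto simp: f_def Z_def bij_betw_def)
  have mods: "f u mod r = f v mod r \<longleftrightarrow> \<pi> u = \<pi> v" if "u \<in> W" "v \<in> W" for u v
  proof -
    have "f u mod r = \<sigma> (\<pi> u)" "f v mod r = \<sigma> (\<pi> v)" using fR[OF that(1)] fR[OF that(2)] by (auto simp: R_def)
    then show ?thesis using \<sigma>(1) \<pi>[OF that(1)] \<pi>[OF that(2)] by (auto simp: bij_betw_def inj_on_def)
  qed
  have "inj_on f W"
  proof (rule inj_onI)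
    fix u v assume uv: "u \<in> W" "v \<in> W" "f u = f v"
    then have "\<pi> u = \<pi> v" using mods[OF uv(1,2)] by simp
    then show "u = v" using uv g[OF \<pi>[OF uv(1)]] by (auto simp: f_def Z_def bij_betw_def inj_on_def)
  qed
  moreover have "f ` W \<subseteq> {..<?N}" using fR by (auto simp: R_def)
  ultimately have "f ` W = {..<?N}" by (intro card_subset_eq) (auto simp: card_image)
  with \<open>inj_on f W\<close> have "bij_betw f W {..<?N}" by (simp add: bij_betw_def)
  then show ?thesis using mods by blast
qed

section \<open>Powers of cycles\<close>

context forbidden
begin

text \<open>
  Up to isomorphism there are only finitely many graphs with \<open>n\<close> vertices.
\<close>

lemma extremal_exists:
  assumes n: "1 \<le> n"
  shows "\<exists>E. extremal s A E {..<n}"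
proof -
  let ?V = "{..<n}"
  define rel where "rel R u v \<longleftrightarrow> (u, v) \<in> R" for R :: "(nat \<times> nat) set" and u v
  define RR where "RR = {R \<in> Pow (?V \<times> ?V). symp (rel R) \<and> irreflp (rel R) \<and> copy_free s A (rel R) ?V}"
  have ne: "?V \<noteq> {}" using n by (auto simp: lessThan_empty_iff)
  have pull: "\<exists>R\<in>RR. qidx (rel R) ?V = qidx E' V'"
    if E': "finite V'" "symp E'" "irreflp E'" "copy_free s A E' V'" "card V' = n" for E' and V' :: "nat set"
  proof -
    obtain g where g: "bij_betw g ?V V'"
      using ex_bij_betw_nat_finite[OF E'(1)] E'(5) by (auto simp: atLeast0LessThan)
    define R where "R = {(u, v). u < n \<and> v < n \<and> E' (g u) (g v)}"
    have RE: "rel R u v \<longleftrightarrow> E' (g u) (g v)" if "u \<in> ?V" "v \<in> ?V" for u v using that by (simp add: rel_def R_def)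
    have "symp (rel R)" "irreflp (rel R)"
      using E'(2,3) by (auto simp: rel_def R_def symp_def irreflp_def)
    moreover have "copy_free s A (rel R) ?V" by (rule copy_free_iso[where g = g and E' = E' and W = V', OF g RE E'(4)])
    ultimately have "R \<in> RR" by (auto simp: RR_def R_def)
    moreover have "qidx (rel R) ?V = qidx E' V'"
      by (rule qidx_iso[where g = g and E' = E' and W = V', OF _ ne E'(2) g RE]) auto
    ultimately show ?thesis by blast
  qed
  have finRR: "finite ((\<lambda>R. qidx (rel R) ?V) ` RR)" by (simp add: RR_def)
  have "\<exists>R\<in>RR. qidx (rel R) ?V = qidx (hub_join {} (\<lambda>v. v mod r)) ?V"
    by (rule pull) (use turan_dense(1)[OF n] symp_hub_join irreflp_hub_join in auto)
  then have "Max ((\<lambda>R. qidx (rel R) ?V) ` RR) \<in> (\<lambda>R. qidx (rel R) ?V) ` RR"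
    using finRR by (intro Max_in) auto
  then obtain R where R: "R \<in> RR" "qidx (rel R) ?V = Max ((\<lambda>R. qidx (rel R) ?V) ` RR)" by auto
  have "extremal s A (rel R) ?V"
    unfolding extremal_def
  proof (intro conjI allI impI)
    fix E' :: "nat \<Rightarrow> nat \<Rightarrow> bool" and V' :: "nat set"
    assume "finite V' \<and> symp E' \<and> irreflp E' \<and> copy_free s A E' V' \<and> card V' = card ?V"
    then obtain R' where "R' \<in> RR" "qidx (rel R') ?V = qidx E' V'" using pull[of V' E'] by auto
    then show "qidx E' V' \<le> qidx (rel R) ?V" unfolding R(2) using finRR by (metis Max_ge image_eqI)
  qed (use R(1) in \<open>auto simp: RR_def\<close>)
  then show ?thesis by blast
qed

end

definition cyc_adj :: "nat \<Rightarrow> nat \<Rightarrow> nat \<Rightarrow> nat \<Rightarrow> bool" where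
  "cyc_adj s k u v \<longleftrightarrow> u < s \<and> v < s \<and> u \<noteq> v \<and> (\<exists>d\<le>k. v = (u + d) mod s \<or> u = (v + d) mod s)"

text \<open>
  The arcs \<open>{z, z + 1, \<dots>, z + k}\<close> modulo \<open>s\<close> that start at the elements \<open>z\<close> of \<open>W\<close> are disjoint.
\<close>

lemma cyc_independent:
  assumes W: "W \<subseteq> {..<s}" and ind: "\<And>y z. y \<in> W \<Longrightarrow> z \<in> W \<Longrightarrow> \<not> cyc_adj s k y z" and k: "k < s"
  shows "card W * (k + 1) \<le> s"
proof -
  let ?h = "\<lambda>(z, i). (z + i) mod s"
  have key: "y = z \<and> i = j" if "y \<in> W" "z \<in> W" "i \<le> j" "j \<le> k" "(y + i) mod s = (z + j) mod s" for y z i j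
  proof -
    have ys: "y < s" "z < s" using that W by auto
    have "[y + i = (z + (j - i)) + i] (mod s)" using that by (simp add: cong_def)
    then have "[y = z + (j - i)] (mod s)" by (simp only: cong_add_rcancel_nat)
    then have y: "y = (z + (j - i)) mod s" using ys by (simp add: cong_def)
    have "y = z"
    proof (rule ccontr)
      assume "y \<noteq> z"
      moreover have "j - i \<le> k" using that by simp
      ultimately have "cyc_adj s k y z" using ys y unfolding cyc_adj_def by blast
      then show False using ind that by blast
    qed
    moreover have "i = j"
    proof -
      have "[0 + z = (j - i) + z] (mod s)" using \<open>[y = z + (j - i)] (mod s)\<close> \<open>y = z\<close> by (simp add: add.commute)
      then have "[0 = j - i] (mod s)" by (simp only: cong_add_rcancel_nat)
      then show ?thesis using that k by (auto simp: cong_def)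
    qed
    ultimately show ?thesis by blast
  qed
  have "inj_on ?h (W \<times> {..k})"
  proof (rule inj_onI, clarify)
    fix y i z j assume "y \<in> W" "z \<in> W" "i \<le> k" "j \<le> k" "(y + i) mod s = (z + j) mod s"
    then show "y = z \<and> i = j" using key[of y z i j] key[of z y j i] by (cases "i \<le> j") auto
  qed
  moreover have "?h ` (W \<times> {..k}) \<subseteq> {..<s}" using k by auto
  ultimately have "card (W \<times> {..k}) \<le> card {..<s}" by (rule card_inj_on_le) simp
  then show ?thesis by (simp add: card_cartesian_product)
qed

text \<open>
  At most \<open>t - 1\<close> vertices of a copy lie in \<open>B\<close>, so more than \<open>p r\<close> lie outside and more than \<open>p\<close> of
  these in one part. They are independent in the copy, contrary to \<open>cyc_independent\<close>.
\<close>

lemma cyc_hub_join_free: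
  fixes V :: "nat set"
  assumes s: "s = p * r + t" "s < (p + 1) * (k + 1)" "k < s" and t: "1 \<le> t"
    and V: "finite V" "B \<subseteq> V" "card B < t" "\<And>u. u \<in> V - B \<Longrightarrow> \<pi> u < r"
  shows "copy_free s (cyc_adj s k) (hub_join B \<pi>) V"
  unfolding copy_free_def
proof
  assume "\<exists>f. inj_on f {..<s} \<and> f ` {..<s} \<subseteq> V \<and> (\<forall>u<s. \<forall>v<s. cyc_adj s k u v \<longrightarrow> hub_join B \<pi> (f u) (f v))"
  then obtain f where f: "inj_on f {..<s}" "f ` {..<s} \<subseteq> V"
    "\<And>u v. \<lbrakk>u < s; v < s; cyc_adj s k u v\<rbrakk> \<Longrightarrow> hub_join B \<pi> (f u) (f v)" by blast
  let ?I = "{z \<in> {..<s}. f z \<in> B}" and ?J = "{z \<in> {..<s}. f z \<notin> B}"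
  have finB: "finite B" using V finite_subset by blast
  have "card ?I \<le> card B"
    by (rule card_inj_on_le[of f]) (use f(1) finB in \<open>auto intro: inj_on_subset\<close>)
  moreover have "card {..<s} = card ?I + card ?J"
  proof -
    have "{..<s} = ?I \<union> ?J" by auto
    then have "card {..<s} = card (?I \<union> ?J)" by (rule arg_cong)
    also have "\<dots> = card ?I + card ?J" by (rule card_Un_disjoint) auto
    finally show ?thesis .
  qed
  ultimately have J: "r * p < card ?J" using V(3) s(1) by (simp add: mult.commute)
  have "(\<lambda>z. \<pi> (f z)) ` ?J \<subseteq> {..<r}" using f(2) V(4) by auto
  then obtain i where i: "p < card {z \<in> ?J. \<pi> (f z) = i}"
    using large_fibre[of ?J "{..<r}" "\<lambda>z. \<pi> (f z)" p] J by auto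
  let ?W = "{z \<in> ?J. \<pi> (f z) = i}"
  have "card ?W * (k + 1) \<le> s"
  proof (rule cyc_independent[OF _ _ s(3)])
    fix y z assume yz: "y \<in> ?W" "z \<in> ?W"
    show "\<not> cyc_adj s k y z"
    proof
      assume "cyc_adj s k y z"
      then have "hub_join B \<pi> (f y) (f z)" using f(3) yz by auto
      then show False using yz by (auto simp: hub_join_def)
    qed
  qed auto
  moreover have "(p + 1) * (k + 1) \<le> card ?W * (k + 1)" using i by (intro mult_right_mono) auto
  ultimately show False using s(2) by linarith
qed

text \<open>
  The first \<open>L = t (r + 1)\<close> vertices of the cycle form \<open>t\<close> blocks with the colours \<open>0, 0, 1, \<dots>, r - 1\<close>, the other
  vertices form \<open>p - t\<close> blocks with the colours \<open>0, 1, \<dots>, r - 1\<close> (truncated subtraction produces the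
  first double \<open>0\<close>). Apart from these doubled zeros, equal colours are at distance at least \<open>r > k\<close>.
\<close>

lemma block_colours:
  fixes p r s t k :: nat
  assumes s: "s = p * r + t" and t: "1 \<le> t" "t \<le> p" and k: "k < r"
  defines "L \<equiv> t * (r + 1)"
  defines "hue \<equiv> \<lambda>v. if v < L then v mod (r + 1) - 1 else (v - L) mod r"
  assumes u: "u < s" and d: "1 \<le> d" "d \<le> k" and same: "hue u = hue ((u + d) mod s)"
  shows "u < L \<and> u mod (r + 1) = 0 \<and> (u + d) mod s = u + 1 \<and> u + 1 < L"
proof -
  have sL: "s = L + (p - t) * r" using s t unfolding L_def by (simp add: algebra_simps diff_mult_distrib)
  have "1 * (r + 1) \<le> t * (r + 1)" using t(1) by (rule mult_right_mono) simp
  then have L1: "r + 1 \<le> L" unfolding L_def by simp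
  have cl: "hue (j * (r + 1) + y) = y - 1" if "j < t" "y \<le> r" for j y
  proof -
    have "j * (r + 1) + y < (j + 1) * (r + 1)" using that by simp
    also have "\<dots> \<le> L" unfolding L_def using that by (intro mult_right_mono) auto
    finally have lt: "j * (r + 1) + y < L" .
    have "(j * (r + 1) + y) mod (r + 1) = y mod (r + 1)" by (rule mod_mult_self3)
    also have "\<dots> = y" using that by (intro mod_less) simp
    finally show ?thesis using lt unfolding hue_def by (simp only: if_True)
  qed
  have cs: "hue (L + j * r + y) = y" if "y < r" for j y using that by (simp add: hue_def)
  have dr: "d < r" using d k by simp
  show ?thesis
  proof (cases "u < L")
    case True
    define j where "j = u div (r + 1)"
    define x where "x = u mod (r + 1)"
    have ux: "u = j * (r + 1) + x" unfolding j_def x_def by (rule div_mult_mod_eq[symmetric])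
    have xr: "x \<le> r" using mod_less_divisor[of "r + 1" u] by (simp add: x_def)
    have jt: "j < t" using True unfolding j_def L_def by (simp add: less_mult_imp_div_less)
    have cu: "hue u = x - 1" using cl[OF jt xr] ux by simp
    show ?thesis
    proof (cases "x + d \<le> r")
      case True
      have e: "u + d = j * (r + 1) + (x + d)" using ux by simp
      have "j * (r + 1) + (x + d) < (j + 1) * (r + 1)" using True by simp
      also have "\<dots> \<le> L" unfolding L_def using jt by (intro mult_right_mono) auto
      finally have lt: "u + d < L" using e by simp
      then have md: "(u + d) mod s = u + d" using sL by simp
      have "hue (u + d) = x + d - 1" unfolding e by (rule cl[OF jt True])
      then have "x - 1 = x + d - 1" using same cu md by simp
      then have "x = 0" "d = 1" using d by linarith+
      then show ?thesis using lt md \<open>u < L\<close> by (simp add: x_def)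
    next
      case False
      define y where "y = x + d - (r + 1)"
      have y: "x + d = (r + 1) + y" "y + 2 \<le> x" using False dr unfolding y_def by linarith+
      have e: "u + d = (j + 1) * (r + 1) + y" using ux y(1) by simp
      have yr: "y < r" using y xr by linarith
      have "hue ((u + d) mod s) \<le> y"
      proof (cases "j + 1 < t")
        case True
        have "(j + 1) * (r + 1) + y < (j + 2) * (r + 1)" using yr by simp
        also have "\<dots> \<le> L" unfolding L_def using True by (intro mult_right_mono) auto
        finally have "u + d < s" using e sL by simp
        then show ?thesis using cl[of "j + 1" y] True yr e by simp
      next
        case False
        then have jt1: "j + 1 = t" using jt by simp
        then have e': "u + d = L + y" using e by (simp add: L_def)
        show ?thesis
        proof (cases "u + d < s")
          case True
          then show ?thesis using cs[of y 0] yr e' by simp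
        next
          case False
          then have "p = t" using e' sL yr t by (cases "p - t") (auto simp: algebra_simps)
          then have "(u + d) mod s = y" using e' sL yr L1 by simp
          then show ?thesis using cl[of 0 y] t yr by simp
        qed
      qed
      then show ?thesis using same cu y by simp
    qed
  next
    case False
    define j where "j = (u - L) div r"
    define x where "x = (u - L) mod r"
    have r0: "0 < r" using k by simp
    have ux: "u = L + j * r + x" using False by (simp add: j_def x_def)
    have xr: "x < r" using r0 by (simp add: x_def)
    have jt: "j < p - t" using u sL False unfolding j_def by (simp add: less_mult_imp_div_less)
    have cu: "hue u = x" using cs[OF xr, of j] ux by simp
    show ?thesis
    proof (cases "x + d < r")
      case True
      have "j * r + (x + d) < (j + 1) * r" using True by simp
      also have "\<dots> \<le> (p - t) * r" using jt by (intro mult_right_mono) auto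
      finally have "u + d < s" using ux sL by simp
      then have "hue ((u + d) mod s) = x + d" using cs[OF True, of j] ux by (simp add: add.assoc)
      then show ?thesis using same cu d by simp
    next
      case False
      define y where "y = x + d - r"
      have y: "x + d = r + y" "y + 1 \<le> x" using False dr unfolding y_def by linarith+
      have e: "u + d = L + (j + 1) * r + y" using ux y(1) by simp
      have yr: "y < r" using y xr by linarith
      have "hue ((u + d) mod s) \<le> y"
      proof (cases "u + d < s")
        case True
        then show ?thesis using cs[OF yr, of "j + 1"] e by simp
      next
        case False
        have "\<not> j + 1 < p - t"
        proof
          assume "j + 1 < p - t"
          then have "(j + 2) * r \<le> (p - t) * r" by (intro mult_right_mono) auto
          moreover have "(j + 1) * r + y < (j + 2) * r" using yr by simp
          ultimately show False using False e sL by linarith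
        qed
        then have "p - t = j + 1" using jt by simp
        then have "u + d = s + y" using e sL by simp
        then have "(u + d) mod s = y" using yr L1 sL by simp
        then show ?thesis using cl[of 0 y] t yr by simp
      qed
      then show ?thesis using same cu y by simp
    qed
  qed
qed

text \<open>
  Colour the cycle as in \<open>block_colours\<close>. The two zeros at the start of the \<open>l\<close>-th long block go to the ends of the
  \<open>l\<close>-th disjoint edge, and every other vertex of colour \<open>c\<close> goes to a vertex of the corresponding part that is
  reserved for its block. The size \<open>p + 2 t\<close> of the parts leaves \<open>p\<close> vertices, one for each block, outside the \<open>t\<close> edges. The
  transposition \<open>\<tau>\<close> of \<open>0\<close> and \<open>i\<close> assigns the part \<open>i\<close> to the colour \<open>0\<close>.
\<close>

lemma blowup_contains_cycle_power:
  fixes E :: "nat \<Rightarrow> nat \<Rightarrow> bool"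
  assumes fin: "finite V" and sym: "symp E" and irr: "irreflp E"
    and mb: "matching_blowup E V r t (p + 2 * t)"
    and s: "s = p * r + t" and t: "1 \<le> t" "t \<le> p" and k: "k < r"
  shows "\<not> copy_free s (cyc_adj s k) E V"
proof -
  obtain i T a b where i: "i < r" and T0: "\<forall>c<r. T c \<subseteq> V \<and> p + 2 * t \<le> card (T c)"
    and cp: "complete_parts E T r" and ab: "disjoint_edges E V t a b"
    and adj0: "\<forall>l<t. \<forall>c<r. c \<noteq> i \<longrightarrow> (\<forall>v\<in>T c. E (a l) v \<and> E (b l) v)"
    using mb unfolding matching_blowup_def by (elim exE conjE)
  have T: "\<And>c. c < r \<Longrightarrow> T c \<subseteq> V" "\<And>c. c < r \<Longrightarrow> p + 2 * t \<le> card (T c)" using T0 by simp_all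
  have adj: "E (a l) v \<and> E (b l) v" if "l < t" "c < r" "c \<noteq> i" "v \<in> T c" for l c v
    using adj0 that by simp
  have aV: "a l \<in> V" "b l \<in> V" "E (a l) (b l)" if "l < t" for l using ab that by (auto simp: disjoint_edges_def)
  have inja: "inj_on a {..<t}" "inj_on b {..<t}" "a ` {..<t} \<inter> b ` {..<t} = {}" using ab by (auto simp: disjoint_edges_def)
  have r0: "0 < r" using i by simp
  define \<tau> where "\<tau> c = (if c = 0 then i else if c = i then 0 else c)" for c :: nat
  have \<tau>: "\<tau> c < r" if "c < r" for c using that i r0 by (simp add: \<tau>_def)
  have \<tau>inj: "\<tau> c = \<tau> d \<longleftrightarrow> c = d" for c d by (auto simp: \<tau>_def)
  have \<tau>0: "\<tau> c = i \<longleftrightarrow> c = 0" for c by (auto simp: \<tau>_def)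
  define AB where "AB = a ` {..<t} \<union> b ` {..<t}"
  have cAB: "card AB \<le> 2 * t"
    unfolding AB_def using card_Un_le[of "a ` {..<t}" "b ` {..<t}"] card_image_le[of "{..<t}" a] card_image_le[of "{..<t}" b] by simp
  have finAB: "finite AB" by (simp add: AB_def)
  have ex: "\<exists>e. inj_on e {..<p} \<and> (\<forall>j<p. e j \<in> T (\<tau> c) - AB)" if c: "c < r" for c
  proof (rule distinct_representatives)
    have "finite (T (\<tau> c))" using T(1)[OF \<tau>[OF c]] fin finite_subset by blast
    then show "finite (T (\<tau> c) - AB)" by blast
    have "card (T (\<tau> c)) - card AB \<le> card (T (\<tau> c) - AB)" by (rule diff_card_le_card_Diff[OF finAB])
    then show "p \<le> card (T (\<tau> c) - AB)" using T(2)[OF \<tau>[OF c]] cAB by linarith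
  qed
  define e where "e c = (SOME e. inj_on e {..<p} \<and> (\<forall>j<p. e j \<in> T (\<tau> c) - AB))" for c
  have "inj_on (e c) {..<p} \<and> (\<forall>j<p. e c j \<in> T (\<tau> c) - AB)" if "c < r" for c
    unfolding e_def by (rule someI_ex[OF ex[OF that]])
  then have e: "\<And>c. c < r \<Longrightarrow> inj_on (e c) {..<p}" "\<And>c j. c < r \<Longrightarrow> j < p \<Longrightarrow> e c j \<in> T (\<tau> c) - AB"
    by simp_all
  define L where "L = t * (r + 1)"
  define hue where "hue v = (if v < L then v mod (r + 1) - 1 else (v - L) mod r)" for v
  define blk where "blk v = (if v < L then v div (r + 1) else t + (v - L) div r)" for v
  define f where "f v = (if v < L \<and> v mod (r + 1) = 0 then a (blk v)
     else if v < L \<and> v mod (r + 1) = 1 then b (blk v) else e (hue v) (blk v))" for v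
  have sL: "s = L + (p - t) * r" using s t unfolding L_def by (simp add: algebra_simps diff_mult_distrib)
  have blt: "blk v < t" if "v < L" for v using that unfolding blk_def L_def by (simp add: less_mult_imp_div_less)
  have bl: "blk v < p" if "v < s" for v
  proof (cases "v < L")
    case True
    then show ?thesis using blt[OF True] t by simp
  next
    case False
    then have "v - L < (p - t) * r" using that sL by linarith
    then have "(v - L) div r < p - t" by (simp add: less_mult_imp_div_less)
    then show ?thesis using False by (simp add: blk_def)
  qed
  have co: "hue v < r" for v
  proof (cases "v < L")
    case True
    have "v mod (r + 1) < r + 1" by simp
    moreover have "hue v = v mod (r + 1) - 1" using True by (simp add: hue_def)
    ultimately show ?thesis using r0 by linarith
  qed (use r0 in \<open>simp add: hue_def\<close>)
  have fcase: "(v < L \<and> v mod (r + 1) = 0 \<and> f v = a (blk v) \<and> blk v < t \<and> hue v = 0) \<or>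
      (v < L \<and> v mod (r + 1) = 1 \<and> f v = b (blk v) \<and> blk v < t \<and> hue v = 0) \<or>
      (f v = e (hue v) (blk v) \<and> f v \<in> T (\<tau> (hue v)) - AB \<and> (v < L \<longrightarrow> 2 \<le> v mod (r + 1)))" if "v < s" for v
  proof -
    consider "v < L \<and> v mod (r + 1) = 0" | "v < L \<and> v mod (r + 1) = 1" | "v < L \<longrightarrow> 2 \<le> v mod (r + 1)" by linarith
    then show ?thesis
    proof cases
      case 1
      then show ?thesis using blt[of v] by (simp add: f_def hue_def)
    next
      case 2
      then show ?thesis using blt[of v] by (simp add: f_def hue_def)
    next
      case 3
      then have "f v = e (hue v) (blk v)" by (auto simp: f_def)
      moreover have "e (hue v) (blk v) \<in> T (\<tau> (hue v)) - AB" by (rule e(2)[OF co bl[OF that]])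
      ultimately show ?thesis using 3 by simp
    qed
  qed
  have fV: "f v \<in> V" if "v < s" for v
    using fcase[OF that] aV T(1)[OF \<tau>[OF co[of v]]] by auto
  have AB1: "a j \<in> AB" "b j \<in> AB" if "j < t" for j using that by (auto simp: AB_def)
  have dc: "E (f u) (f v)" if uv: "u < s" "v < s" "hue u \<noteq> hue v" for u v
  proof -
    have one: "E (f u) (f v)" if uv: "u < s" "v < s" "hue u \<noteq> hue v" "hue v \<noteq> 0" for u v
    proof -
      have fv: "f v \<in> T (\<tau> (hue v))" using fcase[OF uv(2)] uv(4) by auto
      from fcase[OF uv(1)] show ?thesis
      proof (elim disjE)
        assume "u < L \<and> u mod (r + 1) = 0 \<and> f u = a (blk u) \<and> blk u < t \<and> hue u = 0"
        then show ?thesis using adj[of "blk u" "\<tau> (hue v)" "f v"] \<tau>[OF co[of v]] \<tau>0 uv(4) fv by auto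
      next
        assume "u < L \<and> u mod (r + 1) = 1 \<and> f u = b (blk u) \<and> blk u < t \<and> hue u = 0"
        then show ?thesis using adj[of "blk u" "\<tau> (hue v)" "f v"] \<tau>[OF co[of v]] \<tau>0 uv(4) fv by auto
      next
        assume "f u = e (hue u) (blk u) \<and> f u \<in> T (\<tau> (hue u)) - AB \<and> (u < L \<longrightarrow> 2 \<le> u mod (r + 1))"
        then show ?thesis using cp fv \<tau>[OF co[of u]] \<tau>[OF co[of v]] \<tau>inj uv(3) unfolding complete_parts_def by blast
      qed
    qed
    show ?thesis
    proof (cases "hue v = 0")
      case True
      then have "E (f v) (f u)" using one[of v u] uv by simp
      then show ?thesis by (rule sympD[OF sym])
    next
      case False
      then show ?thesis using one uv by blast
    qed
  qed
  have inj: "inj_on f {..<s}"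
  proof (rule inj_onI)
    fix u v assume u: "u \<in> {..<s}" and v: "v \<in> {..<s}" and eq: "f u = f v"
    have cc: "hue u = hue v"
    proof (rule ccontr)
      assume "hue u \<noteq> hue v"
      then have "E (f u) (f v)" using dc u v by simp
      then show False using eq irr by (simp add: irreflp_def)
    qed
    have rebuild: "w < L \<Longrightarrow> w = blk w * (r + 1) + w mod (r + 1)"
      "\<not> w < L \<Longrightarrow> w = L + ((blk w - t) * r + (w - L) mod r)" for w
      by (simp_all only: blk_def if_True if_False div_mult_mod_eq add_diff_cancel_left')
    have abne: "a j \<noteq> b j'" if "j < t" "j' < t" for j j' using inja(3) that by blast
    have ii: "a j = a j' \<longleftrightarrow> j = j'" "b j = b j' \<longleftrightarrow> j = j'" if "j < t" "j' < t" for j j'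
      using inja(1,2) that by (auto simp: inj_on_def)
    have same: "blk u = blk v \<and> ((u < L \<and> v < L \<and> u mod (r + 1) = v mod (r + 1)) \<or>
       (f u = e (hue u) (blk u) \<and> (u < L \<longrightarrow> 2 \<le> u mod (r + 1)) \<and> (v < L \<longrightarrow> 2 \<le> v mod (r + 1))))"
    proof -
      have I: "blk u < t \<Longrightarrow> blk v < t \<Longrightarrow> a (blk u) = a (blk v) \<Longrightarrow> blk u = blk v"
        "blk u < t \<Longrightarrow> blk v < t \<Longrightarrow> b (blk u) = b (blk v) \<Longrightarrow> blk u = blk v" using ii by blast+
      have X: "blk u < t \<Longrightarrow> blk v < t \<Longrightarrow> a (blk u) \<noteq> b (blk v)"
        "blk u < t \<Longrightarrow> blk v < t \<Longrightarrow> b (blk u) \<noteq> a (blk v)" using abne by metis+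
      have A: "blk u < t \<Longrightarrow> a (blk u) \<in> AB \<and> b (blk u) \<in> AB" "blk v < t \<Longrightarrow> a (blk v) \<in> AB \<and> b (blk v) \<in> AB"
        using AB1 by blast+
      have M: "e (hue u) (blk u) = e (hue v) (blk v) \<Longrightarrow> blk u = blk v"
        unfolding cc using e(1)[OF co[of v]] bl[of u] bl[of v] u v by (auto simp: inj_on_def)
      have "u < s" "v < s" using u v by simp_all
      from fcase[OF this(1)] fcase[OF this(2)] eq show ?thesis
        by (elim disjE conjE) (use I X A M in \<open>metis DiffD2\<close>)+
    qed
    have uL: "u < L \<longleftrightarrow> v < L"
    proof -
      have "w < L \<longleftrightarrow> blk w < t" for w using blt[of w] by (cases "w < L") (auto simp: blk_def)
      then show ?thesis using same by simp
    qed
    show "u = v"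
    proof (cases "u < L")
      case True
      then have "u mod (r + 1) = v mod (r + 1)" using same cc uL by (auto simp: hue_def)
      then show ?thesis using rebuild(1)[of u] rebuild(1)[of v] True uL same by metis
    next
      case False
      then have "(u - L) mod r = (v - L) mod r" using cc uL by (simp add: hue_def)
      then show ?thesis using rebuild(2)[of u] rebuild(2)[of v] False uL same by metis
    qed
  qed
  have step: "E (f u) (f ((u + d) mod s))" if u: "u < s" and d: "1 \<le> d" "d \<le> k" for u d
  proof (cases "hue u = hue ((u + d) mod s)")
    case True
    have "u < L \<and> u mod (r + 1) = 0 \<and> (u + d) mod s = u + 1 \<and> u + 1 < L"
      unfolding L_def by (rule block_colours[OF s t k u d]) (use True in \<open>simp only: hue_def L_def\<close>)
    moreover from this have "(u + 1) mod (r + 1) = 1" "(u + 1) div (r + 1) = u div (r + 1)"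
      using r0 by (auto simp: mod_Suc div_Suc)
    ultimately have "f u = a (blk u)" "f ((u + d) mod s) = b (blk u)" "blk u < t"
      using blt[of u] by (auto simp: f_def blk_def)
    then show ?thesis using aV(3) by simp
  next
    case False
    moreover have "(u + d) mod s < s" using u by simp
    ultimately show ?thesis using dc u by blast
  qed
  have "\<forall>u<s. \<forall>v<s. cyc_adj s k u v \<longrightarrow> E (f u) (f v)"
  proof (intro allI impI)
    fix u v assume uv: "u < s" "v < s" "cyc_adj s k u v"
    then obtain d where d: "d \<le> k" "v = (u + d) mod s \<or> u = (v + d) mod s" "u \<noteq> v" by (auto simp: cyc_adj_def)
    then have "1 \<le> d" using uv by (cases d) auto
    from d(2) show "E (f u) (f v)"
    proof
      assume "v = (u + d) mod s"
      then show ?thesis using step[OF uv(1) \<open>1 \<le> d\<close> d(1)] by simp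
    next
      assume "u = (v + d) mod s"
      then have "E (f v) (f u)" using step[OF uv(2) \<open>1 \<le> d\<close> d(1)] by simp
      then show ?thesis by (rule sympD[OF sym])
    qed
  qed
  then show ?thesis using inj fV unfolding copy_free_def by blast
qed

lemma cycle_wf: "pair_wf_digraph (cycle_graph s)"
proof -
  interpret pair_graph "cycle_graph s" by (rule pair_graph_cycle)
  show ?thesis by unfold_locales
qed

text \<open>
  A walk of length \<open>j\<close> in the cycle changes the position modulo \<open>s\<close> by an integer of absolute value at
  most \<open>j\<close>, and conversely \<open>d\<close> steps in one direction form a walk of length \<open>d\<close>.
\<close>

lemma cycle_power_arcs:
  assumes s: "2 \<le> s"
  shows "(u, v) \<in> parcs (graph_power (cycle_graph s) k) \<longleftrightarrow> cyc_adj s k u v"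
proof -
  interpret C: pair_wf_digraph "cycle_graph s" by (rule cycle_wf)
  have arc: "(x, y) \<in> parcs (cycle_graph s) \<longleftrightarrow> x < s \<and> y < s \<and> x \<noteq> y \<and> (y = (x + 1) mod s \<or> x = (y + 1) mod s)" for x y
    by (simp add: cycle_graph_def)
  have verts: "pverts (cycle_graph s) = {..<s}" by (simp add: cycle_graph_def)
  have next_ne: "x \<noteq> (x + 1) mod s" if "x < s" for x
    using that s by (cases "x + 1 = s") auto
  have short: "\<exists>z. \<bar>z\<bar> \<le> int (length w) \<and> int s dvd (int y - int x - z)" if "C.awalk x w y" for x w y
    using that
  proof (induction w arbitrary: x)
    case Nil
    then show ?case by (intro exI[of _ 0]) (simp add: C.awalk_Nil_iff)
  next
    case (Cons a w)
    then obtain x' where a: "a = (x, x')" "(x, x') \<in> parcs (cycle_graph s)" and w: "C.awalk x' w y"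
      by (cases a) (auto simp: C.awalk_Cons_iff)
    from Cons.IH[OF w] obtain z where z: "\<bar>z\<bar> \<le> int (length w)" "int s dvd (int y - int x' - z)" by blast
    have sh: "\<exists>e. \<bar>e\<bar> \<le> 1 \<and> int s dvd (int x' - int x - e)"
    proof -
      have md: "int s dvd int ((y + 1) mod s) - int y - 1" for y
      proof -
        have "int ((y + 1) mod s) mod int s = (int y + 1) mod int s" by (simp add: zmod_int add.commute)
        then show ?thesis by (simp add: mod_eq_dvd_iff diff_diff_eq)
      qed
      from a(2)[unfolded arc] consider "x' = (x + 1) mod s" | "x = (x' + 1) mod s" by blast
      then show ?thesis
      proof cases
        case 1
        then show ?thesis using md[of x] by (intro exI[of _ 1]) simp
      next
        case 2
        have "int s dvd - (int ((x' + 1) mod s) - int x' - 1)" using md[of x'] by (simp only: dvd_minus_iff)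
        moreover have "- (int ((x' + 1) mod s) - int x' - 1) = int x' - int x - (-1)" using 2 by simp
        ultimately have "int s dvd int x' - int x - (-1)" by (simp only:)
        then show ?thesis by (intro exI[of _ "-1"]) simp
      qed
    qed
    then obtain e where e: "\<bar>e\<bar> \<le> 1" "int s dvd (int x' - int x - e)" by blast
    have "int s dvd ((int y - int x' - z) + (int x' - int x - e))" using z(2) e(2) by (rule dvd_add)
    then show ?case using z(1) e(1) by (intro exI[of _ "z + e"]) (auto simp: algebra_simps)
  qed
  have up: "x < s \<Longrightarrow> \<exists>w. C.awalk x w ((x + d) mod s) \<and> length w = d" for x d
  proof (induction d arbitrary: x)
    case 0
    then show ?case by (intro exI[of _ "[]"]) (simp add: C.awalk_Nil_iff verts)
  next
    case (Suc d)
    let ?x = "(x + 1) mod s"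
    have x': "?x < s" using Suc.prems by simp
    obtain w where w: "C.awalk ?x w ((?x + d) mod s)" "length w = d" using Suc.IH[OF x'] by blast
    have "(?x + d) mod s = (x + Suc d) mod s" by (simp add: mod_add_left_eq)
    moreover have "(x, ?x) \<in> parcs (cycle_graph s)" using Suc.prems x' next_ne[OF Suc.prems] by (simp add: arc)
    ultimately show ?case using w by (intro exI[of _ "(x, ?x) # w"]) (simp add: C.awalk_Cons_iff)
  qed
  have down: "x < s \<Longrightarrow> \<exists>w. C.awalk ((x + d) mod s) w x \<and> length w = d" for x d
  proof (induction d)
    case 0
    then show ?case by (intro exI[of _ "[]"]) (simp add: C.awalk_Nil_iff verts)
  next
    case (Suc d)
    let ?y = "(x + d) mod s" and ?z = "(x + Suc d) mod s"
    obtain w where w: "C.awalk ?y w x" "length w = d" using Suc by blast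
    have y: "?y < s" "?z < s" using Suc.prems by simp_all
    have "?z = (?y + 1) mod s" by (simp add: mod_Suc_eq)
    then have "(?z, ?y) \<in> parcs (cycle_graph s)" using y next_ne[OF y(1)] by (simp add: arc)
    then show ?case using w by (intro exI[of _ "(?z, ?y) # w"]) (simp add: C.awalk_Cons_iff)
  qed
  have "graph_dist (cycle_graph s) u v \<le> ereal (real k) \<longleftrightarrow> (\<exists>d\<le>k. v = (u + d) mod s \<or> u = (v + d) mod s)"
    if uv: "u < s" "v < s"
    unfolding graph_dist_le_iff[OF cycle_wf]
  proof
    assume "\<exists>w. C.awalk u w v \<and> length w \<le> k"
    then obtain w where w: "C.awalk u w v" "length w \<le> k" by blast
    from short[OF w(1)] obtain z where z: "\<bar>z\<bar> \<le> int (length w)" "int s dvd (int v - int u - z)" by blast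
    show "\<exists>d\<le>k. v = (u + d) mod s \<or> u = (v + d) mod s"
    proof (cases "0 \<le> z")
      case True
      have "int v mod int s = (int u + z) mod int s" using z(2) by (simp add: mod_eq_dvd_iff diff_diff_eq)
      then have "int v = int ((u + nat z) mod s)" using True uv by (simp add: zmod_int)
      then have "v = (u + nat z) mod s" by (simp only: of_nat_eq_iff)
      then show ?thesis using z(1) w(2) True by (intro exI[of _ "nat z"]) auto
    next
      case False
      have "int s dvd - (int v - int u - z)" using z(2) by (simp only: dvd_minus_iff)
      then have "int u mod int s = (int v + - z) mod int s" by (simp add: mod_eq_dvd_iff algebra_simps)
      then have "int u = int ((v + nat (- z)) mod s)" using False uv by (simp add: zmod_int)
      then have "u = (v + nat (- z)) mod s" by (simp only: of_nat_eq_iff)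
      then show ?thesis using z(1) w(2) False by (intro exI[of _ "nat (- z)"]) auto
    qed
  next
    assume "\<exists>d\<le>k. v = (u + d) mod s \<or> u = (v + d) mod s"
    then show "\<exists>w. C.awalk u w v \<and> length w \<le> k" using up[OF uv(1)] down[OF uv(2)] by metis
  qed
  then show ?thesis by (auto simp: graph_power_def verts cyc_adj_def)
qed

section \<open>Translation to matrices and digraphs\<close>

definition rel_of :: "'a pair_pre_digraph \<Rightarrow> 'a \<Rightarrow> 'a \<Rightarrow> bool" where
  "rel_of G u v \<longleftrightarrow> (u, v) \<in> parcs G"

lemma pair_graph_rel:
  assumes "pair_graph G"
  shows "finite (pverts G)" "symp (rel_of G)" "irreflp (rel_of G)" "pair_wf_digraph G"
proof -
  interpret G: pair_graph G by fact
  show "finite (pverts G)" by simp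
  have "sym (parcs G)" using G.pair_sym_arcs by (simp add: symmetric_def)
  then show "symp (rel_of G)" by (auto simp: rel_of_def symp_def sym_def)
  show "irreflp (rel_of G)" by (intro irreflpI) (auto simp: rel_of_def dest: G.pair_no_loops)
  show "pair_wf_digraph G" by unfold_locales
qed

lemma out_degree_nbhd:
  assumes "pair_wf_digraph G"
  shows "out_degree (with_proj G) u = card (nbhd (rel_of G) (pverts G) u)"
proof -
  interpret G: pair_wf_digraph G by fact
  have "out_arcs (with_proj G) u = Pair u ` nbhd (rel_of G) (pverts G) u"
    by (auto simp: out_arcs_def nbhd_def rel_of_def dest: G.in_arcsD2)
  moreover have "inj_on (Pair u) (nbhd (rel_of G) (pverts G) u)" by (auto simp: inj_on_def)
  ultimately show ?thesis unfolding out_degree_def by (simp add: card_image)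
qed

text \<open>
  Enumerating the vertices identifies \<open>qop\<close> with multiplication by the signless Laplacian matrix. Every
  eigenvalue is a Rayleigh quotient and so at most \<open>qidx\<close>, which is itself an eigenvalue.
\<close>

lemma q_index_eq_qidx:
  fixes G :: "nat pair_pre_digraph"
  assumes G: "pair_graph G" and ne: "pverts G \<noteq> {}"
  shows "q_index G = qidx (rel_of G) (pverts G)"
proof -
  let ?V = "pverts G" and ?E = "rel_of G" and ?n = "card (pverts G)" and ?l = "vertex_list G"
  let ?Q = "signless_laplacian G"
  note EV = pair_graph_rel[OF G]
  have Q: "?Q \<in> carrier_mat ?n ?n" by (auto simp: signless_laplacian_def degree_matrix_def adjacency_matrix_def)
  have len: "length ?l = ?n" and dist: "distinct ?l" and set: "set ?l = ?V"
    unfolding vertex_list_def using EV(1) by simp_all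
  have bij: "bij_betw ((!) ?l) {..<?n} ?V"
    by (rule bij_betw_nth[OF dist]) (simp_all add: len set)
  have ex: "\<exists>i<?n. ?l ! i = u" if "u \<in> ?V" for u
    using that set len by (metis in_set_conv_nth)
  have entry: "(?Q *\<^sub>v v) $ i = qop ?E ?V x (?l ! i)"
    if i: "i < ?n" and v: "v \<in> carrier_vec ?n" and x: "\<And>j. j < ?n \<Longrightarrow> v $ j = x (?l ! j)" for v x i
  proof -
    have "(?Q *\<^sub>v v) $ i = (\<Sum>j<?n. ?Q $$ (i, j) * v $ j)"
      using Q i v by (simp add: scalar_prod_def atLeast0LessThan)
    also have "\<dots> = (\<Sum>j<?n. (if j = i then real (card (nbhd ?E ?V (?l ! i))) * x (?l ! i) else 0) +
        (if ?E (?l ! i) (?l ! j) then x (?l ! j) else 0))"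
      using i x out_degree_nbhd[OF EV(4)]
      by (intro sum.cong refl)
        (auto simp: signless_laplacian_def degree_matrix_def adjacency_matrix_def rel_of_def distrib_right)
    also have "\<dots> = real (card (nbhd ?E ?V (?l ! i))) * x (?l ! i) + (\<Sum>j<?n. if ?E (?l ! i) (?l ! j) then x (?l ! j) else 0)"
      using i by (simp add: sum.distrib)
    also have "(\<Sum>j<?n. if ?E (?l ! i) (?l ! j) then x (?l ! j) else 0) = (\<Sum>u\<in>?V. if ?E (?l ! i) u then x u else 0)"
      by (rule sum.reindex_bij_betw[OF bij])
    also have "\<dots> = sum x (nbhd ?E ?V (?l ! i))" by (rule sum_nbhd[OF EV(1), symmetric])
    finally show ?thesis by (simp add: qop_alt[OF EV(1)])
  qed
  have le: "k \<le> qidx ?E ?V" if k: "k \<in> spectrum ?Q" for k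
  proof -
    obtain v where v: "v \<in> carrier_vec ?n" "v \<noteq> 0\<^sub>v ?n" "?Q *\<^sub>v v = k \<cdot>\<^sub>v v"
      using k Q by (auto simp: spectrum_def eigenvalue_def eigenvector_def)
    define x where "x u = v $ (inv_into {..<?n} ((!) ?l) u)" for u
    have x: "x (?l ! j) = v $ j" if "j < ?n" for j
      using bij that unfolding x_def by (simp add: bij_betw_inv_into_left)
    have eig: "qop ?E ?V x u = k * x u" if uV: "u \<in> ?V" for u
    proof -
      obtain i where i: "i < ?n" "?l ! i = u" using ex[OF uV] by blast
      have "qop ?E ?V x (?l ! i) = (?Q *\<^sub>v v) $ i" by (rule entry[OF i(1) v(1), symmetric]) (simp add: x)
      also have "\<dots> = k * v $ i" using v i(1) by simp
      finally show ?thesis using x[OF i(1)] i(2) by simp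
    qed
    have "qform ?E ?V x = k * nrm2 ?V x"
      unfolding qform_def nrm2_def sum_distrib_left
      by (intro sum.cong refl) (simp add: eig power2_eq_square)
    then have *: "k * nrm2 ?V x \<le> qidx ?E ?V * nrm2 ?V x" using rayleigh_le[OF EV(1) ne EV(2)] by metis
    have "nrm2 ?V x \<noteq> 0"
    proof
      assume "nrm2 ?V x = 0"
      then have "\<forall>u\<in>?V. x u = 0" using nrm2_eq_0[OF EV(1)] by blast
      moreover have "?l ! j \<in> ?V" if "j < ?n" for j using bij that by (auto simp: bij_betw_def)
      ultimately have "v $ j = 0" if "j < ?n" for j using x[OF that] that by simp
      then have "v = 0\<^sub>v ?n" using v(1) by (intro eq_vecI) auto
      then show False using v(2) by blast
    qed
    then have "0 < nrm2 ?V x" using nrm2_nonneg[of ?V x] by simp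
    then show ?thesis using * by simp
  qed
  have mem: "qidx ?E ?V \<in> spectrum ?Q"
  proof -
    obtain x where x: "perron ?E ?V (qidx ?E ?V) x" using perron_qidx[OF EV(1) ne EV(2)] by blast
    let ?v = "vec ?n (\<lambda>j. x (?l ! j))"
    have "(?Q *\<^sub>v ?v) $ i = (qidx ?E ?V \<cdot>\<^sub>v ?v) $ i" if i: "i < ?n" for i
    proof -
      have "?l ! i \<in> ?V" using bij i by (auto simp: bij_betw_def)
      then show ?thesis using entry[OF i, of ?v x] x i by (simp add: perron_def)
    qed
    then have eq: "?Q *\<^sub>v ?v = qidx ?E ?V \<cdot>\<^sub>v ?v" using Q by (intro eq_vecI) auto
    have nz: "?v \<noteq> 0\<^sub>v ?n"
    proof
      assume z: "?v = 0\<^sub>v ?n"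
      obtain u where u: "u \<in> ?V" "0 < x u" using x by (auto simp: perron_def)
      obtain i where i: "i < ?n" "?l ! i = u" using ex[OF u(1)] by blast
      have "?v $ i = 0" unfolding z using i(1) by simp
      then show False using i u(2) by simp
    qed
    have "eigenvector ?Q ?v (qidx ?E ?V)" using eq nz Q by (simp add: eigenvector_def)
    then show ?thesis by (auto simp: spectrum_def eigenvalue_def)
  qed
  have "finite (spectrum ?Q)" using card_finite_spectrum[OF Q] by blast
  then show ?thesis unfolding q_index_def using le mem by (intro Max_eqI) auto
qed

text \<open>
  The arcs of \<open>F\<close> are pairs of vertices below \<open>s\<close>, so quantifying over adjacent numbers below \<open>s\<close> covers all
  of them.
\<close>

lemma contains_copy_rel:
  assumes G: "pair_wf_digraph G" and F: "pair_wf_digraph F" "pverts F = {..<s}"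
  shows "contains_copy G F \<longleftrightarrow> \<not> copy_free s (rel_of F) (rel_of G) (pverts G)"
proof -
  interpret F: pair_wf_digraph F by fact
  have eq: "(\<forall>(u, v)\<in>parcs F. (f u, f v) \<in> parcs G) \<longleftrightarrow>
    (\<forall>u<s. \<forall>v<s. rel_of F u v \<longrightarrow> rel_of G (f u) (f v))" for f
    using F.in_arcsD1 F.in_arcsD2 F(2) by (auto simp: rel_of_def)
  show ?thesis unfolding contains_copy_iff[OF G F(1)] copy_free_def F(2) eq not_not by (rule refl)
qed

lemma copy_free_cong_on:
  "(\<And>u v. u \<in> V \<Longrightarrow> v \<in> V \<Longrightarrow> E u v \<longleftrightarrow> E' u v) \<Longrightarrow> copy_free s A E' V \<Longrightarrow> copy_free s A E V"
  by (rule copy_free_iso[where g = id and W = V and E' = E']) auto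

lemma EX_q_iff:
  fixes F :: "nat pair_pre_digraph" and G :: "nat pair_pre_digraph"
  assumes F: "pair_wf_digraph F" "pverts F = {..<s}" and n: "1 \<le> n"
  shows "G \<in> EX_q n F \<longleftrightarrow> pair_graph G \<and> card (pverts G) = n \<and> extremal s (rel_of F) (rel_of G) (pverts G)"
proof -
  have free: "H \<in> n_vertex_free_graphs n F \<longleftrightarrow> pair_graph H \<and> card (pverts H) = n \<and> copy_free s (rel_of F) (rel_of H) (pverts H)"
    for H :: "nat pair_pre_digraph"
    unfolding n_vertex_free_graphs_def using contains_copy_rel[OF _ F, of H] pair_graph_rel(4)[of H] by auto
  have qi: "q_index H = qidx (rel_of H) (pverts H)" if "H \<in> n_vertex_free_graphs n F" for H :: "nat pair_pre_digraph"
  proof -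
    have H: "pair_graph H" "card (pverts H) = n" using that free by blast+
    then have "pverts H \<noteq> {}" using n by auto
    with H(1) show ?thesis by (rule q_index_eq_qidx)
  qed
  show ?thesis
  proof
    assume G: "G \<in> EX_q n F"
    then have Gf: "G \<in> n_vertex_free_graphs n F" and max: "\<And>H :: nat pair_pre_digraph. H \<in> n_vertex_free_graphs n F \<Longrightarrow> q_index H \<le> q_index G"
      by (auto simp: EX_q_def)
    have G': "pair_graph G" "card (pverts G) = n" "copy_free s (rel_of F) (rel_of G) (pverts G)" using Gf free by blast+
    have "qidx E' V' \<le> qidx (rel_of G) (pverts G)"
      if E': "finite V'" "symp E'" "irreflp E'" "copy_free s (rel_of F) E' V'" "card V' = card (pverts G)"
      for E' :: "nat \<Rightarrow> nat \<Rightarrow> bool" and V' :: "nat set"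
    proof -
      define H where "H = \<lparr>pverts = V', parcs = {(u, v). u \<in> V' \<and> v \<in> V' \<and> E' u v}\<rparr>"
      have relH: "rel_of H u v \<longleftrightarrow> E' u v" if "u \<in> V'" "v \<in> V'" for u v using that by (simp add: H_def rel_of_def)
      have "pair_graph H"
        by (rule pair_graphI) (use E' in \<open>auto simp: H_def irrefl_def sym_def irreflp_def symp_def\<close>)
      moreover have "copy_free s (rel_of F) (rel_of H) V'" by (rule copy_free_cong_on[OF relH E'(4)])
      ultimately have Hf: "H \<in> n_vertex_free_graphs n F" using free[of H] E'(5) G'(2) by (simp add: H_def)
      have ne: "V' \<noteq> {}" using E'(5) G'(2) n by auto
      have "qidx E' V' = qidx (rel_of H) V'" by (rule qidx_cong[OF E'(1) ne E'(2) relH, symmetric])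
      also have "\<dots> = q_index H" using qi[OF Hf] by (simp add: H_def)
      also have "\<dots> \<le> q_index G" by (rule max[OF Hf])
      also have "\<dots> = qidx (rel_of G) (pverts G)" by (rule qi[OF Gf])
      finally show ?thesis .
    qed
    then show "pair_graph G \<and> card (pverts G) = n \<and> extremal s (rel_of F) (rel_of G) (pverts G)"
      using G' pair_graph_rel[OF G'(1)] unfolding extremal_def by blast
  next
    assume G: "pair_graph G \<and> card (pverts G) = n \<and> extremal s (rel_of F) (rel_of G) (pverts G)"
    then have Gf: "G \<in> n_vertex_free_graphs n F" using free by (auto simp: extremal_def)
    have "q_index H \<le> q_index G" if Hf: "H \<in> n_vertex_free_graphs n F" for H :: "nat pair_pre_digraph"
    proof -
      have H: "pair_graph H" "card (pverts H) = n" "copy_free s (rel_of F) (rel_of H) (pverts H)" using Hf free by blast+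
      have "qidx (rel_of H) (pverts H) \<le> qidx (rel_of G) (pverts G)"
        using G H pair_graph_rel[OF H(1)] unfolding extremal_def by simp
      then show ?thesis using qi[OF Gf] qi[OF Hf] by simp
    qed
    then show "G \<in> EX_q n F" using Gf by (auto simp: EX_q_def)
  qed
qed

text \<open>
  Map \<open>B\<close> onto the complete graph and the rest onto the Turan graph by \<open>balanced_bijection\<close>.
\<close>

lemma join_isomorphism:
  fixes V :: "nat set"
  assumes fin: "finite V" and B: "B \<subseteq> V" "card B = t - 1" and t: "1 \<le> t" "t \<le> card V" and r: "0 < r"
    and \<pi>: "\<forall>u\<in>V. \<pi> u < r" and E: "\<forall>u\<in>V. \<forall>v\<in>V. E u v \<longleftrightarrow> hub_join B \<pi> u v"
    and bal: "\<forall>i<r. \<forall>j<r. card {v \<in> V - B. \<pi> v = i} \<le> card {v \<in> V - B. \<pi> v = j} + 1"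
  defines "H \<equiv> graph_join (complete_graph (t - 1)) (turan_graph (card V - t + 1) r)"
  shows "\<exists>g. bij_betw g V (pverts H) \<and> (\<forall>u\<in>V. \<forall>v\<in>V. E u v \<longleftrightarrow> (g u, g v) \<in> parcs H)"
proof -
  let ?N = "card V - t + 1"
  have finB: "finite B" using B(1) fin by (rule finite_subset)
  have cW: "card (V - B) = ?N" using B t finB by (simp add: card_Diff_subset)
  obtain h where h: "bij_betw h B {..<t - 1}"
    using finite_same_card_bij[OF finB, of "{..<t - 1}"] B(2) by auto
  obtain f where f: "bij_betw f (V - B) {..<?N}" "\<forall>u\<in>V - B. \<forall>v\<in>V - B. f u mod r = f v mod r \<longleftrightarrow> \<pi> u = \<pi> v"
    using balanced_bijection[OF r, of "V - B" \<pi>] fin \<pi> bal cW by auto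
  define g where "g v = (if v \<in> B then Inl (h v) else Inr (f v))" for v
  have hB: "h v < t - 1" if "v \<in> B" for v using h that by (auto simp: bij_betw_def)
  have fW: "f v < ?N" if "v \<in> V - B" for v using f(1) that by (auto simp: bij_betw_def)
  let ?L = "Inl :: nat \<Rightarrow> nat + nat" and ?R = "Inr :: nat \<Rightarrow> nat + nat"
  have "bij_betw g (B \<union> (V - B)) (?L ` {..<t - 1} \<union> ?R ` {..<?N})"
  proof (rule bij_betw_combine)
    have "bij_betw (?L \<circ> h) B (?L ` {..<t - 1})"
      by (rule bij_betw_trans[OF h]) (auto intro: inj_on_imp_bij_betw)
    moreover have "bij_betw g B (?L ` {..<t - 1}) \<longleftrightarrow> bij_betw (?L \<circ> h) B (?L ` {..<t - 1})"
      by (rule bij_betw_cong) (simp add: g_def)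
    ultimately show "bij_betw g B (?L ` {..<t - 1})" by simp
    have "bij_betw (?R \<circ> f) (V - B) (?R ` {..<?N})"
      by (rule bij_betw_trans[OF f(1)]) (auto intro: inj_on_imp_bij_betw)
    moreover have "bij_betw g (V - B) (?R ` {..<?N}) \<longleftrightarrow> bij_betw (?R \<circ> f) (V - B) (?R ` {..<?N})"
      by (rule bij_betw_cong) (simp add: g_def)
    ultimately show "bij_betw g (V - B) (?R ` {..<?N})" by simp
  qed auto
  moreover have "B \<union> (V - B) = V" using B(1) by blast
  moreover have "pverts H = Inl ` {..<t - 1} \<union> Inr ` {..<?N}"
    by (auto simp: H_def graph_join_def complete_graph_def turan_graph_def Plus_def)
  ultimately have bij: "bij_betw g V (pverts H)" by simp
  have Harcs: "(Inl x, Inl y) \<in> parcs H \<longleftrightarrow> x < t - 1 \<and> y < t - 1 \<and> x \<noteq> y"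
    "(Inr x', Inr y') \<in> parcs H \<longleftrightarrow> x' < ?N \<and> y' < ?N \<and> x' mod r \<noteq> y' mod r"
    "(Inl x, Inr y') \<in> parcs H \<longleftrightarrow> x < t - 1 \<and> y' < ?N"
    "(Inr x', Inl y) \<in> parcs H \<longleftrightarrow> x' < ?N \<and> y < t - 1" for x y x' y'
    by (auto simp: H_def graph_join_def complete_graph_def turan_graph_def)
  have hinj: "h u = h v \<longleftrightarrow> u = v" if "u \<in> B" "v \<in> B" for u v
    using h that by (auto simp: bij_betw_def inj_on_def)
  have "E u v \<longleftrightarrow> (g u, g v) \<in> parcs H" if uv: "u \<in> V" "v \<in> V" for u v
  proof -
    have "E u v \<longleftrightarrow> hub_join B \<pi> u v" using E uv by blast
    also have "\<dots> \<longleftrightarrow> (g u, g v) \<in> parcs H"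
    proof (cases "u \<in> B"; cases "v \<in> B")
      assume "u \<in> B" "v \<in> B"
      then show ?thesis using hB hinj by (simp add: g_def Harcs hub_join_def)
    next
      assume "u \<in> B" "v \<notin> B"
      then show ?thesis using hB[of u] fW[of v] uv by (auto simp: g_def Harcs hub_join_def)
    next
      assume "u \<notin> B" "v \<in> B"
      then show ?thesis using hB[of v] fW[of u] uv by (auto simp: g_def Harcs hub_join_def)
    next
      assume nB: "u \<notin> B" "v \<notin> B"
      then have "f u mod r = f v mod r \<longleftrightarrow> \<pi> u = \<pi> v" using f(2) uv by blast
      then show ?thesis using nB fW[of u] fW[of v] uv by (auto simp: g_def Harcs hub_join_def)
    qed
    finally show ?thesis .
  qed
  then show ?thesis using bij by blast
qed

text \<open>
  With \<open>h - 1 = d p + \<rho>\<close> and \<open>\<rho> < p\<close> the numbers are \<open>t = \<rho> + 1\<close> and \<open>r = k + d + 1\<close>.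
\<close>

lemma parameters:
  fixes k p h s t r :: nat
  assumes "2 \<le> k" "2 \<le> p" "1 \<le> h" "h \<le> k" "s = p * (k + 1) + h"
    and t: "t = h - nat \<lfloor>(real h - 1) / real p\<rfloor> * p" and r: "r = k + nat \<lceil>real h / real p\<rceil>"
  shows "s = p * r + t" "1 \<le> t" "t \<le> p" "k < r"
proof -
  define d where "d = (h - 1) div p"
  define \<rho> where "\<rho> = (h - 1) mod p"
  have "h - 1 = d * p + \<rho>" unfolding d_def \<rho>_def by (rule div_mult_mod_eq[symmetric])
  then have h: "h = d * p + \<rho> + 1" using assms(3) by linarith
  have \<rho>: "\<rho> < p" using assms(2) by (simp add: \<rho>_def)
  have "\<lfloor>(real h - 1) / real p\<rfloor> = int d"
  proof -
    have "real h - 1 = real (h - 1)" using assms(3) by (simp add: of_nat_diff)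
    then show ?thesis unfolding d_def by (simp only: floor_divide_of_nat_eq)
  qed
  then have t': "t = \<rho> + 1" using t h by simp
  have "\<lceil>real h / real p\<rceil> = int d + 1"
  proof (rule ceiling_unique)
    have p: "0 < real p" using assms(2) by simp
    have "real d * real p < real h" using h by simp
    then show "of_int (int d + 1) - 1 < real h / real p" using p by (simp add: pos_less_divide_eq)
    have "h \<le> (d + 1) * p" using h \<rho> by simp
    then have "real h \<le> real ((d + 1) * p)" by (simp only: of_nat_le_iff)
    then show "real h / real p \<le> of_int (int d + 1)" using p by (simp add: pos_divide_le_eq algebra_simps)
  qed
  then have r': "r = k + d + 1" using r by (simp add: nat_add_distrib)
  show "s = p * r + t" unfolding assms(5) r' t' using h by (simp add: algebra_simps)
  show "1 \<le> t" "t \<le> p" "k < r" using t' \<rho> r' by simp_all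
qed

theorem corollary1p6:
  fixes k p h s t r :: nat
  assumes "2 \<le> k" and "2 \<le> p" and "1 \<le> h" and "h \<le> k"
    and "s = p * (k + 1) + h"
    and "t = h - nat \<lfloor>(real h - 1) / real p\<rfloor> * p"
    and "r = k + nat \<lceil>real h / real p\<rceil>"
  shows "\<exists>N. \<forall>n\<ge>N.
    EX_q n (graph_power (cycle_graph s) k) =
      {G. digraph_iso (with_proj G)
            (with_proj (graph_join (complete_graph (t - 1)) (turan_graph (n - t + 1) r)))}"
proof -
  note par = parameters[OF assms]
  let ?F = "graph_power (cycle_graph s) k"
  have ks: "k + 1 \<le> s" "s < (p + 1) * (k + 1)" "2 \<le> s"
  proof -
    have "1 * (k + 1) \<le> p * (k + 1)" using assms(2) by (intro mult_right_mono) auto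
    then show "k + 1 \<le> s" using assms(5) by simp
    then show "2 \<le> s" using assms(1) by simp
    show "s < (p + 1) * (k + 1)" using assms(4,5) by simp
  qed
  have arcs: "(u, v) \<in> parcs ?F \<longleftrightarrow> cyc_adj s k u v" for u v by (rule cycle_power_arcs[OF ks(3)])
  have relF: "rel_of ?F = cyc_adj s k" by (intro ext) (simp add: rel_of_def arcs)
  have vF: "pverts ?F = {..<s}" by (simp add: graph_power_def cycle_graph_def)
  have wfF: "pair_wf_digraph ?F"
    by unfold_locales (auto simp: arcs vF cyc_adj_def)
  interpret forbidden s r t "p + 2 * t" "cyc_adj s k"
  proof
    show "3 \<le> r" using par(4) assms(1) by simp
    show "1 \<le> t" by (rule par(2))
    show "\<not> copy_free s (cyc_adj s k) E V" if "finite V" "symp E" "irreflp E" "matching_blowup E V r t (p + 2 * t)"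
      for E :: "nat \<Rightarrow> nat \<Rightarrow> bool" and V
      by (rule blowup_contains_cycle_power[OF that par])
    show "copy_free s (cyc_adj s k) (hub_join B \<pi>) V" if "finite V" "B \<subseteq> V" "card B < t" "\<And>u. u \<in> V - B \<Longrightarrow> \<pi> u < r"
      for V :: "nat set" and B \<pi>
      by (rule cyc_hub_join_free[OF par(1) ks(2) _ par(2) that]) (use ks(1) in auto)
  qed
  obtain N where N: "\<forall>E V. extremal s (cyc_adj s k) E V \<and> N \<le> card V \<longrightarrow>
    (\<exists>B \<pi>. B \<subseteq> V \<and> card B = t - 1 \<and> (\<forall>u\<in>V. \<pi> u < r) \<and> (\<forall>u\<in>V. \<forall>v\<in>V. E u v \<longleftrightarrow> hub_join B \<pi> u v) \<and>
      (\<forall>i<r. \<forall>j<r. card {v \<in> V - B. \<pi> v = i} \<le> card {v \<in> V - B. \<pi> v = j} + 1))"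
    using extremal_is_balanced_multipartite ..
  have "EX_q n ?F = {G. digraph_iso (with_proj G)
            (with_proj (graph_join (complete_graph (t - 1)) (turan_graph (n - t + 1) r)))}"
    if n: "max N t \<le> n" for n
  proof -
    define H where "H = graph_join (complete_graph (t - 1)) (turan_graph (n - t + 1) r)"
    have n1: "1 \<le> n" "t \<le> n" "N \<le> n" using n par(2) by auto
    have gc: "pair_graph (complete_graph m)" for m
      by (rule pair_graphI) (auto simp: complete_graph_def irrefl_def sym_def)
    have gH: "pair_graph H" unfolding H_def by (intro pair_graph_join gc pair_graph_turan)
    have toH: "\<exists>g. bij_betw g V (pverts H) \<and> (\<forall>u\<in>V. \<forall>v\<in>V. E u v \<longleftrightarrow> (g u, g v) \<in> parcs H)"
      if ext: "extremal s (cyc_adj s k) E V" and cV: "card V = n" for E V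
    proof -
      have "N \<le> card V" using cV n1(3) by simp
      from N[THEN spec, THEN spec, THEN mp, OF conjI[OF ext this]]
      obtain B \<pi> where "B \<subseteq> V" "card B = t - 1" "\<forall>u\<in>V. \<pi> u < r" "\<forall>u\<in>V. \<forall>v\<in>V. E u v \<longleftrightarrow> hub_join B \<pi> u v"
        "\<forall>i<r. \<forall>j<r. card {v \<in> V - B. \<pi> v = i} \<le> card {v \<in> V - B. \<pi> v = j} + 1"
        by (elim exE conjE)
      moreover have "finite V" using ext by (simp add: extremal_def)
      moreover have "t \<le> card V" "0 < r" using cV n1 r3 by simp_all
      ultimately show ?thesis unfolding H_def cV[symmetric] by (intro join_isomorphism par(2))
    qed
    show ?thesis
      unfolding H_def[symmetric]
    proof (intro Set.set_eqI iffI)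
      fix G :: "nat pair_pre_digraph"
      assume "G \<in> EX_q n ?F"
      then have G: "pair_graph G" "card (pverts G) = n" "extremal s (cyc_adj s k) (rel_of G) (pverts G)"
        using EX_q_iff[OF wfF vF n1(1)] relF by auto
      then show "G \<in> {G. digraph_iso (with_proj G) (with_proj H)}"
        using toH[OF G(3,2)] digraph_iso_pair_iff[OF pair_graph_rel(4)[OF G(1)] pair_graph_rel(4)[OF gH]]
        by (simp add: rel_of_def)
    next
      fix G :: "nat pair_pre_digraph"
      assume "G \<in> {G. digraph_iso (with_proj G) (with_proj H)}"
      then have iso: "digraph_iso (with_proj G) (with_proj H)" by simp
      have "wf_digraph (with_proj G)"
        using iso unfolding digraph_iso_def pre_digraph.digraph_isomorphism_def by blast
      then have wfG: "pair_wf_digraph G"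
        unfolding wf_digraph_def pair_wf_digraph_def by auto
      obtain f where f: "bij_betw f (pverts G) (pverts H)"
        "\<forall>u\<in>pverts G. \<forall>v\<in>pverts G. (u, v) \<in> parcs G \<longleftrightarrow> (f u, f v) \<in> parcs H"
        using iso digraph_iso_pair_iff[OF wfG pair_graph_rel(4)[OF gH]] by blast
      interpret G: pair_wf_digraph G by (rule wfG)
      note HH = pair_graph_rel[OF gH]
      have Gs: "u \<in> pverts G \<and> v \<in> pverts G" if "(u, v) \<in> parcs G" for u v
        using G.in_arcsD1[OF that] G.in_arcsD2[OF that] by blast
      have gG: "pair_graph G"
      proof (rule pair_graphI)
        show "finite (pverts G)" using bij_betw_finite[OF f(1)] HH(1) by simp
        show "parcs G \<subseteq> pverts G \<times> pverts G" using Gs by auto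
        show "irrefl (parcs G)"
        proof (rule irreflI)
          fix u
          show "(u, u) \<notin> parcs G"
          proof
            assume u: "(u, u) \<in> parcs G"
            then have "rel_of H (f u) (f u)" using f(2) Gs[OF u] unfolding rel_of_def by blast
            then show False using HH(3) by (simp add: irreflp_def)
          qed
        qed
        show "sym (parcs G)"
        proof (rule symI)
          fix u v assume uv: "(u, v) \<in> parcs G"
          then have "rel_of H (f u) (f v)" using f(2) Gs[OF uv] unfolding rel_of_def by blast
          then have "rel_of H (f v) (f u)" using HH(2) by (rule sympD[rotated])
          then show "(v, u) \<in> parcs G" using f(2) Gs[OF uv] unfolding rel_of_def by blast
        qed
      qed
      obtain E0 where E0: "extremal s (cyc_adj s k) E0 {..<n}" using extremal_exists[OF n1(1)] by blast
      obtain g where g: "bij_betw g {..<n} (pverts H)"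
        "\<forall>u\<in>{..<n}. \<forall>v\<in>{..<n}. E0 u v \<longleftrightarrow> (g u, g v) \<in> parcs H"
        using toH[OF E0] by auto
      let ?i = "inv_into {..<n} g"
      have j: "bij_betw (?i \<circ> f) (pverts G) {..<n}"
        using f(1) bij_betw_inv_into[OF g(1)] by (rule bij_betw_trans)
      have gi: "g ((?i \<circ> f) u) = f u" if "u \<in> pverts G" for u
      proof -
        have "f u \<in> g ` {..<n}" using f(1) g(1) that by (auto simp: bij_betw_def)
        then show ?thesis by (simp add: f_inv_into_f)
      qed
      have jE: "rel_of G u v \<longleftrightarrow> E0 ((?i \<circ> f) u) ((?i \<circ> f) v)" if "u \<in> pverts G" "v \<in> pverts G" for u v
      proof -
        have "(?i \<circ> f) u \<in> {..<n}" "(?i \<circ> f) v \<in> {..<n}" using j that by (auto simp: bij_betw_def)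
        then have "E0 ((?i \<circ> f) u) ((?i \<circ> f) v) \<longleftrightarrow> (f u, f v) \<in> parcs H" using g(2) gi that by metis
        then show ?thesis using f(2) that by (simp add: rel_of_def)
      qed
      have cG: "card (pverts G) = n" using bij_betw_same_card[OF j] by simp
      have neG: "pverts G \<noteq> {}" using cG n1(1) by auto
      have E0': "symp E0" "copy_free s (cyc_adj s k) E0 {..<n}" using E0 by (auto simp: extremal_def)
      note GG = pair_graph_rel[OF gG]
      have "copy_free s (cyc_adj s k) (rel_of G) (pverts G)"
        by (rule copy_free_iso[where g = "?i \<circ> f" and E' = E0, OF j jE E0'(2)])
      moreover have "qidx (rel_of G) (pverts G) = qidx E0 {..<n}"
        by (rule qidx_iso[where g = "?i \<circ> f" and E' = E0, OF GG(1) neG E0'(1) j jE])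
      ultimately have "extremal s (cyc_adj s k) (rel_of G) (pverts G)"
        using E0 GG cG unfolding extremal_def by simp
      then show "G \<in> EX_q n ?F" using EX_q_iff[OF wfF vF n1(1)] relF gG cG by auto
    qed
  qed
  then show ?thesis by blast
qed

end
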